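(* Let $d=1$, $\mathbb{T}=\mathbb{R}/2\pi\mathbb{Z}$, $\kappa\ge 0$, $p\in2\mathbb{N}$, and let $q\in\mathbb{N}$, $q\geq 3$. Let $Q=(Q_1,\dots,Q_q,\mu_1,\mu_2):\mathbb{T}\to\mathbb{R}^{q+2}$ satisfy both of the following assumptions. (I) $Q_1,\dots,Q_q\in C^\infty(\mathbb{T},\mathbb{R})$ and $\{1,\cos x,\sin x\}\subset\mathrm{span}_{\mathbb{R}}\{Q_1,\dots,Q_q\}$. (II) $Q_1=1$, $\mu_1,\mu_2\in H^3(\mathbb{T},\mathbb{R})$, $\langle\mu_1,c_0\rangle_{L^2}\neq0$, $\langle\mu_2,c_0\rangle_{L^2}=0$, and there exist $b_1,q_1,b_2,q_2>0$ such that for all $k\in\mathbb{N}^*$ $$\lambda_k^{q_1}|\langle\mu_1,c_k\rangle_{L^2}|\ge b_1,\quad \langle\mu_1,s_k\rangle_{L^2}=0,\qquad \lambda_k^{q_2}|\langle\mu_2,s_k\rangle_{L^2}|\ge b_2,\quad \langle\mu_2,c_k\rangle_{L^2}=0,$$ where $\lambda_k=k^2$, $c_0=\frac1{\sqrt{2\pi}}$, $c_k(x)=\frac1{\sqrt\pi}\cos(kx)$, $s_k(x)=\frac1{\sqrt\pi}\sin(kx)$. Consider $$\partial_t\psi(t,x)=\big(\partial_x^2-\kappa\psi(t,x)^p+\langle u(t),Q(x)\rangle\big)\psi(t,x),\qquad\psi(0,\cdot)=\psi_0,\qquad x\in\mathbb{T},\ t>0,$$ with solution denoted $\psi(t;\psi_0,u)$,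 and let $\Phi:=c_0$. Then for any $T>0$ and any $\psi_0\in H^3(\mathbb{T},\mathbb{R})$ with $\psi_0>0$, there exists $u\in L^2((0,T),\mathbb{R}^{q+2})$ such that $\psi(T;\psi_0,u)=\Phi$. Analogously, for any $T>0$ and any $\psi_0\in H^3(\mathbb{T},\mathbb{R})$ with $\psi_0<0$, there exists $u\in L^2((0,T),\mathbb{R}^{q+2})$ such that $\psi(T;\psi_0,u)=-\Phi$.
   Context: $\mathbb{N}=\{0,1,2,\dots\}$, $\mathbb{N}^*=\mathbb{N}\setminus\{0\}$. "Solution" means mild solution: $\psi\in C^0([0,T],H^3(\mathbb{T},\mathbb{R}))$ satisfying $\psi(t)=e^{t\Delta}\psi_0+\int_0^t e^{(t-r)\Delta}\big(\langle u(r),Q\rangle\psi(r)-\kappa\psi(r)^{p+1}\big)dr$; when it exists it is unique, and its existence on $[0,T]$ for the control $u$ is part of the assertion. $\psi_0>0$ (resp. $<0$) means strict positivity (resp. negativity) at every point of $\mathbb{T}$. *)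

theory Defs
  imports "HOL-Analysis.Analysis"
begin

text \<open>
  Functions on the torus \<open>\<real>/2\<pi>\<int>\<close> are represented by \<open>2\<pi>\<close>-periodic functions on the reals, and
  the integral over the torus is the integral over one period.
\<close>

definition periodic_2pi :: "(real \<Rightarrow> real) \<Rightarrow> bool" where
  "periodic_2pi f \<longleftrightarrow> (\<forall>x. f (x + 2 * pi) = f x)"

definition smooth_torus :: "(real \<Rightarrow> real) set" where
  "smooth_torus = {f. periodic_2pi f \<and> (\<forall>n x. (deriv ^^ n) f differentiable (at x))}"

definition inner_L2 :: "(real \<Rightarrow> real) \<Rightarrow> (real \<Rightarrow> real) \<Rightarrow> real" where
  "inner_L2 f g = (LINT x:{0..2 * pi}|lborel. f x * g x)"

definition cos_mode :: "nat \<Rightarrow> real \<Rightarrow> real" where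
  "cos_mode k x = (if k = 0 then 1 / sqrt (2 * pi) else cos (real k * x) / sqrt pi)"

text \<open>
  The mode \<open>sin_mode 0\<close> is identically zero, so that the real Fourier series below can be
  indexed uniformly by all \<open>k\<close>; the orthonormal basis consists of all \<open>cos_mode k\<close> and of
  \<open>sin_mode k\<close> for \<open>k > 0\<close>.
\<close>

definition sin_mode :: "nat \<Rightarrow> real \<Rightarrow> real" where
  "sin_mode k x = sin (real k * x) / sqrt pi"

definition H3_weight :: "(real \<Rightarrow> real) \<Rightarrow> nat \<Rightarrow> real" where
  "H3_weight f k =
     (1 + (real k)\<^sup>2) ^ 3 * ((inner_L2 f (cos_mode k))\<^sup>2 + (inner_L2 f (sin_mode k))\<^sup>2)"

text \<open>
  The Sobolev space \<open>H\<^sup>3\<close> of the torus. In dimension one every class in it has exactly one continuous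
  representative, and the elements are taken to be these representatives. Pointwise conditions
  and equalities of functions are therefore meaningful for them at every point.
\<close>

definition H3 :: "(real \<Rightarrow> real) set" where
  "H3 = {f. periodic_2pi f \<and> continuous_on UNIV f \<and> summable (H3_weight f)}"

definition H3_norm :: "(real \<Rightarrow> real) \<Rightarrow> real" where
  "H3_norm f = sqrt (\<Sum>k. H3_weight f k)"

definition continuous_in_H3 :: "real set \<Rightarrow> (real \<Rightarrow> real \<Rightarrow> real) \<Rightarrow> bool" where
  "continuous_in_H3 I \<psi> \<longleftrightarrow>
     (\<forall>t\<in>I. \<psi> t \<in> H3) \<and>
     (\<forall>t\<in>I. ((\<lambda>s. H3_norm (\<lambda>x. \<psi> s x - \<psi> t x)) \<longlongrightarrow> 0) (at t within I))"

text \<open>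
  The heat semigroup as a Fourier multiplier: both modes of index \<open>k\<close> are eigenfunctions of
  \<open>- \<Delta>\<close> for the eigenvalue \<open>k\<^sup>2\<close>. It is only applied to functions in \<open>H3\<close>, for which the series
  converges absolutely for all \<open>t \<ge> 0\<close>, including \<open>t = 0\<close>.
\<close>

definition heat :: "real \<Rightarrow> (real \<Rightarrow> real) \<Rightarrow> real \<Rightarrow> real" where
  "heat t f x =
     (\<Sum>k. exp (- (real k)\<^sup>2 * t) *
        (inner_L2 f (cos_mode k) * cos_mode k x + inner_L2 f (sin_mode k) * sin_mode k x))"

text \<open>
  Vectors with \<open>n\<close> components (the control values and the family of control potentials) are
  functions of an index ranging over \<open>{1..n}\<close>.
\<close>

definition L2_controls :: "nat \<Rightarrow> real \<Rightarrow> (real \<Rightarrow> nat \<Rightarrow> real) set" where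
  "L2_controls n T =
     {u. \<forall>i\<in>{1..n}. set_borel_measurable lborel {0<..<T} (\<lambda>t. u t i) \<and>
                     set_integrable lborel {0<..<T} (\<lambda>t. (u t i)\<^sup>2)}"

definition control_potential ::
  "nat \<Rightarrow> (nat \<Rightarrow> real \<Rightarrow> real) \<Rightarrow> (nat \<Rightarrow> real) \<Rightarrow> real \<Rightarrow> real" where
  "control_potential n Q v x = (\<Sum>i=1..n. v i * Q i x)"

text \<open>
  Continuous \<open>H3\<close>-valued solutions of the Duhamel formula on \<open>[0, T]\<close>. The formula is an identity
  between functions on the torus and is stated at every point \<open>x\<close>: since point evaluation is a continuous
  linear functional on \<open>H\<^sup>3\<close>, the value at \<open>x\<close> of the Bochner integral is the Lebesgue integral of
  the values at \<open>x\<close>. Integrability is required explicitly because the integral of a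
  non-integrable function is zero by convention.
\<close>

definition mild_solution ::
  "real \<Rightarrow> nat \<Rightarrow> nat \<Rightarrow> (nat \<Rightarrow> real \<Rightarrow> real) \<Rightarrow> real \<Rightarrow> (real \<Rightarrow> real) \<Rightarrow>
   (real \<Rightarrow> nat \<Rightarrow> real) \<Rightarrow> (real \<Rightarrow> real \<Rightarrow> real) \<Rightarrow> bool" where
  "mild_solution \<kappa> p n Q T \<psi>0 u \<psi> \<longleftrightarrow>
     continuous_in_H3 {0..T} \<psi> \<and>
     (let F = (\<lambda>r y. control_potential n Q (u r) y * \<psi> r y - \<kappa> * \<psi> r y ^ (p + 1)) in
      \<forall>t\<in>{0..T}. \<forall>x.
        set_integrable lborel {0..t} (\<lambda>r. heat (t - r) (F r) x) \<and>
        \<psi> t x = heat t \<psi>0 x + (LINT r:{0..t}|lborel. heat (t - r) (F r) x))"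

text \<open>The real span of the finite family \<open>Q 1, \<dots>, Q q\<close>.\<close>

definition family_span :: "nat \<Rightarrow> (nat \<Rightarrow> real \<Rightarrow> real) \<Rightarrow> (real \<Rightarrow> real) set" where
  "family_span q Q = {f. \<exists>a. f = (\<lambda>x. \<Sum>i=1..q. a i * Q i x)}"

end

theory Submission
  imports Defs "HOL-Probability.Probability"
begin

text \<open>
  Everything takes place in the Wiener algebra of real \<open>2\<pi>\<close>-periodic functions with absolutely
  summable Fourier coefficients, a Banach algebra on which the heat semigroup \<open>S\<close> acts by contractions.

  Approximate control: with potentials in the span of 1, cos and sin the linear equation is steered
  close to \<open>exp f * y\<close>, in arbitrarily small time, for every \<open>f\<close> in the algebra. A short strong impulse
  gives \<open>f\<close> in the span. If \<open>a *\<^sub>R f\<close> is accessible for all real \<open>a\<close>, then so is the square of the derivative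
  of \<open>f\<close>, because \<open>S t\<close> is a Gaussian average of translations and hence
  \<open>exp (- n f) * S (1 / (2 n\<^sup>2)) (exp (n f) * y)\<close> tends to \<open>exp (f'\<^sup>2 / 2) * y\<close>. Sums of such squares
  produce all frequencies successively. For a positive initial state one takes \<open>f = ln (c / \<psi>\<^sub>0)\<close> with \<open>c\<close> the
  value of the target. A time dependent scaling of the state makes the nonlinearity negligible.

  Exact control near the target: the potential \<open>\<kappa> * c ^ p\<close> makes \<open>c\<close> stationary, the linearised equation
  is a moment problem, solved in time \<open>\<tau>\<close> at the cost \<open>exp (A / \<tau> ^ 5)\<close>, and the remainder is
  quadratic. Iterating on geometrically shrinking time intervals reaches \<open>c\<close> exactly.

  The coefficients of the solution gain a factor \<open>1 + k\<^sup>2\<close> from each use of the Duhamel formula, and two uses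
  give continuity in \<open>H\<^sup>3\<close>. The case \<open>p = 0\<close> reduces to \<open>\<kappa> = 0\<close>, since \<open>\<kappa>\<close> can be absorbed in the control of
  \<open>Q\<^sub>1 = 1\<close>; negative data follow by changing the sign of the solution.
\<close>

section \<open>Fourier coefficients\<close>

text \<open>The dynamics are set in the Wiener algebra because translations and the heat flow are
  contractions there, multiplication by \<open>exp f\<close> is bounded, and estimates can be made
  one Fourier coefficient at a time; H3 is recovered at the end. Competing rates fix the constants.
  In the moment problem the biorthogonal functions lose a factor exp (C (k+1) / \<tau>^2), while a
  bump supported in the second half of the interval gains exp (k^2 \<tau> / 2); completing the
  square between the two produces the cost exponent \<tau>^(-5). In the iteration the steps shrink
  by 8/9 because (9/8)^5 < 2, so the cost grows more slowly than quadratic convergence gains.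
  Globally, the accuracy demanded near the target depends on the length of the last time interval,
  which is therefore fixed before the approximate phase. Two potentials are used near the target
  because k^2 is a double eigenvalue: the even one acts on the real parts of the coefficients, the
  odd one on the imaginary parts. Approximate control is stated for operators rather than for
  states, so that it can be composed, conjugated and passed to the limit.\<close>

lemma has_integral_cis_period:
  "((\<lambda>x. cis (of_int k * x)) has_integral (if k = 0 then complex_of_real (2 * pi) else 0)) {0..2 * pi}"
proof (cases "k = 0")
  case True
  then show ?thesis
    using has_integral_const_real[of "1::complex" 0 "2 * pi"] by (simp add: scaleR_conv_of_real)
next
  case False
  have "((\<lambda>x. cis (of_int k * x)) has_integral
      (cis (of_int k * (2 * pi)) / (\<i> * of_int k) - cis (of_int k * 0) / (\<i> * of_int k))) {0..2 * pi}"
  proof (rule fundamental_theorem_of_calculus)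
    fix x :: real
    show "((\<lambda>x. cis (of_int k * x) / (\<i> * of_int k)) has_vector_derivative cis (of_int k * x)) (at x within {0..2 * pi})"
      using False unfolding cis_conv_exp
      by (auto intro!: derivative_eq_intros has_vector_derivative_real_field simp: field_simps)
  qed simp
  moreover have "cis (of_int k * (2 * pi)) = 1"
    using cis_multiple_2pi[of "of_int k"] by (simp add: mult_ac)
  ultimately show ?thesis using False by simp
qed

definition fcoef :: "(real \<Rightarrow> real) \<Rightarrow> int \<Rightarrow> complex" where
  "fcoef f k = integral {0..2 * pi} (\<lambda>x. complex_of_real (f x) * cis (- (of_int k * x))) / (2 * pi)"

text \<open>Requiring the function's own Fourier series to converge to it at every point makes
  continuity and periodicity consequences (\<open>continuous_on_fn\<close>,
  \<open>fn_periodic\<close>); membership can be proved from any absolutely summable series with the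
  right sum.\<close>

definition wiener_fun :: "(real \<Rightarrow> real) \<Rightarrow> bool" where
  "wiener_fun f \<longleftrightarrow> (\<lambda>k. norm (fcoef f k)) summable_on UNIV \<and>
     (\<forall>x. ((\<lambda>k. fcoef f k * cis (of_int k * x)) has_sum complex_of_real (f x)) UNIV)"

lemma uniform_limit_fourier:
  fixes c :: "int \<Rightarrow> complex"
  assumes c: "(\<lambda>k. norm (c k)) summable_on UNIV"
    and f: "\<And>x. ((\<lambda>k. c k * cis (of_int k * x)) has_sum complex_of_real (f x)) UNIV"
  shows "uniform_limit X (\<lambda>K x. \<Sum>k\<in>K. c k * cis (of_int k * x)) (\<lambda>x. complex_of_real (f x)) (finite_subsets_at_top UNIV)"
  by (rule Weierstrass_m_test_general'[where M = "\<lambda>k. norm (c k)"]) (use c f in \<open>auto simp: norm_mult\<close>)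

text \<open>Absolute summability gives uniform convergence, so the series may be integrated term by
  term against the conjugate mode m, and orthogonality picks out \<open>c m\<close>. The coefficient
  formulas for sums, products and modes all follow by exhibiting a series.\<close>

lemma fcoef_unique:
  fixes c :: "int \<Rightarrow> complex"
  assumes c: "(\<lambda>k. norm (c k)) summable_on UNIV"
    and f: "\<And>x. ((\<lambda>k. c k * cis (of_int k * x)) has_sum complex_of_real (f x)) UNIV"
  shows "fcoef f = c"
proof
  fix m :: int
  have s: "((\<lambda>k. c k * cis (of_int (k - m) * x)) has_sum complex_of_real (f x) * cis (- (of_int m * x))) UNIV" for x
    using has_sum_cmult_left[OF f[of x], of "cis (- (of_int m * x))"]
    by (simp add: cis_mult mult.assoc left_diff_distrib)
  have u: "uniform_limit {0..2*pi} (\<lambda>K x. \<Sum>k\<in>K. c k * cis (of_int (k - m) * x))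
      (\<lambda>x. complex_of_real (f x) * cis (- (of_int m * x))) (finite_subsets_at_top UNIV)"
    by (rule Weierstrass_m_test_general'[where M = "\<lambda>k. norm (c k)"]) (use c s in \<open>auto simp: norm_mult\<close>)
  have cont: "continuous_on {0..2*pi} (\<lambda>x. \<Sum>k\<in>K. c k * cis (of_int (k - m) * x))" for K
    by (intro continuous_intros)
  obtain I J where I: "\<And>K. ((\<lambda>x. \<Sum>k\<in>K. c k * cis (of_int (k - m) * x)) has_integral I K) {0..2*pi}"
    and J: "((\<lambda>x. complex_of_real (f x) * cis (- (of_int m * x))) has_integral J) {0..2*pi}"
    and IJ: "(I \<longlongrightarrow> J) (finite_subsets_at_top UNIV)"
    using uniform_limit_integral[OF u cont finite_subsets_at_top_neq_bot] by blast
  have "I K = 2 * pi * c m" if "finite K" "m \<in> K" for K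
  proof -
    have "((\<lambda>x. \<Sum>k\<in>K. c k * cis (of_int (k - m) * x)) has_integral
        (\<Sum>k\<in>K. c k * (if k - m = 0 then complex_of_real (2 * pi) else 0))) {0..2*pi}"
      by (intro has_integral_sum that has_integral_mult_right has_integral_cis_period)
    moreover have "(\<Sum>k\<in>K. c k * (if k - m = 0 then complex_of_real (2 * pi) else 0)) = 2 * pi * c m"
      using that by (simp add: if_distrib sum.delta cong: if_cong)
    ultimately show ?thesis by (simp only: has_integral_unique[OF I])
  qed
  then have "eventually (\<lambda>K. I K = 2 * pi * c m) (finite_subsets_at_top UNIV)"
    unfolding eventually_finite_subsets_at_top by (auto intro!: exI[of _ "{m}"])
  then have "J = 2 * pi * c m"
    by (intro tendsto_unique[OF finite_subsets_at_top_neq_bot IJ] tendsto_eventually)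
  then show "fcoef f m = c m"
    using J unfolding fcoef_def by (simp add: integral_unique)
qed

lemma wiener_funI:
  fixes c :: "int \<Rightarrow> complex"
  assumes "(\<lambda>k. norm (c k)) summable_on UNIV"
    and "\<And>x. ((\<lambda>k. c k * cis (of_int k * x)) has_sum complex_of_real (f x)) UNIV"
  shows "wiener_fun f"
  using fcoef_unique[OF assms] assms unfolding wiener_fun_def by simp

lemma wiener_funD:
  assumes "wiener_fun f"
  shows "(\<lambda>k. norm (fcoef f k)) summable_on UNIV"
    "((\<lambda>k. fcoef f k * cis (of_int k * x)) has_sum complex_of_real (f x)) UNIV"
  using assms unfolding wiener_fun_def by auto

lemma
  assumes f: "wiener_fun f" and g: "wiener_fun g"
  shows wiener_fun_add: "wiener_fun (\<lambda>x. f x + g x)"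
    and fcoef_add: "fcoef (\<lambda>x. f x + g x) = (\<lambda>k. fcoef f k + fcoef g k)"
proof -
  have a: "(\<lambda>k. norm (fcoef f k + fcoef g k)) summable_on UNIV"
    by (rule summable_on_comparison_test[OF summable_on_add[OF wiener_funD(1)[OF f] wiener_funD(1)[OF g]]])
      (auto simp: norm_triangle_ineq)
  have b: "((\<lambda>k. (fcoef f k + fcoef g k) * cis (of_int k * x)) has_sum complex_of_real (f x + g x)) UNIV" for x
    using has_sum_add[OF wiener_funD(2)[OF f] wiener_funD(2)[OF g]] by (simp add: algebra_simps)
  show "wiener_fun (\<lambda>x. f x + g x)" "fcoef (\<lambda>x. f x + g x) = (\<lambda>k. fcoef f k + fcoef g k)"
    using wiener_funI[OF a b] fcoef_unique[OF a b] by auto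
qed

lemma
  assumes f: "wiener_fun f"
  shows wiener_fun_cmult: "wiener_fun (\<lambda>x. r * f x)"
    and fcoef_cmult: "fcoef (\<lambda>x. r * f x) = (\<lambda>k. r *\<^sub>R fcoef f k)"
proof -
  have a: "(\<lambda>k. norm (r *\<^sub>R fcoef f k)) summable_on UNIV"
    using summable_on_cmult_right[OF wiener_funD(1)[OF f], of "\<bar>r\<bar>"] by simp
  have b: "((\<lambda>k. (r *\<^sub>R fcoef f k) * cis (of_int k * x)) has_sum complex_of_real (r * f x)) UNIV" for x
    using has_sum_cmult_right[OF wiener_funD(2)[OF f], of "of_real r"] by (simp add: scaleR_conv_of_real mult_ac)
  show "wiener_fun (\<lambda>x. r * f x)" "fcoef (\<lambda>x. r * f x) = (\<lambda>k. r *\<^sub>R fcoef f k)"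
    using wiener_funI[OF a b] fcoef_unique[OF a b] by auto
qed

lemma has_sum_if_single: "((\<lambda>k. if k = a then b else (0::'a::{comm_monoid_add,topological_space})) has_sum b) UNIV"
  by (rule has_sum_finite_neutralI[of "{a}"]) auto

lemma
  shows wiener_fun_const: "wiener_fun (\<lambda>x. r)"
    and fcoef_const: "fcoef (\<lambda>x. r) = (\<lambda>k. if k = 0 then complex_of_real r else 0)"
proof -
  have a: "(\<lambda>k. norm (if k = (0::int) then complex_of_real r else 0)) summable_on UNIV"
    using has_sum_imp_summable[OF has_sum_if_single[of 0 "\<bar>r\<bar>"]] by (simp add: if_distrib cong: if_cong)
  have b: "((\<lambda>k. (if k = 0 then complex_of_real r else 0) * cis (of_int k * x)) has_sum complex_of_real r) UNIV" for x
    using has_sum_if_single[of "0::int" "complex_of_real r"]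
    by (rule has_sum_cong[THEN iffD1, rotated]) auto
  show "wiener_fun (\<lambda>x. r)" "fcoef (\<lambda>x. r) = (\<lambda>k. if k = 0 then complex_of_real r else 0)"
    using wiener_funI[OF a b] fcoef_unique[OF a b] by auto
qed

lemma bij_conv: "bij (\<lambda>(k::int, j). (j, k - j))"
  by (rule bij_betw_byWitness[where f' = "\<lambda>(j, l). (j + l, j)"]) auto

text \<open>The Cauchy product over the integers: the double family \<open>a j * b l\<close> is
  absolutely summable, and the substitution k = j + l followed by summation over j for fixed k is
  Fubini. The generality in the algebra covers complex coefficients as well as their real
  moduli.\<close>

lemma has_sum_convolution:
  fixes a b :: "int \<Rightarrow> 'a::{real_normed_div_algebra, banach}"
  assumes a: "(\<lambda>k. norm (a k)) summable_on UNIV" "(a has_sum A) UNIV"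
    and b: "(\<lambda>k. norm (b k)) summable_on UNIV" "(b has_sum B) UNIV"
  shows "((\<lambda>k. \<Sum>\<^sub>\<infinity>j. a j * b (k - j)) has_sum A * B) UNIV"
    "\<And>k. (\<lambda>j. norm (a j * b (k - j))) summable_on UNIV"
    "(\<lambda>k. \<Sum>\<^sub>\<infinity>j. norm (a j * b (k - j))) summable_on UNIV"
    "(\<lambda>k. norm (\<Sum>\<^sub>\<infinity>j. a j * b (k - j))) summable_on UNIV"
proof -
  have s: "(\<lambda>x. norm (case x of (j, l) \<Rightarrow> a j * b l)) summable_on (UNIV \<times> UNIV)"
    by (rule Infinite_Sum.abs_summable_on_Sigma_iff[THEN iffD2])
      (use summable_on_cmult_right[OF b(1)] summable_on_cmult_left[OF a(1)] in
        \<open>auto simp: norm_mult infsum_cmult_right' infsum_nonneg\<close>)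
  have h1: "((\<lambda>(j, l). a j * b l) has_sum A * B) (UNIV \<times> UNIV)"
    by (rule has_sum_SigmaI[where g = "\<lambda>j. a j * B"])
      (use abs_summable_summable[OF s] has_sum_cmult_right[OF b(2)] has_sum_cmult_left[OF a(2)] in auto)
  have h2: "((\<lambda>(k, j). a j * b (k - j)) has_sum A * B) (UNIV \<times> UNIV)"
    using has_sum_reindex_bij_betw[OF bij_conv, of "\<lambda>(j, l). a j * b l" "A * B"] h1
    by (simp add: case_prod_unfold)
  have s2: "(\<lambda>x. norm (case x of (k, j) \<Rightarrow> a j * b (k - j))) summable_on (UNIV \<times> UNIV)"
    using summable_on_reindex_bij_betw[OF bij_conv, of "\<lambda>x. norm (case x of (j, l) \<Rightarrow> a j * b l)"] s
    by (simp add: case_prod_unfold)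
  then show 1: "\<And>k. (\<lambda>j. norm (a j * b (k - j))) summable_on UNIV"
    and 2: "(\<lambda>k. \<Sum>\<^sub>\<infinity>j. norm (a j * b (k - j))) summable_on UNIV"
    unfolding Infinite_Sum.abs_summable_on_Sigma_iff by (auto simp: infsum_nonneg)
  show "((\<lambda>k. \<Sum>\<^sub>\<infinity>j. a j * b (k - j)) has_sum A * B) UNIV"
    by (rule has_sum_SigmaD[where f = "\<lambda>(k, j). a j * b (k - j)" and B = "\<lambda>_. UNIV"])
      (use h2 in \<open>auto intro!: has_sum_infsum abs_summable_summable 1\<close>)
  show "(\<lambda>k. norm (\<Sum>\<^sub>\<infinity>j. a j * b (k - j))) summable_on UNIV"
    by (rule summable_on_comparison_test[OF 2]) (auto intro!: norm_infsum_bound 1)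
qed

lemma
  assumes f: "wiener_fun f" and g: "wiener_fun g"
  shows wiener_fun_mult: "wiener_fun (\<lambda>x. f x * g x)"
    and fcoef_mult: "fcoef (\<lambda>x. f x * g x) = (\<lambda>k. \<Sum>\<^sub>\<infinity>j. fcoef f j * fcoef g (k - j))"
proof -
  note F = wiener_funD[OF f] and G = wiener_funD[OF g]
  have a: "(\<lambda>k. norm (\<Sum>\<^sub>\<infinity>j. fcoef f j * fcoef g (k - j))) summable_on UNIV"
    by (rule has_sum_convolution(4)) (use F G in \<open>auto intro!: has_sum_infsum abs_summable_summable\<close>)
  have b: "((\<lambda>k. (\<Sum>\<^sub>\<infinity>j. fcoef f j * fcoef g (k - j)) * cis (of_int k * x)) has_sum complex_of_real (f x * g x)) UNIV" for x
  proof -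
    have "((\<lambda>k. \<Sum>\<^sub>\<infinity>j. (fcoef f j * cis (of_int j * x)) * (fcoef g (k - j) * cis (of_int (k - j) * x)))
        has_sum complex_of_real (f x) * complex_of_real (g x)) UNIV"
      by (rule has_sum_convolution(1)) (use F G in \<open>auto simp: norm_mult\<close>)
    moreover have "(fcoef f j * cis (of_int j * x)) * (fcoef g (k - j) * cis (of_int (k - j) * x))
        = (fcoef f j * fcoef g (k - j)) * cis (of_int k * x)" for j k
    proof -
      have "cis (of_int j * x) * cis (of_int (k - j) * x) = cis (of_int k * x)"
        by (simp add: cis_mult algebra_simps)
      moreover have "(a * b) * (c * d) = (a * c) * (b * d)" for a b c d :: complex
        by (simp add: mult_ac)
      ultimately show ?thesis by metis
    qed
    ultimately show ?thesis by (simp only: infsum_cmult_left' of_real_mult)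
  qed
  show "wiener_fun (\<lambda>x. f x * g x)" "fcoef (\<lambda>x. f x * g x) = (\<lambda>k. \<Sum>\<^sub>\<infinity>j. fcoef f j * fcoef g (k - j))"
    using wiener_funI[OF a b] fcoef_unique[OF a b] by auto
qed

section \<open>The Wiener algebra\<close>

typedef wiener = "Collect wiener_fun" morphisms fn Wiener
  using wiener_fun_const by auto

lemma wiener_fn [simp]: "wiener_fun (fn f)"
  using fn by simp

lemma fn_Wiener: "wiener_fun f \<Longrightarrow> fn (Wiener f) = f"
  by (simp add: Wiener_inverse)

lemma wiener_eqI: "(\<And>x. fn f x = fn g x) \<Longrightarrow> f = g"
  by (metis ext fn_inject)

definition coef :: "wiener \<Rightarrow> int \<Rightarrow> complex" where
  "coef f = fcoef (fn f)"

lemma coef_summable: "(\<lambda>k. norm (coef f k)) summable_on UNIV"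
  and coef_has_sum: "((\<lambda>k. coef f k * cis (of_int k * x)) has_sum complex_of_real (fn f x)) UNIV"
  unfolding coef_def using wiener_funD[OF wiener_fn] by auto

lemma wiener_coef_eqI: "(\<And>k. coef f k = coef g k) \<Longrightarrow> f = g"
  by (rule wiener_eqI) (metis (no_types, lifting) coef_has_sum has_sum_cong has_sum_unique of_real_eq_iff)

instantiation wiener :: "{zero, one, plus, minus, uminus, times, scaleR}"
begin

definition "0 = Wiener (\<lambda>x. 0)"
definition "1 = Wiener (\<lambda>x. 1)"
definition "f + g = Wiener (\<lambda>x. fn f x + fn g x)"
definition "f - g = Wiener (\<lambda>x. fn f x - fn g x)"
definition "- f = Wiener (\<lambda>x. - fn f x)"
definition "f * g = Wiener (\<lambda>x. fn f x * fn g x)"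
definition "r *\<^sub>R f = Wiener (\<lambda>x. r * fn f x)"

instance ..

end

lemma fn_simps [simp]:
  "fn 0 x = 0" "fn 1 x = 1" "fn (f + g) x = fn f x + fn g x" "fn (f - g) x = fn f x - fn g x"
  "fn (- f) x = - fn f x" "fn (f * g) x = fn f x * fn g x" "fn (r *\<^sub>R f) x = r * fn f x"
proof -
  have m: "wiener_fun (\<lambda>x. - fn f x)" for f
    using wiener_fun_cmult[OF wiener_fn, of "-1"] by simp
  have "wiener_fun (\<lambda>x. fn f x - fn g x)"
    using wiener_fun_add[OF wiener_fn m, of f g] by simp
  with m show "fn 0 x = 0" "fn 1 x = 1" "fn (f + g) x = fn f x + fn g x" "fn (f - g) x = fn f x - fn g x"
    "fn (- f) x = - fn f x" "fn (f * g) x = fn f x * fn g x" "fn (r *\<^sub>R f) x = r * fn f x"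
    by (simp_all add: zero_wiener_def one_wiener_def plus_wiener_def minus_wiener_def uminus_wiener_def
      times_wiener_def scaleR_wiener_def fn_Wiener wiener_fun_const wiener_fun_add wiener_fun_mult wiener_fun_cmult)
qed

lemma coef_simps:
  "coef 0 k = 0" "coef 1 k = (if k = 0 then 1 else 0)"
  "coef (f + g) k = coef f k + coef g k" "coef (r *\<^sub>R f) k = r *\<^sub>R coef f k"
  "coef (f * g) k = (\<Sum>\<^sub>\<infinity>j. coef f j * coef g (k - j))"
proof -
  have e: "fn 0 = (\<lambda>x. 0)" "fn 1 = (\<lambda>x. 1)" "fn (f + g) = (\<lambda>x. fn f x + fn g x)"
    "fn (r *\<^sub>R f) = (\<lambda>x. r * fn f x)" "fn (f * g) = (\<lambda>x. fn f x * fn g x)"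
    by auto
  show "coef 0 k = 0" "coef 1 k = (if k = 0 then 1 else 0)"
    "coef (f + g) k = coef f k + coef g k" "coef (r *\<^sub>R f) k = r *\<^sub>R coef f k"
    "coef (f * g) k = (\<Sum>\<^sub>\<infinity>j. coef f j * coef g (k - j))"
    unfolding coef_def e by (simp_all add: fcoef_const fcoef_add fcoef_cmult fcoef_mult)
qed

instance wiener :: comm_ring_1
proof
  show "(0::wiener) \<noteq> 1"
  proof
    assume "(0::wiener) = 1"
    then have "fn 0 0 = fn 1 0" by simp
    then show False by simp
  qed
qed (rule wiener_eqI; simp add: algebra_simps)+

instance wiener :: real_algebra_1
  by standard (rule wiener_eqI; simp add: algebra_simps)+

lemma coef_uminus: "coef (- f) k = - coef f k"
  using coef_simps(4)[of "-1" f k] by (simp del: coef_simps)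

lemma coef_diff: "coef (f - g) k = coef f k - coef g k"
  using coef_simps(3)[of f "- g" k] by (simp add: coef_uminus)

text \<open>The convolution lemma is used twice: for the moduli, where it evaluates the dominating
  double sum exactly, and for the coefficients, where it gives summability.\<close>

lemma infsum_coef_mult:
  "(\<Sum>\<^sub>\<infinity>k. norm (coef (f * g) k)) \<le> (\<Sum>\<^sub>\<infinity>k. norm (coef f k)) * (\<Sum>\<^sub>\<infinity>k. norm (coef g k))"
proof -
  let ?a = "\<lambda>k. norm (coef f k)" and ?b = "\<lambda>k. norm (coef g k)"
  have s: "(\<lambda>k. norm (?a k)) summable_on UNIV" "(\<lambda>k. norm (?b k)) summable_on UNIV"
    "(?a has_sum infsum ?a UNIV) UNIV" "(?b has_sum infsum ?b UNIV) UNIV"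
    using coef_summable by auto
  note C = has_sum_convolution[OF s(1,3,2,4)]
  note D = has_sum_convolution[OF coef_summable has_sum_infsum[OF abs_summable_summable[OF coef_summable]]
      coef_summable has_sum_infsum[OF abs_summable_summable[OF coef_summable]], of f g]
  have "(\<Sum>\<^sub>\<infinity>k. norm (coef (f * g) k)) = (\<Sum>\<^sub>\<infinity>k. norm (\<Sum>\<^sub>\<infinity>j. coef f j * coef g (k - j)))"
    by (simp add: coef_simps)
  also have "\<dots> \<le> (\<Sum>\<^sub>\<infinity>k. \<Sum>\<^sub>\<infinity>j. ?a j * ?b (k - j))"
  proof (rule infsum_mono)
    show "norm (\<Sum>\<^sub>\<infinity>j. coef f j * coef g (k - j)) \<le> (\<Sum>\<^sub>\<infinity>j. ?a j * ?b (k - j))" for k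
      using norm_infsum_bound[OF D(2)[of k]] by (simp add: norm_mult)
  qed (use C(1) D(4) in \<open>auto dest: has_sum_imp_summable\<close>)
  also have "\<dots> = infsum ?a UNIV * infsum ?b UNIV"
    using C(1) by (rule infsumI)
  finally show ?thesis .
qed

instantiation wiener :: real_normed_vector
begin

definition "norm f = (\<Sum>\<^sub>\<infinity>k. norm (coef f k))"
definition "dist (f :: wiener) g = norm (f - g)"
definition "sgn (f :: wiener) = inverse (norm f) *\<^sub>R f"
definition "(uniformity :: (wiener \<times> wiener) filter) = (INF e\<in>{0 <..}. principal {(x, y). dist x y < e})"
definition "open (U :: wiener set) = (\<forall>x\<in>U. \<forall>\<^sub>F (x', y) in uniformity. x' = x \<longrightarrow> y \<in> U)"

instance
proof
  fix f g :: wiener and a :: real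
  show "dist f g = norm (f - g)" "sgn f = f /\<^sub>R norm f" 
    "uniformity = (INF e\<in>{0 <..}. principal {(x, y::wiener). dist x y < e})"
    by (simp_all add: dist_wiener_def sgn_wiener_def uniformity_wiener_def)
  show "open U = (\<forall>x\<in>U. \<forall>\<^sub>F (x', y) in uniformity. x' = x \<longrightarrow> y \<in> U)" for U :: "wiener set"
    by (simp add: open_wiener_def)
  show "(norm f = 0) = (f = 0)"
  proof
    assume "norm f = 0"
    then have "norm (coef f k) = 0" for k
      unfolding norm_wiener_def by (intro nonneg_infsum_le_0D[where A = UNIV and f = "\<lambda>k. norm (coef f k)"] coef_summable) auto
    then show "f = 0"
      by (intro wiener_coef_eqI) (simp add: coef_simps)
  qed (simp add: norm_wiener_def coef_simps)
  show "norm (f + g) \<le> norm f + norm g"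
  proof -
    have "norm (f + g) \<le> (\<Sum>\<^sub>\<infinity>k. norm (coef f k) + norm (coef g k))"
      unfolding norm_wiener_def
      by (rule infsum_mono[OF coef_summable summable_on_add[OF coef_summable coef_summable]])
        (simp add: coef_simps norm_triangle_ineq)
    then show ?thesis
      by (simp add: infsum_add[OF coef_summable coef_summable] norm_wiener_def)
  qed
  show "norm (a *\<^sub>R f) = \<bar>a\<bar> * norm f"
    by (simp add: norm_wiener_def coef_simps infsum_cmult_right')
qed

end

instance wiener :: real_normed_algebra_1
proof
  show "norm (f * g) \<le> norm f * norm g" for f g :: wiener
    unfolding norm_wiener_def by (rule infsum_coef_mult)
  show "norm (1::wiener) = 1"
    using infsumI[OF has_sum_if_single[of "0::int" "1::real"]]
    by (simp add: norm_wiener_def coef_simps if_distrib cong: if_cong)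
qed

lemma coef_le_norm: "norm (coef f k) \<le> norm f"
  using finite_sum_le_infsum[OF coef_summable[of f], of "{k}"] by (simp add: norm_wiener_def)

lemma fn_le_norm: "\<bar>fn f x\<bar> \<le> norm f"
  using norm_has_sum_bound[OF _ coef_has_sum[of f x]] coef_summable[of f]
  by (simp add: norm_mult norm_wiener_def)

lemma bounded_linear_coef: "bounded_linear (\<lambda>f. coef f k)"
  by (rule bounded_linear_intro[where K = 1]) (auto simp: coef_simps coef_le_norm)

lemma bounded_linear_fn: "bounded_linear (\<lambda>f. fn f x)"
  by (rule bounded_linear_intro[where K = 1]) (auto simp: fn_le_norm)

lemma coef_sum: "coef (sum f A) k = (\<Sum>a\<in>A. coef (f a) k)"
  using bounded_linear.linear[OF bounded_linear_coef] by (rule linear_sum)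

lemma fn_sum: "fn (sum f A) x = (\<Sum>a\<in>A. fn (f a) x)"
  using bounded_linear.linear[OF bounded_linear_fn] by (rule linear_sum)

lemma fn_periodic: "fn f (x + 2 * pi) = fn f x"
proof -
  have "cis (of_int k * (x + 2 * pi)) = cis (of_int k * x)" for k
    using cis_multiple_2pi[of "of_int k"] by (simp add: distrib_left mult_ac flip: cis_mult)
  with coef_has_sum[of f "x + 2 * pi"]
  have "((\<lambda>k. coef f k * cis (of_int k * x)) has_sum complex_of_real (fn f (x + 2 * pi))) UNIV"
    by simp
  from has_sum_unique[OF this coef_has_sum] show ?thesis
    by (simp only: of_real_eq_iff)
qed

lemma continuous_on_fn: "continuous_on X (fn f)"
proof -
  have "continuous_on X (\<lambda>x. complex_of_real (fn f x))"
    by (rule uniform_limit_theorem[OF _ uniform_limit_fourier[OF coef_summable coef_has_sum]])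
      (auto intro!: always_eventually continuous_intros)
  from continuous_on_Re[OF this] show ?thesis by simp

qed

lemma cnj_mult_cis: "cnj (a * cis (of_int k * x)) = cnj a * cis (of_int (- k) * x)"
  by (simp add: cis_cnj)

lemma coef_cnj: "coef f (- k) = cnj (coef f k)"
proof -
  let ?c = "\<lambda>k. cnj (coef f (- k))"
  have b: "bij (uminus :: int \<Rightarrow> int)" by (rule bij_uminus)
  have 1: "(\<lambda>k. norm (?c k)) summable_on UNIV"
    using summable_on_reindex_bij_betw[OF b, of "\<lambda>k. norm (coef f k)"] coef_summable by simp
  have 2: "((\<lambda>k. ?c k * cis (of_int k * x)) has_sum complex_of_real (fn f x)) UNIV" for x
  proof -
    have "((\<lambda>k. cnj (coef f k * cis (of_int k * x))) has_sum cnj (complex_of_real (fn f x))) UNIV"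
      unfolding has_sum_cnj_iff by (rule coef_has_sum)
    then have "((\<lambda>k. cnj (coef f k) * cis (of_int (- k) * x)) has_sum complex_of_real (fn f x)) UNIV"
      unfolding cnj_mult_cis complex_cnj_complex_of_real .
    then show ?thesis
      by (subst (asm) has_sum_reindex_bij_betw[OF b, symmetric]) (simp only: minus_minus)
  qed
  show ?thesis
    using fun_cong[OF fcoef_unique[OF 1 2], of "- k"] by (simp add: coef_def)
qed

text \<open>The inverse of \<open>coef\<close> on summable hermitian sequences. The real part is
  taken to land in real functions; under \<open>c (- k) = cnj (c k)\<close> the sum is already
  real.\<close>

definition of_coef :: "(int \<Rightarrow> complex) \<Rightarrow> wiener" where
  "of_coef c = Wiener (\<lambda>x. Re (\<Sum>\<^sub>\<infinity>k. c k * cis (of_int k * x)))"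

lemma coef_of_coef:
  assumes c: "(\<lambda>k. norm (c k)) summable_on UNIV" and h: "\<And>k. c (- k) = cnj (c k)"
  shows "coef (of_coef c) = c"
proof -
  let ?s = "\<lambda>x. \<Sum>\<^sub>\<infinity>k. c k * cis (of_int k * x)"
  have s: "((\<lambda>k. c k * cis (of_int k * x)) has_sum ?s x) UNIV" for x
    by (rule has_sum_infsum, rule abs_summable_summable) (use c in \<open>simp add: norm_mult\<close>)
  have "((\<lambda>k. c k * cis (of_int k * x)) has_sum cnj (?s x)) UNIV" for x
  proof -
    have "((\<lambda>k. cnj (c k * cis (of_int k * x))) has_sum cnj (?s x)) UNIV"
      unfolding has_sum_cnj_iff by (rule s)
    then have "((\<lambda>k. c (- k) * cis (of_int (- k) * x)) has_sum cnj (?s x)) UNIV"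
      unfolding cnj_mult_cis h .
    then show ?thesis
      by (subst (asm) has_sum_reindex_bij_betw[OF bij_uminus, of "\<lambda>k. c k * cis (of_int k * x)"])
  qed
  then have "cnj (?s x) = ?s x" for x
    using has_sum_unique[OF _ s] by blast
  then have "complex_of_real (Re (?s x)) = ?s x" for x
    by (metis Reals_cnj_iff of_real_Re)
  with s have s': "((\<lambda>k. c k * cis (of_int k * x)) has_sum complex_of_real (Re (?s x))) UNIV" for x
    by simp
  show ?thesis
    using wiener_funI[OF c s'] fcoef_unique[OF c s'] by (simp add: coef_def of_coef_def fn_Wiener)
qed

text \<open>A Cauchy sequence converges coefficientwise, and the norm estimate passes to the limit
  because it is tested on finite sets of frequencies (\<open>bd\<close>). Hermitian symmetry
  survives, so the limit is again a real function.\<close>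

instance wiener :: banach
proof
  fix X :: "nat \<Rightarrow> wiener"
  assume X: "Cauchy X"
  have "Cauchy (\<lambda>n. coef (X n) k)" for k
    using bounded_linear.Cauchy[OF bounded_linear_coef X] .
  then have "\<exists>l. (\<lambda>n. coef (X n) k) \<longlonglongrightarrow> l" for k
    by (simp add: Cauchy_convergent_iff convergent_def)
  then obtain c where c: "\<And>k. (\<lambda>n. coef (X n) k) \<longlonglongrightarrow> c k" by metis
  have bd: "(\<Sum>k\<in>F. norm (coef (X n) k - c k)) \<le> e"
    if F: "finite F" and N: "\<And>m. m \<ge> N \<Longrightarrow> norm (X n - X m) \<le> e" for F n N e
  proof (rule tendsto_upperbound)
    show "(\<lambda>m. \<Sum>k\<in>F. norm (coef (X n) k - coef (X m) k)) \<longlonglongrightarrow> (\<Sum>k\<in>F. norm (coef (X n) k - c k))"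
      by (intro tendsto_intros c)
    show "\<forall>\<^sub>F m in sequentially. (\<Sum>k\<in>F. norm (coef (X n) k - coef (X m) k)) \<le> e"
      using eventually_ge_at_top[of N]
    proof eventually_elim
      case (elim m)
      have "(\<Sum>k\<in>F. norm (coef (X n - X m) k)) \<le> norm (X n - X m)"
        unfolding norm_wiener_def by (rule finite_sum_le_infsum[OF coef_summable F]) auto
      with N[OF elim] show ?case by (simp add: coef_diff)
    qed
  qed auto
  have C: "\<exists>N. \<forall>n\<ge>N. \<forall>m\<ge>N. norm (X n - X m) \<le> e" if "e > 0" for e
    using X that unfolding Cauchy_iff by (meson less_imp_le)
  have sd: "(\<lambda>k. norm (coef (X n) k - c k)) summable_on UNIV"
    and sb: "(\<Sum>\<^sub>\<infinity>k. norm (coef (X n) k - c k)) \<le> e"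
    if "\<And>m. m \<ge> N \<Longrightarrow> norm (X n - X m) \<le> e" for n N e
  proof -
    show 1: "(\<lambda>k. norm (coef (X n) k - c k)) summable_on UNIV"
      by (rule nonneg_bdd_above_summable_on) (auto intro!: bdd_aboveI[where M = e] bd[OF _ that])
    show "(\<Sum>\<^sub>\<infinity>k. norm (coef (X n) k - c k)) \<le> e"
      by (rule infsum_le_finite_sums[OF 1]) (auto intro!: bd[OF _ that])
  qed
  obtain N1 where N1: "\<And>n m. n \<ge> N1 \<Longrightarrow> m \<ge> N1 \<Longrightarrow> norm (X n - X m) \<le> 1"
    using C[of 1] by auto
  have sc: "(\<lambda>k. norm (c k)) summable_on UNIV"
  proof (rule summable_on_comparison_test[OF summable_on_add[OF sd[OF N1[of N1]] coef_summable[of "X N1"]]])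
    show "norm (c k) \<le> norm (coef (X N1) k - c k) + norm (coef (X N1) k)" for k
      using norm_triangle_ineq4[of "coef (X N1) k" "coef (X N1) k - c k"] by simp
  qed auto
  have h: "c (- k) = cnj (c k)" for k
  proof (rule LIMSEQ_unique[OF c])
    show "(\<lambda>n. coef (X n) (- k)) \<longlonglongrightarrow> cnj (c k)"
      unfolding coef_cnj by (intro tendsto_intros c)
  qed
  have "X \<longlonglongrightarrow> of_coef c"
  proof (rule LIMSEQ_I)
    fix r :: real assume "r > 0"
    then obtain N where N: "\<And>n m. n \<ge> N \<Longrightarrow> m \<ge> N \<Longrightarrow> norm (X n - X m) \<le> r / 2"
      using C[of "r / 2"] by auto
    have "norm (X n - of_coef c) < r" if "n \<ge> N" for n
      using sb[of N n "r / 2", OF N[OF that]] \<open>r > 0\<close> by (simp add: norm_wiener_def coef_diff coef_of_coef[OF sc h])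
    then show "\<exists>N. \<forall>n\<ge>N. norm (X n - of_coef c) < r" by blast
  qed
  then show "convergent X" by (auto simp: convergent_def)
qed

section \<open>The heat semigroup and translations\<close>

lemma continuous_on_infsum:
  fixes a :: "'i \<Rightarrow> 'b::topological_space \<Rightarrow> 'c::banach"
  assumes "\<And>k y. y \<in> X \<Longrightarrow> norm (a k y) \<le> M k" and "M summable_on UNIV"
    and "\<And>k. continuous_on X (a k)"
  shows "continuous_on X (\<lambda>y. \<Sum>\<^sub>\<infinity>k. a k y)"
proof (rule uniform_limit_theorem)
  show "uniform_limit X (\<lambda>K y. \<Sum>k\<in>K. a k y) (\<lambda>y. \<Sum>\<^sub>\<infinity>k. a k y) (finite_subsets_at_top UNIV)"
    by (rule Weierstrass_m_test_general) (use assms in auto)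
qed (auto intro!: always_eventually continuous_intros assms(3))

definition fmul :: "(int \<Rightarrow> complex) \<Rightarrow> wiener \<Rightarrow> wiener" where
  "fmul m f = of_coef (\<lambda>k. m k * coef f k)"

text \<open>Symbols of modulus at most 1 act as contractions; hermitian symmetry keeps the functions
  real.\<close>

definition multiplier :: "(int \<Rightarrow> complex) \<Rightarrow> bool" where
  "multiplier m \<longleftrightarrow> (\<forall>k. norm (m k) \<le> 1 \<and> m (- k) = cnj (m k))"

lemma coef_fmul:
  assumes "multiplier m"
  shows "coef (fmul m f) k = m k * coef f k"
proof -
  have m: "norm (m k) \<le> 1" "m (- k) = cnj (m k)" for k
    using assms by (auto simp: multiplier_def)
  have "(\<lambda>k. norm (m k * coef f k)) summable_on UNIV"
    by (rule summable_on_comparison_test[OF coef_summable[of f]])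
      (use m in \<open>auto simp: norm_mult intro!: mult_left_le_one_le\<close>)
  from coef_of_coef[OF this] show ?thesis
    by (simp add: fmul_def m(2) coef_cnj)
qed

lemma norm_fmul_le:
  assumes "multiplier m"
  shows "norm (fmul m f) \<le> norm f"
proof -
  have "norm (coef (fmul m f) k) \<le> norm (coef f k)" for k
    using assms by (auto simp: norm_mult coef_fmul multiplier_def intro!: mult_left_le_one_le)
  then show ?thesis
    unfolding norm_wiener_def by (intro infsum_mono coef_summable)
qed

lemma bounded_linear_fmul:
  assumes "multiplier m"
  shows "bounded_linear (fmul m)"
  by (rule bounded_linear_intro[where K = 1])
    (auto intro!: wiener_coef_eqI simp: coef_fmul[OF assms] coef_simps algebra_simps norm_fmul_le[OF assms])

text \<open>Continuity of the symbol at each single frequency suffices: on the fixed function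
  \<open>g\<close> its change is dominated by \<open>2 * norm (coef g k)\<close>, and contractivity
  reduces the moving argument to \<open>norm (f x - g)\<close>.\<close>

lemma continuous_on_fmul:
  assumes m: "\<And>y. multiplier (m y)" and c: "\<And>k. continuous_on UNIV (\<lambda>y::'b::topological_space. m y k)"
    and t: "(y \<longlongrightarrow> l) F" and f: "(f \<longlongrightarrow> g) F"
  shows "((\<lambda>x. fmul (m (y x)) (f x)) \<longlongrightarrow> fmul (m l) g) F"
proof -
  let ?G = "\<lambda>z. \<Sum>\<^sub>\<infinity>k. norm (m z k * coef g k - m l k * coef g k)"
  have b: "norm (norm (m z k * coef g k - m l k * coef g k)) \<le> 2 * norm (coef g k)" for z k
  proof -
    have "norm (m z k) \<le> 1" "norm (m l k) \<le> 1"
      using m by (auto simp: multiplier_def)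
    then have "norm (m z k - m l k) \<le> 2"
      using norm_triangle_ineq4[of "m z k" "m l k"] by linarith
    then have "norm (m z k - m l k) * norm (coef g k) \<le> 2 * norm (coef g k)"
      by (rule mult_right_mono) simp
    then show ?thesis
      by (simp add: norm_mult[symmetric] left_diff_distrib)
  qed
  have "continuous_on UNIV ?G"
    by (rule continuous_on_infsum[OF b]) (auto intro!: summable_on_cmult_right coef_summable continuous_intros c)
  then have "((\<lambda>x. ?G (y x)) \<longlongrightarrow> ?G l) F"
    by (rule continuous_on_tendsto_compose[OF _ t]) auto
  then have *: "((\<lambda>x. norm (f x - g) + ?G (y x)) \<longlongrightarrow> 0) F"
    using tendsto_add[OF tendsto_norm[OF tendsto_diff[OF f tendsto_const[of g]]], of "\<lambda>x. ?G (y x)" "?G l"] by simp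
  have "norm (fmul (m (y x)) (f x) - fmul (m l) g) \<le> norm (f x - g) + ?G (y x)" for x
  proof -
    have 1: "fmul (m (y x)) (f x) - fmul (m l) g = fmul (m (y x)) (f x - g) + (fmul (m (y x)) g - fmul (m l) g)"
      using bounded_linear.linear[OF bounded_linear_fmul[OF m]] by (simp add: linear_diff)
    have 2: "norm (fmul (m (y x)) g - fmul (m l) g) = ?G (y x)"
      by (simp add: norm_wiener_def coef_diff coef_fmul[OF m])
    have "norm (fmul (m (y x)) (f x) - fmul (m l) g) \<le> norm (fmul (m (y x)) (f x - g)) + ?G (y x)"
      unfolding 1 by (rule order_trans[OF norm_triangle_ineq]) (simp only: 2 order_refl)
    also have "norm (fmul (m (y x)) (f x - g)) \<le> norm (f x - g)"
      by (rule norm_fmul_le[OF m])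
    finally show ?thesis by simp
  qed
  then have "((\<lambda>x. fmul (m (y x)) (f x) - fmul (m l) g) \<longlongrightarrow> 0) F"
    by (intro Lim_null_comparison[OF _ *] always_eventually allI)
  then show ?thesis by (rule LIM_zero_cancel)
qed

text \<open>Clipping at 0 makes \<open>S t\<close> the identity for negative \<open>t\<close>, and jointly continuous in \<open>t\<close> and the function.\<close>

definition heat_mult :: "real \<Rightarrow> int \<Rightarrow> complex" where
  "heat_mult t k = complex_of_real (exp (- (of_int k)\<^sup>2 * max 0 t))"

definition S :: "real \<Rightarrow> wiener \<Rightarrow> wiener" where
  "S t = fmul (heat_mult t)"

definition Tr :: "real \<Rightarrow> wiener \<Rightarrow> wiener" where
  "Tr h = fmul (\<lambda>k. cis (of_int k * h))"

lemma multiplier_heat: "multiplier (heat_mult t)"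
  and multiplier_Tr: "multiplier (\<lambda>k. cis (of_int k * h))"
  unfolding multiplier_def heat_mult_def by (auto simp: cis_cnj mult_nonneg_nonneg)

lemma coef_S: "coef (S t f) k = exp (- (of_int k)\<^sup>2 * max 0 t) *\<^sub>R coef f k"
  unfolding S_def coef_fmul[OF multiplier_heat] by (simp add: heat_mult_def scaleR_conv_of_real)

lemma coef_Tr: "coef (Tr h f) k = cis (of_int k * h) * coef f k"
  unfolding Tr_def coef_fmul[OF multiplier_Tr] by simp

lemmas bounded_linear_S = bounded_linear_fmul[OF multiplier_heat, folded S_def]
lemmas bounded_linear_Tr = bounded_linear_fmul[OF multiplier_Tr, folded Tr_def]
lemmas norm_S_le = norm_fmul_le[OF multiplier_heat, folded S_def]
lemmas norm_Tr_le = norm_fmul_le[OF multiplier_Tr, folded Tr_def]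

lemma S_simps:
  "S t (f + g) = S t f + S t g" "S t (f - g) = S t f - S t g" "S t (r *\<^sub>R f) = r *\<^sub>R S t f" "S t 0 = 0"
  using bounded_linear.linear[OF bounded_linear_S] by (auto simp: linear_add linear_diff linear_scale linear_0)

lemma Tr_simps:
  "Tr t (f + g) = Tr t f + Tr t g" "Tr t (f - g) = Tr t f - Tr t g" "Tr t (r *\<^sub>R f) = r *\<^sub>R Tr t f" "Tr t 0 = 0"
  using bounded_linear.linear[OF bounded_linear_Tr] by (auto simp: linear_add linear_diff linear_scale linear_0)

lemma tendsto_S [tendsto_intros]:
  "(y \<longlongrightarrow> l) F \<Longrightarrow> (f \<longlongrightarrow> g) F \<Longrightarrow> ((\<lambda>x. S (y x) (f x)) \<longlongrightarrow> S l g) F"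
  unfolding S_def by (rule continuous_on_fmul[OF multiplier_heat]) (auto simp: heat_mult_def intro!: continuous_intros)

lemma tendsto_Tr [tendsto_intros]:
  "(y \<longlongrightarrow> l) F \<Longrightarrow> (f \<longlongrightarrow> g) F \<Longrightarrow> ((\<lambda>x. Tr (y x) (f x)) \<longlongrightarrow> Tr l g) F"
  unfolding Tr_def by (rule continuous_on_fmul[where m = "\<lambda>h k. cis (of_int k * h)", OF multiplier_Tr])
    (auto intro!: continuous_intros)

lemma continuous_on_S [continuous_intros]:
  "continuous_on X t \<Longrightarrow> continuous_on X f \<Longrightarrow> continuous_on X (\<lambda>x. S (t x) (f x))"
  unfolding continuous_on_def by (auto intro!: tendsto_S)

lemma continuous_on_Tr [continuous_intros]:
  "continuous_on X t \<Longrightarrow> continuous_on X f \<Longrightarrow> continuous_on X (\<lambda>x. Tr (t x) (f x))"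
  unfolding continuous_on_def by (auto intro!: tendsto_Tr)

lemma S_0 [simp]: "S 0 f = f"
  by (rule wiener_coef_eqI) (simp add: coef_S)

lemma S_const: "S t (r *\<^sub>R 1) = r *\<^sub>R 1"
  by (rule wiener_coef_eqI) (simp add: coef_S coef_simps)

lemma fn_Tr: "fn (Tr h f) x = fn f (x + h)"
proof -
  have "((\<lambda>k. coef (Tr h f) k * cis (of_int k * x)) has_sum complex_of_real (fn f (x + h))) UNIV"
    using coef_has_sum[of f "x + h"]
    by (rule has_sum_cong[THEN iffD1, rotated]) (simp add: coef_Tr distrib_left flip: cis_mult)
  from has_sum_unique[OF coef_has_sum this] show ?thesis
    by (simp only: of_real_eq_iff)
qed

lemma Tr_0 [simp]: "Tr 0 f = f"
  by (rule wiener_eqI) (simp add: fn_Tr)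

lemma Tr_Tr: "Tr s (Tr t f) = Tr (s + t) f"
  by (rule wiener_eqI) (simp add: fn_Tr algebra_simps)

lemma fn_power [simp]: "fn (f ^ n) x = fn f x ^ n"
  by (induction n) auto

lemma fn_exp [simp]: "fn (exp f) x = exp (fn f x)"
proof -
  have "(\<lambda>n. fn (f ^ n /\<^sub>R fact n) x) sums fn (exp f) x"
    using bounded_linear.sums[OF bounded_linear_fn exp_converges[of f]] .
  moreover have "(\<lambda>n. fn (f ^ n /\<^sub>R fact n) x) sums exp (fn f x)"
    using exp_converges[of "fn f x"] by simp
  ultimately show ?thesis by (rule sums_unique2)
qed

lemma exp_add_wiener: "exp (f + g) = exp f * exp (g :: wiener)"
  by (rule exp_add_commuting) (rule mult.commute)

section \<open>Trigonometric modes and differentiation along translations\<close>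

definition cosW :: "int \<Rightarrow> wiener" where "cosW n = Wiener (\<lambda>x. cos (of_int n * x))"
definition sinW :: "int \<Rightarrow> wiener" where "sinW n = Wiener (\<lambda>x. sin (of_int n * x))"

lemma has_sum_two_modes:
  fixes a b :: complex
  shows "(\<lambda>k. norm ((if k = n then a else 0) + (if k = - n then b else 0))) summable_on UNIV"
    "((\<lambda>k. ((if k = n then a else 0) + (if k = - n then b else 0)) * cis (of_int k * x)) has_sum
      a * cis (of_int n * x) + b * cis (- (of_int n * x))) UNIV"
proof -
  have f: "(\<lambda>k. norm (if k = m then c else 0)) summable_on UNIV" for m :: int and c :: complex
    by (rule has_sum_imp_summable[OF has_sum_finite_neutralI[of "{m}"]]) auto
  show "(\<lambda>k. norm ((if k = n then a else 0) + (if k = - n then b else 0))) summable_on UNIV"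
    by (rule summable_on_comparison_test[OF summable_on_add[OF f[of n a] f[of "-n" b]]]) (auto simp: norm_triangle_ineq)
  have "((\<lambda>k. (if k = n then a * cis (of_int n * x) else 0) + (if k = - n then b * cis (- (of_int n * x)) else 0)) has_sum
      a * cis (of_int n * x) + b * cis (- (of_int n * x))) UNIV"
    by (intro has_sum_add has_sum_if_single)
  then show "((\<lambda>k. ((if k = n then a else 0) + (if k = - n then b else 0)) * cis (of_int k * x)) has_sum
      a * cis (of_int n * x) + b * cis (- (of_int n * x))) UNIV"
    by (rule has_sum_cong[THEN iffD1, rotated]) (auto simp: distrib_right)
qed

lemma fn_cosW [simp]: "fn (cosW n) x = cos (of_int n * x)"
  and coef_cosW: "coef (cosW n) k = (if k = n then 1/2 else 0) + (if k = - n then 1/2 else 0)"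
proof -
  let ?c = "\<lambda>k. (if k = n then 1/2 else 0) + (if k = - n then 1/2 else (0::complex))"
  have h: "((\<lambda>k. ?c k * cis (of_int k * x)) has_sum complex_of_real (cos (of_int n * x))) UNIV" for x
  proof -
    have "1/2 * cis (of_int n * x) + 1/2 * cis (- (of_int n * x)) = complex_of_real (cos (of_int n * x))"
      by (simp add: complex_eq_iff)
    with has_sum_two_modes(2)[of n "1/2" "1/2" x] show ?thesis by (simp only:)
  qed
  have "wiener_fun (\<lambda>x. cos (of_int n * x))"
    by (rule wiener_funI[OF has_sum_two_modes(1) h])
  then have e: "fn (cosW n) = (\<lambda>x. cos (of_int n * x))"
    by (simp add: cosW_def fn_Wiener)
  show "fn (cosW n) x = cos (of_int n * x)" by (simp add: e)
  show "coef (cosW n) k = ?c k"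
    using fun_cong[OF fcoef_unique[OF has_sum_two_modes(1) h], of k] by (simp add: coef_def e)
qed

lemma fn_sinW [simp]: "fn (sinW n) x = sin (of_int n * x)"
  and coef_sinW: "coef (sinW n) k = (if k = n then - \<i>/2 else 0) + (if k = - n then \<i>/2 else 0)"
proof -
  let ?c = "\<lambda>k. (if k = n then - \<i>/2 else 0) + (if k = - n then \<i>/2 else (0::complex))"
  have h: "((\<lambda>k. ?c k * cis (of_int k * x)) has_sum complex_of_real (sin (of_int n * x))) UNIV" for x
  proof -
    have "- \<i>/2 * cis (of_int n * x) + \<i>/2 * cis (- (of_int n * x)) = complex_of_real (sin (of_int n * x))"
      by (simp add: complex_eq_iff)
    with has_sum_two_modes(2)[of n "- \<i>/2" "\<i>/2" x] show ?thesis by (simp only:)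
  qed
  have "wiener_fun (\<lambda>x. sin (of_int n * x))"
    by (rule wiener_funI[OF has_sum_two_modes(1) h])
  then have e: "fn (sinW n) = (\<lambda>x. sin (of_int n * x))"
    by (simp add: sinW_def fn_Wiener)
  show "fn (sinW n) x = sin (of_int n * x)" by (simp add: e)
  show "coef (sinW n) k = ?c k"
    using fun_cong[OF fcoef_unique[OF has_sum_two_modes(1) h], of k] by (simp add: coef_def e)
qed

text \<open>Differentiability of the translation orbit in the norm of the algebra, which is stronger
  than differentiability of \<open>fn f\<close> at every point. The Gaussian limit further on takes
  place in this norm.\<close>

definition tderiv :: "wiener \<Rightarrow> wiener \<Rightarrow> bool" where
  "tderiv f f' \<longleftrightarrow> ((\<lambda>h. Tr h f) has_vector_derivative f') (at 0)"

lemma tderiv_add: "tderiv f f' \<Longrightarrow> tderiv g g' \<Longrightarrow> tderiv (f + g) (f' + g')"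
  unfolding tderiv_def Tr_simps by (rule has_vector_derivative_add)

lemma tderiv_scaleR: "tderiv f f' \<Longrightarrow> tderiv (r *\<^sub>R f) (r *\<^sub>R f')"
  unfolding tderiv_def Tr_simps by (rule has_vector_derivative_scaleR[OF DERIV_const, simplified])

lemma tderiv_cosW: "tderiv (cosW n) (- of_int n *\<^sub>R sinW n)"
proof -
  have "Tr h (cosW n) = cos (of_int n * h) *\<^sub>R cosW n - sin (of_int n * h) *\<^sub>R sinW n" for h
    by (rule wiener_eqI) (simp add: fn_Tr distrib_left cos_add algebra_simps)
  moreover have "((\<lambda>h. cos (of_int n * h) *\<^sub>R cosW n - sin (of_int n * h) *\<^sub>R sinW n)
      has_vector_derivative (- of_int n *\<^sub>R sinW n)) (at 0)"
    by (auto intro!: derivative_eq_intros)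
  ultimately show ?thesis by (simp add: tderiv_def)
qed

lemma tderiv_sinW: "tderiv (sinW n) (of_int n *\<^sub>R cosW n)"
proof -
  have "Tr h (sinW n) = cos (of_int n * h) *\<^sub>R sinW n + sin (of_int n * h) *\<^sub>R cosW n" for h
    by (rule wiener_eqI) (simp add: fn_Tr distrib_left sin_add algebra_simps)
  moreover have "((\<lambda>h. cos (of_int n * h) *\<^sub>R sinW n + sin (of_int n * h) *\<^sub>R cosW n)
      has_vector_derivative (of_int n *\<^sub>R cosW n)) (at 0)"
    by (auto intro!: derivative_eq_intros)
  ultimately show ?thesis by (simp add: tderiv_def)
qed

text \<open>The group law transports the derivative at 0 to every s, where it is
  \<open>Tr s f'\<close>, of norm at most \<open>norm f'\<close>; the mean value inequality
  concludes.\<close>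

lemma tderiv_lipschitz:
  assumes "tderiv f f'"
  shows "norm (Tr h f - f) \<le> \<bar>h\<bar> * norm f'"
proof -
  have d: "((\<lambda>h. Tr h f) has_vector_derivative Tr s f') (at s)" for s
  proof -
    have "((\<lambda>h. Tr h f) has_vector_derivative f') (at ((\<lambda>h. h - s) s))"
      using assms by (simp add: tderiv_def)
    then have "((\<lambda>h. Tr h f) \<circ> (\<lambda>h. h - s) has_vector_derivative 1 *\<^sub>R f') (at s)"
      by (intro vector_diff_chain_at) (auto intro!: derivative_eq_intros)
    then have "((\<lambda>h. Tr (h - s) f) has_vector_derivative f') (at s)"
      by (simp add: o_def)
    from bounded_linear.has_vector_derivative[OF bounded_linear_Tr[of s] this]
    show ?thesis by (simp add: Tr_Tr)
  qed
  have "norm (Tr h f - Tr 0 f) \<le> norm f' * norm (h - 0)"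
  proof (rule differentiable_bound[where f' = "\<lambda>s y. y *\<^sub>R Tr s f'"])
    show "((\<lambda>h. Tr h f) has_derivative (\<lambda>y. y *\<^sub>R Tr s f')) (at s within UNIV)" for s
      using d[of s] by (simp add: has_vector_derivative_def)
    show "onorm (\<lambda>y::real. y *\<^sub>R Tr s f') \<le> norm f'" for s
      using norm_Tr_le[of s f'] by (intro onorm_bound) (auto simp: mult.commute intro!: mult_left_mono)
  qed auto
  then show ?thesis by (simp add: mult.commute)
qed

section \<open>The inhomogeneous heat equation\<close>

definition duh :: "(real \<Rightarrow> wiener) \<Rightarrow> real \<Rightarrow> wiener" where
  "duh F t = integral {0..t} (\<lambda>r. S (t - r) (F r))"

lemma continuous_on_duh_integrand:
  assumes "continuous_on {0..\<tau>} F" "t \<in> {0..\<tau>}"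
  shows "continuous_on {0..t} (\<lambda>r. S (t - r) (F r))"
  by (intro continuous_intros continuous_on_subset[OF assms(1)]) (use assms(2) in auto)

text \<open>The upper limit of integration is frozen at \<tau>: since \<open>S\<close> is the
  identity at negative times, the integrand is jointly continuous on the whole square, and the
  surplus over \<open>{t..\<tau>}\<close> is a plain integral of F.\<close>

lemma continuous_on_duh:
  assumes F: "continuous_on {0..\<tau>} F"
  shows "continuous_on {0..\<tau>} (duh F)"
proof -
  have "continuous_on ({0..\<tau>} \<times> cbox 0 \<tau>) (\<lambda>(t, r). S (t - r) (F r))"
    unfolding case_prod_unfold
    by (intro continuous_intros continuous_on_compose2[OF F]) auto
  from integral_continuous_on_param[OF this]
  have 1: "continuous_on {0..\<tau>} (\<lambda>t. integral {0..\<tau>} (\<lambda>r. S (t - r) (F r)))"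
    by simp
  have 2: "continuous_on {0..\<tau>} (\<lambda>t. integral {0..t} F)"
    by (intro indefinite_integral_continuous_1 integrable_continuous_real F)
  have "duh F t = integral {0..\<tau>} (\<lambda>r. S (t - r) (F r)) - (integral {0..\<tau>} F - integral {0..t} F)"
    if t: "t \<in> {0..\<tau>}" for t
  proof -
    have 3: "continuous_on {0..\<tau>} (\<lambda>r. S (t - r) (F r))"
      by (intro continuous_intros F)
    have 4: "S (t - r) (F r) = F r" if "r \<in> {t..\<tau>}" for r
      using that by (intro wiener_coef_eqI) (auto simp: coef_S max_def)
    have "integral {0..t} (\<lambda>r. S (t - r) (F r)) + integral {t..\<tau>} (\<lambda>r. S (t - r) (F r)) = integral {0..\<tau>} (\<lambda>r. S (t - r) (F r))"
      by (intro Henstock_Kurzweil_Integration.integral_combine integrable_continuous_real 3) (use t in auto)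
    moreover have "integral {t..\<tau>} (\<lambda>r. S (t - r) (F r)) = integral {t..\<tau>} F"
      by (intro integral_cong 4)
    moreover have "integral {0..t} F + integral {t..\<tau>} F = integral {0..\<tau>} F"
      by (intro Henstock_Kurzweil_Integration.integral_combine integrable_continuous_real F) (use t in auto)
    ultimately show ?thesis unfolding duh_def by (metis add_diff_cancel_left' add_diff_cancel_right')
  qed
  then show ?thesis
    by (subst continuous_on_cong[OF refl]) (auto intro!: continuous_intros 1 2)
qed

lemma norm_duh_le:
  assumes F: "continuous_on {0..\<tau>} F" and t: "t \<in> {0..\<tau>}"
    and g: "\<And>r. r \<in> {0..t} \<Longrightarrow> norm (F r) \<le> g r" and gi: "g integrable_on {0..t}"
  shows "norm (duh F t) \<le> integral {0..t} g"
  unfolding duh_def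
proof (rule integral_norm_bound_integral[OF integrable_continuous_real gi])
  show "continuous_on {0..t} (\<lambda>r. S (t - r) (F r))"
    by (rule continuous_on_duh_integrand[OF F t])
  show "norm (S (t - r) (F r)) \<le> g r" if "r \<in> {0..t}" for r
    by (rule order_trans[OF norm_S_le g[OF that]])
qed

lemma coef_duh:
  assumes F: "continuous_on {0..\<tau>} F" and t: "t \<in> {0..\<tau>}"
  shows "((\<lambda>r. exp ((of_int k)\<^sup>2 * r) *\<^sub>R coef (F r) k) has_integral exp ((of_int k)\<^sup>2 * t) *\<^sub>R coef (duh F t) k) {0..t}"
proof -
  have "((\<lambda>r. S (t - r) (F r)) has_integral duh F t) {0..t}"
    unfolding duh_def
    by (intro integrable_integral integrable_continuous_real continuous_on_duh_integrand[OF F t])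
  from has_integral_linear[OF this bounded_linear_coef[of k]]
  have "((\<lambda>r. coef (S (t - r) (F r)) k) has_integral coef (duh F t) k) {0..t}"
    by (simp add: o_def)
  from has_integral_cmul[OF this, of "exp ((of_int k)\<^sup>2 * t)"]
  show ?thesis
    by (rule has_integral_eq[rotated]) (auto simp: coef_S algebra_simps simp flip: exp_add)
qed

text \<open>The equation \<open>\<partial>\<^sub>t y = \<partial>\<^sub>x\<^sup>2 y + F\<close>, integrated coefficient by coefficient after multiplication by \<open>exp (k\<^sup>2 * t)\<close>.\<close>

definition heat_sol :: "real \<Rightarrow> real \<Rightarrow> (real \<Rightarrow> wiener) \<Rightarrow> (real \<Rightarrow> wiener) \<Rightarrow> bool" where
  "heat_sol a b y F \<longleftrightarrow> continuous_on {a..b} y \<and>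
     (\<forall>k. \<forall>t\<in>{a..b}. ((\<lambda>r. exp ((of_int k)\<^sup>2 * r) *\<^sub>R coef (F r) k) has_integral
        (exp ((of_int k)\<^sup>2 * t) *\<^sub>R coef (y t) k - exp ((of_int k)\<^sup>2 * a) *\<^sub>R coef (y a) k)) {a..t})"

lemma duh_0 [simp]: "duh F 0 = 0"
  by (simp add: duh_def)

lemma heat_sol_duh:
  assumes F: "continuous_on {0..\<tau>} F" and y: "\<And>t. t \<in> {0..\<tau>} \<Longrightarrow> y t = S t y0 + duh F t" and "0 \<le> \<tau>"
  shows "heat_sol 0 \<tau> y F"
  unfolding heat_sol_def
proof (intro conjI allI ballI)
  show "continuous_on {0..\<tau>} y"
    by (subst continuous_on_cong[OF refl y]) (auto intro!: continuous_intros continuous_on_duh F)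
  fix k t assume t: "t \<in> {0..\<tau>}"
  have "exp ((of_int k)\<^sup>2 * t) *\<^sub>R coef (y t) k - exp ((of_int k)\<^sup>2 * 0) *\<^sub>R coef (y 0) k
      = exp ((of_int k)\<^sup>2 * t) *\<^sub>R coef (duh F t) k"
    using t \<open>0 \<le> \<tau>\<close> by (simp add: y coef_simps coef_S scaleR_add_right flip: exp_add)
  with coef_duh[OF F t, of k]
  show "((\<lambda>r. exp ((of_int k)\<^sup>2 * r) *\<^sub>R coef (F r) k) has_integral
      (exp ((of_int k)\<^sup>2 * t) *\<^sub>R coef (y t) k - exp ((of_int k)\<^sup>2 * 0) *\<^sub>R coef (y 0) k)) {0..t}"
    by simp
qed

lemma heat_sol_imp_duh:
  assumes y: "heat_sol 0 \<tau> y F" and F: "continuous_on {0..\<tau>} F" and t: "t \<in> {0..\<tau>}"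
  shows "y t = S t (y 0) + duh F t"
proof (rule wiener_coef_eqI)
  fix k
  have "exp ((of_int k)\<^sup>2 * t) *\<^sub>R coef (y t) k - exp ((of_int k)\<^sup>2 * 0) *\<^sub>R coef (y 0) k
      = exp ((of_int k)\<^sup>2 * t) *\<^sub>R coef (duh F t) k"
    using y t coef_duh[OF F t, of k] unfolding heat_sol_def by (blast intro: has_integral_unique)
  then have "exp ((of_int k)\<^sup>2 * t) *\<^sub>R coef (y t) k = exp ((of_int k)\<^sup>2 * t) *\<^sub>R coef (S t (y 0) + duh F t) k"
    using t by (simp add: coef_simps coef_S scaleR_add_right algebra_simps flip: exp_add)
  then show "coef (y t) k = coef (S t (y 0) + duh F t) k" by simp
qed

lemma heat_sol_continuous: "heat_sol a b y F \<Longrightarrow> continuous_on {a..b} y"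
  by (simp add: heat_sol_def)

text \<open>Agreement of the sources on the open interval is enough, because two points do not
  affect the integrals. This is what allows the potential to jump at the switching time when pieces
  are joined.\<close>

lemma heat_sol_cong:
  assumes "heat_sol a b y F" and "\<And>t. t \<in> {a..b} \<Longrightarrow> y t = z t" and "\<And>t. t \<in> {a<..<b} \<Longrightarrow> F t = G t"
  shows "heat_sol a b z G"
  unfolding heat_sol_def
proof (intro conjI allI ballI)
  show "continuous_on {a..b} z"
    using assms(1,2) continuous_on_cong[of "{a..b}" "{a..b}" y z] by (simp add: heat_sol_def)
  fix k t assume t: "t \<in> {a..b}"
  have *: "((\<lambda>r. exp ((of_int k)\<^sup>2 * r) *\<^sub>R coef (F r) k) has_integral
        (exp ((of_int k)\<^sup>2 * t) *\<^sub>R coef (y t) k - exp ((of_int k)\<^sup>2 * a) *\<^sub>R coef (y a) k)) {a..t}"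
    using assms(1) t by (simp add: heat_sol_def)
  have "y t = z t" "y a = z a"
    using t by (auto intro!: assms(2))
  then show "((\<lambda>r. exp ((of_int k)\<^sup>2 * r) *\<^sub>R coef (G r) k) has_integral
        (exp ((of_int k)\<^sup>2 * t) *\<^sub>R coef (z t) k - exp ((of_int k)\<^sup>2 * a) *\<^sub>R coef (z a) k)) {a..t}"
  proof (intro has_integral_spike_finite[OF _ _ *[unfolded \<open>y t = z t\<close> \<open>y a = z a\<close>]])
    show "exp ((of_int k)\<^sup>2 * r) *\<^sub>R coef (G r) k = exp ((of_int k)\<^sup>2 * r) *\<^sub>R coef (F r) k"
      if "r \<in> {a..t} - {a, b}" for r
      using that t by (simp add: assms(3))
  qed simp
qed

lemma heat_sol_join:
  assumes 1: "heat_sol a b y F" and 2: "heat_sol b c y F" and "a \<le> b" "b \<le> c"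
  shows "heat_sol a c y F"
  unfolding heat_sol_def
proof (intro conjI allI ballI)
  have "{a..c} = {a..b} \<union> {b..c}" using assms by auto
  then show "continuous_on {a..c} y"
    using 1 2 by (auto simp: heat_sol_def intro!: continuous_on_closed_Un)
  fix k t assume t: "t \<in> {a..c}"
  show "((\<lambda>r. exp ((of_int k)\<^sup>2 * r) *\<^sub>R coef (F r) k) has_integral
        (exp ((of_int k)\<^sup>2 * t) *\<^sub>R coef (y t) k - exp ((of_int k)\<^sup>2 * a) *\<^sub>R coef (y a) k)) {a..t}"
  proof (cases "t \<le> b")
    case True
    then show ?thesis using 1 t by (simp add: heat_sol_def)
  next
    case False
    have "((\<lambda>r. exp ((of_int k)\<^sup>2 * r) *\<^sub>R coef (F r) k) has_integral
        ((exp ((of_int k)\<^sup>2 * b) *\<^sub>R coef (y b) k - exp ((of_int k)\<^sup>2 * a) *\<^sub>R coef (y a) k) +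
         (exp ((of_int k)\<^sup>2 * t) *\<^sub>R coef (y t) k - exp ((of_int k)\<^sup>2 * b) *\<^sub>R coef (y b) k))) {a..t}"
      by (rule has_integral_combine[where c = b]) (use 1 2 t False assms in \<open>auto simp: heat_sol_def\<close>)
    then show ?thesis by simp
  qed
qed

lemma heat_sol_shift:
  assumes "heat_sol a b y F"
  shows "heat_sol (a + s) (b + s) (\<lambda>t. y (t - s)) (\<lambda>t. F (t - s))"
  unfolding heat_sol_def
proof (intro conjI allI ballI)
  show "continuous_on {a + s..b + s} (\<lambda>t. y (t - s))"
    using assms by (auto simp: heat_sol_def intro!: continuous_intros continuous_on_compose2[of "{a..b}" y])
  fix k t assume t: "t \<in> {a + s..b + s}"
  let ?g = "\<lambda>r. exp ((of_int k)\<^sup>2 * r) *\<^sub>R coef (F r) k"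
  have "(?g has_integral (exp ((of_int k)\<^sup>2 * (t - s)) *\<^sub>R coef (y (t - s)) k - exp ((of_int k)\<^sup>2 * a) *\<^sub>R coef (y a) k)) {a..t - s}"
    using assms t by (auto simp: heat_sol_def)
  then have "((\<lambda>r. ?g (r - s)) has_integral (exp ((of_int k)\<^sup>2 * (t - s)) *\<^sub>R coef (y (t - s)) k - exp ((of_int k)\<^sup>2 * a) *\<^sub>R coef (y a) k)) {a + s..t}"
    using has_integral_shift_cbox_iff[of "\<lambda>r. ?g (r - s)" s _ a "t - s"] by (simp add: o_def)
  from has_integral_cmul[OF this, of "exp ((of_int k)\<^sup>2 * s)"]
  show "((\<lambda>r. exp ((of_int k)\<^sup>2 * r) *\<^sub>R coef (F (r - s)) k) has_integral
        (exp ((of_int k)\<^sup>2 * t) *\<^sub>R coef (y (t - s)) k - exp ((of_int k)\<^sup>2 * (a + s)) *\<^sub>R coef (y (a + s - s)) k)) {a + s..t}"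
    by (simp add: scaleR_diff_right right_diff_distrib distrib_left add.commute flip: exp_add)
qed

lemma heat_sol_diff:
  assumes "heat_sol a b y F" "heat_sol a b z G"
  shows "heat_sol a b (\<lambda>t. y t - z t) (\<lambda>t. F t - G t)"
  unfolding heat_sol_def
proof (intro conjI allI ballI)
  show "continuous_on {a..b} (\<lambda>t. y t - z t)"
    using assms by (auto simp: heat_sol_def intro!: continuous_intros)
  fix k t assume t: "t \<in> {a..b}"
  with assms have "((\<lambda>r. exp ((of_int k)\<^sup>2 * r) *\<^sub>R coef (F r) k - exp ((of_int k)\<^sup>2 * r) *\<^sub>R coef (G r) k) has_integral
     ((exp ((of_int k)\<^sup>2 * t) *\<^sub>R coef (y t) k - exp ((of_int k)\<^sup>2 * a) *\<^sub>R coef (y a) k) -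
      (exp ((of_int k)\<^sup>2 * t) *\<^sub>R coef (z t) k - exp ((of_int k)\<^sup>2 * a) *\<^sub>R coef (z a) k))) {a..t}"
    unfolding heat_sol_def by (intro has_integral_diff) auto
  then show "((\<lambda>r. exp ((of_int k)\<^sup>2 * r) *\<^sub>R coef (F r - G r) k) has_integral
     (exp ((of_int k)\<^sup>2 * t) *\<^sub>R coef (y t - z t) k - exp ((of_int k)\<^sup>2 * a) *\<^sub>R coef (y a - z a) k)) {a..t}"
    by (simp add: coef_diff algebra_simps)
qed

lemma heat_sol_scaleR:
  assumes "heat_sol a b y F" shows "heat_sol a b (\<lambda>t. c *\<^sub>R y t) (\<lambda>t. c *\<^sub>R F t)"
  unfolding heat_sol_def
proof (intro conjI allI ballI)
  show "continuous_on {a..b} (\<lambda>t. c *\<^sub>R y t)"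
    using assms by (auto simp: heat_sol_def intro!: continuous_intros)
  fix k t assume t: "t \<in> {a..b}"
  with assms have "((\<lambda>r. c *\<^sub>R exp ((of_int k)\<^sup>2 * r) *\<^sub>R coef (F r) k) has_integral
     (c *\<^sub>R (exp ((of_int k)\<^sup>2 * t) *\<^sub>R coef (y t) k - exp ((of_int k)\<^sup>2 * a) *\<^sub>R coef (y a) k))) {a..t}"
    unfolding heat_sol_def by (intro has_integral_cmul) auto
  then show "((\<lambda>r. exp ((of_int k)\<^sup>2 * r) *\<^sub>R coef (c *\<^sub>R F r) k) has_integral
     (exp ((of_int k)\<^sup>2 * t) *\<^sub>R coef (c *\<^sub>R y t) k - exp ((of_int k)\<^sup>2 * a) *\<^sub>R coef (c *\<^sub>R y a) k)) {a..t}"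
    by (simp add: coef_simps(4) scaleR_diff_right mult.commute)
qed

lemma heat_sol_add:
  assumes "heat_sol a b y F" "heat_sol a b z G"
  shows "heat_sol a b (\<lambda>t. y t + z t) (\<lambda>t. F t + G t)"
  using heat_sol_diff[OF assms(1) heat_sol_scaleR[OF assms(2), of "-1"]] by simp

text \<open>The product rule, applied to coefficients: since F is continuous, each weighted
  coefficient of y is a differentiable primitive, although y is only known to be continuous in norm.
  The extra source m' y shows that a positive scaling m costs the constant potential m'/m.\<close>

lemma heat_sol_gauge:
  assumes y: "heat_sol a b y F" and F: "continuous_on {a..b} F"
    and m: "\<And>t. t \<in> {a..b} \<Longrightarrow> (m has_real_derivative m' t) (at t within {a..b})" and m': "continuous_on {a..b} m'"
  shows "heat_sol a b (\<lambda>t. m t *\<^sub>R y t) (\<lambda>t. m t *\<^sub>R F t + m' t *\<^sub>R y t)"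
  unfolding heat_sol_def
proof (intro conjI allI ballI)
  have cm: "continuous_on {a..b} m"
    by (rule DERIV_continuous_on) (rule m)
  then show "continuous_on {a..b} (\<lambda>t. m t *\<^sub>R y t)"
    using y by (auto simp: heat_sol_def intro!: continuous_intros)
  fix k t assume t: "t \<in> {a..b}"
  define E where "E = (\<lambda>t. exp ((of_int k)\<^sup>2 * t) *\<^sub>R coef (y t) k)"
  define g where "g = (\<lambda>r. exp ((of_int k)\<^sup>2 * r) *\<^sub>R coef (F r) k)"
  have cg: "continuous_on {a..b} g"
    unfolding g_def by (intro continuous_intros bounded_linear.continuous_on[OF bounded_linear_coef] F)
  have E: "E s = E a + integral {a..s} g" if "s \<in> {a..b}" for s
  proof -
    have "(g has_integral E s - E a) {a..s}"
      using y that by (simp add: heat_sol_def E_def g_def)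
    from integral_unique[OF this] show ?thesis by simp
  qed
  have dE: "(E has_vector_derivative g s) (at s within {a..b})" if s: "s \<in> {a..b}" for s
  proof -
    have "((\<lambda>s. E a + integral {a..s} g) has_vector_derivative g s) (at s within {a..b})"
      using integral_has_vector_derivative[OF cg s] by (auto intro!: derivative_eq_intros)
    then show ?thesis
      by (rule has_vector_derivative_transform[OF s, rotated]) (rule E)
  qed
  have "((\<lambda>s. m s *\<^sub>R g s + m' s *\<^sub>R E s) has_integral (m t *\<^sub>R E t - m a *\<^sub>R E a)) {a..t}"
  proof (rule fundamental_theorem_of_calculus)
    fix s assume s: "s \<in> {a..t}"
    have "((\<lambda>s. m s *\<^sub>R E s) has_vector_derivative m s *\<^sub>R g s + m' s *\<^sub>R E s) (at s within {a..b})"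
      using s t by (intro has_vector_derivative_scaleR m dE) auto
    then show "((\<lambda>s. m s *\<^sub>R E s) has_vector_derivative m s *\<^sub>R g s + m' s *\<^sub>R E s) (at s within {a..t})"
      using t by (auto elim: has_vector_derivative_within_subset)
  qed (use t in auto)
  then show "((\<lambda>r. exp ((of_int k)\<^sup>2 * r) *\<^sub>R coef (m r *\<^sub>R F r + m' r *\<^sub>R y r) k) has_integral
     (exp ((of_int k)\<^sup>2 * t) *\<^sub>R coef (m t *\<^sub>R y t) k - exp ((of_int k)\<^sup>2 * a) *\<^sub>R coef (m a *\<^sub>R y a) k)) {a..t}"
    by (simp add: coef_simps(3,4) E_def g_def scaleR_add_right mult.commute)
qed

section \<open>Duhamel equations in exponentially weighted norms\<close>

lemma integral_exp_weight:
  fixes L t :: real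
  assumes "L > 0" "0 \<le> t"
  shows "(\<lambda>r. L * exp (2 * L * r)) integrable_on {0..t}"
    and "integral {0..t} (\<lambda>r. L * exp (2 * L * r)) \<le> exp (2 * L * t) / 2"
proof -
  have *: "((\<lambda>r. L * exp (2 * L * r)) has_integral (exp (2 * L * t) / 2 - exp (2 * L * 0) / 2)) {0..t}"
    by (rule fundamental_theorem_of_calculus)
      (use assms in \<open>auto intro!: derivative_eq_intros simp flip: has_real_derivative_iff_has_vector_derivative\<close>)
  show "(\<lambda>r. L * exp (2 * L * r)) integrable_on {0..t}"
    using * by (rule has_integral_integrable)
  show "integral {0..t} (\<lambda>r. L * exp (2 * L * r)) \<le> exp (2 * L * t) / 2"
    unfolding integral_unique[OF *] by simp
qed

text \<open>In the sup norm with weight exp (-2 L t), a Lipschitz map of constant L followed by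
  Duhamel integration contracts by 1/2 on an interval of any length, so existence and stability need
  no subdivision of time.\<close>

lemma norm_duh_weighted:
  assumes F: "continuous_on {0..\<tau>} F" and t: "t \<in> {0..\<tau>}" and "L > 0"
    and b: "\<And>r. r \<in> {0..\<tau>} \<Longrightarrow> norm (F r) \<le> L * (exp (2 * L * r) * M)" and "0 \<le> M"
  shows "norm (duh F t) \<le> exp (2 * L * t) * M / 2"
proof -
  have "norm (duh F t) \<le> integral {0..t} (\<lambda>r. M * (L * exp (2 * L * r)))"
  proof (rule norm_duh_le[OF F t])
    show "(\<lambda>r. M * (L * exp (2 * L * r))) integrable_on {0..t}"
      by (rule integrable_on_mult_right[OF integral_exp_weight(1)[OF \<open>L > 0\<close>]]) (use t in auto)
  qed (use t b in \<open>auto simp: mult_ac\<close>)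
  also have "\<dots> = M * integral {0..t} (\<lambda>r. L * exp (2 * L * r))"
    by simp
  also have "\<dots> \<le> M * (exp (2 * L * t) / 2)"
    using integral_exp_weight(2)[OF \<open>L > 0\<close>, of t] t \<open>0 \<le> M\<close> by (intro mult_left_mono) auto
  finally show ?thesis by (simp add: mult.commute)
qed

text \<open>A contraction by 1/2 in the weighted norm. G is Lipschitz only on the ball of radius R;
  hypothesis \<open>R\<close> ensures that the a priori bound on the iterates keeps them inside it.
  The lemma serves the linear equation, the local step and the gauged nonlinear equation.\<close>

lemma duhamel_fixed_point:
  assumes "0 \<le> \<tau>" "L > 0" and h: "continuous_on {0..\<tau>} h" and hb: "\<And>t. t \<in> {0..\<tau>} \<Longrightarrow> norm (h t) \<le> g0"
    and Gc: "continuous_on ({0..\<tau>} \<times> cball 0 R) (\<lambda>(r, e). G r e)"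
    and G0: "\<And>r. r \<in> {0..\<tau>} \<Longrightarrow> G r 0 = 0"
    and GL: "\<And>r a b. r \<in> {0..\<tau>} \<Longrightarrow> norm a \<le> R \<Longrightarrow> norm b \<le> R \<Longrightarrow> norm (G r a - G r b) \<le> L * norm (a - b)"
    and R: "2 * g0 * exp (2 * L * \<tau>) \<le> R"
  shows "\<exists>e. continuous_on {0..\<tau>} e \<and> (\<forall>t\<in>{0..\<tau>}. e t = h t + duh (\<lambda>r. G r (e r)) t \<and> norm (e t) \<le> 2 * g0 * exp (2 * L * t))"
proof -
  have g0: "g0 \<ge> 0" using hb[of 0] norm_ge_zero[of "h 0"] \<open>0 \<le> \<tau>\<close> by (meson atLeastAtMost_iff order_refl order_trans)
  \<comment> \<open>Clamping time to \<open>{0..\<tau>}\<close> makes the unknowns bounded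
    continuous functions on the whole line, a complete space.\<close>
  define cl where "cl = (\<lambda>t. max 0 (min \<tau> t))"
  have cl: "cl t \<in> {0..\<tau>}" "t \<in> {0..\<tau>} \<Longrightarrow> cl t = t" for t
    using \<open>0 \<le> \<tau>\<close> by (auto simp: cl_def)
  have ccl: "continuous_on X cl" for X
    unfolding cl_def by (intro continuous_intros)
  \<comment> \<open>y stands for the weighted unknown: \<open>ex\<close> removes the weight and
    \<open>K\<close> restores it after the Duhamel step.\<close>
  define ex where "ex = (\<lambda>(y :: real \<Rightarrow>\<^sub>C wiener) r. exp (2 * L * r) *\<^sub>R apply_bcontfun y r)"
  define K where "K = (\<lambda>y t. exp (- 2 * L * cl t) *\<^sub>R (h (cl t) + duh (\<lambda>r. G r (ex y r)) (cl t)))"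
  define Z where "Z = cball (0 :: real \<Rightarrow>\<^sub>C wiener) (2 * g0)"
  have Zb: "norm (apply_bcontfun y t) \<le> 2 * g0" if "y \<in> Z" for y t
    using norm_bounded[of y t] that by (simp add: Z_def)
  have exb: "norm (ex y r) \<le> exp (2 * L * r) * (2 * g0)" "norm (ex y r) \<le> R" if "y \<in> Z" "r \<in> {0..\<tau>}" for y r
  proof -
    show 1: "norm (ex y r) \<le> exp (2 * L * r) * (2 * g0)"
      using Zb[OF that(1), of r] by (simp add: ex_def)
    have "exp (2 * L * r) * (2 * g0) \<le> exp (2 * L * \<tau>) * (2 * g0)"
      using that \<open>L > 0\<close> g0 by (intro mult_right_mono) auto
    with 1 R show "norm (ex y r) \<le> R" by (simp add: mult_ac)
  qed
  have exc: "continuous_on X (ex y)" for X y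
    unfolding ex_def by (intro continuous_intros continuous_on_apply_bcontfun)
  have GC: "continuous_on {0..\<tau>} (\<lambda>r. G r (ex y r))" if "y \<in> Z" for y
  proof -
    have "continuous_on {0..\<tau>} (\<lambda>r. case (r, ex y r) of (r, e) \<Rightarrow> G r e)"
      by (rule continuous_on_compose2[OF Gc]) (use exb(2)[OF that] in \<open>auto intro!: continuous_intros exc\<close>)
    then show ?thesis by simp
  qed
  have Kc: "continuous_on UNIV (K y)" if "y \<in> Z" for y
    unfolding K_def
    by (intro continuous_intros ccl continuous_on_compose2[OF h] continuous_on_compose2[OF continuous_on_duh[OF GC[OF that]]])
      (use cl in auto)
  \<comment> \<open>One half of the radius \<open>2 * g0\<close> is used up by h, the other by the
    Duhamel term.\<close>
  have Kb: "norm (K y t) \<le> 2 * g0" if y: "y \<in> Z" for y t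
  proof -
    have "norm (duh (\<lambda>r. G r (ex y r)) (cl t)) \<le> exp (2 * L * cl t) * (2 * g0) / 2"
    proof (rule norm_duh_weighted[OF GC[OF y] cl(1) \<open>L > 0\<close>])
      fix r assume r: "r \<in> {0..\<tau>}"
      have "norm (G r (ex y r)) \<le> L * norm (ex y r)"
        using GL[OF r, of "ex y r" 0] G0[OF r] exb(2)[OF y r] norm_ge_zero order_trans[OF norm_ge_zero exb(2)[OF y r]] by simp
      also have "\<dots> \<le> L * (exp (2 * L * r) * (2 * g0))"
        using exb(1)[OF y r] \<open>L > 0\<close> by (intro mult_left_mono) auto
      finally show "norm (G r (ex y r)) \<le> L * (exp (2 * L * r) * (2 * g0))" .
    qed (use g0 in auto)
    then have "norm (h (cl t) + duh (\<lambda>r. G r (ex y r)) (cl t)) \<le> g0 + exp (2 * L * cl t) * g0"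
      using hb[OF cl(1), of t] by (intro order_trans[OF norm_triangle_ineq]) auto
    then have "norm (K y t) \<le> exp (- 2 * L * cl t) * (g0 + exp (2 * L * cl t) * g0)"
      unfolding K_def by simp
    also have "\<dots> = exp (- 2 * L * cl t) * g0 + g0"
      by (simp add: distrib_left mult.assoc[symmetric] flip: exp_add)
    also have "\<dots> \<le> 1 * g0 + g0"
      using cl(1)[of t] \<open>L > 0\<close> g0 by (intro add_right_mono mult_right_mono) auto
    finally show ?thesis by simp
  qed
  define \<Phi> where "\<Phi> = (\<lambda>y. Bcontfun (K y))"
  have \<Phi>: "apply_bcontfun (\<Phi> y) = K y" if "y \<in> Z" for y
    unfolding \<Phi>_def by (rule Bcontfun_inverse, rule bcontfun_normI[OF Kc[OF that] Kb[OF that]])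
  have con: "dist (\<Phi> y) (\<Phi> z) \<le> 1 / 2 * dist y z" if yz: "y \<in> Z" "z \<in> Z" for y z
  proof (rule dist_bound)
    fix t
    have "norm (duh (\<lambda>r. G r (ex y r) - G r (ex z r)) (cl t)) \<le> exp (2 * L * cl t) * dist y z / 2"
    proof (rule norm_duh_weighted[OF _ cl(1) \<open>L > 0\<close>])
      show "continuous_on {0..\<tau>} (\<lambda>r. G r (ex y r) - G r (ex z r))"
        by (intro continuous_intros GC yz)
      fix r assume r: "r \<in> {0..\<tau>}"
      have "norm (G r (ex y r) - G r (ex z r)) \<le> L * norm (ex y r - ex z r)"
        by (intro GL r exb yz)
      also have "norm (ex y r - ex z r) = exp (2 * L * r) * dist (apply_bcontfun y r) (apply_bcontfun z r)"
        by (simp add: ex_def dist_norm flip: scaleR_diff_right)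
      also have "L * \<dots> \<le> L * (exp (2 * L * r) * dist y z)"
        using dist_bounded[of y r z] \<open>L > 0\<close> by (intro mult_left_mono) auto
      finally show "norm (G r (ex y r) - G r (ex z r)) \<le> L * (exp (2 * L * r) * dist y z)" by simp
    qed simp
    moreover have "K y t - K z t = exp (- 2 * L * cl t) *\<^sub>R duh (\<lambda>r. G r (ex y r) - G r (ex z r)) (cl t)"
    proof -
      have e: "duh (\<lambda>r. G r (ex y r) - G r (ex z r)) (cl t) = duh (\<lambda>r. G r (ex y r)) (cl t) - duh (\<lambda>r. G r (ex z r)) (cl t)"
        unfolding duh_def S_simps
        by (rule Henstock_Kurzweil_Integration.integral_diff)
          (intro integrable_continuous_real continuous_on_duh_integrand[OF GC cl(1)] yz)+
      show ?thesis unfolding K_def e by (simp flip: scaleR_diff_right)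
    qed
    ultimately have "dist (K y t) (K z t) \<le> exp (- 2 * L * cl t) * (exp (2 * L * cl t) * dist y z / 2)"
      by (simp add: dist_norm)
    also have "\<dots> = 1 / 2 * dist y z"
      by (simp add: mult.assoc[symmetric] flip: exp_add)
    finally show "dist (apply_bcontfun (\<Phi> y) t) (apply_bcontfun (\<Phi> z) t) \<le> 1 / 2 * dist y z"
      by (simp add: \<Phi> yz)
  qed
  have "\<exists>!y. y \<in> Z \<and> \<Phi> y = y"
  proof (rule Banach_fix[where c = "1/2"])
    show "uniform_space_class.complete Z" unfolding Z_def by (simp add: complete_eq_closed)
    show "Z \<noteq> {}" using g0 by (simp add: Z_def)
    show "\<Phi> ` Z \<subseteq> Z"
      using Kb \<Phi> by (auto simp: Z_def intro!: norm_bound)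
  qed (use con in auto)
  then obtain y where y: "y \<in> Z" "\<Phi> y = y" by blast
  have fx: "apply_bcontfun y t = K y t" for t
    using \<Phi>[OF y(1)] y(2) by metis
  have "ex y t = h t + duh (\<lambda>r. G r (ex y r)) t" if "t \<in> {0..\<tau>}" for t
  proof -
    have "ex y t = exp (2 * L * t) *\<^sub>R K y t"
      by (subst ex_def) (simp only: fx)
    then show ?thesis
      by (simp add: K_def cl(2)[OF that] flip: exp_add)
  qed
  moreover have "norm (ex y t) \<le> 2 * g0 * exp (2 * L * t)" if "t \<in> {0..\<tau>}" for t
    using exb(1)[OF y(1) that] by (simp add: mult_ac)
  ultimately show ?thesis
    using exc by blast
qed

section \<open>Moment problems\<close>

text \<open>A factor \<open>I - e i * (translation by h i)\<close> multiplies the moment against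
  \<open>exp (l * s)\<close> by \<open>1 - e i * exp (l * h i)\<close> and enlarges the support by h
  i. Later e i is exp (-i^2 h i), which kills the moment for l = i^2.\<close>

primrec psi :: "(nat \<Rightarrow> real) \<Rightarrow> (nat \<Rightarrow> real) \<Rightarrow> (real \<Rightarrow> real) \<Rightarrow> nat \<Rightarrow> real \<Rightarrow> real" where
  "psi e h \<beta> 0 = \<beta>"
| "psi e h \<beta> (Suc n) = (\<lambda>s. psi e h \<beta> n s - e n * psi e h \<beta> n (s - h n))"

text \<open>Each factor has norm at most 1 + e i <= exp (e i), so the bound is uniform in the number
  of factors.\<close>

lemma psi_bound:
  assumes "\<And>i. e i \<ge> 0" "summable e" "\<And>s. \<bar>\<beta> s\<bar> \<le> 1"
  shows "\<bar>psi e h \<beta> n s\<bar> \<le> exp (suminf e)"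
proof -
  have "\<bar>psi e h \<beta> n s\<bar> \<le> exp (sum e {..<n})" for s
  proof (induction n arbitrary: s)
    case (Suc n)
    have "\<bar>psi e h \<beta> (Suc n) s\<bar> \<le> \<bar>psi e h \<beta> n s\<bar> + e n * \<bar>psi e h \<beta> n (s - h n)\<bar>"
      using abs_triangle_ineq4[of "psi e h \<beta> n s" "e n * psi e h \<beta> n (s - h n)"] assms(1)[of n] by (simp add: abs_mult)
    also have "\<dots> \<le> exp (sum e {..<n}) + e n * exp (sum e {..<n})"
      using Suc.IH assms(1)[of n] by (intro add_mono mult_left_mono) auto
    also have "\<dots> = (1 + e n) * exp (sum e {..<n})" by (simp add: algebra_simps)
    also have "\<dots> \<le> exp (e n) * exp (sum e {..<n})"
      using exp_ge_add_one_self[of "e n"] by (intro mult_right_mono) auto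
    finally show ?case by (simp add: exp_add mult.commute)
  qed (use assms(3) in auto)
  moreover have "sum e {..<n} \<le> suminf e"
    using assms by (intro sum_le_suminf) auto
  ultimately show ?thesis by (meson exp_le_cancel_iff order_trans)
qed

lemma psi_support:
  assumes "\<And>i. h i \<ge> 0" "\<And>s. s < p \<or> s > q \<Longrightarrow> \<beta> s = 0"
  shows "s < p \<or> s > q + sum h {..<n} \<Longrightarrow> psi e h \<beta> n s = 0"
proof (induction n arbitrary: s)
  case (Suc n)
  have "psi e h \<beta> n s = 0" "psi e h \<beta> n (s - h n) = 0"
    using Suc.prems assms(1)[of n] by (auto intro!: Suc.IH)
  then show ?case by simp
qed (use assms in auto)

lemma continuous_on_psi:
  assumes "continuous_on UNIV \<beta>"
  shows "continuous_on X (psi e h \<beta> n)"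
proof -
  have "continuous_on UNIV (psi e h \<beta> n)"
    by (induction n) (auto intro!: continuous_intros assms continuous_on_compose2[of UNIV "psi e h \<beta> _"])
  then show ?thesis by (rule continuous_on_subset) simp
qed

text \<open>Translation multiplies the moment by \<open>exp (l * h n)\<close> as long as no mass
  leaves \<open>{0..\<tau>}\<close>; hypothesis \<open>t\<close> keeps the enlarged support
  inside.\<close>

lemma psi_moment:
  assumes h: "\<And>i. h i \<ge> 0" and s: "\<And>s. s < p \<or> s > q \<Longrightarrow> \<beta> s = 0" and c: "continuous_on UNIV \<beta>"
    and p: "0 \<le> p" "p \<le> q" and t: "\<And>n. q + sum h {..<n} \<le> \<tau>"
    and I: "((\<lambda>s. exp (l * s) * \<beta> s) has_integral B) {0..\<tau>}"
  shows "((\<lambda>s. exp (l * s) * psi e h \<beta> n s) has_integral (\<Prod>i<n. 1 - e i * exp (l * h i)) * B) {0..\<tau>}"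
proof (induction n)
  case (Suc n)
  let ?F = "\<lambda>s. exp (l * s) * psi e h \<beta> n s" and ?I = "(\<Prod>i<n. 1 - e i * exp (l * h i)) * B"
  let ?q = "q + sum h {..<n}"
  have z: "?F s = 0" if "s \<notin> {p..?q}" for s
    using psi_support[OF h s, where s = s and n = n and e = e] that by auto
  have "(?F has_integral integral {p..?q} ?F) {p..?q}"
    by (intro integrable_integral integrable_continuous_real continuous_intros continuous_on_psi c)
  note sup = has_integral_on_superset[OF this z]
  have hn: "0 \<le> h n" "?q + h n \<le> \<tau>" using h[of n] t[of "Suc n"] by auto
  have "(?F has_integral integral {p..?q} ?F) {0..\<tau>}"
    by (rule sup) (use p t[of n] in auto)
  with Suc.IH have "integral {p..?q} ?F = ?I" by (rule has_integral_unique[rotated])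
  then have "(?F has_integral ?I) {- h n..\<tau> - h n}"
    using sup[of "{- h n..\<tau> - h n}"] p hn by auto
  then have "((\<lambda>s. ?F (s - h n)) has_integral ?I) {0..\<tau>}"
    using has_integral_shift_cbox_iff[of "\<lambda>s. ?F (s - h n)" "h n" ?I "- h n" "\<tau> - h n"] by (simp add: o_def)
  from has_integral_diff[OF Suc.IH has_integral_mult_right[OF this, of "e n * exp (l * h n)"]]
  have "((\<lambda>s. ?F s - e n * exp (l * h n) * ?F (s - h n)) has_integral ?I - e n * exp (l * h n) * ?I) {0..\<tau>}" .
  moreover have "?F s - e n * exp (l * h n) * ?F (s - h n) = exp (l * s) * psi e h \<beta> (Suc n) s" for s
  proof -
    have "exp (l * h n) * exp (l * (s - h n)) = exp (l * s)"
      by (simp add: algebra_simps flip: exp_add)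
    then show ?thesis by (simp add: right_diff_distrib mult_ac)
  qed
  moreover have "?I - e n * exp (l * h n) * ?I = (\<Prod>i<Suc n. 1 - e i * exp (l * h i)) * B"
    by (simp add: algebra_simps)
  ultimately show ?case by (simp only:)
qed (use I in simp)

text \<open>Successive compositions differ by at most \<open>e n * exp (suminf e)\<close>, so they
  converge uniformly, and their moments with them. The moments of the limit appear as limits of
  partial products, the form in which they are bounded below afterwards. The room left at both ends
  makes \<sigma> vanish there.\<close>

lemma psi_limit:
  fixes e h :: "nat \<Rightarrow> real" and \<beta> :: "real \<Rightarrow> real"
  assumes e: "\<And>i. e i \<ge> 0" "summable e" and b: "\<And>s. \<bar>\<beta> s\<bar> \<le> 1" and h: "\<And>i. h i \<ge> 0" and s: "\<And>s. s < p \<or> s > q \<Longrightarrow> \<beta> s = 0"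
    and c: "continuous_on UNIV \<beta>"
    and p: "0 < p" "p \<le> q" and t: "\<And>n. q + sum h {..<n} < \<tau>"
    and I: "\<And>l. ((\<lambda>s. exp (l * s) * \<beta> s) has_integral B l) {0..\<tau>}"
  obtains \<sigma> where "continuous_on UNIV \<sigma>" "\<And>s. \<bar>\<sigma> s\<bar> \<le> exp (suminf e)" "\<sigma> 0 = 0" "\<sigma> \<tau> = 0"
    "\<And>l. \<exists>J. ((\<lambda>s. exp (l * s) * \<sigma> s) has_integral J) {0..\<tau>} \<and> (\<lambda>n. (\<Prod>i<n. 1 - e i * exp (l * h i)) * B l) \<longlonglongrightarrow> J"
proof -
  let ?M = "exp (suminf e)"
  define f where "f = (\<lambda>n s. - e n * psi e h \<beta> n (s - h n))"
  have ps: "psi e h \<beta> n s = \<beta> s + (\<Sum>i<n. f i s)" for n s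
    by (induction n) (auto simp: f_def)
  have "uniform_limit UNIV (\<lambda>n s. \<Sum>i<n. f i s) (\<lambda>s. \<Sum>i. f i s) sequentially"
  proof (rule Weierstrass_m_test)
    show "norm (f n s) \<le> e n * ?M" for n s
      using psi_bound[OF e b, where s = "s - h n"] e(1)[of n] by (auto simp: f_def abs_mult intro!: mult_left_mono)
    show "summable (\<lambda>n. e n * ?M)" by (intro summable_mult2 e)
  qed
  then have u: "uniform_limit UNIV (psi e h \<beta>) (\<lambda>s. \<beta> s + (\<Sum>i. f i s)) sequentially"
    unfolding ps[abs_def] by (intro uniform_limit_intros)
  define \<sigma> where "\<sigma> = (\<lambda>s. \<beta> s + (\<Sum>i. f i s))"
  note u = u[folded \<sigma>_def]
  have lim: "(\<lambda>n. psi e h \<beta> n s) \<longlonglongrightarrow> \<sigma> s" for s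
    using tendsto_uniform_limitI[OF u] by simp
  show ?thesis
  proof
    show sc: "continuous_on UNIV \<sigma>"
      by (rule uniform_limit_theorem[OF _ u]) (auto intro!: always_eventually continuous_on_psi c)
    show "\<bar>\<sigma> s\<bar> \<le> ?M" for s
      by (rule LIMSEQ_le_const2[OF tendsto_rabs[OF lim]]) (auto intro!: psi_bound e b)
    have z: "\<sigma> s = 0" if "\<And>n. psi e h \<beta> n s = 0" for s
      using lim[of s] that by (simp add: LIMSEQ_const_iff)
    show "\<sigma> 0 = 0" "\<sigma> \<tau> = 0"
      using psi_support[OF h s, where e = e] p t by (auto intro!: z)
    fix l
    have "uniform_limit {0..\<tau>} (\<lambda>n s. exp (l * s) * psi e h \<beta> n s) (\<lambda>s. exp (l * s) * \<sigma> s) sequentially"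
      by (intro uniform_lim_mult uniform_limit_on_subset[OF u] uniform_limit_const)
        (auto intro!: compact_imp_bounded compact_continuous_image continuous_intros continuous_on_subset[OF sc])
    then obtain I J where 1: "\<And>n. ((\<lambda>s. exp (l * s) * psi e h \<beta> n s) has_integral I n) {0..\<tau>}"
      and 2: "((\<lambda>s. exp (l * s) * \<sigma> s) has_integral J) {0..\<tau>}" and 3: "I \<longlonglongrightarrow> J"
      by (rule uniform_limit_integral) (auto intro!: continuous_intros continuous_on_psi c)
    have "I = (\<lambda>n. (\<Prod>i<n. 1 - e i * exp (l * h i)) * B l)"
      by (rule ext, rule has_integral_unique[OF 1 psi_moment[OF h s c less_imp_le[OF p(1)] p(2) less_imp_le[OF t] I]])
    with 2 3 show "\<exists>J. ((\<lambda>s. exp (l * s) * \<sigma> s) has_integral J) {0..\<tau>} \<and> (\<lambda>n. (\<Prod>i<n. 1 - e i * exp (l * h i)) * B l) \<longlonglongrightarrow> J"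
      by blast
  qed
qed

text \<open>Turns a lower bound for a product of factors |1 - exp x_i| into an upper bound for the
  sum of 1 / x_i^2. For x > 0, exp x >= 1 + x^2 gives 1 - exp (-x) >= x^2 / (1 + x^2) = 1 / (1 +
  1/x^2) >= exp (-1/x^2).\<close>

lemma one_minus_exp_lower:
  fixes y :: real
  assumes "y \<noteq> 0"
  shows "exp (- (1 / y\<^sup>2)) \<le> \<bar>1 - exp y\<bar>"
proof -
  have *: "exp (- (1 / x\<^sup>2)) \<le> 1 - exp (- x)" if x: "x > 0" for x :: real
  proof -
    have "(1 + 1 / x\<^sup>2) \<le> exp (1 / x\<^sup>2)" by (rule exp_ge_add_one_self)
    then have "exp (- (1 / x\<^sup>2)) \<le> 1 / (1 + 1 / x\<^sup>2)"
      by (simp add: exp_minus field_simps add_pos_nonneg)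
    also have "\<dots> = 1 - 1 / (1 + x\<^sup>2)"
    proof -
      have "x\<^sup>2 > 0" using x by simp
      then have "1 + x\<^sup>2 > 0" by linarith
      then have "1 + x\<^sup>2 \<noteq> 0" by (rule less_imp_neq[symmetric])
      with \<open>x\<^sup>2 > 0\<close> show ?thesis by (simp add: divide_simps)
    qed
    also have "1 + x\<^sup>2 \<le> exp x"
    proof -
      have "(\<Sum>k\<le>3. x ^ k /\<^sub>R fact k) \<le> exp x"
        using x exp_first_terms[of x 4] suminf_nonneg[of "\<lambda>n. x ^ (n + 4) /\<^sub>R fact (n + 4)"]
          summable_ignore_initial_segment[OF summable_exp_generic[of x], of 4]
        by (simp add: atMost_atLeast0 atLeastLessThanSuc_atLeastAtMost[symmetric] lessThan_atLeast0 numeral_eq_Suc)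
      then have "1 + x + x\<^sup>2 / 2 + x ^ 3 / 6 \<le> exp x"
        by (simp add: numeral_eq_Suc fact_reduce)
      \<comment> \<open>x - x^2/2 + x^3/6 equals x/6 times (x - 3/2)^2 + 15/4.\<close>
      moreover have "x\<^sup>2 / 2 \<le> x + x ^ 3 / 6"
      proof -
        have "0 \<le> x * ((x - 3/2)\<^sup>2 + 15/4)" using x by simp
        then show ?thesis by (simp add: power2_eq_square power3_eq_cube algebra_simps)
      qed
      ultimately show ?thesis by simp
    qed
    then have "1 - 1 / (1 + x\<^sup>2) \<le> 1 - exp (- x)"
      by (simp add: exp_minus divide_inverse le_imp_inverse_le add_pos_nonneg)
    finally show ?thesis .
  qed
  show ?thesis
  proof (cases "y < 0")
    case True
    with *[of "- y"] show ?thesis by simp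
  next
    case False
    then have y: "y > 0" using assms by simp
    have "1 - exp (- y) \<le> exp y - 1"
    proof -
      have "0 \<le> (exp y - 1)\<^sup>2 / exp y" by simp
      then show ?thesis by (simp add: power2_eq_square field_simps exp_minus)
    qed
    with *[OF y] y show ?thesis by simp
  qed
qed

lemma summable_powr_shift: "a < -1 \<Longrightarrow> summable (\<lambda>j::nat. (real j + 1) powr a)"
  using summable_Suc_iff[of "\<lambda>j. real j powr a"] summable_real_powr_iff[of a] by (simp add: add.commute)

text \<open>The indices on either side of k are folded onto their distances from k, each distance
  occurring once per side; the bound is therefore uniform in k.\<close>

lemma sum_abs_diff_le:
  fixes f :: "nat \<Rightarrow> real"
  assumes f: "\<And>l. f l \<ge> 0" "summable f"
  shows "(\<Sum>i<n. f (nat \<bar>int i - int k\<bar>)) \<le> 2 * suminf f"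
proof -
  have "(\<Sum>i<n. f (nat \<bar>int i - int k\<bar>)) \<le> (\<Sum>i\<in>{..<n} \<inter> {..k}. f (k - i)) + (\<Sum>i\<in>{..<n} - {..k}. f (i - k))"
    by (subst sum.Int_Diff[of "{..<n}" _ "{..k}"]) (auto intro!: add_mono sum_mono simp: nat_diff_distrib of_nat_diff abs_if)
  also have "(\<Sum>i\<in>{..<n} \<inter> {..k}. f (k - i)) = (\<Sum>l\<in>(\<lambda>i. k - i) ` ({..<n} \<inter> {..k}). f l)"
    by (subst sum.reindex) (auto simp: inj_on_def)
  also have "(\<Sum>i\<in>{..<n} - {..k}. f (i - k)) = (\<Sum>l\<in>(\<lambda>i. i - k) ` ({..<n} - {..k}). f l)"
    by (subst sum.reindex) (auto simp: inj_on_def)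
  also have "(\<Sum>l\<in>(\<lambda>i. k - i) ` ({..<n} \<inter> {..k}). f l) + (\<Sum>l\<in>(\<lambda>i. i - k) ` ({..<n} - {..k}). f l) \<le> suminf f + suminf f"
    by (intro add_mono sum_le_suminf f) auto
  finally show ?thesis by simp
qed

lemma square_diff_lower:
  fixes i k :: nat
  assumes "i \<noteq> k"
  shows "\<bar>real i - real k\<bar> * (real i + 1) / 2 \<le> \<bar>(real k)\<^sup>2 - (real i)\<^sup>2\<bar>"
proof -
  have "(real k)\<^sup>2 - (real i)\<^sup>2 = (real k - real i) * (real i + real k)"
    by (simp add: power2_eq_square algebra_simps)
  then have "\<bar>(real k)\<^sup>2 - (real i)\<^sup>2\<bar> = \<bar>real i - real k\<bar> * (real i + real k)"
    by (simp add: abs_mult abs_minus_commute)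
  moreover have "(real i + 1) / 2 \<le> real i + real k"
    using assms by (cases "i = 0") (auto simp: field_simps)
  ultimately show ?thesis
    by (metis abs_ge_zero mult_left_mono times_divide_eq_right)
qed

text \<open>The functions \<open>\<sigma>\<close> are biorthogonal, up to normalisation, to \<open>s \<mapsto> exp (k\<^sup>2 * s)\<close>: the operator
  \<open>I - exp (- j\<^sup>2 * h) * (translation by h)\<close> annihilates the \<open>j\<close>-th moment, and these operators are composed
  for all \<open>j \<noteq> k\<close>, with a summable sequence of translation lengths.\<close>

lemma biorthogonal:
  obtains C :: real where "C \<ge> 0"
    "\<And>\<tau> k. 0 < \<tau> \<Longrightarrow> \<tau> \<le> 1 \<Longrightarrow> \<exists>\<sigma> M. continuous_on UNIV \<sigma> \<and> \<sigma> 0 = 0 \<and> \<sigma> \<tau> = 0 \<and>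
       (\<forall>s. \<bar>\<sigma> s\<bar> \<le> exp (C / \<tau>\<^sup>2)) \<and>
       (\<forall>j::nat. ((\<lambda>s. exp ((real j)\<^sup>2 * s) * \<sigma> s) has_integral (if j = k then M else 0)) {0..\<tau>}) \<and>
       \<bar>M\<bar> \<ge> \<tau> / 16 * exp ((real k)\<^sup>2 * \<tau> / 2 - C * (real k + 1) / \<tau>\<^sup>2)"
proof -
  define Z where "Z = (\<Sum>j::nat. (real j + 1) powr (-5/4))"
  define Z' where "Z' = (\<Sum>j::nat. (real j + 1) powr (-3/2))"
  define Y where "Y = (\<Sum>l::nat. real l powr (-3/2))"
  have sZ: "summable (\<lambda>j::nat. (real j + 1) powr (-5/4))" "summable (\<lambda>j::nat. (real j + 1) powr (-3/2))"
    by (auto intro!: summable_powr_shift)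
  have sY: "summable (\<lambda>l::nat. real l powr (-3/2))"
    using summable_real_powr_iff[of "-3/2"] by simp
  have Z1: "Z \<ge> 1"
    using sum_le_suminf[OF sZ(1), of "{0}"] by (simp add: Z_def)
  have Z'0: "Z' \<ge> 0" and Y0: "Y \<ge> 0"
    unfolding Z'_def Y_def using sZ sY by (auto intro!: suminf_nonneg)
  \<comment> \<open>Normalises the translation lengths to a total of at most \<tau>/8.\<close>
  define c where "c = 1 / (8 * Z)"
  have c: "c > 0" "c \<le> 1/8" using Z1 by (auto simp: c_def divide_simps)
  define C where "C = 32 * Z' / c\<^sup>2 + 16 * Y / c\<^sup>2"
  have "C \<ge> 0" using Z'0 Y0 by (auto simp: C_def)
  have main: "\<exists>\<sigma> M. continuous_on UNIV \<sigma> \<and> \<sigma> 0 = 0 \<and> \<sigma> \<tau> = 0 \<and>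
       (\<forall>s. \<bar>\<sigma> s\<bar> \<le> exp (C / \<tau>\<^sup>2)) \<and>
       (\<forall>j::nat. ((\<lambda>s. exp ((real j)\<^sup>2 * s) * \<sigma> s) has_integral (if j = k then M else 0)) {0..\<tau>}) \<and>
       \<bar>M\<bar> \<ge> \<tau> / 16 * exp ((real k)\<^sup>2 * \<tau> / 2 - C * (real k + 1) / \<tau>\<^sup>2)"
    if \<tau>: "0 < \<tau>" "\<tau> \<le> 1" for \<tau> :: real and k :: nat
  proof -
    \<comment> \<open>The exponent -5/4 is a compromise: the lengths are summable, j^2 h j grows
      like j^(3/4) so that the e j are summable, and (k^2 - i^2) h i is still large enough for its
      inverse squares to have a sum growing at most linearly in k.\<close>
    define h where "h = (\<lambda>j::nat. \<tau> * c * (real j + 1) powr (-5/4))"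
    define e where "e = (\<lambda>j::nat. if j = k then 0 else exp (- ((real j)\<^sup>2 * h j)))"
    \<comment> \<open>A tent of height 1 on [\<tau>/2, 3\<tau>/4]. Starting at \<tau>/2 makes its
      moments at least of order exp (k^2 \<tau>/2), and after all translations the support still
      lies in [\<tau>/2, 7\<tau>/8].\<close>
    define \<beta> where "\<beta> = (\<lambda>s. max 0 (1 - \<bar>8 * s / \<tau> - 5\<bar>))"
    have h0: "h j > 0" for j
      using c \<tau> by (simp add: h_def)
    have hs: "sum h {..<n} \<le> \<tau> / 8" for n
    proof -
      have "(\<Sum>j<n. (real j + 1) powr (-5/4)) \<le> Z"
        unfolding Z_def by (rule sum_le_suminf[OF sZ(1)]) auto
      then have "\<tau> * c * (\<Sum>j<n. (real j + 1) powr (-5/4)) \<le> \<tau> * c * Z"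
        using c \<tau> by (intro mult_left_mono) auto
      moreover have "\<tau> * c * Z = \<tau> / 8" using Z1 by (simp add: c_def)
      ultimately show ?thesis unfolding h_def sum_distrib_left by simp
    qed
    have e0: "e j \<ge> 0" for j by (simp add: e_def)
    \<comment> \<open>For j >= 1, j >= (j+1)/2 gives j^2 h j >= y with y proportional to
      (j+1)^(3/4), and exp (-y) <= 2/y^2 leaves the summable power -3/2.\<close>
    have eb: "e j \<le> 32 / (\<tau>\<^sup>2 * c\<^sup>2) * (real j + 1) powr (-3/2)" for j
    proof (cases "j = 0")
      case True
      have "\<tau>\<^sup>2 * c\<^sup>2 \<le> 1 * 1"
        using \<tau> c by (intro mult_mono power_le_one) auto
      then have "1 \<le> 32 / (\<tau>\<^sup>2 * c\<^sup>2)" using \<tau> c by (simp add: field_simps)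
      with True show ?thesis by (simp add: e_def)
    next
      case False
      define n where "n = real j + 1"
      have n: "n \<ge> 2" using False by (simp add: n_def)
      define y where "y = \<tau> * c * n powr (3/4) / 4"
      have y: "y > 0" using n \<tau> c by (simp add: y_def)
      have "n\<^sup>2 / 4 \<le> (real j)\<^sup>2"
      proof -
        have "n / 2 \<le> real j" using False by (simp add: n_def)
        then have "(n / 2)\<^sup>2 \<le> (real j)\<^sup>2" using n by (intro power_mono) auto
        then show ?thesis by (simp add: power_divide)
      qed
      then have "n\<^sup>2 / 4 * h j \<le> (real j)\<^sup>2 * h j"
        using h0[of j] by (intro mult_right_mono) auto
      moreover have "n\<^sup>2 / 4 * h j = y"
      proof -
        have "n\<^sup>2 * n powr (-5/4) = n powr (3/4)"
          using n by (simp flip: powr_numeral powr_add)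
        then show ?thesis by (simp add: h_def y_def n_def[symmetric])
      qed
      ultimately have "e j \<le> exp (- y)"
        by (simp add: e_def)
      also have "\<dots> \<le> 2 / y\<^sup>2"
      proof -
        have "y\<^sup>2 / 2 \<le> exp y"
          using exp_lower_Taylor_quadratic[of y] y by simp
        then show ?thesis using y by (simp add: exp_minus field_simps)
      qed
      also have "y\<^sup>2 = \<tau>\<^sup>2 * c\<^sup>2 * n powr (3/2) / 16"
        using n by (simp add: y_def power_mult_distrib power_divide powr_power)
      also have "2 / \<dots> = 32 / (\<tau>\<^sup>2 * c\<^sup>2) * n powr (-3/2)"
        using n by (simp add: powr_minus field_simps)
      finally show ?thesis by (simp add: n_def)
    qed
    have es: "summable e"
      by (rule summable_comparison_test'[OF summable_mult[OF sZ(2), of "32 / (\<tau>\<^sup>2 * c\<^sup>2)"], of 0])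
        (use e0 eb in simp)
    have "suminf e \<le> (\<Sum>j. 32 / (\<tau>\<^sup>2 * c\<^sup>2) * (real j + 1) powr (-3/2))"
      by (rule suminf_le[OF eb es]) (intro summable_mult sZ)
    also have "\<dots> = 32 * Z' / c\<^sup>2 / \<tau>\<^sup>2"
      unfolding Z'_def using suminf_mult[OF sZ(2), of "32 / (\<tau>\<^sup>2 * c\<^sup>2)"] by (simp add: mult.commute)
    also have "\<dots> \<le> C / \<tau>\<^sup>2"
      using Y0 by (intro divide_right_mono) (auto simp: C_def)
    finally have eC: "suminf e \<le> C / \<tau>\<^sup>2" .
    have bc: "continuous_on X \<beta>" for X
      unfolding \<beta>_def using \<tau> by (intro continuous_intros) auto
    have b1: "\<bar>\<beta> s\<bar> \<le> 1" for s by (simp add: \<beta>_def)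
    have b0: "\<beta> s = 0" if "s < \<tau> / 2 \<or> s > 3 * \<tau> / 4" for s
      using that \<tau> by (auto simp: \<beta>_def field_simps abs_if max_def)
    define B where "B = (\<lambda>l. integral {0..\<tau>} (\<lambda>s. exp (l * s) * \<beta> s))"
    have BI: "((\<lambda>s. exp (l * s) * \<beta> s) has_integral B l) {0..\<tau>}" for l
      unfolding B_def by (intro integrable_integral integrable_continuous_real continuous_intros bc)
    have B: "B ((real k)\<^sup>2) \<ge> \<tau> / 16 * exp ((real k)\<^sup>2 * \<tau> / 2)"
    proof -
      \<comment> \<open>The middle half of the tent, of length \<tau>/8, where \<beta> is at least
        1/2.\<close>
      let ?I = "{9 * \<tau> / 16..11 * \<tau> / 16}"
      have 1: "((\<lambda>s. exp ((real k)\<^sup>2 * \<tau> / 2) / 2) has_integral (11 * \<tau> / 16 - 9 * \<tau> / 16) *\<^sub>R (exp ((real k)\<^sup>2 * \<tau> / 2) / 2)) ?I"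
        by (rule has_integral_const_real[THEN has_integral_eq_rhs]) (use \<tau> in auto)
      have 3: "exp ((real k)\<^sup>2 * \<tau> / 2) / 2 \<le> exp ((real k)\<^sup>2 * s) * \<beta> s" if "s \<in> ?I" for s
      proof -
        have "1/2 \<le> \<beta> s" using that \<tau> by (auto simp: \<beta>_def field_simps abs_if max_def)
        moreover have "(real k)\<^sup>2 * (\<tau> / 2) \<le> (real k)\<^sup>2 * s"
          using that \<tau> by (intro mult_left_mono) auto
        ultimately have "exp ((real k)\<^sup>2 * \<tau> / 2) * (1/2) \<le> exp ((real k)\<^sup>2 * s) * \<beta> s"
          by (intro mult_mono) auto
        then show ?thesis by simp
      qed
      have 2: "((\<lambda>s. exp ((real k)\<^sup>2 * s) * \<beta> s) has_integral integral ?I (\<lambda>s. exp ((real k)\<^sup>2 * s) * \<beta> s)) ?I"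
        by (intro integrable_integral integrable_continuous_real continuous_intros bc)
      have "(11 * \<tau> / 16 - 9 * \<tau> / 16) *\<^sub>R (exp ((real k)\<^sup>2 * \<tau> / 2) / 2) \<le> integral ?I (\<lambda>s. exp ((real k)\<^sup>2 * s) * \<beta> s)"
        by (rule has_integral_le[OF 1 2 3])
      also have "\<dots> \<le> B ((real k)\<^sup>2)"
        unfolding B_def
        by (rule integral_subset_le) (use \<tau> in \<open>auto intro!: integrable_continuous_real continuous_intros bc mult_nonneg_nonneg simp: \<beta>_def\<close>)
      finally show ?thesis by (simp add: field_simps)
    qed
    obtain \<sigma> where sc: "continuous_on UNIV \<sigma>" and sb: "\<And>s. \<bar>\<sigma> s\<bar> \<le> exp (suminf e)" and s0: "\<sigma> 0 = 0" "\<sigma> \<tau> = 0"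
      and sJ: "\<And>l. \<exists>J. ((\<lambda>s. exp (l * s) * \<sigma> s) has_integral J) {0..\<tau>} \<and> (\<lambda>n. (\<Prod>i<n. 1 - e i * exp (l * h i)) * B l) \<longlonglongrightarrow> J"
    proof (rule psi_limit[of e \<beta> h "\<tau> / 2" "3 * \<tau> / 4" \<tau> B, OF e0 es b1 less_imp_le[OF h0] b0 bc _ _ _ BI])
      show "3 * \<tau> / 4 + sum h {..<n} < \<tau>" for n
        using hs[of n] \<tau> by simp
    qed (use \<tau> in auto)
    obtain J where J: "\<And>l. ((\<lambda>s. exp (l * s) * \<sigma> s) has_integral J l) {0..\<tau>}"
      and JL: "\<And>l. (\<lambda>n. (\<Prod>i<n. 1 - e i * exp (l * h i)) * B l) \<longlonglongrightarrow> J l"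
      using sJ by metis
    have ee: "e i * exp (l\<^sup>2 * h i) = exp ((l\<^sup>2 - (real i)\<^sup>2) * h i)" if "i \<noteq> k" for i l
      using that by (simp add: e_def left_diff_distrib flip: exp_add)
    \<comment> \<open>The factor with index j is 1 - exp 0 at the moment j^2, so all partial
      products beyond it vanish.\<close>
    have J0: "J ((real j)\<^sup>2) = 0" if "j \<noteq> k" for j
    proof (rule LIMSEQ_unique[OF JL])
      have "\<forall>\<^sub>F n in sequentially. (\<Prod>i<n. 1 - e i * exp ((real j)\<^sup>2 * h i)) * B ((real j)\<^sup>2) = 0"
        using eventually_gt_at_top[of j]
      proof eventually_elim
        case (elim n)
        have "1 - e j * exp ((real j)\<^sup>2 * h j) = 0" by (simp add: ee[OF that])
        with elim have "(\<Prod>i<n. 1 - e i * exp ((real j)\<^sup>2 * h i)) = 0" by (intro prod_zero) auto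
        then show ?case by simp
      qed
      then show "(\<lambda>n. (\<Prod>i<n. 1 - e i * exp ((real j)\<^sup>2 * h i)) * B ((real j)\<^sup>2)) \<longlonglongrightarrow> 0"
        by (rule tendsto_eventually)
    qed
    let ?x = "\<lambda>i. ((real k)\<^sup>2 - (real i)\<^sup>2) * h i"
    \<comment> \<open>With l = |i - k| and n = i + 1, |k^2 - i^2| >= l n / 2, so the square of
      \<open>?x i\<close> is at least a multiple of l^2 n^(-1/2). The bound n <= 2 (k+1) l trades
      the growth in n for a factor k + 1 and the summable power l^(-3/2).\<close>
    have xb: "1 / (?x i)\<^sup>2 \<le> 8 * (real k + 1) / (\<tau>\<^sup>2 * c\<^sup>2) * real (nat \<bar>int i - int k\<bar>) powr (-3/2)" if "i \<noteq> k" for i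
    proof -
      define l where "l = \<bar>real i - real k\<bar>"
      define n where "n = real i + 1"
      have l: "l \<ge> 1" "real (nat \<bar>int i - int k\<bar>) = l" using that by (auto simp: l_def)
      have n: "n \<ge> 1" by (simp add: n_def)
      have "l * n / 2 * h i \<le> \<bar>(real k)\<^sup>2 - (real i)\<^sup>2\<bar> * h i"
        using square_diff_lower[OF that] h0[of i] unfolding l_def n_def by (intro mult_right_mono) auto
      also have "\<dots> = \<bar>?x i\<bar>" using h0[of i] by (simp add: abs_mult)
      finally have "(l * n / 2 * h i)\<^sup>2 \<le> \<bar>?x i\<bar>\<^sup>2"
        using l n h0[of i] by (intro power_mono) auto
      moreover have pos: "0 < l * n / 2 * h i" using l n h0[of i] by simp
      ultimately have "1 / (?x i)\<^sup>2 \<le> 1 / (l * n / 2 * h i)\<^sup>2"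
        by (intro divide_left_mono) (auto intro!: mult_pos_pos)
      also have "(l * n / 2 * h i)\<^sup>2 = l\<^sup>2 * \<tau>\<^sup>2 * c\<^sup>2 / 4 * n powr (-1/2)"
      proof -
        have "n * n powr (-5/4) = n powr (-1/4)"
          using n powr_add[of n 1 "-5/4"] by simp
        then have *: "l * n / 2 * h i = l * \<tau> * c / 2 * n powr (-1/4)"
          by (simp add: h_def n_def[symmetric] mult_ac)
        show ?thesis unfolding * using n by (simp add: power_mult_distrib power_divide powr_power)
      qed
      also have "1 / (l\<^sup>2 * \<tau>\<^sup>2 * c\<^sup>2 / 4 * n powr (-1/2)) = 4 / (\<tau>\<^sup>2 * c\<^sup>2) * (n powr (1/2) / l\<^sup>2)"
        using n l by (simp add: powr_minus field_simps)
      also have "\<dots> \<le> 4 / (\<tau>\<^sup>2 * c\<^sup>2) * (2 * (real k + 1) * l powr (-3/2))"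
      proof (rule mult_left_mono)
        have "n \<le> 2 * (real k + 1) * l"
        proof -
          have "n \<le> real k + 1 + l" by (simp add: n_def l_def)
          also have "\<dots> \<le> (real k + 1) * l + (real k + 1) * l"
            using l by (intro add_mono) (auto simp: mult_le_cancel_left1 mult_le_cancel_right1)
          finally show ?thesis by (simp add: algebra_simps)
        qed
        then have "n powr (1/2) \<le> (2 * (real k + 1) * l) powr (1/2)"
          using n by (intro powr_mono2) auto
        also have "\<dots> = (2 * (real k + 1)) powr (1/2) * l powr (1/2)"
          using l by (simp add: powr_mult)
        also have "(2 * (real k + 1)) powr (1/2) \<le> (2 * (real k + 1)) powr 1"
          by (intro powr_mono) auto
        finally have "n powr (1/2) \<le> 2 * (real k + 1) * l powr (1/2)"
          by (simp add: mult_right_mono)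
        then have "n powr (1/2) / l\<^sup>2 \<le> 2 * (real k + 1) * l powr (1/2) / l\<^sup>2"
          by (intro divide_right_mono) auto
        also have "\<dots> = 2 * (real k + 1) * l powr (-3/2)"
        proof -
          have "l powr (1/2) / l\<^sup>2 = l powr (1/2 - 2)"
            using l by (subst powr_diff) (simp add: powr_numeral)
          then show ?thesis by (simp flip: times_divide_eq_right)
        qed
        finally show "n powr (1/2) / l\<^sup>2 \<le> 2 * (real k + 1) * l powr (-3/2)" .
      qed simp
      also have "\<dots> = 8 * (real k + 1) / (\<tau>\<^sup>2 * c\<^sup>2) * l powr (-3/2)" by simp
      finally show ?thesis by (simp only: l)
    qed
    \<comment> \<open>The factor i = k equals 1 because e k = 0; every other factor is at least exp
      (- 1 / x_i^2).\<close>
    have PL: "exp (- (C * (real k + 1) / \<tau>\<^sup>2)) \<le> \<bar>\<Prod>i<n. 1 - e i * exp ((real k)\<^sup>2 * h i)\<bar>" for n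
    proof -
      have "(\<Sum>i\<in>{..<n} - {k}. 1 / (?x i)\<^sup>2) \<le> (\<Sum>i\<in>{..<n} - {k}. 8 * (real k + 1) / (\<tau>\<^sup>2 * c\<^sup>2) * real (nat \<bar>int i - int k\<bar>) powr (-3/2))"
        by (intro sum_mono xb) auto
      also have "\<dots> \<le> (\<Sum>i<n. 8 * (real k + 1) / (\<tau>\<^sup>2 * c\<^sup>2) * real (nat \<bar>int i - int k\<bar>) powr (-3/2))"
        by (intro sum_mono2) auto
      also have "\<dots> = 8 * (real k + 1) / (\<tau>\<^sup>2 * c\<^sup>2) * (\<Sum>i<n. real (nat \<bar>int i - int k\<bar>) powr (-3/2))"
        by (simp add: sum_distrib_left)
      also have "\<dots> \<le> 8 * (real k + 1) / (\<tau>\<^sup>2 * c\<^sup>2) * (2 * Y)"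
        unfolding Y_def by (intro mult_left_mono sum_abs_diff_le sY) auto
      also have "\<dots> = 16 * Y / c\<^sup>2 * (real k + 1) / \<tau>\<^sup>2" by (simp add: field_simps)
      also have "\<dots> \<le> C * (real k + 1) / \<tau>\<^sup>2"
        using Z'0 by (intro divide_right_mono mult_right_mono) (auto simp: C_def)
      finally have "exp (- (C * (real k + 1) / \<tau>\<^sup>2)) \<le> exp (\<Sum>i\<in>{..<n} - {k}. - (1 / (?x i)\<^sup>2))"
        by (simp add: sum_negf)
      also have "\<dots> = (\<Prod>i\<in>{..<n} - {k}. exp (- (1 / (?x i)\<^sup>2)))"
        by (simp add: exp_sum)
      also have "\<dots> \<le> (\<Prod>i\<in>{..<n} - {k}. \<bar>1 - e i * exp ((real k)\<^sup>2 * h i)\<bar>)"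
      proof (intro prod_mono conjI)
        fix i assume i: "i \<in> {..<n} - {k}"
        then have "?x i \<noteq> 0" using h0[of i] by auto
        then show "exp (- (1 / (?x i)\<^sup>2)) \<le> \<bar>1 - e i * exp ((real k)\<^sup>2 * h i)\<bar>"
          using one_minus_exp_lower[of "?x i"] i by (simp add: ee)
      qed auto
      also have "\<dots> = (\<Prod>i<n. \<bar>1 - e i * exp ((real k)\<^sup>2 * h i)\<bar>)"
        by (rule prod.mono_neutral_left) (auto simp: e_def)
      finally show ?thesis by (simp add: abs_prod)
    qed
    have "\<tau> / 16 * exp ((real k)\<^sup>2 * \<tau> / 2 - C * (real k + 1) / \<tau>\<^sup>2) \<le> \<bar>J ((real k)\<^sup>2)\<bar>"
    proof (rule LIMSEQ_le_const[OF tendsto_rabs[OF JL]], intro exI allI impI)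
      fix n :: nat
      have "\<tau> / 16 * exp ((real k)\<^sup>2 * \<tau> / 2 - C * (real k + 1) / \<tau>\<^sup>2) =
          exp (- (C * (real k + 1) / \<tau>\<^sup>2)) * (\<tau> / 16 * exp ((real k)\<^sup>2 * \<tau> / 2))"
      proof -
        have "exp (a - b) = exp (- b) * exp a" for a b :: real by (simp flip: exp_add)
        then show ?thesis by (simp only: mult_ac)
      qed
      also have "\<dots> \<le> \<bar>\<Prod>i<n. 1 - e i * exp ((real k)\<^sup>2 * h i)\<bar> * \<bar>B ((real k)\<^sup>2)\<bar>"
        using PL B \<tau> by (intro mult_mono) auto
      finally show "\<tau> / 16 * exp ((real k)\<^sup>2 * \<tau> / 2 - C * (real k + 1) / \<tau>\<^sup>2) \<le>
          \<bar>(\<Prod>i<n. 1 - e i * exp ((real k)\<^sup>2 * h i)) * B ((real k)\<^sup>2)\<bar>"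
        by (simp add: abs_mult)
    qed
    moreover have "((\<lambda>s. exp ((real j)\<^sup>2 * s) * \<sigma> s) has_integral (if j = k then J ((real k)\<^sup>2) else 0)) {0..\<tau>}" for j
      using J[of "(real j)\<^sup>2"] J0[of j] by auto
    moreover have "\<bar>\<sigma> s\<bar> \<le> exp (C / \<tau>\<^sup>2)" for s
      using order_trans[OF sb[of s]] eC by simp
    ultimately show ?thesis
      using sc s0 by (intro exI[of _ \<sigma>] exI[of _ "J ((real k)\<^sup>2)"]) blast
  qed
  show ?thesis using that[OF \<open>C \<ge> 0\<close> main] .
qed

text \<open>The solution is the series of d k / M k times biorthogonal functions. The factor exp
  (-k^2 \<tau>/2) contained in 1 / M k beats both the growth of d and the loss exp (C
  (k+1)/\<tau>^2). Polynomially growing data are allowed because the coefficients of the control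
  potentials, by which one divides, may be polynomially small.\<close>

lemma moment_problem:
  fixes m :: nat
  obtains C :: real where "C \<ge> 0"
    "\<And>\<tau> d D. 0 < \<tau> \<Longrightarrow> \<tau> \<le> 1 \<Longrightarrow> (\<And>k. \<bar>d k\<bar> \<le> D * (real k + 1) ^ m) \<Longrightarrow>
       \<exists>w. continuous_on {0..\<tau>} w \<and> w 0 = 0 \<and> w \<tau> = 0 \<and> (\<forall>s. \<bar>w s\<bar> \<le> D * exp (C / \<tau> ^ 5)) \<and>
         (\<forall>k::nat. ((\<lambda>s. exp ((real k)\<^sup>2 * s) * w s) has_integral d k) {0..\<tau>})"
proof -
  obtain C where C: "C \<ge> 0" and bio:
    "\<And>\<tau> k. 0 < \<tau> \<Longrightarrow> \<tau> \<le> 1 \<Longrightarrow> \<exists>\<sigma> M. continuous_on UNIV \<sigma> \<and> \<sigma> 0 = 0 \<and> \<sigma> \<tau> = 0 \<and>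
       (\<forall>s. \<bar>\<sigma> s\<bar> \<le> exp (C / \<tau>\<^sup>2)) \<and>
       (\<forall>j::nat. ((\<lambda>s. exp ((real j)\<^sup>2 * s) * \<sigma> s) has_integral (if j = k then M else 0)) {0..\<tau>}) \<and>
       \<bar>M\<bar> \<ge> \<tau> / 16 * exp ((real k)\<^sup>2 * \<tau> / 2 - C * (real k + 1) / \<tau>\<^sup>2)"
    using biorthogonal by blast
  \<comment> \<open>The rates linear in k + 1 that the square has to absorb: the growth of d, the
    loss in M, and 1 for a convergent geometric series.\<close>
  define c where "c = real m + C + 1"
  \<comment> \<open>16 covers the factor 16/\<tau>, the remaining unit of 17 the passage from k^2 to
    (k+1)^2/2, C the bound on \<sigma>, and \<open>c\<^sup>2\<close> the completed square.\<close>
  define C' where "C' = 17 + C + c\<^sup>2"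
  have "C' \<ge> 0" using C by (simp add: C'_def)
  have main: "\<exists>w. continuous_on {0..\<tau>} w \<and> w 0 = 0 \<and> w \<tau> = 0 \<and> (\<forall>s. \<bar>w s\<bar> \<le> D * exp (C' / \<tau> ^ 5)) \<and>
         (\<forall>k::nat. ((\<lambda>s. exp ((real k)\<^sup>2 * s) * w s) has_integral d k) {0..\<tau>})"
    if \<tau>: "0 < \<tau>" "\<tau> \<le> 1" and d: "\<And>k. \<bar>d k\<bar> \<le> D * (real k + 1) ^ m" for \<tau> d D
  proof -
    have D: "D \<ge> 0" using order_trans[OF abs_ge_zero d[of 0]] by simp
    obtain \<sigma> M where sc: "\<And>k. continuous_on UNIV (\<sigma> k)" and s0: "\<And>k. \<sigma> k 0 = 0" "\<And>k. \<sigma> k \<tau> = 0"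
      and sb: "\<And>k s. \<bar>\<sigma> k s\<bar> \<le> exp (C / \<tau>\<^sup>2)"
      and sI: "\<And>k j::nat. ((\<lambda>s. exp ((real j)\<^sup>2 * s) * \<sigma> k s) has_integral (if j = k then M k else 0)) {0..\<tau>}"
      and Mb: "\<And>k::nat. \<bar>M k\<bar> \<ge> \<tau> / 16 * exp ((real k)\<^sup>2 * \<tau> / 2 - C * (real k + 1) / \<tau>\<^sup>2)"
    proof -
      define P where "P = (\<lambda>k \<sigma> M. continuous_on UNIV \<sigma> \<and> \<sigma> 0 = 0 \<and> \<sigma> \<tau> = 0 \<and>
        (\<forall>s. \<bar>\<sigma> s\<bar> \<le> exp (C / \<tau>\<^sup>2)) \<and>
        (\<forall>j::nat. ((\<lambda>s. exp ((real j)\<^sup>2 * s) * \<sigma> s) has_integral (if j = k then M else 0)) {0..\<tau>}) \<and>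
        \<bar>M\<bar> \<ge> \<tau> / 16 * exp ((real k)\<^sup>2 * \<tau> / 2 - C * (real k + 1) / \<tau>\<^sup>2))"
      have "\<forall>k. \<exists>\<sigma> M. P k \<sigma> M"
        using bio[OF \<tau>] unfolding P_def by blast
      then obtain \<sigma> M where "\<And>k. P k (\<sigma> k) (M k)"
        by metis
      then show ?thesis
        by (intro that[of \<sigma> M]) (simp_all add: P_def)
    qed
    have M0: "\<bar>M k\<bar> > 0" for k
      using Mb[of k] \<tau> by (intro less_le_trans[OF _ Mb]) simp
    define E where "E = exp (C' / \<tau> ^ 5)"
    have tp: "1 / \<tau>\<^sup>2 \<le> 1 / \<tau> ^ 5" "1 / \<tau> \<le> 1 / \<tau> ^ 5" "1 \<le> 1 / \<tau> ^ 5" "1 \<le> 1 / \<tau>\<^sup>2"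
      using \<tau> power_decreasing[of 2 5 \<tau>] power_decreasing[of 1 5 \<tau>] power_le_one[of \<tau> 5] power_le_one[of \<tau> 2]
      by (auto intro!: divide_left_mono)
    have key: "\<bar>d k / M k * \<sigma> k s\<bar> \<le> D * E * exp (- 1) ^ Suc k" for k s
    proof -
      define n where "n = real k + 1"
      have n: "n \<ge> 1" by (simp add: n_def)
      have "n ^ m \<le> exp (real m * n)"
        using power_mono[of n "exp n" m] exp_ge_add_one_self[of n] n by (simp add: exp_of_nat_mult)
      also have "\<dots> \<le> exp (real m * n / \<tau>\<^sup>2)"
        using mult_left_mono[OF tp(4), of "real m * n"] n by simp
      finally have 1: "n ^ m \<le> exp (real m * n / \<tau>\<^sup>2)" .
      have 2: "16 / \<tau> \<le> exp (16 / \<tau> ^ 5)"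
      proof -
        have "16 / \<tau> \<le> 16 / \<tau> ^ 5" using mult_left_mono[OF tp(2), of 16] by simp
        also have "\<dots> \<le> exp (16 / \<tau> ^ 5)" using exp_ge_add_one_self[of "16 / \<tau> ^ 5"] by linarith
        finally show ?thesis .
      qed
      have "\<bar>d k / M k * \<sigma> k s\<bar> = \<bar>d k\<bar> * \<bar>\<sigma> k s\<bar> / \<bar>M k\<bar>" by (simp add: abs_mult)
      also have "\<dots> \<le> (D * n ^ m) * exp (C / \<tau>\<^sup>2) / (\<tau> / 16 * exp ((real k)\<^sup>2 * \<tau> / 2 - C * n / \<tau>\<^sup>2))"
        using d[of k] sb[of k s] Mb[of k] \<tau> D unfolding n_def by (intro frac_le mult_mono) auto
      also have "\<dots> = D * (n ^ m * (16 / \<tau>) * (exp (C / \<tau>\<^sup>2) * exp (C * n / \<tau>\<^sup>2 - (real k)\<^sup>2 * \<tau> / 2)))"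
      proof -
        have "exp (C * n / \<tau>\<^sup>2 - (real k)\<^sup>2 * \<tau> / 2) * exp ((real k)\<^sup>2 * \<tau> / 2 - C * n / \<tau>\<^sup>2) = 1"
          by (simp flip: exp_add)
        then have "exp (C * n / \<tau>\<^sup>2 - (real k)\<^sup>2 * \<tau> / 2) = 1 / exp ((real k)\<^sup>2 * \<tau> / 2 - C * n / \<tau>\<^sup>2)"
          by (simp add: eq_divide_eq)
        then show ?thesis by simp
      qed
      also have "\<dots> \<le> D * (exp (real m * n / \<tau>\<^sup>2) * exp (16 / \<tau> ^ 5) * (exp (C / \<tau>\<^sup>2) * exp (C * n / \<tau>\<^sup>2 - (real k)\<^sup>2 * \<tau> / 2)))"
        using 1 2 n D \<tau> by (intro mult_left_mono mult_mono mult_right_mono) auto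
      also have "\<dots> = D * exp (real m * n / \<tau>\<^sup>2 + 16 / \<tau> ^ 5 + (C / \<tau>\<^sup>2 + (C * n / \<tau>\<^sup>2 - (real k)\<^sup>2 * \<tau> / 2)))"
        by (simp only: exp_add)
      also have "\<dots> \<le> D * exp (C' / \<tau> ^ 5 - n)"
      proof -
        \<comment> \<open>Completing the square in n; the fifth power of 1/\<tau> originates
          here.\<close>
        have a: "c * n / \<tau>\<^sup>2 \<le> n\<^sup>2 * \<tau> / 4 + c\<^sup>2 / \<tau> ^ 5"
        proof -
          have "0 \<le> (n * \<tau> ^ 3 / 2 - c)\<^sup>2 / \<tau> ^ 5" using \<tau> by simp
          also have "\<dots> = n\<^sup>2 * \<tau> / 4 + c\<^sup>2 / \<tau> ^ 5 - c * n / \<tau>\<^sup>2"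
            using \<tau> by (simp add: power2_eq_square field_simps eval_nat_numeral)
          finally show ?thesis by simp
        qed
        have b: "n\<^sup>2 * \<tau> / 4 - 1 \<le> (real k)\<^sup>2 * \<tau> / 2"
        proof -
          have "0 \<le> (n / 2 - 1)\<^sup>2 * 2" by simp
          then have "n\<^sup>2 / 2 - 1 \<le> (real k)\<^sup>2" by (simp add: n_def power2_eq_square algebra_simps)
          then have "(n\<^sup>2 / 2 - 1) * (\<tau> / 2) \<le> (real k)\<^sup>2 * (\<tau> / 2)" using \<tau> by (intro mult_right_mono) auto
          then show ?thesis using \<tau> by (simp add: algebra_simps)
        qed
        have c': "C / \<tau>\<^sup>2 \<le> C / \<tau> ^ 5"
          using mult_left_mono[OF tp(1) C] by simp
        have d': "n \<le> n / \<tau>\<^sup>2"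
          using mult_left_mono[OF tp(4), of n] n by simp
        have "real m * n / \<tau>\<^sup>2 + C * n / \<tau>\<^sup>2 + n / \<tau>\<^sup>2 = c * n / \<tau>\<^sup>2"
          by (simp add: c_def distrib_right add_divide_distrib)
        moreover have "C' / \<tau> ^ 5 = 16 / \<tau> ^ 5 + 1 / \<tau> ^ 5 + C / \<tau> ^ 5 + c\<^sup>2 / \<tau> ^ 5"
          by (simp add: C'_def add_divide_distrib)
        ultimately have "real m * n / \<tau>\<^sup>2 + 16 / \<tau> ^ 5 + (C / \<tau>\<^sup>2 + (C * n / \<tau>\<^sup>2 - (real k)\<^sup>2 * \<tau> / 2)) \<le> C' / \<tau> ^ 5 - n"
          using a b c' d' tp(3) by linarith
        then show ?thesis using D by (intro mult_left_mono) auto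
      qed
      also have "D * exp (C' / \<tau> ^ 5 - n) = D * E * exp (- 1) ^ Suc k"
      proof -
        have "exp (- 1) ^ Suc k = exp (- n)"
          using exp_of_nat_mult[of "Suc k" "- 1 :: real"] by (simp add: n_def algebra_simps)
        then show ?thesis by (simp add: E_def diff_conv_add_uminus exp_add del: power_Suc add_uminus_conv_diff)
      qed
      finally show ?thesis .
    qed
    have e1: "exp (- 1) \<le> (1/2 :: real)"
    proof -
      have "2 \<le> exp (1::real)" using exp_ge_add_one_self[of 1] by simp
      then show ?thesis by (simp add: exp_minus field_simps)
    qed
    have key2: "\<bar>d k / M k * \<sigma> k s\<bar> \<le> D * E * (1/2) ^ Suc k" for k s
    proof (rule order_trans[OF key])
      have "exp (- 1) ^ Suc k \<le> (1/2 :: real) ^ Suc k" by (intro power_mono e1) auto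
      then show "D * E * exp (- 1) ^ Suc k \<le> D * E * (1/2) ^ Suc k"
        using D by (intro mult_left_mono) (auto simp: E_def)
    qed
    have sm: "(\<lambda>k. D * E * (1/2) ^ Suc k) sums (D * E * 1)"
      by (intro sums_mult power_half_series)
    define w where "w = (\<lambda>s. \<Sum>k. d k / M k * \<sigma> k s)"
    have u: "uniform_limit UNIV (\<lambda>n s. \<Sum>k<n. d k / M k * \<sigma> k s) w sequentially"
      unfolding w_def
      by (rule Weierstrass_m_test[where M = "\<lambda>k. D * E * (1/2) ^ Suc k"])
        (use key2 sums_summable[OF sm] in auto)
    have wc: "continuous_on UNIV w"
    proof (rule uniform_limit_theorem[OF _ u])
      have "M k \<noteq> 0" for k using M0[of k] by simp
      then show "\<forall>\<^sub>F n in sequentially. continuous_on UNIV (\<lambda>s. \<Sum>k<n. d k / M k * \<sigma> k s)"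
        by (intro always_eventually allI continuous_intros sc)
    qed simp
    have w0: "w 0 = 0" "w \<tau> = 0" by (simp_all add: w_def s0)
    have wb: "\<bar>w s\<bar> \<le> D * E" for s
    proof -
      have "summable (\<lambda>k. norm (d k / M k * \<sigma> k s))"
        by (rule summable_comparison_test'[OF sums_summable[OF sm], of 0]) (use key2 in simp)
      then have "norm (w s) \<le> (\<Sum>k. norm (d k / M k * \<sigma> k s))"
        unfolding w_def by (rule summable_norm)
      also have "\<dots> \<le> (\<Sum>k. D * E * (1/2) ^ Suc k)"
        by (rule suminf_le) (use key2 \<open>summable _\<close> sums_summable[OF sm] in auto)
      also have "\<dots> = D * E" using sums_unique[OF sm] by simp
      finally show ?thesis by simp
    qed
    have "((\<lambda>s. exp ((real j)\<^sup>2 * s) * w s) has_integral d j) {0..\<tau>}" for j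
    proof -
      have "uniform_limit {0..\<tau>} (\<lambda>n s. exp ((real j)\<^sup>2 * s) * (\<Sum>k<n. d k / M k * \<sigma> k s)) (\<lambda>s. exp ((real j)\<^sup>2 * s) * w s) sequentially"
        by (intro uniform_lim_mult uniform_limit_on_subset[OF u] uniform_limit_const)
          (auto intro!: compact_imp_bounded compact_continuous_image continuous_intros continuous_on_subset[OF wc])
      then obtain I J where 1: "\<And>n. ((\<lambda>s. exp ((real j)\<^sup>2 * s) * (\<Sum>k<n. d k / M k * \<sigma> k s)) has_integral I n) {0..\<tau>}"
        and 2: "((\<lambda>s. exp ((real j)\<^sup>2 * s) * w s) has_integral J) {0..\<tau>}" and 3: "I \<longlonglongrightarrow> J"
      proof (rule uniform_limit_integral)
        show "continuous_on {0..\<tau>} (\<lambda>s. exp ((real j)\<^sup>2 * s) * (\<Sum>k<n. d k / M k * \<sigma> k s))" for n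
          using M0 by (intro continuous_intros continuous_on_subset[OF sc]) auto
      qed auto
      have "I n = d j" if "n > j" for n
      proof -
        have "((\<lambda>s. \<Sum>k<n. d k / M k * (exp ((real j)\<^sup>2 * s) * \<sigma> k s)) has_integral (\<Sum>k<n. d k / M k * (if j = k then M k else 0))) {0..\<tau>}"
          by (intro has_integral_sum has_integral_mult_right sI) auto
        moreover have "(\<lambda>s. \<Sum>k<n. d k / M k * (exp ((real j)\<^sup>2 * s) * \<sigma> k s)) = (\<lambda>s. exp ((real j)\<^sup>2 * s) * (\<Sum>k<n. d k / M k * \<sigma> k s))"
          by (simp add: sum_distrib_left mult_ac)
        moreover have "(\<Sum>k<n. d k / M k * (if j = k then M k else 0)) = d j"
        proof -
          have "(\<Sum>k<n. d k / M k * (if j = k then M k else 0)) = (\<Sum>k<n. if j = k then d k else 0)"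
            using M0[of j] by (intro sum.cong) auto
          also have "\<dots> = d j" using that by (simp add: sum.delta')
          finally show ?thesis .
        qed
        ultimately show ?thesis using has_integral_unique[OF 1] by simp
      qed
      then have "I \<longlonglongrightarrow> d j"
        by (intro tendsto_eventually eventually_mono[OF eventually_gt_at_top[of j]])
      then have "J = d j" using 3 LIMSEQ_unique by blast
      with 2 show ?thesis by simp
    qed
    then show ?thesis
      using w0 wb continuous_on_subset[OF wc] unfolding E_def by blast
  qed
  show ?thesis using that[OF \<open>C' \<ge> 0\<close> main] by blast
qed

section \<open>Exact control near the target\<close>

text \<open>A Taylor remainder in difference form: b = 0 gives the quadratic error, general a and b
  give the small Lipschitz constant needed for a contraction.\<close>

lemma power_linearization:
  fixes C :: "'a::{real_normed_algebra_1, comm_ring_1}"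
  shows "\<exists>K\<ge>0. \<forall>a b \<rho>. norm a \<le> \<rho> \<longrightarrow> norm b \<le> \<rho> \<longrightarrow> \<rho> \<le> 1 \<longrightarrow>
    norm ((C + a) ^ Suc n - (C + b) ^ Suc n - of_nat (Suc n) * C ^ n * (a - b)) \<le> K * \<rho> * norm (a - b)"
proof (induction n)
  case 0
  then show ?case by (intro exI[of _ 0]) auto
next
  case (Suc n)
  then obtain K where K: "K \<ge> 0" and IH: "\<And>a b \<rho>. norm a \<le> \<rho> \<Longrightarrow> norm b \<le> \<rho> \<Longrightarrow> \<rho> \<le> 1 \<Longrightarrow>
    norm ((C + a) ^ Suc n - (C + b) ^ Suc n - of_nat (Suc n) * C ^ n * (a - b)) \<le> K * \<rho> * norm (a - b)" by blast
  define N where "N = norm (of_nat (Suc n) * C ^ n)"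
  have N: "N \<ge> 0" by (simp add: N_def)
  define K' where "K' = (norm C + 1) * K + (K + N) + N"
  have "norm ((C + a) ^ Suc (Suc n) - (C + b) ^ Suc (Suc n) - of_nat (Suc (Suc n)) * C ^ Suc n * (a - b)) \<le> K' * \<rho> * norm (a - b)"
    if a: "norm a \<le> \<rho>" and b: "norm b \<le> \<rho>" and r: "\<rho> \<le> 1" for a b \<rho>
  proof -
    let ?D = "(C + a) ^ Suc n - (C + b) ^ Suc n - of_nat (Suc n) * C ^ n * (a - b)"
    have r0: "\<rho> \<ge> 0" using a norm_ge_zero order_trans by blast
    \<comment> \<open>Peeling off one factor leaves the old remainder times C + a and two terms that
      are visibly of second order.\<close>
    have eq: "(C + a) ^ Suc (Suc n) - (C + b) ^ Suc (Suc n) - of_nat (Suc (Suc n)) * C ^ Suc n * (a - b)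
      = (C + a) * ?D + (a - b) * ((C + b) ^ Suc n - C ^ Suc n) + a * (of_nat (Suc n) * C ^ n) * (a - b)"
      by (simp add: algebra_simps)
    have 1: "norm ((C + a) * ?D) \<le> (norm C + 1) * (K * \<rho> * norm (a - b))"
      using norm_triangle_ineq[of C a] a r
      by (intro order_trans[OF norm_mult_ineq] mult_mono IH[OF a b r]) auto
    have "norm ((C + b) ^ Suc n - (C + 0) ^ Suc n - of_nat (Suc n) * C ^ n * (b - 0)) \<le> K * \<rho> * norm (b - 0)"
      using r0 by (intro IH b r) auto
    also have "\<dots> \<le> K * \<rho> * 1"
      using b r r0 K by (intro mult_left_mono mult_nonneg_nonneg) auto
    finally have "norm ((C + b) ^ Suc n - C ^ Suc n - of_nat (Suc n) * C ^ n * b) \<le> K * \<rho>" by simp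
    moreover have "norm (of_nat (Suc n) * C ^ n * b) \<le> N * \<rho>"
      unfolding N_def using b by (intro order_trans[OF norm_mult_ineq] mult_left_mono) auto
    ultimately have 2: "norm ((C + b) ^ Suc n - C ^ Suc n) \<le> (K + N) * \<rho>"
      using norm_triangle_ineq[of "(C + b) ^ Suc n - C ^ Suc n - of_nat (Suc n) * C ^ n * b" "of_nat (Suc n) * C ^ n * b"]
      by (simp add: algebra_simps)
    have 2: "norm ((a - b) * ((C + b) ^ Suc n - C ^ Suc n)) \<le> norm (a - b) * ((K + N) * \<rho>)"
      by (intro order_trans[OF norm_mult_ineq] mult_left_mono 2) auto
    have 3: "norm (a * (of_nat (Suc n) * C ^ n) * (a - b)) \<le> \<rho> * N * norm (a - b)"
      unfolding N_def using a
      by (intro order_trans[OF norm_mult_ineq] mult_right_mono) (auto intro!: order_trans[OF norm_mult_ineq] mult_right_mono)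
    have "norm ((C + a) * ?D + (a - b) * ((C + b) ^ Suc n - C ^ Suc n) + a * (of_nat (Suc n) * C ^ n) * (a - b))
      \<le> (norm C + 1) * (K * \<rho> * norm (a - b)) + norm (a - b) * ((K + N) * \<rho>) + \<rho> * N * norm (a - b)"
      by (intro order_trans[OF norm_triangle_ineq] add_mono 1 2 3)
    also have "\<dots> = K' * \<rho> * norm (a - b)"
      by (simp add: K'_def algebra_simps)
    finally show ?thesis unfolding eq .
  qed
  moreover have "K' \<ge> 0" using K N by (simp add: K'_def)
  ultimately show ?case by blast
qed

text \<open>Multiplying the k-th coefficient by exp (k^2 \<tau>) turns null control into moment
  equations. As \<open>\<mu>1\<close> has real and \<open>\<mu>2\<close> imaginary coefficients, the
  real and imaginary parts of the data separate into two scalar moment problems with simple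
  exponents k^2. Dividing by the coefficients costs (k+1)^m / b; negative frequencies follow by
  conjugation.\<close>

lemma linear_null_control:
  fixes \<mu>1 \<mu>2 :: wiener and c b :: real and m :: nat
  assumes c: "c > 0" and b: "b > 0"
    and m1: "\<And>k::nat. \<bar>Re (coef \<mu>1 (int k))\<bar> * (real k + 1) ^ m \<ge> b" "\<And>k::nat. Im (coef \<mu>1 (int k)) = 0"
    and m2: "\<And>k::nat. k \<ge> 1 \<Longrightarrow> \<bar>Im (coef \<mu>2 (int k))\<bar> * (real k + 1) ^ m \<ge> b" "\<And>k::nat. Re (coef \<mu>2 (int k)) = 0"
  obtains A :: real where "A \<ge> 0"
    "\<And>\<tau> \<xi>0. 0 < \<tau> \<Longrightarrow> \<tau> \<le> 1 \<Longrightarrow> \<exists>w1 w2. continuous_on {0..\<tau>} w1 \<and> continuous_on {0..\<tau>} w2 \<and>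
        w1 0 = 0 \<and> w1 \<tau> = 0 \<and> w2 0 = 0 \<and> w2 \<tau> = 0 \<and>
        (\<forall>s. \<bar>w1 s\<bar> \<le> exp (A / \<tau> ^ 5) * norm \<xi>0) \<and> (\<forall>s. \<bar>w2 s\<bar> \<le> exp (A / \<tau> ^ 5) * norm \<xi>0) \<and>
        S \<tau> \<xi>0 + duh (\<lambda>r. c *\<^sub>R (w1 r *\<^sub>R \<mu>1 + w2 r *\<^sub>R \<mu>2)) \<tau> = 0"
proof -
  obtain C where C: "C \<ge> 0" and mom:
    "\<And>\<tau> d D. 0 < \<tau> \<Longrightarrow> \<tau> \<le> 1 \<Longrightarrow> (\<And>k. \<bar>d k\<bar> \<le> D * (real k + 1) ^ m) \<Longrightarrow>
       \<exists>w. continuous_on {0..\<tau>} w \<and> w 0 = 0 \<and> w \<tau> = 0 \<and> (\<forall>s. \<bar>w s\<bar> \<le> D * exp (C / \<tau> ^ 5)) \<and>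
         (\<forall>k::nat. ((\<lambda>s. exp ((real k)\<^sup>2 * s) * w s) has_integral d k) {0..\<tau>})"
    using moment_problem[of m] by blast
  \<comment> \<open>The factor 1 / (c b) is absorbed into the exponential, since x <= exp (x /
    \<tau>^5) for x >= 0 and \<tau> <= 1.\<close>
  define A where "A = C + 1 / (c * b)"
  have A: "A \<ge> 0" using C c b by (simp add: A_def)
  have "\<exists>w1 w2. continuous_on {0..\<tau>} w1 \<and> continuous_on {0..\<tau>} w2 \<and>
        w1 0 = 0 \<and> w1 \<tau> = 0 \<and> w2 0 = 0 \<and> w2 \<tau> = 0 \<and>
        (\<forall>s. \<bar>w1 s\<bar> \<le> exp (A / \<tau> ^ 5) * norm \<xi>0) \<and> (\<forall>s. \<bar>w2 s\<bar> \<le> exp (A / \<tau> ^ 5) * norm \<xi>0) \<and>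
        S \<tau> \<xi>0 + duh (\<lambda>r. c *\<^sub>R (w1 r *\<^sub>R \<mu>1 + w2 r *\<^sub>R \<mu>2)) \<tau> = 0"
    if \<tau>: "0 < \<tau>" "\<tau> \<le> 1" for \<tau> and \<xi>0 :: wiener
  proof -
    define D where "D = norm \<xi>0 / (c * b)"
    have q: "\<bar>x / (c * y)\<bar> \<le> D * (real k + 1) ^ m"
      if "\<bar>x\<bar> \<le> norm \<xi>0" "\<bar>y\<bar> * (real k + 1) ^ m \<ge> b" for x y :: real and k :: nat
    proof -
      have y: "\<bar>y\<bar> > 0" using that(2) b by (metis abs_ge_zero less_eq_real_def mult_zero_left not_le)
      have "\<bar>x / (c * y)\<bar> * b \<le> \<bar>x / (c * y)\<bar> * (\<bar>y\<bar> * (real k + 1) ^ m)"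
        using that(2) by (intro mult_left_mono) auto
      also have "\<dots> = \<bar>x\<bar> / c * (real k + 1) ^ m"
        using y c by (simp add: abs_mult)
      also have "\<dots> \<le> norm \<xi>0 / c * (real k + 1) ^ m"
        using that(1) c by (intro mult_right_mono divide_right_mono) auto
      finally show ?thesis using b c by (simp add: D_def field_simps)
    qed
    define d1 where "d1 = (\<lambda>k::nat. - (Re (coef \<xi>0 (int k)) / (c * Re (coef \<mu>1 (int k)))))"
    define d2 where "d2 = (\<lambda>k::nat. - (Im (coef \<xi>0 (int k)) / (c * Im (coef \<mu>2 (int k)))))"
    have re: "\<bar>Re (coef \<xi>0 k)\<bar> \<le> norm \<xi>0" "\<bar>Im (coef \<xi>0 k)\<bar> \<le> norm \<xi>0" for k
      using order_trans[OF abs_Re_le_cmod coef_le_norm] order_trans[OF abs_Im_le_cmod coef_le_norm] by auto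
    \<comment> \<open>Frequency 0 carries no imaginary part, so nothing is demanded there of
      \<open>\<mu>2\<close>, whose coefficient vanishes.\<close>
    have im0: "Im (coef f 0) = 0" for f
      using coef_cnj[of f 0] by (simp add: complex_eq_iff)
    have b1: "\<bar>d1 k\<bar> \<le> D * (real k + 1) ^ m" for k
      unfolding d1_def abs_minus_cancel by (rule q[OF re(1) m1(1)])
    have b2: "\<bar>d2 k\<bar> \<le> D * (real k + 1) ^ m" for k
    proof (cases "k = 0")
      case True
      then show ?thesis using c b by (simp add: d2_def im0 D_def)
    next
      case False
      then show ?thesis unfolding d2_def abs_minus_cancel by (intro q[OF re(2) m2(1)]) auto
    qed
    obtain w1 where w1: "continuous_on {0..\<tau>} w1" "w1 0 = 0" "w1 \<tau> = 0" "\<And>s. \<bar>w1 s\<bar> \<le> D * exp (C / \<tau> ^ 5)"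
      and i1: "\<And>k::nat. ((\<lambda>s. exp ((real k)\<^sup>2 * s) * w1 s) has_integral d1 k) {0..\<tau>}"
      using mom[of \<tau> d1 D, OF \<tau> b1] by blast
    obtain w2 where w2: "continuous_on {0..\<tau>} w2" "w2 0 = 0" "w2 \<tau> = 0" "\<And>s. \<bar>w2 s\<bar> \<le> D * exp (C / \<tau> ^ 5)"
      and i2: "\<And>k::nat. ((\<lambda>s. exp ((real k)\<^sup>2 * s) * w2 s) has_integral d2 k) {0..\<tau>}"
      using mom[of \<tau> d2 D, OF \<tau> b2] by blast
    have DA: "D * exp (C / \<tau> ^ 5) \<le> exp (A / \<tau> ^ 5) * norm \<xi>0"
    proof -
      have t5: "1 \<le> 1 / \<tau> ^ 5" using \<tau> by (simp add: power_le_one)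
      have "1 / (c * b) \<le> 1 / (c * b) * (1 / \<tau> ^ 5)"
        using mult_left_mono[OF t5, of "1 / (c * b)"] c b by simp
      also have "\<dots> \<le> exp (1 / (c * b) * (1 / \<tau> ^ 5))"
        using exp_ge_add_one_self[of "1 / (c * b) * (1 / \<tau> ^ 5)"] by linarith
      finally have "1 / (c * b) * exp (C / \<tau> ^ 5) \<le> exp (1 / (c * b) * (1 / \<tau> ^ 5)) * exp (C / \<tau> ^ 5)"
        by (intro mult_right_mono) auto
      also have "\<dots> = exp (A / \<tau> ^ 5)"
        by (simp add: A_def add_divide_distrib exp_add)
      finally have "1 / (c * b) * exp (C / \<tau> ^ 5) * norm \<xi>0 \<le> exp (A / \<tau> ^ 5) * norm \<xi>0"
        by (intro mult_right_mono) auto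
      then show ?thesis by (simp add: D_def mult_ac)
    qed
    let ?F = "\<lambda>r. c *\<^sub>R (w1 r *\<^sub>R \<mu>1 + w2 r *\<^sub>R \<mu>2)"
    have Fc: "continuous_on {0..\<tau>} ?F" by (intro continuous_intros w1 w2)
    have "coef (S \<tau> \<xi>0 + duh ?F \<tau>) (int k) = 0" for k :: nat
    proof -
      let ?e = "exp ((real k)\<^sup>2 * \<tau>)"
      have I1: "((\<lambda>s. (exp ((real k)\<^sup>2 * s) * w1 s) *\<^sub>R (c *\<^sub>R coef \<mu>1 (int k))) has_integral d1 k *\<^sub>R (c *\<^sub>R coef \<mu>1 (int k))) {0..\<tau>}"
        by (rule has_integral_scaleR_left[OF i1])
      have I2: "((\<lambda>s. (exp ((real k)\<^sup>2 * s) * w2 s) *\<^sub>R (c *\<^sub>R coef \<mu>2 (int k))) has_integral d2 k *\<^sub>R (c *\<^sub>R coef \<mu>2 (int k))) {0..\<tau>}"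
        by (rule has_integral_scaleR_left[OF i2])
      have h1: "((\<lambda>r. exp ((of_int (int k))\<^sup>2 * r) *\<^sub>R coef (?F r) (int k)) has_integral
          d1 k *\<^sub>R (c *\<^sub>R coef \<mu>1 (int k)) + d2 k *\<^sub>R (c *\<^sub>R coef \<mu>2 (int k))) {0..\<tau>}"
        by (rule has_integral_eq[OF _ has_integral_add[OF I1 I2]])
          (simp add: coef_simps(3,4) scaleR_add_right mult_ac)
      have h2: "((\<lambda>r. exp ((of_int (int k))\<^sup>2 * r) *\<^sub>R coef (?F r) (int k)) has_integral
          exp ((of_int (int k))\<^sup>2 * \<tau>) *\<^sub>R coef (duh ?F \<tau>) (int k)) {0..\<tau>}"
        by (rule coef_duh[OF Fc]) (use \<tau> in auto)
      have "?e *\<^sub>R coef (duh ?F \<tau>) (int k) = d1 k *\<^sub>R (c *\<^sub>R coef \<mu>1 (int k)) + d2 k *\<^sub>R (c *\<^sub>R coef \<mu>2 (int k))"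
        using has_integral_unique[OF h2 h1] by simp
      also have "\<dots> = - coef \<xi>0 (int k)"
      proof (rule complex_eqI)
        have "Re (coef \<mu>1 (int k)) \<noteq> 0" using m1(1)[of k] b by auto
        then show "Re (d1 k *\<^sub>R (c *\<^sub>R coef \<mu>1 (int k)) + d2 k *\<^sub>R (c *\<^sub>R coef \<mu>2 (int k))) = Re (- coef \<xi>0 (int k))"
          using c by (simp add: d1_def m2(2))
        show "Im (d1 k *\<^sub>R (c *\<^sub>R coef \<mu>1 (int k)) + d2 k *\<^sub>R (c *\<^sub>R coef \<mu>2 (int k))) = Im (- coef \<xi>0 (int k))"
        proof (cases "k = 0")
          case True
          then show ?thesis by (simp add: im0)
        next
          case False
          then have "Im (coef \<mu>2 (int k)) \<noteq> 0" using m2(1)[of k] b by auto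
          then show ?thesis using c by (simp add: d2_def m1(2))
        qed
      qed
      finally have "?e *\<^sub>R coef (duh ?F \<tau>) (int k) = - coef \<xi>0 (int k)" .
      moreover have "?e *\<^sub>R coef (S \<tau> \<xi>0) (int k) = coef \<xi>0 (int k)"
        using \<tau> by (simp add: coef_S flip: exp_add)
      ultimately have "?e *\<^sub>R coef (S \<tau> \<xi>0 + duh ?F \<tau>) (int k) = 0"
        by (simp add: coef_simps(3) scaleR_add_right)
      then show ?thesis by simp
    qed
    then have "coef (S \<tau> \<xi>0 + duh ?F \<tau>) k = 0" for k
      using coef_cnj[of "S \<tau> \<xi>0 + duh ?F \<tau>" "- k"] by (cases k rule: int_cases2) auto
    then have "S \<tau> \<xi>0 + duh ?F \<tau> = 0"
      by (intro wiener_coef_eqI) (simp add: coef_simps)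
    then show ?thesis
      using w1 w2 order_trans[OF _ DA] by (intro exI[of _ w1] exI[of _ w2]) auto
  qed
  then show ?thesis using that[OF A] by blast
qed

lemma fn_of_nat [simp]: "fn (of_nat n) x = of_nat n"
  by (induction n) auto

definition rhs :: "real \<Rightarrow> nat \<Rightarrow> wiener \<Rightarrow> wiener \<Rightarrow> wiener" where
  "rhs \<kappa> p v y = v * y - \<kappa> *\<^sub>R y ^ (p + 1)"

text \<open>The potential \<open>\<kappa> * c ^ p\<close> makes c stationary. Its contribution
  \<kappa> c^p and the derivative -\<kappa> (p+1) c^p of the power leave the damping -\<kappa> p c^p
  in the linear part.\<close>

lemma rhs_expand:
  obtains CR :: real where "CR \<ge> 0"
    "\<And>v a b \<rho>. norm a \<le> \<rho> \<Longrightarrow> norm b \<le> \<rho> \<Longrightarrow> \<rho> \<le> 1 \<Longrightarrow>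
      norm (rhs \<kappa> p (v + (\<kappa> * c ^ p) *\<^sub>R 1) (c *\<^sub>R 1 + a) - rhs \<kappa> p (v + (\<kappa> * c ^ p) *\<^sub>R 1) (c *\<^sub>R 1 + b)
         - v * (a - b) + (\<kappa> * p * c ^ p) *\<^sub>R (a - b)) \<le> CR * \<rho> * norm (a - b)"
proof -
  obtain K where K: "K \<ge> 0" and b: "\<And>a b \<rho>. norm a \<le> \<rho> \<Longrightarrow> norm b \<le> \<rho> \<Longrightarrow> \<rho> \<le> 1 \<Longrightarrow>
    norm ((c *\<^sub>R (1::wiener) + a) ^ Suc p - (c *\<^sub>R 1 + b) ^ Suc p - of_nat (Suc p) * (c *\<^sub>R 1) ^ p * (a - b)) \<le> K * \<rho> * norm (a - b)"
    using power_linearization[of "c *\<^sub>R (1::wiener)" p] by blast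
  show ?thesis
  proof (rule that[of "\<bar>\<kappa>\<bar> * K"])
    fix v a b :: wiener and \<rho> :: real
    assume ab: "norm a \<le> \<rho>" "norm b \<le> \<rho>" "\<rho> \<le> 1"
    let ?D = "(c *\<^sub>R (1::wiener) + a) ^ Suc p - (c *\<^sub>R 1 + b) ^ Suc p - of_nat (Suc p) * (c *\<^sub>R 1) ^ p * (a - b)"
    have "rhs \<kappa> p (v + (\<kappa> * c ^ p) *\<^sub>R 1) (c *\<^sub>R 1 + a) - rhs \<kappa> p (v + (\<kappa> * c ^ p) *\<^sub>R 1) (c *\<^sub>R 1 + b)
         - v * (a - b) + (\<kappa> * p * c ^ p) *\<^sub>R (a - b) = - \<kappa> *\<^sub>R ?D"
      by (rule wiener_eqI) (simp add: rhs_def algebra_simps)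
    then have "norm (rhs \<kappa> p (v + (\<kappa> * c ^ p) *\<^sub>R 1) (c *\<^sub>R 1 + a) - rhs \<kappa> p (v + (\<kappa> * c ^ p) *\<^sub>R 1) (c *\<^sub>R 1 + b)
         - v * (a - b) + (\<kappa> * p * c ^ p) *\<^sub>R (a - b)) = \<bar>\<kappa>\<bar> * norm ?D" by (simp del: of_nat_Suc power_Suc)
    also have "\<dots> \<le> \<bar>\<kappa>\<bar> * (K * \<rho> * norm (a - b))"
      by (intro mult_left_mono b ab) auto
    finally show "norm (rhs \<kappa> p (v + (\<kappa> * c ^ p) *\<^sub>R 1) (c *\<^sub>R 1 + a) - rhs \<kappa> p (v + (\<kappa> * c ^ p) *\<^sub>R 1) (c *\<^sub>R 1 + b)
         - v * (a - b) + (\<kappa> * p * c ^ p) *\<^sub>R (a - b)) \<le> \<bar>\<kappa>\<bar> * K * \<rho> * norm (a - b)"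
      by (simp add: mult_ac)
  qed (use K in auto)
qed

lemma continuous_on_rhs:
  assumes "continuous_on X v" "continuous_on X y"
  shows "continuous_on X (\<lambda>r. rhs \<kappa> p (v r) (y r))"
  unfolding rhs_def by (intro continuous_intros assms)

text \<open>A Newton-like step: the control that annihilates the linearised deviation is applied to
  the full equation. What remains at time \<tau> is the response to the second-order defect, hence
  quadratic in the initial deviation.\<close>

lemma local_step:
  fixes \<mu>1 \<mu>2 :: wiener and c b \<kappa> :: real and m p :: nat
  assumes c: "c > 0" and b: "b > 0" and k: "\<kappa> \<ge> 0"
    and m1: "\<And>k::nat. \<bar>Re (coef \<mu>1 (int k))\<bar> * (real k + 1) ^ m \<ge> b" "\<And>k::nat. Im (coef \<mu>1 (int k)) = 0"
    and m2: "\<And>k::nat. k \<ge> 1 \<Longrightarrow> \<bar>Im (coef \<mu>2 (int k))\<bar> * (real k + 1) ^ m \<ge> b" "\<And>k::nat. Re (coef \<mu>2 (int k)) = 0"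
  obtains A :: real where "A \<ge> 0"
    "\<And>\<tau> \<xi>0. 0 < \<tau> \<Longrightarrow> \<tau> \<le> 1 \<Longrightarrow> exp (A / \<tau> ^ 5) * norm \<xi>0 \<le> 1 / 2 \<Longrightarrow> \<exists>v1 v2 \<xi>.
        continuous_on {0..\<tau>} v1 \<and> continuous_on {0..\<tau>} v2 \<and> v1 0 = 0 \<and> v1 \<tau> = 0 \<and> v2 0 = 0 \<and> v2 \<tau> = 0 \<and>
        (\<forall>s\<in>{0..\<tau>}. \<bar>v1 s\<bar> \<le> exp (A / \<tau> ^ 5) * norm \<xi>0 \<and> \<bar>v2 s\<bar> \<le> exp (A / \<tau> ^ 5) * norm \<xi>0 \<and>
           norm (\<xi> s) \<le> exp (A / \<tau> ^ 5) * norm \<xi>0) \<and>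
        heat_sol 0 \<tau> \<xi> (\<lambda>r. rhs \<kappa> p (v1 r *\<^sub>R \<mu>1 + v2 r *\<^sub>R \<mu>2 + (\<kappa> * c ^ p) *\<^sub>R 1) (c *\<^sub>R 1 + \<xi> r)) \<and>
        \<xi> 0 = \<xi>0 \<and> norm (\<xi> \<tau>) \<le> (exp (A / \<tau> ^ 5) * norm \<xi>0)\<^sup>2"
proof -
  obtain A0 where A0: "A0 \<ge> 0" and lin: "\<And>\<tau> \<xi>0. 0 < \<tau> \<Longrightarrow> \<tau> \<le> 1 \<Longrightarrow> \<exists>w1 w2. continuous_on {0..\<tau>} w1 \<and> continuous_on {0..\<tau>} w2 \<and>
        w1 0 = 0 \<and> w1 \<tau> = 0 \<and> w2 0 = 0 \<and> w2 \<tau> = 0 \<and>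
        (\<forall>s. \<bar>w1 s\<bar> \<le> exp (A0 / \<tau> ^ 5) * norm \<xi>0) \<and> (\<forall>s. \<bar>w2 s\<bar> \<le> exp (A0 / \<tau> ^ 5) * norm \<xi>0) \<and>
        S \<tau> \<xi>0 + duh (\<lambda>r. c *\<^sub>R (w1 r *\<^sub>R \<mu>1 + w2 r *\<^sub>R \<mu>2)) \<tau> = 0"
    using linear_null_control[OF c b m1 m2] by blast
  define \<nu> where "\<nu> = \<kappa> * p * c ^ p"
  have nu: "\<nu> \<ge> 0" using c k by (simp add: \<nu>_def)
  obtain CR where CR: "CR \<ge> 0" and rem: "\<And>v a b \<rho>. norm a \<le> \<rho> \<Longrightarrow> norm b \<le> \<rho> \<Longrightarrow> \<rho> \<le> 1 \<Longrightarrow>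
      norm (rhs \<kappa> p (v + (\<kappa> * c ^ p) *\<^sub>R 1) (c *\<^sub>R 1 + a) - rhs \<kappa> p (v + (\<kappa> * c ^ p) *\<^sub>R 1) (c *\<^sub>R 1 + b)
         - v * (a - b) + \<nu> *\<^sub>R (a - b)) \<le> CR * \<rho> * norm (a - b)"
    unfolding \<nu>_def using rhs_expand[of \<kappa> p c] by blast
  define m0 where "m0 = norm \<mu>1 + norm \<mu>2"
  have m0: "m0 \<ge> 0" by (simp add: m0_def)
  \<comment> \<open>In terms of the control size z: k1 z bounds the linearised trajectory, k2 z^2
    its defect and k3 z^2 the correction; k4 dominates all of these, and L is the Lipschitz constant
    of the equation for the correction.\<close>
  define k1 where "k1 = 1 + c * m0"
  define k2 where "k2 = m0 * k1 + CR * k1 * k1"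
  define L where "L = CR + m0 + \<nu> + 1"
  define k3 where "k3 = 2 * k2 * exp (2 * L)"
  define k4 where "k4 = 1 + k1 + 2 * k3"
  have k1: "k1 \<ge> 1" using m0 c by (simp add: k1_def)
  have k2: "k2 \<ge> 0" using m0 k1 CR by (simp add: k2_def)
  have k3: "k3 \<ge> 0" using k2 by (simp add: k3_def)
  have k4: "k4 \<ge> 1" "k1 \<le> k4" "2 * k3 \<le> k4" using k1 k3 by (auto simp: k4_def)
  have L: "L > 0" using CR m0 nu by (simp add: L_def)
  \<comment> \<open>The constant k4 is absorbed into the cost through k4 <= exp (k4 /
    \<tau>^5).\<close>
  define A where "A = A0 + k4"
  have A: "A \<ge> 0" using A0 k4 by (simp add: A_def)
  have main: "\<exists>v1 v2 \<xi>.
        continuous_on {0..\<tau>} v1 \<and> continuous_on {0..\<tau>} v2 \<and> v1 0 = 0 \<and> v1 \<tau> = 0 \<and> v2 0 = 0 \<and> v2 \<tau> = 0 \<and>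
        (\<forall>s\<in>{0..\<tau>}. \<bar>v1 s\<bar> \<le> exp (A / \<tau> ^ 5) * norm \<xi>0 \<and> \<bar>v2 s\<bar> \<le> exp (A / \<tau> ^ 5) * norm \<xi>0 \<and>
           norm (\<xi> s) \<le> exp (A / \<tau> ^ 5) * norm \<xi>0) \<and>
        heat_sol 0 \<tau> \<xi> (\<lambda>r. rhs \<kappa> p (v1 r *\<^sub>R \<mu>1 + v2 r *\<^sub>R \<mu>2 + (\<kappa> * c ^ p) *\<^sub>R 1) (c *\<^sub>R 1 + \<xi> r)) \<and>
        \<xi> 0 = \<xi>0 \<and> norm (\<xi> \<tau>) \<le> (exp (A / \<tau> ^ 5) * norm \<xi>0)\<^sup>2"
    if \<tau>: "0 < \<tau>" "\<tau> \<le> 1" and small: "exp (A / \<tau> ^ 5) * norm \<xi>0 \<le> 1 / 2" for \<tau> and \<xi>0 :: wiener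
  proof -
    define z where "z = exp (A0 / \<tau> ^ 5) * norm \<xi>0"
    have z0: "z \<ge> 0" by (simp add: z_def)
    have t5: "1 \<le> 1 / \<tau> ^ 5" using \<tau> by (simp add: power_le_one)
    have zA: "k4 * z \<le> exp (A / \<tau> ^ 5) * norm \<xi>0"
    proof -
      have "k4 \<le> k4 * (1 / \<tau> ^ 5)" using mult_left_mono[OF t5, of k4] k4 by simp
      also have "\<dots> \<le> exp (k4 * (1 / \<tau> ^ 5))" using exp_ge_add_one_self[of "k4 * (1 / \<tau> ^ 5)"] by linarith
      finally have "k4 * z \<le> exp (k4 * (1 / \<tau> ^ 5)) * z" using z0 by (rule mult_right_mono)
      then show ?thesis by (simp add: z_def A_def add_divide_distrib exp_add mult_ac)
    qed
    have xz: "norm \<xi>0 \<le> z"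
    proof -
      have "1 * norm \<xi>0 \<le> exp (A0 / \<tau> ^ 5) * norm \<xi>0"
        using A0 \<tau> by (intro mult_right_mono) auto
      then show ?thesis by (simp add: z_def)
    qed
    have kz: "k4 * z \<le> 1 / 2" using zA small by linarith
    have zk: "z \<le> k4 * z" "k1 * z \<le> k4 * z" "2 * k3 * z \<le> k4 * z"
      using k4 z0 mult_right_mono[of 1 k4 z] by (auto intro: mult_right_mono)
    have zh: "z \<le> 1 / 2" "k1 * z \<le> 1 / 2" "2 * k3 * z \<le> 1 / 2"
      using zk kz by linarith+
    have k3z: "k3 * z\<^sup>2 \<le> z / 4"
      using mult_right_mono[OF zh(3) z0] by (simp add: power2_eq_square)
    obtain w1 w2 where w: "continuous_on {0..\<tau>} w1" "continuous_on {0..\<tau>} w2"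
        "w1 0 = 0" "w1 \<tau> = 0" "w2 0 = 0" "w2 \<tau> = 0"
      and wb: "\<And>s. \<bar>w1 s\<bar> \<le> z" "\<And>s. \<bar>w2 s\<bar> \<le> z"
      and wnull: "S \<tau> \<xi>0 + duh (\<lambda>r. c *\<^sub>R (w1 r *\<^sub>R \<mu>1 + w2 r *\<^sub>R \<mu>2)) \<tau> = 0"
      using lin[OF \<tau>, of \<xi>0] unfolding z_def by blast
    define Fw where "Fw = (\<lambda>r. c *\<^sub>R (w1 r *\<^sub>R \<mu>1 + w2 r *\<^sub>R \<mu>2))"
    define \<eta> where "\<eta> = (\<lambda>t. S t \<xi>0 + duh Fw t)"
    have Fwc: "continuous_on {0..\<tau>} Fw" unfolding Fw_def by (intro continuous_intros w)
    have hs\<eta>: "heat_sol 0 \<tau> \<eta> Fw"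
      by (rule heat_sol_duh[OF Fwc]) (use \<tau> in \<open>auto simp: \<eta>_def\<close>)
    have lincomb: "norm (x *\<^sub>R \<mu>1 + y *\<^sub>R \<mu>2) \<le> m0 * z" if "\<bar>x\<bar> \<le> z" "\<bar>y\<bar> \<le> z" for x y
    proof -
      have "norm (x *\<^sub>R \<mu>1 + y *\<^sub>R \<mu>2) \<le> \<bar>x\<bar> * norm \<mu>1 + \<bar>y\<bar> * norm \<mu>2"
        using norm_triangle_ineq[of "x *\<^sub>R \<mu>1" "y *\<^sub>R \<mu>2"] by simp
      also have "\<dots> \<le> z * norm \<mu>1 + z * norm \<mu>2"
        using that by (intro add_mono mult_right_mono) auto
      finally show ?thesis by (simp add: m0_def algebra_simps)
    qed
    have \<eta>b: "norm (\<eta> t) \<le> k1 * z" if t: "t \<in> {0..\<tau>}" for t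
    proof -
      have "norm (duh Fw t) \<le> integral {0..t} (\<lambda>r. c * (m0 * z))"
        by (rule norm_duh_le[OF Fwc t]) (use c in \<open>auto simp: Fw_def intro!: mult_left_mono lincomb wb\<close>)
      also have "\<dots> = t * (c * (m0 * z))" using t by simp
      also have "\<dots> \<le> 1 * (c * (m0 * z))"
        using t \<tau> c m0 z0 by (intro mult_right_mono) auto
      finally have "norm (duh Fw t) \<le> c * m0 * z" by (simp add: mult_ac)
      moreover have "norm (\<eta> t) \<le> norm (S t \<xi>0) + norm (duh Fw t)"
        unfolding \<eta>_def by (rule norm_triangle_ineq)
      ultimately have "norm (\<eta> t) \<le> z + c * m0 * z"
        using norm_S_le[of t \<xi>0] xz by linarith
      then show ?thesis by (simp add: k1_def algebra_simps)
    qed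
    \<comment> \<open>The linearised equation is damped at rate \<nu>. Scaling an undamped
      trajectory and its controls by exp (-\<nu> t) yields a damped one and keeps the value 0 at
      time \<tau>.\<close>
    define v1 where "v1 = (\<lambda>r. exp (- \<nu> * r) * w1 r)"
    define v2 where "v2 = (\<lambda>r. exp (- \<nu> * r) * w2 r)"
    define V where "V = (\<lambda>r. v1 r *\<^sub>R \<mu>1 + v2 r *\<^sub>R \<mu>2)"
    have vc: "continuous_on {0..\<tau>} v1" "continuous_on {0..\<tau>} v2"
      unfolding v1_def v2_def by (intro continuous_intros w)+
    have Vc: "continuous_on {0..\<tau>} V" unfolding V_def by (intro continuous_intros vc)
    have e1: "exp (- \<nu> * r) \<le> 1" if "r \<in> {0..\<tau>}" for r
      using that nu by (simp add: mult_nonneg_nonneg)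
    have vb: "\<bar>v1 r\<bar> \<le> z" "\<bar>v2 r\<bar> \<le> z" if "r \<in> {0..\<tau>}" for r
      using mult_mono[OF e1[OF that] wb(1)[of r]] mult_mono[OF e1[OF that] wb(2)[of r]]
      by (auto simp: v1_def v2_def abs_mult)
    have Vb: "norm (V r) \<le> m0 * z" if "r \<in> {0..\<tau>}" for r
      unfolding V_def by (intro lincomb vb that)
    define \<xi>L where "\<xi>L = (\<lambda>t. exp (- \<nu> * t) *\<^sub>R \<eta> t)"
    have "heat_sol 0 \<tau> (\<lambda>t. exp (- \<nu> * t) *\<^sub>R \<eta> t) (\<lambda>t. exp (- \<nu> * t) *\<^sub>R Fw t + (- \<nu> * exp (- \<nu> * t)) *\<^sub>R \<eta> t)"
      by (rule heat_sol_gauge[OF hs\<eta> Fwc]) (auto intro!: derivative_eq_intros continuous_intros)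
    then have hsL: "heat_sol 0 \<tau> \<xi>L (\<lambda>t. c *\<^sub>R V t - \<nu> *\<^sub>R \<xi>L t)"
      by (rule heat_sol_cong) (auto simp: \<xi>L_def V_def v1_def v2_def Fw_def algebra_simps)
    have Lc: "continuous_on {0..\<tau>} \<xi>L" using heat_sol_continuous[OF hsL] .
    have Lb: "norm (\<xi>L t) \<le> k1 * z" if "t \<in> {0..\<tau>}" for t
      using mult_mono[OF e1[OF that] \<eta>b[OF that]] by (simp add: \<xi>L_def)
    have L0: "\<xi>L 0 = \<xi>0" "\<xi>L \<tau> = 0"
      using wnull by (auto simp: \<xi>L_def \<eta>_def Fw_def)
    define H where "H = (\<lambda>r a. rhs \<kappa> p (V r + (\<kappa> * c ^ p) *\<^sub>R 1) (c *\<^sub>R 1 + a))"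
    have H0: "H r 0 = c *\<^sub>R V r" for r
      unfolding H_def rhs_def by (rule wiener_eqI) (simp add: algebra_simps)
    have Hc: "continuous_on X (\<lambda>x. H (r x) (a x))" if "continuous_on X r" "continuous_on X a" "r ` X \<subseteq> {0..\<tau>}" for X :: "'z::topological_space set" and r a
      unfolding H_def
      by (intro continuous_on_rhs continuous_intros that(1,2) continuous_on_compose2[OF Vc that(1) that(3)])
    \<comment> \<open>f is the defect of \<open>\<xi>L\<close> in the full equation and of order
      z^2; G is the increment of the right-hand side, so that the correction e driven by f and G
      makes \<open>\<xi>L + e\<close> an exact solution.\<close>
    define f where "f = (\<lambda>r. H r (\<xi>L r) - c *\<^sub>R V r + \<nu> *\<^sub>R \<xi>L r)"
    define G where "G = (\<lambda>r e. H r (\<xi>L r + e) - H r (\<xi>L r))"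
    have fc: "continuous_on {0..\<tau>} f"
      unfolding f_def by (intro continuous_intros Hc Vc Lc) auto
    have fb: "norm (f r) \<le> k2 * z\<^sup>2" if r: "r \<in> {0..\<tau>}" for r
    proof -
      have "norm (H r (\<xi>L r) - H r 0 - V r * (\<xi>L r - 0) + \<nu> *\<^sub>R (\<xi>L r - 0)) \<le> CR * (k1 * z) * norm (\<xi>L r - 0)"
        unfolding H_def using Lb[OF r] zh k1 z0 by (intro rem) auto
      also have "\<dots> \<le> CR * (k1 * z) * (k1 * z)"
        using Lb[OF r] CR k1 z0 by (intro mult_left_mono) auto
      finally have 1: "norm (H r (\<xi>L r) - c *\<^sub>R V r - V r * \<xi>L r + \<nu> *\<^sub>R \<xi>L r) \<le> CR * (k1 * z) * (k1 * z)"
        by (simp add: H0)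
      have 2: "norm (V r * \<xi>L r) \<le> (m0 * z) * (k1 * z)"
        using Vb[OF r] Lb[OF r] m0 z0 by (intro order_trans[OF norm_mult_ineq] mult_mono) auto
      have "f r = (H r (\<xi>L r) - c *\<^sub>R V r - V r * \<xi>L r + \<nu> *\<^sub>R \<xi>L r) + V r * \<xi>L r"
        by (simp add: f_def)
      then have "norm (f r) \<le> CR * (k1 * z) * (k1 * z) + (m0 * z) * (k1 * z)"
        using 1 2 norm_triangle_mono by metis
      also have "\<dots> = k2 * z\<^sup>2" by (simp add: k2_def power2_eq_square algebra_simps)
      finally show ?thesis .
    qed
    have hb: "norm (duh f t) \<le> k2 * z\<^sup>2" if t: "t \<in> {0..\<tau>}" for t
    proof -
      have "norm (duh f t) \<le> integral {0..t} (\<lambda>r. k2 * z\<^sup>2)"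
        by (rule norm_duh_le[OF fc t]) (use fb t in auto)
      also have "\<dots> = t * (k2 * z\<^sup>2)" using t by simp
      also have "\<dots> \<le> 1 * (k2 * z\<^sup>2)" using t \<tau> k2 by (intro mult_right_mono) auto
      finally show ?thesis by simp
    qed
    have expL: "exp (2 * L * t) \<le> exp (2 * L)" if "t \<in> {0..\<tau>}" for t
      using that \<tau> L mult_left_mono[of t 1 "2 * L"] by auto
    have bound: "2 * (k2 * z\<^sup>2) * exp (2 * L * t) \<le> k3 * z\<^sup>2" if "t \<in> {0..\<tau>}" for t
      using mult_left_mono[OF expL[OF that], of "2 * (k2 * z\<^sup>2)"] k2 by (simp add: k3_def mult_ac)
    have "\<exists>e. continuous_on {0..\<tau>} e \<and> (\<forall>t\<in>{0..\<tau>}. e t = duh f t + duh (\<lambda>r. G r (e r)) t \<and>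
        norm (e t) \<le> 2 * (k2 * z\<^sup>2) * exp (2 * L * t))"
    proof (rule duhamel_fixed_point[where R = "1/2"])
      show "continuous_on {0..\<tau>} (duh f)" by (rule continuous_on_duh[OF fc])
      show "continuous_on ({0..\<tau>} \<times> cball 0 (1/2)) (\<lambda>(r, e). G r e)"
        unfolding G_def case_prod_unfold
        by (intro continuous_intros Hc continuous_on_compose2[OF Lc]) auto
      show "2 * (k2 * z\<^sup>2) * exp (2 * L * \<tau>) \<le> 1 / 2"
        using bound[of \<tau>] k3z zh \<tau> by auto
      fix r and a d :: wiener assume r: "r \<in> {0..\<tau>}" and a: "norm a \<le> 1/2" and d: "norm d \<le> 1/2"
      let ?a = "\<xi>L r + a" and ?d = "\<xi>L r + d"
      have "norm ?a \<le> 1" "norm ?d \<le> 1"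
        using norm_triangle_ineq[of "\<xi>L r" a] norm_triangle_ineq[of "\<xi>L r" d] a d Lb[OF r] zh by linarith+
      then have 1: "norm (H r ?a - H r ?d - V r * (?a - ?d) + \<nu> *\<^sub>R (?a - ?d)) \<le> CR * 1 * norm (?a - ?d)"
        unfolding H_def by (intro rem) auto
      have 2: "norm (V r * (a - d)) \<le> m0 * norm (a - d)"
      proof -
        have "norm (V r) \<le> m0"
          using Vb[OF r] mult_left_mono[of z 1 m0] m0 zh by simp
        then show ?thesis by (intro order_trans[OF norm_mult_ineq] mult_right_mono) auto
      qed
      have eq: "G r a - G r d = (H r ?a - H r ?d - V r * (?a - ?d) + \<nu> *\<^sub>R (?a - ?d)) + V r * (a - d) + (- \<nu>) *\<^sub>R (a - d)"
        by (simp add: G_def)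
      have "norm (G r a - G r d) \<le> CR * 1 * norm (?a - ?d) + m0 * norm (a - d) + norm ((- \<nu>) *\<^sub>R (a - d))"
        unfolding eq by (intro order_trans[OF norm_triangle_ineq] add_mono 1 2 order_refl)
      also have "norm ((- \<nu>) *\<^sub>R (a - d)) = \<nu> * norm (a - d)" using nu by (simp only: norm_scaleR) simp
      also have "CR * 1 * norm (?a - ?d) + m0 * norm (a - d) + \<nu> * norm (a - d) = (CR + m0 + \<nu>) * norm (a - d)"
        by (simp add: algebra_simps)
      also have "\<dots> \<le> L * norm (a - d)" unfolding L_def by (intro mult_right_mono) auto
      finally show "norm (G r a - G r d) \<le> L * norm (a - d)" .
    qed (use \<tau> L hb in \<open>auto simp: G_def\<close>)
    then obtain e where ec: "continuous_on {0..\<tau>} e"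
      and e: "\<And>t. t \<in> {0..\<tau>} \<Longrightarrow> e t = duh f t + duh (\<lambda>r. G r (e r)) t"
      and eb: "\<And>t. t \<in> {0..\<tau>} \<Longrightarrow> norm (e t) \<le> k3 * z\<^sup>2"
      using bound order_trans by blast
    have Gc: "continuous_on {0..\<tau>} (\<lambda>r. G r (e r))"
      unfolding G_def by (intro continuous_intros Hc Lc ec) auto
    have fG: "heat_sol 0 \<tau> (\<lambda>t. duh f t + duh (\<lambda>r. G r (e r)) t) (\<lambda>r. f r + G r (e r))"
    proof (rule heat_sol_add)
      show "heat_sol 0 \<tau> (duh f) f"
        by (rule heat_sol_duh[OF fc, where ?y0.0 = 0]) (use \<tau> in \<open>auto simp: S_simps\<close>)
      show "heat_sol 0 \<tau> (duh (\<lambda>r. G r (e r))) (\<lambda>r. G r (e r))"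
        by (rule heat_sol_duh[OF Gc, where ?y0.0 = 0]) (use \<tau> in \<open>auto simp: S_simps\<close>)
    qed
    have "heat_sol 0 \<tau> (\<lambda>t. \<xi>L t + (duh f t + duh (\<lambda>r. G r (e r)) t)) (\<lambda>t. c *\<^sub>R V t - \<nu> *\<^sub>R \<xi>L t + (f t + G t (e t)))"
      by (rule heat_sol_add[OF hsL fG])
    then have hs: "heat_sol 0 \<tau> (\<lambda>t. \<xi>L t + e t) (\<lambda>t. rhs \<kappa> p (v1 t *\<^sub>R \<mu>1 + v2 t *\<^sub>R \<mu>2 + (\<kappa> * c ^ p) *\<^sub>R 1) (c *\<^sub>R 1 + (\<xi>L t + e t)))"
    proof (rule heat_sol_cong)
      show "\<xi>L t + (duh f t + duh (\<lambda>r. G r (e r)) t) = \<xi>L t + e t" if "t \<in> {0..\<tau>}" for t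
        by (simp only: e[OF that])
    qed (auto simp: f_def G_def H_def V_def)
    have e0: "e 0 = 0" using e[of 0] \<tau> by simp
    have bx: "norm (\<xi>L t + e t) \<le> k4 * z" if t: "t \<in> {0..\<tau>}" for t
    proof -
      have "norm (\<xi>L t + e t) \<le> k1 * z + z / 4"
        using norm_triangle_ineq[of "\<xi>L t" "e t"] Lb[OF t] eb[OF t] k3z by linarith
      also have "\<dots> \<le> k1 * z + 1 * z" using z0 by simp
      also have "\<dots> \<le> k4 * z" unfolding distrib_right[symmetric]
        using z0 k3 by (intro mult_right_mono) (auto simp: k4_def)
      finally show ?thesis .
    qed
    have end': "norm (\<xi>L \<tau> + e \<tau>) \<le> (exp (A / \<tau> ^ 5) * norm \<xi>0)\<^sup>2"
    proof -
      have "norm (\<xi>L \<tau> + e \<tau>) \<le> k3 * z\<^sup>2" using eb[of \<tau>] \<tau> by (simp add: L0)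
      also have "\<dots> \<le> k4\<^sup>2 * z\<^sup>2"
      proof (rule mult_right_mono)
        have "k4 * 1 \<le> k4 * k4" using k4 by (intro mult_left_mono) auto
        then show "k3 \<le> k4\<^sup>2" using k4 k3 unfolding power2_eq_square by linarith
      qed simp
      also have "\<dots> = (k4 * z)\<^sup>2" by (simp add: power_mult_distrib)
      also have "\<dots> \<le> (exp (A / \<tau> ^ 5) * norm \<xi>0)\<^sup>2"
        using zA k4 z0 by (intro power_mono) auto
      finally show ?thesis .
    qed
    have vbA: "\<bar>v1 s\<bar> \<le> exp (A / \<tau> ^ 5) * norm \<xi>0 \<and> \<bar>v2 s\<bar> \<le> exp (A / \<tau> ^ 5) * norm \<xi>0 \<and>
           norm (\<xi>L s + e s) \<le> exp (A / \<tau> ^ 5) * norm \<xi>0" if "s \<in> {0..\<tau>}" for s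
      using vb[OF that] bx[OF that] zk zA by (intro conjI) linarith+
    show ?thesis
      by (rule exI[of _ v1], rule exI[of _ v2], rule exI[of _ "\<lambda>t. \<xi>L t + e t"])
        (use vc vbA hs end' e0 L0 w in \<open>auto simp: v1_def v2_def\<close>)
  qed
  show ?thesis using that[OF A main] .
qed

text \<open>Infinitely many pieces accumulate at T. Matching end values give continuity before T,
  and the bounds b n, uniform on each piece and tending to 0, give the limit l at T.\<close>

lemma glue_pieces:
  fixes f :: "nat \<Rightarrow> real \<Rightarrow> 'a::real_normed_vector" and tn :: "nat \<Rightarrow> real"
  assumes mono: "strict_mono tn" and t0: "tn 0 = 0" and lim: "tn \<longlonglongrightarrow> T"
    and f: "\<And>n. continuous_on {0..tn (Suc n) - tn n} (f n)"
    and match: "\<And>n. f n (tn (Suc n) - tn n) = f (Suc n) 0"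
    and bd: "\<And>n s. s \<in> {0..tn (Suc n) - tn n} \<Longrightarrow> norm (f n s - l) \<le> b n" and b: "b \<longlonglongrightarrow> 0"
  obtains g where "continuous_on {0..T} g" "\<And>n t. t \<in> {tn n..tn (Suc n)} \<Longrightarrow> g t = f n (t - tn n)" "g T = l"
proof -
  have tT: "tn n < T" for n
  proof -
    have "tn n < tn (Suc n)" using mono by (simp add: strict_mono_def)
    also have "tn (Suc n) \<le> T"
      using incseq_le[OF strict_mono_mono[OF mono] lim] .
    finally show ?thesis .
  qed
  have ex: "\<exists>n. t \<in> {tn n..<tn (Suc n)}" if "0 \<le> t" "t < T" for t
  proof -
    have "\<exists>n. t < tn n"
      using order_tendstoD(1)[OF lim \<open>t < T\<close>] by (auto simp: eventually_sequentially)
    then obtain n where n: "t < tn n" "\<And>k. k < n \<Longrightarrow> \<not> t < tn k"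
      using exists_least_iff[of "\<lambda>n. t < tn n"] by blast
    have "n \<noteq> 0"
    proof
      assume "n = 0"
      with n(1) t0 that show False by simp
    qed
    then obtain k where "n = Suc k" by (cases n) auto
    with n(1) n(2)[of k] show ?thesis by (intro exI[of _ k]) simp
  qed
  have uniq: "n = k" if "t \<in> {tn n..<tn (Suc n)}" "t \<in> {tn k..<tn (Suc k)}" for t n k
  proof (rule ccontr)
    assume "n \<noteq> k"
    then consider "Suc n \<le> k" | "Suc k \<le> n" by linarith
    then show False
      using that strict_mono_mono[OF mono] by cases (force dest: monoD)+
  qed
  define idx where "idx = (\<lambda>t. THE n. t \<in> {tn n..<tn (Suc n)})"
  have idx: "idx t = n" if "t \<in> {tn n..<tn (Suc n)}" for t n
    unfolding idx_def using that uniq by (intro the_equality) auto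
  define g where "g = (\<lambda>t. if t < T then f (idx t) (t - tn (idx t)) else l)"
  have gT: "g T = l" by (simp add: g_def)
  have gn: "g t = f n (t - tn n)" if t: "t \<in> {tn n..tn (Suc n)}" for n t
  proof (cases "t = tn (Suc n)")
    case True
    have "t \<in> {tn (Suc n)..<tn (Suc (Suc n))}"
      using True mono by (simp add: strict_mono_def)
    from idx[OF this] show ?thesis
      using True tT[of "Suc n"] by (simp add: g_def match)
  next
    case False
    with t have "t \<in> {tn n..<tn (Suc n)}" by auto
    with idx[OF this] tT[of "Suc n"] show ?thesis by (simp add: g_def)
  qed
  have tn0: "0 \<le> tn n" for n
    using monoD[OF strict_mono_mono[OF mono], of 0 n] t0 by simp
  have cn: "continuous_on {tn n..tn (Suc n)} g" for n
  proof -
    have "continuous_on {tn n..tn (Suc n)} (\<lambda>t. f n (t - tn n))"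
      by (rule continuous_on_compose2[OF f[of n]]) (auto intro!: continuous_intros)
    then show ?thesis by (rule continuous_on_eq) (simp add: gn)
  qed
  have c0: "continuous_on {0..tn n} g" for n
  proof (induction n)
    case (Suc n)
    have "tn n \<le> tn (Suc n)" using mono by (simp add: strict_mono_def less_imp_le)
    then have "{0..tn (Suc n)} = {0..tn n} \<union> {tn n..tn (Suc n)}" using tn0[of n] by auto
    then show ?case using Suc cn[of n] by (auto intro!: continuous_on_closed_Un)
  qed (simp add: t0)
  have "continuous_on {0..T} g"
    unfolding continuous_on_eq_continuous_within
  proof
    fix t assume t: "t \<in> {0..T}"
    show "continuous (at t within {0..T}) g"
    proof (cases "t = T")
      case True
      have "(g \<longlongrightarrow> l) (at T within {0..T})"
      proof (rule tendstoI)
        fix e :: real assume "e > 0"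
        then obtain N where N: "\<And>n. n \<ge> N \<Longrightarrow> b n < e"
          using order_tendstoD(2)[OF b] by (auto simp: eventually_sequentially)
        have "dist (g s) l < e" if s: "tn N < s" "s \<in> {0..T}" "s \<noteq> T" for s
        proof -
          obtain n where n: "s \<in> {tn n..<tn (Suc n)}" using ex[of s] s by auto
          have "n \<ge> N"
          proof (rule ccontr)
            assume "\<not> N \<le> n"
            then have "tn (Suc n) \<le> tn N" using monoD[OF strict_mono_mono[OF mono]] by simp
            with n s show False by auto
          qed
          have "norm (g s - l) \<le> b n"
            using n by (subst gn[of s n]) (auto intro!: bd)
          with N[OF \<open>n \<ge> N\<close>] show ?thesis by (simp add: dist_norm)
        qed
        then show "\<forall>\<^sub>F s in at T within {0..T}. dist (g s) l < e"
          unfolding eventually_at_topological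
          by (intro exI[of _ "{tn N<..}"]) (use tT[of N] in auto)
      qed
      then show ?thesis by (simp add: True continuous_within gT)
    next
      case False
      with t have "t < T" "0 \<le> t" by auto
      then obtain n where n: "t < tn (Suc n)" using ex[of t] by auto
      have "continuous (at t within {0..tn (Suc n)}) g"
        using c0[of "Suc n"] n \<open>0 \<le> t\<close> by (auto simp: continuous_on_eq_continuous_within)
      moreover have "at t within {0..tn (Suc n)} = at t within {0..T}"
        by (rule at_within_nhd[of _ "{..<tn (Suc n)}"]) (use n tT[of "Suc n"] in auto)
      ultimately show ?thesis by simp
    qed
  qed
  then show ?thesis using that gn gT by blast
qed

text \<open>The glued pieces are known to solve the equation only up to each
  \<open>tn n < T\<close>; both sides of the integrated identity are continuous in the end time,
  which extends it to T.\<close>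

lemma heat_sol_closure:
  fixes tn :: "nat \<Rightarrow> real"
  assumes y: "continuous_on {0..T} y" and F: "continuous_on {0..T} F"
    and lim: "tn \<longlonglongrightarrow> T" and tn: "\<And>n. 0 \<le> tn n" "\<And>n. tn n < T" and h: "\<And>n. heat_sol 0 (tn n) y F"
  shows "heat_sol 0 T y F"
  unfolding heat_sol_def
proof (intro conjI allI ballI y)
  fix k t assume t: "t \<in> {0..T}"
  define E where "E = (\<lambda>t. exp ((of_int k)\<^sup>2 * t) *\<^sub>R coef (y t) k)"
  define f where "f = (\<lambda>r. exp ((of_int k)\<^sup>2 * r) *\<^sub>R coef (F r) k)"
  have fc: "continuous_on {0..T} f"
    unfolding f_def by (intro continuous_intros bounded_linear.continuous_on[OF bounded_linear_coef] F)
  have Ec: "continuous_on {0..T} E"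
    unfolding E_def by (intro continuous_intros bounded_linear.continuous_on[OF bounded_linear_coef] y)
  have less: "(f has_integral (E s - E 0)) {0..s}" if "0 \<le> s" "s < T" for s
  proof -
    obtain n where "s < tn n"
      using order_tendstoD(1)[OF lim \<open>s < T\<close>] by (auto simp: eventually_sequentially)
    with h[of n] that show ?thesis by (simp add: heat_sol_def E_def f_def)
  qed
  have T0: "T \<ge> 0" using t by auto
  have "integral {0..T} f = E T - E 0"
  proof (rule LIMSEQ_unique)
    have "continuous_on {0..T} (\<lambda>s. integral {0..s} f)"
      by (intro indefinite_integral_continuous_1 integrable_continuous_real fc)
    then show "(\<lambda>n. integral {0..tn n} f) \<longlonglongrightarrow> integral {0..T} f"
      by (rule continuous_on_tendsto_compose[OF _ lim]) (use T0 tn less_imp_le in \<open>auto intro!: always_eventually\<close>)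
    have "(\<lambda>n. E (tn n) - E 0) \<longlonglongrightarrow> E T - E 0"
      by (intro tendsto_diff tendsto_const continuous_on_tendsto_compose[OF Ec lim])
        (use T0 tn less_imp_le in \<open>auto intro!: always_eventually\<close>)
    moreover have "integral {0..tn n} f = E (tn n) - E 0" for n
      using less[OF tn] by (rule integral_unique)
    ultimately show "(\<lambda>n. integral {0..tn n} f) \<longlonglongrightarrow> E T - E 0" by simp
  qed
  then have "(f has_integral (E T - E 0)) {0..T}"
    using integrable_continuous_real[OF fc] by (simp add: has_integral_iff)
  then have "(f has_integral (E t - E 0)) {0..t}"
    using less[of t] t by (cases "t = T") auto
  then show "((\<lambda>r. exp ((of_int k)\<^sup>2 * r) *\<^sub>R coef (F r) k) has_integral
        (exp ((of_int k)\<^sup>2 * t) *\<^sub>R coef (y t) k - exp ((of_int k)\<^sup>2 * 0) *\<^sub>R coef (y 0) k)) {0..t}"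
    by (simp add: E_def f_def)
qed

text \<open>Step n costs a factor exp (A' q^n) with q < 2, whereas squaring doubles the exponent of
  smallness; the errors therefore tend to 0 although the time steps shrink.\<close>

lemma local_exact_control:
  fixes \<mu>1 \<mu>2 :: wiener and c b \<kappa> T :: real and m p :: nat
  assumes c: "c > 0" and b: "b > 0" and k: "\<kappa> \<ge> 0"
    and m1: "\<And>k::nat. \<bar>Re (coef \<mu>1 (int k))\<bar> * (real k + 1) ^ m \<ge> b" "\<And>k::nat. Im (coef \<mu>1 (int k)) = 0"
    and m2: "\<And>k::nat. k \<ge> 1 \<Longrightarrow> \<bar>Im (coef \<mu>2 (int k))\<bar> * (real k + 1) ^ m \<ge> b" "\<And>k::nat. Re (coef \<mu>2 (int k)) = 0"
    and T: "0 < T" "T \<le> 1"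
  obtains \<epsilon> :: real where "\<epsilon> > 0"
    "\<And>\<xi>0. norm \<xi>0 \<le> \<epsilon> \<Longrightarrow> \<exists>v1 v2 \<xi>. continuous_on {0..T} v1 \<and> continuous_on {0..T} v2 \<and>
        heat_sol 0 T \<xi> (\<lambda>r. rhs \<kappa> p (v1 r *\<^sub>R \<mu>1 + v2 r *\<^sub>R \<mu>2 + (\<kappa> * c ^ p) *\<^sub>R 1) (c *\<^sub>R 1 + \<xi> r)) \<and>
        \<xi> 0 = \<xi>0 \<and> \<xi> T = 0"
proof -
  obtain A where A: "A \<ge> 0" and step:
    "\<And>\<tau> \<xi>0. 0 < \<tau> \<Longrightarrow> \<tau> \<le> 1 \<Longrightarrow> exp (A / \<tau> ^ 5) * norm \<xi>0 \<le> 1 / 2 \<Longrightarrow> \<exists>v1 v2 \<xi>.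
        continuous_on {0..\<tau>} v1 \<and> continuous_on {0..\<tau>} v2 \<and> v1 0 = 0 \<and> v1 \<tau> = 0 \<and> v2 0 = 0 \<and> v2 \<tau> = 0 \<and>
        (\<forall>s\<in>{0..\<tau>}. \<bar>v1 s\<bar> \<le> exp (A / \<tau> ^ 5) * norm \<xi>0 \<and> \<bar>v2 s\<bar> \<le> exp (A / \<tau> ^ 5) * norm \<xi>0 \<and>
           norm (\<xi> s) \<le> exp (A / \<tau> ^ 5) * norm \<xi>0) \<and>
        heat_sol 0 \<tau> \<xi> (\<lambda>r. rhs \<kappa> p (v1 r *\<^sub>R \<mu>1 + v2 r *\<^sub>R \<mu>2 + (\<kappa> * c ^ p) *\<^sub>R 1) (c *\<^sub>R 1 + \<xi> r)) \<and>
        \<xi> 0 = \<xi>0 \<and> norm (\<xi> \<tau>) \<le> (exp (A / \<tau> ^ 5) * norm \<xi>0)\<^sup>2"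
    using local_step[OF c b k m1 m2, where p = p] by blast
  \<comment> \<open>The ratio has to satisfy th^(-5) < 2; the step lengths T/9 * th^n add up to
    T.\<close>
  define th :: real where "th = 8 / 9"
  define q :: real where "q = (9 / 8) ^ 5"
  have q: "q < 2" "q \<ge> 1" by (simp_all add: q_def power_divide)
  define tn where "tn = (\<lambda>n. T * (1 - th ^ n))"
  define \<tau> where "\<tau> = (\<lambda>n. T / 9 * th ^ n)"
  have tau: "tn (Suc n) - tn n = \<tau> n" for n
    by (simp add: tn_def \<tau>_def th_def algebra_simps)
  have tau0: "\<tau> n > 0" "\<tau> n \<le> 1" for n
  proof -
    show "\<tau> n > 0" using T by (simp add: \<tau>_def th_def)
    have "T / 9 * th ^ n \<le> 1 * 1" using T by (intro mult_mono power_le_one) (auto simp: th_def)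
    then show "\<tau> n \<le> 1" by (simp add: \<tau>_def)
  qed
  define A' where "A' = A * (9 / T) ^ 5"
  have A': "A' \<ge> 0" using A T by (simp add: A'_def)
  have Aq: "A / \<tau> n ^ 5 = A' * q ^ n" for n
  proof -
    have *: "1 / \<tau> n = 9 / T * (9 / 8) ^ n" by (simp add: \<tau>_def th_def power_divide)
    have "(1 / \<tau> n) ^ 5 = (9 / T) ^ 5 * q ^ n"
      unfolding * q_def power_mult_distrib power_mult[symmetric] by (simp only: mult.commute)
    then have "A * (1 / \<tau> n ^ 5) = A * ((9 / T) ^ 5 * q ^ n)"
      by (simp only: power_divide power_one)
    then show ?thesis unfolding A'_def by (simp only: mult.assoc mult_1_right times_divide_eq_right)
  qed
  \<comment> \<open>The solution of 2 A' + B q = 2 B, which makes \<open>good\<close> pass from n to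
    n + 1 under squaring with the cost exp (A' q^n).\<close>
  define B where "B = 2 * A' / (2 - q)"
  have B: "B \<ge> A'" "B * (2 - q) = 2 * A'"
  proof -
    show *: "B * (2 - q) = 2 * A'" using q by (simp add: B_def)
    have "B \<ge> 0" using A' q by (simp add: B_def)
    then have "B * (2 - q) \<le> B * 1" using q by (intro mult_left_mono) auto
    with * A' show "B \<ge> A'" by simp
  qed
  \<comment> \<open>The factor exp (B q^n) pays for the next step; the power of 1/2 makes controls
    and states of step n tend to 0, hence continuous at T after gluing.\<close>
  define good where "good = (\<lambda>n (s::wiener). norm s * exp (B * q ^ n) \<le> (1/2) ^ Suc n)"
  define P where "P = (\<lambda>n s (v1 :: real \<Rightarrow> real, v2 :: real \<Rightarrow> real, \<xi>).
    continuous_on {0..\<tau> n} v1 \<and> continuous_on {0..\<tau> n} v2 \<and> v1 0 = 0 \<and> v1 (\<tau> n) = 0 \<and> v2 0 = 0 \<and> v2 (\<tau> n) = 0 \<and>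
        (\<forall>s\<in>{0..\<tau> n}. \<bar>v1 s\<bar> \<le> (1/2) ^ n \<and> \<bar>v2 s\<bar> \<le> (1/2) ^ n \<and> norm (\<xi> s) \<le> (1/2) ^ n) \<and>
        heat_sol 0 (\<tau> n) \<xi> (\<lambda>r. rhs \<kappa> p (v1 r *\<^sub>R \<mu>1 + v2 r *\<^sub>R \<mu>2 + (\<kappa> * c ^ p) *\<^sub>R 1) (c *\<^sub>R 1 + \<xi> r)) \<and>
        \<xi> 0 = s \<and> good (Suc n) (\<xi> (\<tau> n)))"
  have exP: "\<exists>x. P n s x" if g: "good n s" for n s
  proof -
    let ?K = "exp (A / \<tau> n ^ 5)"
    have Ks: "?K * norm s \<le> norm s * exp (B * q ^ n)"
      using B q mult_right_mono[OF B(1), of "q ^ n"] by (simp add: Aq mult.commute mult_left_mono)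
    then have Kb: "?K * norm s \<le> (1/2) ^ Suc n" using g by (simp add: good_def)
    have h: "(1/2::real) ^ Suc n \<le> 1/2" using power_le_one[of "1/2::real" n] by simp
    have h': "(1/2::real) ^ Suc n \<le> (1/2) ^ n" by simp
    obtain v1 v2 \<xi> where v: "continuous_on {0..\<tau> n} v1" "continuous_on {0..\<tau> n} v2" "v1 0 = 0" "v1 (\<tau> n) = 0" "v2 0 = 0" "v2 (\<tau> n) = 0"
      and bd: "\<And>r. r\<in>{0..\<tau> n} \<Longrightarrow> \<bar>v1 r\<bar> \<le> ?K * norm s \<and> \<bar>v2 r\<bar> \<le> ?K * norm s \<and> norm (\<xi> r) \<le> ?K * norm s"
      and hs: "heat_sol 0 (\<tau> n) \<xi> (\<lambda>r. rhs \<kappa> p (v1 r *\<^sub>R \<mu>1 + v2 r *\<^sub>R \<mu>2 + (\<kappa> * c ^ p) *\<^sub>R 1) (c *\<^sub>R 1 + \<xi> r))"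
      and e: "\<xi> 0 = s" "norm (\<xi> (\<tau> n)) \<le> (?K * norm s)\<^sup>2"
      using step[OF tau0 order_trans[OF Kb h]] by blast
    have "good (Suc n) (\<xi> (\<tau> n))"
    proof -
      have eq: "2 * (A' * q ^ n) + B * q ^ Suc n = 2 * (B * q ^ n)"
      proof -
        have "(B * (2 - q)) * q ^ n = 2 * A' * q ^ n" by (simp only: B(2))
        then show ?thesis by (simp add: algebra_simps)
      qed
      have "norm (\<xi> (\<tau> n)) * exp (B * q ^ Suc n) \<le> (?K * norm s)\<^sup>2 * exp (B * q ^ Suc n)"
        by (intro mult_right_mono e) auto
      also have "\<dots> = (norm s)\<^sup>2 * exp (2 * (A' * q ^ n) + B * q ^ Suc n)"
        by (simp add: Aq power_mult_distrib exp_add exp_double)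
      also have "\<dots> = (norm s * exp (B * q ^ n))\<^sup>2"
        unfolding eq by (simp add: power_mult_distrib exp_double)
      also have "\<dots> \<le> ((1/2) ^ Suc n)\<^sup>2"
        using g by (intro power_mono) (auto simp: good_def)
      also have "\<dots> \<le> (1/2) ^ Suc (Suc n)"
        unfolding power_mult[symmetric] by (intro power_decreasing) auto
      finally show ?thesis by (simp add: good_def)
    qed
    then have "P n s (v1, v2, \<xi>)"
      unfolding P_def using v hs e(1) order_trans[OF _ order_trans[OF Kb h']] bd by auto
    then show ?thesis by blast
  qed
  then have "\<forall>n s. \<exists>x. good n s \<longrightarrow> P n s x" by blast
  then obtain X where X: "\<And>n s. good n s \<Longrightarrow> P n s (X n s)" by metis
  \<comment> \<open>Exactly the smallness expressed by \<open>good 0\<close>.\<close>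
  define \<epsilon> where "\<epsilon> = exp (- B) / 2"
  have "\<exists>v1 v2 \<xi>. continuous_on {0..T} v1 \<and> continuous_on {0..T} v2 \<and>
        heat_sol 0 T \<xi> (\<lambda>r. rhs \<kappa> p (v1 r *\<^sub>R \<mu>1 + v2 r *\<^sub>R \<mu>2 + (\<kappa> * c ^ p) *\<^sub>R 1) (c *\<^sub>R 1 + \<xi> r)) \<and>
        \<xi> 0 = \<xi>0 \<and> \<xi> T = 0" if small: "norm \<xi>0 \<le> \<epsilon>" for \<xi>0
  proof -
    define s where "s = rec_nat \<xi>0 (\<lambda>n s. snd (snd (X n s)) (\<tau> n))"
    have s0: "s 0 = \<xi>0" and sS: "s (Suc n) = snd (snd (X n (s n))) (\<tau> n)" for n
      by (simp_all add: s_def)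
    have "good 0 \<xi>0"
    proof -
      have "norm \<xi>0 * exp B \<le> \<epsilon> * exp B" using small by (intro mult_right_mono) auto
      also have "\<dots> = 1/2" by (simp add: \<epsilon>_def flip: exp_add)
      finally show ?thesis by (simp add: good_def)
    qed
    have gs: "good n (s n)" for n
    proof (induction n)
      case (Suc n)
      from X[OF Suc] show ?case by (auto simp: P_def sS split: prod.splits)
    qed (simp add: s0 \<open>good 0 \<xi>0\<close>)
    define f1 where "f1 = (\<lambda>n. fst (X n (s n)))"
    define f2 where "f2 = (\<lambda>n. fst (snd (X n (s n))))"
    define f3 where "f3 = (\<lambda>n. snd (snd (X n (s n))))"
    have PX: "P n (s n) (f1 n, f2 n, f3 n)" for n
      using X[OF gs[of n]] by (simp add: f1_def f2_def f3_def)
    note PX' = PX[unfolded P_def prod.case]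
    have c3: "continuous_on {0..\<tau> n} (f3 n)" for n
      using PX'[of n] heat_sol_continuous by blast
    have m3: "f3 n (\<tau> n) = f3 (Suc n) 0" for n
      using PX'[of "Suc n"] by (simp add: sS f3_def)
    have mono: "strict_mono tn"
      unfolding strict_mono_Suc_iff using tau tau0(1) by (metis diff_gt_0_iff_gt)
    have tn0: "tn 0 = 0" by (simp add: tn_def)
    have lim: "tn \<longlonglongrightarrow> T"
    proof -
      have "(\<lambda>n. T * (1 - th ^ n)) \<longlonglongrightarrow> T * (1 - 0)"
        by (intro tendsto_intros LIMSEQ_realpow_zero) (auto simp: th_def)
      then show ?thesis by (simp add: tn_def)
    qed
    have hz: "(\<lambda>n. (1/2::real) ^ n) \<longlonglongrightarrow> 0" by (intro LIMSEQ_realpow_zero) auto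
    obtain v1 where v1: "continuous_on {0..T} v1" "\<And>n t. t \<in> {tn n..tn (Suc n)} \<Longrightarrow> v1 t = f1 n (t - tn n)"
      by (rule glue_pieces[OF mono tn0 lim, of f1 0 "\<lambda>n. (1/2) ^ n"]) (use PX' hz in \<open>auto simp: tau\<close>)
    obtain v2 where v2: "continuous_on {0..T} v2" "\<And>n t. t \<in> {tn n..tn (Suc n)} \<Longrightarrow> v2 t = f2 n (t - tn n)"
      by (rule glue_pieces[OF mono tn0 lim, of f2 0 "\<lambda>n. (1/2) ^ n"]) (use PX' hz in \<open>auto simp: tau\<close>)
    obtain \<xi> where x: "continuous_on {0..T} \<xi>" "\<And>n t. t \<in> {tn n..tn (Suc n)} \<Longrightarrow> \<xi> t = f3 n (t - tn n)" "\<xi> T = 0"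
      by (rule glue_pieces[OF mono tn0 lim, of f3 0 "\<lambda>n. (1/2) ^ n"]) (use PX' hz c3 m3 in \<open>auto simp: tau\<close>)
    define F where "F = (\<lambda>r. rhs \<kappa> p (v1 r *\<^sub>R \<mu>1 + v2 r *\<^sub>R \<mu>2 + (\<kappa> * c ^ p) *\<^sub>R 1) (c *\<^sub>R 1 + \<xi> r))"
    have Fc: "continuous_on {0..T} F"
      unfolding F_def by (intro continuous_on_rhs continuous_intros v1 v2 x)
    have tle: "0 \<le> tn n" "tn n < T" "tn n \<le> tn (Suc n)" for n
      using T mono by (auto simp: tn_def th_def power_le_one strict_mono_def less_imp_le)
    have piece: "heat_sol (tn n) (tn (Suc n)) \<xi> F" for n
    proof -
      have *: "heat_sol (0 + tn n) (\<tau> n + tn n) (\<lambda>t. f3 n (t - tn n))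
         (\<lambda>t. rhs \<kappa> p (f1 n (t - tn n) *\<^sub>R \<mu>1 + f2 n (t - tn n) *\<^sub>R \<mu>2 + (\<kappa> * c ^ p) *\<^sub>R 1) (c *\<^sub>R 1 + f3 n (t - tn n)))"
        by (rule heat_sol_shift) (use PX'[of n] in blast)
      have e: "0 + tn n = tn n" "\<tau> n + tn n = tn (Suc n)" using tau[of n] by auto
      show ?thesis
        by (rule heat_sol_cong[OF *[unfolded e]]) (auto simp: F_def v1(2)[of _ n] v2(2)[of _ n] x(2)[of _ n])
    qed
    have "heat_sol 0 (tn n) \<xi> F" for n
    proof (induction n)
      case 0
      show ?case unfolding heat_sol_def tn0 by (auto simp: has_integral_refl)
    next
      case (Suc n)
      then show ?case using heat_sol_join[OF Suc piece tle(1,3)] by blast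
    qed
    then have "heat_sol 0 T \<xi> F"
      using heat_sol_closure[OF x(1) Fc lim tle(1,2)] by blast
    moreover have "\<xi> 0 = \<xi>0"
      using x(2)[of 0 0] tn0 tle(3)[of 0] PX'[of 0] by (simp add: s0)
    ultimately show ?thesis using v1(1) v2(1) x(3) unfolding F_def by blast
  qed
  moreover have "\<epsilon> > 0" by (simp add: \<epsilon>_def)
  ultimately show ?thesis using that by blast
qed

section \<open>Approximate control of the linear equation\<close>

text \<open>A Gronwall estimate read off where exp (-2 L r) times the norm of y is maximal: there
  the Duhamel term is at most half of the maximum and can be absorbed. The general forcing g also
  allows approximate solutions to be compared with exact ones.\<close>

lemma duhamel_stability:
  assumes "0 \<le> \<tau>" and y: "\<And>t. t \<in> {0..\<tau>} \<Longrightarrow> y t = g t + duh (\<lambda>r. v r * y r) t" and yc: "continuous_on {0..\<tau>} y"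
    and v: "continuous_on {0..\<tau>} v" and g: "\<And>t. t \<in> {0..\<tau>} \<Longrightarrow> norm (g t) \<le> g0"
    and vb: "\<And>r. r \<in> {0..\<tau>} \<Longrightarrow> norm (v r) \<le> L" and "L > 0" and t: "t \<in> {0..\<tau>}"
  shows "norm (y t) \<le> 2 * exp (2 * L * t) * g0"
proof -
  have vy: "continuous_on {0..\<tau>} (\<lambda>r. v r * y r)" by (intro continuous_intros v yc)
  have *: "continuous_on {0..\<tau>} (\<lambda>r. exp (- 2 * L * r) * norm (y r))"
    by (intro continuous_intros yc)
  obtain s where s: "s \<in> {0..\<tau>}"
    and sm: "\<And>r. r \<in> {0..\<tau>} \<Longrightarrow> exp (- 2 * L * r) * norm (y r) \<le> exp (- 2 * L * s) * norm (y s)"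
    using continuous_attains_sup[OF compact_Icc _ *] \<open>0 \<le> \<tau>\<close> by auto
  define M where "M = exp (- 2 * L * s) * norm (y s)"
  have b: "norm (y r) \<le> exp (2 * L * r) * M" if "r \<in> {0..\<tau>}" for r
  proof -
    have "exp (2 * L * r) * (exp (- 2 * L * r) * norm (y r)) \<le> exp (2 * L * r) * M"
      unfolding M_def by (intro mult_left_mono sm that) auto
    then show ?thesis by (simp add: mult.assoc[symmetric] flip: exp_add)
  qed
  have g0: "g0 \<ge> 0" using order_trans[OF norm_ge_zero g[OF s]] .
  have "norm (duh (\<lambda>r. v r * y r) s) \<le> exp (2 * L * s) * M / 2"
  proof (rule norm_duh_weighted[OF vy s \<open>L > 0\<close>])
    fix r assume r: "r \<in> {0..\<tau>}"
    have "norm (v r * y r) \<le> norm (v r) * norm (y r)" by (rule norm_mult_ineq)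
    also have "\<dots> \<le> L * (exp (2 * L * r) * M)"
      using vb[OF r] b[OF r] \<open>L > 0\<close> by (intro mult_mono) auto
    finally show "norm (v r * y r) \<le> L * (exp (2 * L * r) * M)" .
  qed (simp add: M_def)
  moreover have "norm (y s) \<le> norm (g s) + norm (duh (\<lambda>r. v r * y r) s)"
    by (subst y[OF s]) (rule norm_triangle_ineq)
  ultimately have "norm (y s) \<le> g0 + exp (2 * L * s) * M / 2"
    using g[OF s] by linarith
  then have "M \<le> exp (- 2 * L * s) * (g0 + exp (2 * L * s) * M / 2)"
    unfolding M_def by (intro mult_left_mono) auto
  also have "\<dots> = exp (- 2 * L * s) * g0 + M / 2"
    by (simp add: distrib_left mult.assoc[symmetric] flip: exp_add)
  also have "exp (- 2 * L * s) * g0 \<le> 1 * g0"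
    using s \<open>L > 0\<close> g0 by (intro mult_right_mono) auto
  finally have "M \<le> 2 * g0" by simp
  then have "exp (2 * L * t) * M \<le> exp (2 * L * t) * (2 * g0)"
    by (intro mult_left_mono) auto
  from order_trans[OF b[OF t] this] show ?thesis by (simp add: mult_ac)
qed

lemma continuous_norm_bound:
  assumes "continuous_on {0..\<tau>} (v :: real \<Rightarrow> 'a::real_normed_vector)"
  obtains L where "L > 0" "\<And>r. r \<in> {0..\<tau>} \<Longrightarrow> norm (v r) \<le> L"
proof -
  have "bounded (v ` {0..\<tau>})"
    using assms by (intro compact_imp_bounded compact_continuous_image) auto
  then obtain L where "L > 0" "\<forall>x\<in>v ` {0..\<tau>}. norm x \<le> L"
    using bounded_pos by blast
  then show ?thesis by (intro that[of L]) auto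
qed

lemma linear_heat_exists:
  assumes "0 \<le> \<tau>" and v: "continuous_on {0..\<tau>} v"
  shows "\<exists>y. heat_sol 0 \<tau> y (\<lambda>r. v r * y r) \<and> y 0 = y0"
proof -
  obtain L where L: "L > 0" "\<And>r. r \<in> {0..\<tau>} \<Longrightarrow> norm (v r) \<le> L"
    using continuous_norm_bound[OF v] by blast
  have "\<exists>e. continuous_on {0..\<tau>} e \<and> (\<forall>t\<in>{0..\<tau>}. e t = S t y0 + duh (\<lambda>r. v r * e r) t \<and> norm (e t) \<le> 2 * norm y0 * exp (2 * L * t))"
  proof (rule duhamel_fixed_point[OF assms(1) L(1), where R = "2 * norm y0 * exp (2 * L * \<tau>)"])
    show "continuous_on ({0..\<tau>} \<times> cball 0 (2 * norm y0 * exp (2 * L * \<tau>))) (\<lambda>(r, e). v r * e)"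
      unfolding case_prod_unfold by (intro continuous_intros continuous_on_compose2[OF v]) auto
    show "norm (v r * a - v r * b) \<le> L * norm (a - b)" if "r \<in> {0..\<tau>}" for r and a b :: wiener
      unfolding right_diff_distrib[symmetric]
      by (intro order_trans[OF norm_mult_ineq] mult_right_mono L that) auto
  qed (auto intro!: continuous_intros norm_S_le)
  then obtain e where e: "continuous_on {0..\<tau>} e" "\<And>t. t \<in> {0..\<tau>} \<Longrightarrow> e t = S t y0 + duh (\<lambda>r. v r * e r) t"
    by blast
  have "heat_sol 0 \<tau> e (\<lambda>r. v r * e r)"
    by (rule heat_sol_duh[OF _ e(2) assms(1)]) (auto intro!: continuous_intros v e)
  moreover have "e 0 = y0" using e(2)[of 0] assms(1) by simp
  ultimately show ?thesis by blast
qed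

section \<open>Propagators and approximately reachable operators\<close>

definition trig1 :: "wiener set" where
  "trig1 = {a *\<^sub>R 1 + b *\<^sub>R cosW 1 + d *\<^sub>R sinW 1 | a b d. True}"

lemma trig1_scaleR: "f \<in> trig1 \<Longrightarrow> r *\<^sub>R f \<in> trig1"
proof -
  assume "f \<in> trig1"
  then obtain a b d where "f = a *\<^sub>R 1 + b *\<^sub>R cosW 1 + d *\<^sub>R sinW 1" by (auto simp: trig1_def)
  then have "r *\<^sub>R f = (r * a) *\<^sub>R 1 + (r * b) *\<^sub>R cosW 1 + (r * d) *\<^sub>R sinW 1"
    by (simp add: scaleR_add_right)
  then show ?thesis unfolding trig1_def by blast
qed

lemma trig1_0: "0 \<in> trig1"
  unfolding trig1_def by (rule CollectI, rule exI[of _ 0], rule exI[of _ 0], rule exI[of _ 0]) simp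

text \<open>The potentials vanish at both ends so that their concatenations are continuous.\<close>

definition propagator :: "real \<Rightarrow> (real \<Rightarrow> wiener) \<Rightarrow> (wiener \<Rightarrow> wiener) \<Rightarrow> bool" where
  "propagator t v B \<longleftrightarrow> continuous_on {0..t} v \<and> v 0 = 0 \<and> v t = 0 \<and> (\<forall>r. v r \<in> trig1) \<and>
     (\<forall>y0. \<exists>y. heat_sol 0 t y (\<lambda>r. v r * y r) \<and> y 0 = y0 \<and> y t = B y0)"

lemma propagator_exists:
  assumes "0 \<le> t" "continuous_on {0..t} v" "v 0 = 0" "v t = 0" "\<And>r. v r \<in> trig1"
  shows "\<exists>B. propagator t v B"
proof -
  have "\<forall>y0. \<exists>y. heat_sol 0 t y (\<lambda>r. v r * y r) \<and> y 0 = y0"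
    using linear_heat_exists[OF assms(1,2)] by blast
  then obtain Y where "\<And>y0. heat_sol 0 t (Y y0) (\<lambda>r. v r * Y y0 r)" "\<And>y0. Y y0 0 = y0"
    by metis
  then have "propagator t v (\<lambda>y0. Y y0 t)"
    unfolding propagator_def using assms by blast
  then show ?thesis by blast
qed

text \<open>Differences of trajectories solve the same linear equation, so stability applies to
  them. The constant K measures how an approximate state is distorted by a later propagator.\<close>

lemma propagator_lipschitz:
  assumes "0 \<le> t" and B: "propagator t v B"
  obtains K where "K > 0" "\<And>x y. norm (B x - B y) \<le> K * norm (x - y)"
proof -
  have v: "continuous_on {0..t} v" using B by (simp add: propagator_def)
  obtain L where L: "L > 0" "\<And>r. r \<in> {0..t} \<Longrightarrow> norm (v r) \<le> L"
    using continuous_norm_bound[OF v] by blast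
  have "norm (B x - B y) \<le> 2 * exp (2 * L * t) * norm (x - y)" for x y
  proof -
    obtain X where X: "heat_sol 0 t X (\<lambda>r. v r * X r)" "X 0 = x" "X t = B x"
      using B unfolding propagator_def by blast
    obtain Y where Y: "heat_sol 0 t Y (\<lambda>r. v r * Y r)" "Y 0 = y" "Y t = B y"
      using B unfolding propagator_def by blast
    define Z where "Z = (\<lambda>r. X r - Y r)"
    have Z: "heat_sol 0 t Z (\<lambda>r. v r * Z r)"
      using heat_sol_diff[OF X(1) Y(1)] by (simp add: Z_def right_diff_distrib)
    have Zc: "continuous_on {0..t} Z" using heat_sol_continuous[OF Z] .
    have "norm (Z t) \<le> 2 * exp (2 * L * t) * norm (Z 0)"
    proof (rule duhamel_stability[OF assms(1) _ Zc v _ L(2) L(1)])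
      show "Z s = S s (Z 0) + duh (\<lambda>r. v r * Z r) s" if "s \<in> {0..t}" for s
        by (rule heat_sol_imp_duh[OF Z _ that]) (intro continuous_intros v Zc)
    qed (use assms(1) norm_S_le in auto)
    then show ?thesis by (simp add: Z_def X Y)
  qed
  then show ?thesis by (intro that[of "2 * exp (2 * L * t)"]) auto
qed

lemma propagator_S:
  assumes "0 \<le> t" shows "propagator t (\<lambda>r. 0) (S t)"
  unfolding propagator_def
proof (intro conjI allI)
  fix y0
  have "heat_sol 0 t (\<lambda>s. S s y0) (\<lambda>r. 0)"
    by (rule heat_sol_duh[OF _ _ assms]) (auto simp: duh_def S_simps)
  then show "\<exists>y. heat_sol 0 t y (\<lambda>r. 0 * y r) \<and> y 0 = y0 \<and> y t = S t y0"
    by (intro exI[of _ "\<lambda>s. S s y0"]) simp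
qed (auto simp: trig1_0)

lemma propagator_compose:
  assumes s: "0 \<le> s" and t: "0 \<le> t" and B: "propagator s v B" and C: "propagator t w C"
  shows "\<exists>u. propagator (s + t) u (\<lambda>x. C (B x))"
proof -
  define u where "u = (\<lambda>r. if r \<le> s then v r else w (r - s))"
  have us: "u r = w (r - s)" if "r \<ge> s" for r
    using B C that by (cases "r = s") (auto simp: u_def propagator_def)
  have "{0..s + t} = {0..s} \<union> {s..s + t}" using s t by auto
  moreover have "continuous_on {0..s} u"
    using B by (auto simp: propagator_def u_def cong: continuous_on_cong_simp)
  moreover have "continuous_on {s..s + t} u"
  proof -
    have "continuous_on {s..s + t} (\<lambda>r. w (r - s))"
      using C by (auto simp: propagator_def intro!: continuous_on_compose2[of "{0..t}" w] continuous_intros)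
    then show ?thesis by (rule continuous_on_eq) (simp add: us)
  qed
  ultimately have uc: "continuous_on {0..s + t} u" by (simp add: continuous_on_closed_Un)
  have "\<exists>y. heat_sol 0 (s + t) y (\<lambda>r. u r * y r) \<and> y 0 = y0 \<and> y (s + t) = C (B y0)" for y0
  proof -
    obtain X where X: "heat_sol 0 s X (\<lambda>r. v r * X r)" "X 0 = y0" "X s = B y0"
      using B unfolding propagator_def by blast
    obtain Y where Y: "heat_sol 0 t Y (\<lambda>r. w r * Y r)" "Y 0 = B y0" "Y t = C (B y0)"
      using C unfolding propagator_def by blast
    define y where "y = (\<lambda>r. if r \<le> s then X r else Y (r - s))"
    have ys: "y r = Y (r - s)" if "r \<ge> s" for r
      using X Y that by (cases "r = s") (auto simp: y_def)
    have "heat_sol 0 s y (\<lambda>r. u r * y r)"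
      by (rule heat_sol_cong[OF X(1)]) (auto simp: y_def u_def)
    moreover have "heat_sol s (s + t) y (\<lambda>r. u r * y r)"
    proof (rule heat_sol_cong[OF heat_sol_shift[OF Y(1), of s, simplified, unfolded add.commute[of t s]]])
    qed (auto simp: ys us)
    ultimately have "heat_sol 0 (s + t) y (\<lambda>r. u r * y r)"
      by (rule heat_sol_join) (use s t in auto)
    moreover have "y 0 = y0" "y (s + t) = C (B y0)"
      using s t X Y ys[of "s + t"] by (auto simp: y_def)
    ultimately show ?thesis by blast
  qed
  then have "propagator (s + t) u (\<lambda>x. C (B x))"
    unfolding propagator_def using B C uc s t us[of "s + t"] by (auto simp: propagator_def u_def)
  then show ?thesis by blast
qed

text \<open>Approximation in the strong sense: one state y at a time, with a control that may depend
  on y, in time at most s up to an arbitrarily small excess. For s = 0 the time is as short as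
  desired. Composition adds the times, and pointwise limits are allowed.\<close>

definition reach :: "real \<Rightarrow> (wiener \<Rightarrow> wiener) \<Rightarrow> bool" where
  "reach s X \<longleftrightarrow> (\<forall>y \<epsilon> \<delta>. \<epsilon> > 0 \<longrightarrow> \<delta> > 0 \<longrightarrow>
     (\<exists>t v B. 0 \<le> t \<and> t \<le> s + \<delta> \<and> propagator t v B \<and> norm (B y - X y) < \<epsilon>))"

lemma reach_S: "0 \<le> t \<Longrightarrow> reach t (S t)"
  unfolding reach_def using propagator_S by (intro allI impI exI[of _ t]) fastforce

text \<open>The second propagator is fixed first, at the ideal intermediate state X y; its Lipschitz
  constant then prescribes the accuracy of the first one.\<close>

lemma reach_compose:
  assumes X: "reach s X" and Y: "reach t Y"
  shows "reach (s + t) (\<lambda>y. Y (X y))"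
  unfolding reach_def
proof (intro allI impI)
  fix y and \<epsilon> \<delta> :: real assume "\<epsilon> > 0" "\<delta> > 0"
  then obtain t2 v2 C where t2: "0 \<le> t2" "t2 \<le> t + \<delta> / 2" and C: "propagator t2 v2 C"
    and CY: "norm (C (X y) - Y (X y)) < \<epsilon> / 2"
    using Y unfolding reach_def by (metis half_gt_zero)
  obtain K where K: "K > 0" "\<And>x z. norm (C x - C z) \<le> K * norm (x - z)"
    using propagator_lipschitz[OF t2(1) C] by blast
  have "\<epsilon> / (2 * K) > 0" using K \<open>\<epsilon> > 0\<close> by simp
  then obtain t1 v1 B where t1: "0 \<le> t1" "t1 \<le> s + \<delta> / 2" and B: "propagator t1 v1 B"
    and BX: "norm (B y - X y) < \<epsilon> / (2 * K)"
    using X \<open>\<delta> > 0\<close> unfolding reach_def by (metis half_gt_zero)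
  obtain u where u: "propagator (t1 + t2) u (\<lambda>x. C (B x))"
    using propagator_compose[OF t1(1) t2(1) B C] by blast
  have "norm (C (B y) - Y (X y)) \<le> norm (C (B y) - C (X y)) + norm (C (X y) - Y (X y))"
    using norm_triangle_ineq[of "C (B y) - C (X y)" "C (X y) - Y (X y)"] by simp
  also have "\<dots> < K * (\<epsilon> / (2 * K)) + \<epsilon> / 2"
    using K(2)[of "B y" "X y"] mult_strict_left_mono[OF BX K(1)] CY by linarith
  also have "\<dots> = \<epsilon>" using K by simp
  finally show "\<exists>r v B. 0 \<le> r \<and> r \<le> s + t + \<delta> \<and> propagator r v B \<and> norm (B y - Y (X y)) < \<epsilon>"
    using t1 t2 u by (intro exI[of _ "t1 + t2"] exI[of _ u] exI[of _ "\<lambda>x. C (B x)"]) auto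
qed

lemma reach_limit:
  assumes "\<And>n::nat. reach (s n) (X n)" "s \<longlonglongrightarrow> l" "\<And>y. (\<lambda>n. X n y) \<longlonglongrightarrow> Z y"
  shows "reach l Z"
  unfolding reach_def
proof (intro allI impI)
  fix y and \<epsilon> \<delta> :: real assume "\<epsilon> > 0" "\<delta> > 0"
  have "\<forall>\<^sub>F n in sequentially. s n < l + \<delta> / 2 \<and> norm (X n y - Z y) < \<epsilon> / 2"
    using order_tendstoD(2)[OF assms(2), of "l + \<delta> / 2"] tendstoD[OF assms(3)[of y], of "\<epsilon> / 2"] \<open>\<epsilon> > 0\<close> \<open>\<delta> > 0\<close>
    by (intro eventually_conj) (auto simp: dist_norm)
  then obtain n where n: "s n < l + \<delta> / 2" "norm (X n y - Z y) < \<epsilon> / 2"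
    by (auto simp: eventually_sequentially)
  obtain t v B where B: "0 \<le> t" "t \<le> s n + \<delta> / 2" "propagator t v B" "norm (B y - X n y) < \<epsilon> / 2"
    using assms(1)[of n] \<open>\<epsilon> > 0\<close> \<open>\<delta> > 0\<close> unfolding reach_def by (metis half_gt_zero)
  have "norm (B y - Z y) < \<epsilon>"
    using norm_triangle_ineq[of "B y - X n y" "X n y - Z y"] B(4) n(2) by simp
  with B n show "\<exists>t v B. 0 \<le> t \<and> t \<le> l + \<delta> \<and> propagator t v B \<and> norm (B y - Z y) < \<epsilon>"
    by (intro exI[of _ t] exI[of _ v] exI[of _ B]) auto
qed

lemma norm_exp_minus_one:
  fixes h :: "'a::{real_normed_algebra_1, banach}"
  shows "norm (exp h - 1) \<le> exp (norm h) - 1"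
proof -
  have s: "summable (\<lambda>n. norm h ^ Suc n /\<^sub>R fact (Suc n))"
    using summable_exp_generic[of "norm h"] by (subst summable_Suc_iff) simp
  have b: "norm (h ^ Suc n /\<^sub>R fact (Suc n)) \<le> norm h ^ Suc n /\<^sub>R fact (Suc n)" for n
    using norm_power_ineq[of h "Suc n"] by (simp del: power_Suc fact_Suc add: mult_left_mono)
  have "exp h - 1 = (\<Sum>n. h ^ Suc n /\<^sub>R fact (Suc n))"
    using exp_first_term[of h] by simp
  also have "norm \<dots> \<le> (\<Sum>n. norm h ^ Suc n /\<^sub>R fact (Suc n))"
    by (rule norm_suminf_le[OF b s])
  also have "\<dots> = exp (norm h) - 1"
    using exp_first_term[of "norm h"] by simp
  finally show ?thesis .
qed

lemma tendsto_exp_wiener [tendsto_intros]: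
  fixes f :: "_ \<Rightarrow> wiener"
  assumes "(f \<longlongrightarrow> l) F"
  shows "((\<lambda>x. exp (f x)) \<longlongrightarrow> exp l) F"
proof -
  have "((\<lambda>x. norm (exp l) * (exp (norm (f x - l)) - 1)) \<longlongrightarrow> norm (exp l) * (exp (norm (l - l)) - 1)) F"
    by (intro tendsto_intros assms)
  then have 0: "((\<lambda>x. norm (exp l) * (exp (norm (f x - l)) - 1)) \<longlongrightarrow> 0) F" by simp
  have "norm (exp (f x) - exp l) \<le> norm (exp l) * (exp (norm (f x - l)) - 1)" for x
  proof -
    have *: "exp (f x) - exp l = exp l * (exp (f x - l) - 1)"
      using exp_add_wiener[of l "f x - l"] by (simp add: right_diff_distrib)
    show ?thesis
      unfolding * by (rule order_trans[OF norm_mult_ineq mult_left_mono[OF norm_exp_minus_one]]) simp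
  qed
  then have "((\<lambda>x. exp (f x) - exp l) \<longlongrightarrow> 0) F"
    by (intro Lim_null_comparison[OF _ 0] always_eventually allI)
  then show ?thesis by (rule LIM_zero_cancel)
qed

lemma continuous_on_exp_wiener [continuous_intros]:
  fixes f :: "_ \<Rightarrow> wiener"
  shows "continuous_on X f \<Longrightarrow> continuous_on X (\<lambda>x. exp (f x))"
  unfolding continuous_on_def by (auto intro!: tendsto_exp_wiener)

text \<open>Joint continuity on a compact square makes the effect of a short diffusion uniformly
  small along a curve, here meant for the curve swept out during an impulse.\<close>

lemma S_uniform:
  assumes g: "continuous_on {0..1::real} g" and "\<epsilon> > 0"
  obtains \<delta> where "\<delta> > 0" "\<And>s x. 0 \<le> s \<Longrightarrow> s < \<delta> \<Longrightarrow> x \<in> {0..1} \<Longrightarrow> norm (S s (g x) - g x) < \<epsilon>"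
proof -
  have "continuous_on ({0..1} \<times> {0..1}) (\<lambda>(s, x). S s (g x))"
    unfolding case_prod_unfold by (intro continuous_intros continuous_on_compose2[OF g]) auto
  from compact_uniformly_continuous[OF this compact_Times[OF compact_Icc compact_Icc]]
  obtain d where d: "d > 0" and
    du: "\<And>p q. p \<in> {0..1} \<times> {0..1} \<Longrightarrow> q \<in> {0..1} \<times> {0..1} \<Longrightarrow> dist q p < d \<Longrightarrow>
      dist ((\<lambda>(s, x). S s (g x)) q) ((\<lambda>(s, x). S s (g x)) p) < \<epsilon>"
    unfolding uniformly_continuous_on_def using \<open>\<epsilon> > 0\<close> by metis
  show ?thesis
  proof (rule that[of "min d 1"])
    fix s x :: real assume s: "0 \<le> s" "s < min d 1" "x \<in> {0..1}"
    then have "dist (s, x) (0, x) < d" by (simp add: dist_prod_def dist_real_def)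
    with du[of "(0, x)" "(s, x)"] s show "norm (S s (g x) - g x) < \<epsilon>"
      by (simp add: dist_norm)
  qed (use d in auto)
qed

text \<open>An impulse of size 1/\<eta> during time \<eta>. Its time integral f does not depend on
  \<eta>, and neither does the Gronwall factor, while the effect of diffusion during time \<eta>
  tends to 0.\<close>

lemma reach_exp_trig1:
  assumes f: "f \<in> trig1"
  shows "reach 0 (\<lambda>y. exp f * y)"
  unfolding reach_def
proof (intro allI impI)
  fix y and \<epsilon> \<delta> :: real assume "\<epsilon> > 0" "\<delta> > 0"
  \<comment> \<open>The profile has integral 1 and vanishes at 0 and 1, as propagators require; R is
    its primitive. Its maximum 3/2 enters L.\<close>
  define \<rho> where "\<rho> = (\<lambda>x::real. 6 * x * (1 - x))"
  define R where "R = (\<lambda>x::real. 3 * x\<^sup>2 - 2 * x ^ 3)"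
  define \<gamma> where "\<gamma> = (\<lambda>x. \<rho> x *\<^sub>R (f * (exp (R x *\<^sub>R f) * y)))"
  define L where "L = 3 / 2 * norm f + 1"
  \<comment> \<open>The final estimate is \<open>4 * exp (2 * L) * \<epsilon>'\<close>, that is
    \<epsilon>/2.\<close>
  define \<epsilon>' where "\<epsilon>' = \<epsilon> / (8 * exp (2 * L))"
  have e': "\<epsilon>' > 0" using \<open>\<epsilon> > 0\<close> by (simp add: \<epsilon>'_def)
  have L: "L > 0" by (simp add: L_def add_nonneg_pos)
  have \<gamma>c: "continuous_on X \<gamma>" for X
    unfolding \<gamma>_def \<rho>_def R_def by (intro continuous_intros)
  obtain d1 where d1: "d1 > 0" "\<And>s x. 0 \<le> s \<Longrightarrow> s < d1 \<Longrightarrow> x \<in> {0..1} \<Longrightarrow> norm (S s (\<gamma> x) - \<gamma> x) < \<epsilon>'"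
    using S_uniform[OF \<gamma>c e'] by blast
  obtain d2 where d2: "d2 > 0" "\<And>s x. 0 \<le> s \<Longrightarrow> s < d2 \<Longrightarrow> x \<in> {0..1::real} \<Longrightarrow> norm (S s y - y) < \<epsilon>'"
    using S_uniform[OF continuous_on_const[of _ y] e'] by blast
  define \<eta> where "\<eta> = min \<delta> (min d1 d2) / 2"
  have \<eta>: "\<eta> > 0" "\<eta> \<le> \<delta>" "\<eta> < d1" "\<eta> < d2" using d1 d2 \<open>\<delta> > 0\<close> by (auto simp: \<eta>_def min_def)
  define v where "v = (\<lambda>r. (\<rho> (r / \<eta>) / \<eta>) *\<^sub>R f)"
  have vc: "continuous_on X v" for X
    unfolding v_def \<rho>_def using \<eta> by (intro continuous_intros) auto
  have \<rho>b: "0 \<le> \<rho> x \<and> \<rho> x \<le> 3 / 2" if "x \<in> {0..1}" for x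
  proof -
    have "0 \<le> (2 * x - 1)\<^sup>2" by simp
    then have "\<rho> x \<le> 3 / 2" by (simp add: \<rho>_def power2_eq_square algebra_simps)
    then show ?thesis using that by (simp add: \<rho>_def)
  qed
  have rx: "r / \<eta> \<in> {0..1}" if "r \<in> {0..\<eta>}" for r
    using that \<eta> by auto
  have vb: "norm (v r) \<le> L / \<eta>" if r: "r \<in> {0..\<eta>}" for r
  proof -
    have "norm (v r) = \<rho> (r / \<eta>) * norm f / \<eta>"
      using \<rho>b[OF rx[OF r]] \<eta> by (simp add: v_def)
    also have "\<dots> \<le> L / \<eta>"
      using \<rho>b[OF rx[OF r]] \<eta> mult_right_mono[of "\<rho> (r / \<eta>)" "3/2" "norm f"] by (intro divide_right_mono) (auto simp: L_def)
    finally show ?thesis .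
  qed
  obtain B where B: "propagator \<eta> v B"
    using propagator_exists[of \<eta> v] \<eta> vc trig1_scaleR[OF f] by (auto simp: v_def \<rho>_def)
  obtain \<phi> where chi: "heat_sol 0 \<eta> \<phi> (\<lambda>r. v r * \<phi> r)" "\<phi> 0 = y" "\<phi> \<eta> = B y"
    using B unfolding propagator_def by blast
  \<comment> \<open>The trajectory without diffusion; g further down is its defect in the Duhamel
    equation.\<close>
  define \<zeta> where "\<zeta> = (\<lambda>r. exp (R (r / \<eta>) *\<^sub>R f) * y)"
  have \<zeta>c: "continuous_on X \<zeta>" for X
    unfolding \<zeta>_def R_def using \<eta> by (intro continuous_intros) auto
  have v\<zeta>: "v r * \<zeta> r = (1 / \<eta>) *\<^sub>R \<gamma> (r / \<eta>)" for r
    by (simp add: v_def \<zeta>_def \<gamma>_def)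
  have d\<zeta>: "(\<zeta> has_vector_derivative v r * \<zeta> r) (at r within X)" for r X
  proof -
    have "((\<lambda>r. R (r / \<eta>)) has_vector_derivative \<rho> (r / \<eta>) / \<eta>) (at r within X)"
      unfolding has_real_derivative_iff_has_vector_derivative[symmetric] R_def \<rho>_def using \<eta>
      by (auto intro!: derivative_eq_intros simp: field_simps eval_nat_numeral)
    from vector_diff_chain_within[OF this exp_scaleR_has_vector_derivative_right]
    have "((\<lambda>r. exp (R (r / \<eta>) *\<^sub>R f)) has_vector_derivative (\<rho> (r / \<eta>) / \<eta>) *\<^sub>R (exp (R (r / \<eta>) *\<^sub>R f) * f)) (at r within X)"
      by (simp add: o_def)
    from has_vector_derivative_mult_left[OF this, of y] show ?thesis
      by (simp add: \<zeta>_def v_def mult_ac)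
  qed
  define g where "g = (\<lambda>t. S t y + duh (\<lambda>r. v r * \<zeta> r) t - \<zeta> t)"
  have gb: "norm (g t) \<le> 2 * \<epsilon>'" if t: "t \<in> {0..\<eta>}" for t
  proof -
    have c1: "continuous_on {0..t} (\<lambda>r. v r * \<zeta> r)" by (intro continuous_intros vc \<zeta>c)
    have c2: "continuous_on {0..t} (\<lambda>r. S (t - r) (v r * \<zeta> r))" by (intro continuous_intros c1)
    have "((\<lambda>r. v r * \<zeta> r) has_integral \<zeta> t - \<zeta> 0) {0..t}"
      by (rule fundamental_theorem_of_calculus) (use t d\<zeta> in auto)
    then have "\<zeta> t = y + integral {0..t} (\<lambda>r. v r * \<zeta> r)"
      by (simp add: integral_unique \<zeta>_def R_def)
    moreover have "duh (\<lambda>r. v r * \<zeta> r) t - integral {0..t} (\<lambda>r. v r * \<zeta> r) = integral {0..t} (\<lambda>r. S (t - r) (v r * \<zeta> r) - v r * \<zeta> r)"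
      unfolding duh_def by (rule Henstock_Kurzweil_Integration.integral_diff[symmetric]) (intro integrable_continuous_real c1 c2)+
    ultimately have g: "g t = (S t y - y) + integral {0..t} (\<lambda>r. S (t - r) (v r * \<zeta> r) - v r * \<zeta> r)"
      by (simp add: g_def)
    have "norm (integral {0..t} (\<lambda>r. S (t - r) (v r * \<zeta> r) - v r * \<zeta> r)) \<le> integral {0..t} (\<lambda>r. \<epsilon>' / \<eta>)"
    proof (rule integral_norm_bound_integral)
      fix r assume r: "r \<in> {0..t}"
      have "norm (S (t - r) (\<gamma> (r / \<eta>)) - \<gamma> (r / \<eta>)) < \<epsilon>'"
        using r t \<eta> by (intro d1 rx) auto
      then have "(1 / \<eta>) * norm (S (t - r) (\<gamma> (r / \<eta>)) - \<gamma> (r / \<eta>)) \<le> (1 / \<eta>) * \<epsilon>'"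
        using \<eta> by (intro mult_left_mono) auto
      then show "norm (S (t - r) (v r * \<zeta> r) - v r * \<zeta> r) \<le> \<epsilon>' / \<eta>"
        using \<eta> unfolding v\<zeta> S_simps scaleR_diff_right[symmetric] by simp
    qed (intro integrable_continuous_real continuous_intros c1 c2)+
    also have "\<dots> = t * (\<epsilon>' / \<eta>)" using t by simp
    also have "\<dots> \<le> \<eta> * (\<epsilon>' / \<eta>)" using t \<eta> e' by (intro mult_right_mono) auto
    finally have "norm (integral {0..t} (\<lambda>r. S (t - r) (v r * \<zeta> r) - v r * \<zeta> r)) \<le> \<epsilon>'" using \<eta> by simp
    moreover have "norm (S t y - y) < \<epsilon>'" using t \<eta> by (intro d2(2)[of _ 0]) auto
    ultimately show ?thesis
      unfolding g using norm_triangle_ineq[of "S t y - y" "integral {0..t} (\<lambda>r. S (t - r) (v r * \<zeta> r) - v r * \<zeta> r)"] by linarith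
  qed
  have \<phi>c: "continuous_on {0..\<eta>} \<phi>" using heat_sol_continuous[OF chi(1)] .
  have "norm (\<phi> \<eta> - \<zeta> \<eta>) \<le> 2 * exp (2 * (L / \<eta>) * \<eta>) * (2 * \<epsilon>')"
  proof (rule duhamel_stability[where v = v and g = g and y = "\<lambda>t. \<phi> t - \<zeta> t"])
    fix t assume t: "t \<in> {0..\<eta>}"
    have c1: "continuous_on {0..\<eta>} (\<lambda>r. v r * \<phi> r)" "continuous_on {0..\<eta>} (\<lambda>r. v r * \<zeta> r)"
      by (intro continuous_intros vc \<zeta>c \<phi>c)+
    have "duh (\<lambda>r. v r * (\<phi> r - \<zeta> r)) t = duh (\<lambda>r. v r * \<phi> r) t - duh (\<lambda>r. v r * \<zeta> r) t"
      unfolding duh_def S_simps right_diff_distrib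
      by (rule Henstock_Kurzweil_Integration.integral_diff)
        (intro integrable_continuous_real continuous_on_duh_integrand[OF c1(1) t] continuous_on_duh_integrand[OF c1(2) t])+
    with heat_sol_imp_duh[OF chi(1) c1(1) t] chi(2)
    show "\<phi> t - \<zeta> t = g t + duh (\<lambda>r. v r * (\<phi> r - \<zeta> r)) t"
      by (simp add: g_def)
  qed (use \<eta> L vb gb vc in \<open>auto intro!: continuous_intros \<zeta>c \<phi>c\<close>)
  also have "\<dots> = 4 * exp (2 * L) * \<epsilon>'" using \<eta> by simp
  also have "\<dots> < \<epsilon>" using \<open>\<epsilon> > 0\<close> by (simp add: \<epsilon>'_def)
  finally have "norm (B y - exp f * y) < \<epsilon>"
    using chi(3) \<eta> by (simp add: \<zeta>_def R_def)
  then show "\<exists>t v B. 0 \<le> t \<and> t \<le> 0 + \<delta> \<and> propagator t v B \<and> norm (B y - exp f * y) < \<epsilon>"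
    using \<eta> B by (intro exI[of _ \<eta>] exI[of _ v] exI[of _ B]) auto
qed

section \<open>Gaussian averages of translations and exponentials\<close>

lemma has_integral_UNIV_limit:
  fixes f :: "real \<Rightarrow> 'a::banach"
  assumes "(f has_integral I) UNIV"
  shows "(\<lambda>N. integral {- real N..real N} f) \<longlonglongrightarrow> I"
proof (rule LIMSEQ_I)
  fix r :: real assume "r > 0"
  with assms obtain B where B: "B > 0" "\<And>a b. ball 0 B \<subseteq> cbox a b \<Longrightarrow> \<exists>z. (f has_integral z) (cbox a b) \<and> norm (z - I) < r"
    using assms[unfolded has_integral'[of f I UNIV]] by auto
  show "\<exists>N. \<forall>n\<ge>N. norm (integral {- real n..real n} f - I) < r"
  proof (intro exI allI impI)
    fix n assume n: "n \<ge> nat \<lceil>B\<rceil>"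
    then have "B \<le> real n" by linarith
    then have "ball 0 B \<subseteq> cbox (- real n) (real n)"
      by (auto simp: dist_real_def)
    with B(2) show "norm (integral {- real n..real n} f - I) < r"
      by (metis cbox_interval integral_unique)
  qed
qed

lemma continuous_on_std_normal [continuous_intros]: "continuous_on X std_normal_density"
  unfolding normal_density_def by (intro continuous_intros) auto

lemma gauss_cis:
  "((\<lambda>y. std_normal_density y *\<^sub>R cis (a * y)) has_integral complex_of_real (exp (- a\<^sup>2 / 2))) UNIV"
proof -
  have i: "integrable lborel (\<lambda>y. std_normal_density y *\<^sub>R cis (a * y))"
  proof (rule Bochner_Integration.integrable_bound[OF integrable_normal_density])
    show "(\<lambda>y. std_normal_density y *\<^sub>R cis (a * y)) \<in> borel_measurable lborel"
      by (simp, intro borel_measurable_continuous_onI continuous_intros)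
  qed auto
  have "char std_normal_distribution a = (CLINT y|lborel. std_normal_density y *\<^sub>R cis (a * y))"
    unfolding char_def by (subst integral_density) (auto simp: cis_conv_exp)
  then show ?thesis
    using has_integral_integral_lborel[OF i] by (simp add: char_std_normal_distribution)
qed

lemma gauss_exp:
  "((\<lambda>y. std_normal_density y * exp (a * y)) has_integral exp (a\<^sup>2 / 2)) UNIV"
  "integrable lborel (\<lambda>y. std_normal_density y * exp (a * y))"
proof -
  have "normal_density a 1 y * exp (a\<^sup>2 / 2) = std_normal_density y * exp (a * y)" for y
  proof -
    have "- (y - a)\<^sup>2 / 2 + a\<^sup>2 / 2 = - y\<^sup>2 / 2 + a * y"
      by (simp add: power2_eq_square field_simps)
    then have "exp (- (y - a)\<^sup>2 / 2) * exp (a\<^sup>2 / 2) = exp (- y\<^sup>2 / 2) * exp (a * y)"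
      by (simp flip: exp_add)
    then show ?thesis by (simp add: normal_density_def)
  qed
  moreover have i: "integrable lborel (\<lambda>y. normal_density a 1 y * exp (a\<^sup>2 / 2))"
    by (intro integrable_mult_left integrable_normal_density) auto
  moreover have "(LINT y|lborel. normal_density a 1 y * exp (a\<^sup>2 / 2)) = exp (a\<^sup>2 / 2)"
    using integral_normal_density[of 1 a] by simp
  ultimately show "((\<lambda>y. std_normal_density y * exp (a * y)) has_integral exp (a\<^sup>2 / 2)) UNIV"
    "integrable lborel (\<lambda>y. std_normal_density y * exp (a * y))"
    using has_integral_integral_lborel[OF i] by auto
qed

lemma exp_abs_le: "exp (c * \<bar>y\<bar>) \<le> exp (c * y) + exp (- c * y)" for c y :: real
  by (cases "y \<ge> 0") (auto simp: abs_if)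

text \<open>Improper integrals with values in the algebra are limits over \<open>{- N..N}\<close>.
  The scalar majorant w has a convergent integral, and its tails dominate those of the integral of
  H, which gives a Cauchy sequence.\<close>

lemma gauss_limit_exists:
  fixes H :: "real \<Rightarrow> wiener"
  assumes Hc: "continuous_on UNIV H" and Hb: "\<And>y. norm (H y) \<le> C * exp (c * \<bar>y\<bar>)"
  shows "\<exists>E. (\<lambda>N. integral {- real N..real N} (\<lambda>y. std_normal_density y *\<^sub>R H y)) \<longlonglongrightarrow> E"
proof -
  let ?g = "\<lambda>y. std_normal_density y *\<^sub>R H y"
  define w where "w = (\<lambda>y. C * (std_normal_density y * exp (c * y) + std_normal_density y * exp (- c * y)))"
  have C: "C \<ge> 0" using order_trans[OF norm_ge_zero Hb[of 0]] by simp
  have gw: "norm (?g y) \<le> w y" for y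
  proof -
    have "norm (?g y) = std_normal_density y * norm (H y)" by simp
    also have "\<dots> \<le> std_normal_density y * (C * (exp (c * y) + exp (- c * y)))"
      using order_trans[OF Hb[of y] mult_left_mono[OF exp_abs_le C]] by (intro mult_left_mono) auto
    also have "\<dots> = w y" by (simp add: w_def algebra_simps)
    finally show ?thesis .
  qed
  have gi: "?g integrable_on {a..b}" for a b
    by (intro integrable_continuous_real continuous_intros continuous_on_subset[OF Hc]) auto
  have wi: "w integrable_on {a..b}" for a b
    unfolding w_def by (intro integrable_continuous_real continuous_intros)
  have "(w has_integral C * (exp (c\<^sup>2 / 2) + exp ((- c)\<^sup>2 / 2))) UNIV"
    unfolding w_def by (intro has_integral_mult_right has_integral_add gauss_exp(1))
  from has_integral_UNIV_limit[OF this]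
  have J: "Cauchy (\<lambda>N. integral {- real N..real N} w)" by (rule LIMSEQ_imp_Cauchy)
  have le: "norm (integral {- real n..real n} ?g - integral {- real m..real m} ?g)
      \<le> integral {- real n..real n} w - integral {- real m..real m} w" if "m \<le> n" for m n
  proof -
    have split: "integral {- real n..real n} f = integral {- real n..- real m} f + integral {- real m..real m} f + integral {real m..real n} f"
      if "\<And>a b. f integrable_on {a..b}" for f :: "real \<Rightarrow> 'z::banach"
    proof -
      have "integral {- real n..- real m} f + integral {- real m..real n} f = integral {- real n..real n} f"
        "integral {- real m..real m} f + integral {real m..real n} f = integral {- real m..real n} f"
        using \<open>m \<le> n\<close> that by (intro Henstock_Kurzweil_Integration.integral_combine; simp)+
      then show ?thesis by (simp add: add.assoc)
    qed
    have "norm (integral {- real n..- real m} ?g + integral {real m..real n} ?g)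
        \<le> integral {- real n..- real m} w + integral {real m..real n} w"
      by (intro order_trans[OF norm_triangle_ineq] add_mono integral_norm_bound_integral gi wi gw)
    then show ?thesis
      by (simp add: split[of ?g, OF gi] split[of w, OF wi])
  qed
  have "Cauchy (\<lambda>N. integral {- real N..real N} ?g)"
  proof (rule CauchyI')
    fix e :: real assume "e > 0"
    then obtain M where M: "\<And>m n. m \<ge> M \<Longrightarrow> n \<ge> M \<Longrightarrow> norm (integral {- real m..real m} w - integral {- real n..real n} w) < e"
      using J unfolding Cauchy_iff by blast
    have "norm (integral {- real m..real m} ?g - integral {- real n..real n} ?g) < e" if "m \<ge> M" "n > m" for m n
      using le[of m n] M[of n m] that by (simp add: norm_minus_commute)
    then show "\<exists>M. \<forall>m\<ge>M. \<forall>n>m. dist (integral {- real m..real m} ?g) (integral {- real n..real n} ?g) < e"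
      unfolding dist_norm by blast
  qed
  then show ?thesis by (simp add: Cauchy_convergent_iff convergent_def)
qed

text \<open>On frequency k this is the characteristic function of the standard normal law: the mean
  of exp (i k h y) is exp (-k^2 h^2 / 2).\<close>

lemma S_gauss:
  "(\<lambda>N. integral {- real N..real N} (\<lambda>y. std_normal_density y *\<^sub>R Tr (y * h) g)) \<longlonglongrightarrow> S (h\<^sup>2 / 2) g"
proof -
  have c: "continuous_on X (\<lambda>y. Tr (y * h) g)" for X by (intro continuous_intros)
  obtain E where E: "(\<lambda>N. integral {- real N..real N} (\<lambda>y. std_normal_density y *\<^sub>R Tr (y * h) g)) \<longlonglongrightarrow> E"
    using gauss_limit_exists[OF c, of "norm g" 0] norm_Tr_le by auto
  have "E = S (h\<^sup>2 / 2) g"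
  proof (rule wiener_coef_eqI)
    fix k
    have "(\<lambda>N. integral {- real N..real N} (\<lambda>y. std_normal_density y *\<^sub>R cis ((of_int k * h) * y))) \<longlonglongrightarrow> complex_of_real (exp (- (of_int k * h)\<^sup>2 / 2))"
      by (rule has_integral_UNIV_limit[OF gauss_cis])
    then have 1: "(\<lambda>N. integral {- real N..real N} (\<lambda>y. std_normal_density y *\<^sub>R cis ((of_int k * h) * y)) * coef g k) \<longlonglongrightarrow> complex_of_real (exp (- (of_int k * h)\<^sup>2 / 2)) * coef g k"
      by (intro tendsto_intros)
    have "coef (integral {- real N..real N} (\<lambda>y. std_normal_density y *\<^sub>R Tr (y * h) g)) k
        = integral {- real N..real N} (\<lambda>y. std_normal_density y *\<^sub>R cis ((of_int k * h) * y)) * coef g k" for N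
    proof -
      have "(\<lambda>y. std_normal_density y *\<^sub>R Tr (y * h) g) integrable_on {- real N..real N}"
        by (intro integrable_continuous_real continuous_intros)
      from integral_linear[OF this bounded_linear_coef[of k]]
      have "coef (integral {- real N..real N} (\<lambda>y. std_normal_density y *\<^sub>R Tr (y * h) g)) k
          = integral {- real N..real N} (\<lambda>y. (std_normal_density y *\<^sub>R cis ((of_int k * h) * y)) * coef g k)"
        by (simp add: o_def coef_simps(4) coef_Tr mult_ac)
      also have "((\<lambda>y. (std_normal_density y *\<^sub>R cis ((of_int k * h) * y)) * coef g k) has_integral
          integral {- real N..real N} (\<lambda>y. std_normal_density y *\<^sub>R cis ((of_int k * h) * y)) * coef g k) {- real N..real N}"
        by (intro has_integral_mult_left integrable_integral integrable_continuous_real continuous_intros)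
      note integral_unique[OF this]
      finally show ?thesis .
    qed
    with bounded_linear.tendsto[OF bounded_linear_coef E, of k]
    have 2: "(\<lambda>N. integral {- real N..real N} (\<lambda>y. std_normal_density y *\<^sub>R cis ((of_int k * h) * y)) * coef g k) \<longlonglongrightarrow> coef E k"
      by simp
    from LIMSEQ_unique[OF 2 1] show "coef E k = coef (S (h\<^sup>2 / 2) g) k"
      by (simp add: coef_S scaleR_conv_of_real power_mult_distrib)
  qed
  with E show ?thesis by simp
qed

text \<open>The moment generating function of the normal law, read off at each point x.\<close>

lemma exp_gauss:
  "(\<lambda>N. integral {- real N..real N} (\<lambda>y. std_normal_density y *\<^sub>R exp (y *\<^sub>R f))) \<longlonglongrightarrow> exp ((1/2) *\<^sub>R (f * f))"
  for f :: wiener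
proof -
  have c: "continuous_on X (\<lambda>y. exp (y *\<^sub>R f))" for X by (intro continuous_intros)
  obtain E where E: "(\<lambda>N. integral {- real N..real N} (\<lambda>y. std_normal_density y *\<^sub>R exp (y *\<^sub>R f))) \<longlonglongrightarrow> E"
  proof -
    have "norm (exp (y *\<^sub>R f)) \<le> 1 * exp (norm f * \<bar>y\<bar>)" for y
      using norm_exp[of "y *\<^sub>R f"] by (simp add: mult.commute)
    from gauss_limit_exists[OF c this] that show ?thesis by blast
  qed
  have "E = exp ((1/2) *\<^sub>R (f * f))"
  proof (rule wiener_eqI)
    fix x
    have 1: "(\<lambda>N. integral {- real N..real N} (\<lambda>y. std_normal_density y * exp (fn f x * y))) \<longlonglongrightarrow> exp ((fn f x)\<^sup>2 / 2)"
      by (rule has_integral_UNIV_limit[OF gauss_exp(1)])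
    have "fn (integral {- real N..real N} (\<lambda>y. std_normal_density y *\<^sub>R exp (y *\<^sub>R f))) x
        = integral {- real N..real N} (\<lambda>y. std_normal_density y * exp (fn f x * y))" for N
    proof -
      have "(\<lambda>y. std_normal_density y *\<^sub>R exp (y *\<^sub>R f)) integrable_on {- real N..real N}"
        by (intro integrable_continuous_real continuous_intros)
      from integral_linear[OF this bounded_linear_fn[of x]]
      show ?thesis by (simp add: o_def mult.commute)
    qed
    with bounded_linear.tendsto[OF bounded_linear_fn E, of x]
    have 2: "(\<lambda>N. integral {- real N..real N} (\<lambda>y. std_normal_density y * exp (fn f x * y))) \<longlonglongrightarrow> fn E x"
      by simp
    from LIMSEQ_unique[OF 2 1] show "fn E x = fn (exp ((1/2) *\<^sub>R (f * f))) x"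
      by (simp add: power2_eq_square)
  qed
  with E show ?thesis by simp
qed

text \<open>With a = n + 1, exp (-a f) Tr (y/a) (exp (a f) g) = exp (D) Tr (y/a) g where D = a (Tr
  (y/a) f - f) tends to y f'. Averaging over a Gaussian y turns exp (y f') into exp (f'^2 /
  2).\<close>

lemma conjugated_heat_limit:
  assumes f: "tderiv f f'"
  shows "(\<lambda>n. exp (- real (Suc n) *\<^sub>R f) * S ((1 / real (Suc n))\<^sup>2 / 2) (exp (real (Suc n) *\<^sub>R f) * g))
    \<longlonglongrightarrow> exp ((1/2) *\<^sub>R (f' * f')) * g"
proof -
  define a where "a = (\<lambda>n. real (Suc n))"
  have a: "a n > 0" for n by (simp add: a_def)
  define D where "D = (\<lambda>n y. a n *\<^sub>R (Tr (y / a n) f - f))"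
  define M where "M = norm f'"
  \<comment> \<open>Uniform in n, hence the source of the Gaussian integrable majorant.\<close>
  have Db: "norm (D n y) \<le> M * \<bar>y\<bar>" for n y
  proof -
    have "norm (D n y) = a n * norm (Tr (y / a n) f - f)" using a[of n] by (simp add: D_def)
    also have "\<dots> \<le> a n * (\<bar>y / a n\<bar> * M)"
      using tderiv_lipschitz[OF f, of "y / a n"] a[of n] unfolding M_def by (intro mult_left_mono) auto
    also have "\<dots> = M * \<bar>y\<bar>" using a[of n] by simp
    finally show ?thesis .
  qed
  have DL: "(\<lambda>n. D n y) \<longlonglongrightarrow> y *\<^sub>R f'" for y
  proof (cases "y = 0")
    case True
    then show ?thesis by (simp add: D_def)
  next
    case False
    have "((\<lambda>h. norm (Tr h f - f - h *\<^sub>R f') / norm h) \<longlongrightarrow> 0) (at 0)"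
      using f unfolding tderiv_def has_vector_derivative_def has_derivative_at by simp
    moreover have "filterlim (\<lambda>n. y / a n) (at 0) sequentially"
      unfolding filterlim_at
    proof (intro conjI always_eventually allI)
      have "(\<lambda>n. y * (1 / a n)) \<longlonglongrightarrow> y * 0"
        unfolding a_def by (intro tendsto_intros LIMSEQ_Suc[OF lim_1_over_n])
      then show "(\<lambda>n. y / a n) \<longlonglongrightarrow> 0" by simp
    qed (use a False in \<open>auto simp: less_imp_neq[symmetric]\<close>)
    ultimately have "(\<lambda>n. norm (Tr (y / a n) f - f - (y / a n) *\<^sub>R f') / norm (y / a n)) \<longlonglongrightarrow> 0"
      by (rule filterlim_compose)
    then have "(\<lambda>n. \<bar>y\<bar> * (norm (Tr (y / a n) f - f - (y / a n) *\<^sub>R f') / norm (y / a n))) \<longlonglongrightarrow> \<bar>y\<bar> * 0"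
      by (intro tendsto_intros)
    moreover have "\<bar>y\<bar> * (norm (Tr (y / a n) f - f - (y / a n) *\<^sub>R f') / norm (y / a n)) = norm (D n y - y *\<^sub>R f')" for n
    proof -
      have "D n y - y *\<^sub>R f' = a n *\<^sub>R (Tr (y / a n) f - f - (y / a n) *\<^sub>R f')"
        using a[of n] by (simp add: D_def scaleR_diff_right)
      then show ?thesis using a[of n] False by simp
    qed
    ultimately have "(\<lambda>n. D n y - y *\<^sub>R f') \<longlonglongrightarrow> 0"
      by (simp add: tendsto_norm_zero_iff)
    then show ?thesis by (rule LIM_zero_cancel)
  qed
  define H where "H = (\<lambda>n y. exp (D n y) * Tr (y / a n) g - exp (y *\<^sub>R f') * g)"
  have Heq: "H n y = exp (- a n *\<^sub>R f) * Tr (y * (1 / a n)) (exp (a n *\<^sub>R f) * g) - exp (y *\<^sub>R f') * g" for n y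
  proof (rule wiener_eqI)
    fix x
    have "exp (a n * (u - v)) = exp (- a n * v) * exp (a n * u)" for u v :: real
      by (simp add: right_diff_distrib flip: exp_add)
    then show "fn (H n y) x = fn (exp (- a n *\<^sub>R f) * Tr (y * (1 / a n)) (exp (a n *\<^sub>R f) * g) - exp (y *\<^sub>R f') * g) x"
      unfolding H_def D_def by (simp add: fn_Tr)
  qed
  have Dc: "continuous_on X (D n)" for n X
    unfolding D_def using a[of n] by (intro continuous_intros) auto
  have Hc: "continuous_on X (H n)" for n X
    unfolding H_def using a[of n] by (intro continuous_intros Dc) auto
  have Hb: "norm (H n y) \<le> 2 * norm g * exp (M * \<bar>y\<bar>)" for n y
  proof -
    have "norm (exp (D n y) * Tr (y / a n) g) \<le> exp (M * \<bar>y\<bar>) * norm g"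
      using order_trans[OF norm_exp, of "D n y"] Db[of n y] norm_Tr_le
      by (intro order_trans[OF norm_mult_ineq] mult_mono) auto
    moreover have "norm (exp (y *\<^sub>R f') * g) \<le> exp (M * \<bar>y\<bar>) * norm g"
      using order_trans[OF norm_exp, of "y *\<^sub>R f'" "exp (M * \<bar>y\<bar>)"]
      by (intro order_trans[OF norm_mult_ineq] mult_right_mono) (auto simp: M_def mult.commute)
    ultimately show ?thesis
      unfolding H_def using norm_triangle_ineq4[of "exp (D n y) * Tr (y / a n) g" "exp (y *\<^sub>R f') * g"]
      by (simp add: mult_ac)
  qed
  have HL: "(\<lambda>n. H n y) \<longlonglongrightarrow> 0" for y
  proof -
    have "(\<lambda>n. y * (1 / a n)) \<longlonglongrightarrow> y * 0"
      unfolding a_def by (intro tendsto_intros LIMSEQ_Suc[OF lim_1_over_n])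
    then have "(\<lambda>n. y / a n) \<longlonglongrightarrow> 0" by simp
    then have "(\<lambda>n. H n y) \<longlonglongrightarrow> exp (y *\<^sub>R f') * Tr 0 g - exp (y *\<^sub>R f') * g"
      unfolding H_def by (intro tendsto_intros DL)
    then show ?thesis by simp
  qed
  define w where "w = (\<lambda>y. 2 * norm g * (std_normal_density y * exp (M * y) + std_normal_density y * exp (- M * y)))"
  have wi: "integrable lborel w"
    unfolding w_def by (intro integrable_mult_right Bochner_Integration.integrable_add gauss_exp(2))
  \<comment> \<open>Dominated convergence is applied to the scalar norms of H; the algebra-valued
    integrals are compared with it through \<open>XQ\<close>.\<close>
  define Q where "Q = (\<lambda>n. LINT y|lborel. std_normal_density y * norm (H n y))"
  have qm: "(\<lambda>y. std_normal_density y * norm (H n y)) \<in> borel_measurable lborel" for n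
    by (simp, intro borel_measurable_continuous_onI continuous_intros Hc)
  have qw: "std_normal_density y * norm (H n y) \<le> w y" for n y
  proof -
    have "std_normal_density y * norm (H n y) \<le> std_normal_density y * (2 * norm g * (exp (M * y) + exp (- M * y)))"
      using order_trans[OF Hb[of n y] mult_left_mono[OF exp_abs_le, of "2 * norm g"]] by (intro mult_left_mono) auto
    then show ?thesis by (simp add: w_def algebra_simps)
  qed
  have qi: "integrable lborel (\<lambda>y. std_normal_density y * norm (H n y))" for n
    by (rule Bochner_Integration.integrable_bound[OF wi qm]) (use qw in \<open>auto intro!: order_trans[OF qw] AE_I2\<close>)
  have "(\<lambda>n. LINT y|lborel. std_normal_density y * norm (H n y)) \<longlonglongrightarrow> (LINT y::real|lborel. 0)"
  proof (rule integral_dominated_convergence[OF _ qm wi])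
    have "(\<lambda>n. std_normal_density y * norm (H n y)) \<longlonglongrightarrow> std_normal_density y * norm (0::wiener)" for y
      by (intro tendsto_intros HL)
    then show "AE y in lborel. (\<lambda>n. std_normal_density y * norm (H n y)) \<longlonglongrightarrow> 0" by simp
    show "\<And>n. AE y in lborel. norm (std_normal_density y * norm (H n y)) \<le> w y"
      using qw by auto
  qed simp
  then have Q0: "Q \<longlonglongrightarrow> 0" by (simp add: Q_def)
  define X where "X = (\<lambda>n. exp (- a n *\<^sub>R f) * S ((1 / a n)\<^sup>2 / 2) (exp (a n *\<^sub>R f) * g))"
  have XQ: "norm (X n - exp ((1/2) *\<^sub>R (f' * f')) * g) \<le> Q n" for n
  proof (rule LIMSEQ_le_const2)
    let ?I1 = "\<lambda>N. integral {- real N..real N} (\<lambda>y. std_normal_density y *\<^sub>R Tr (y * (1 / a n)) (exp (a n *\<^sub>R f) * g))"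
    let ?I2 = "\<lambda>N. integral {- real N..real N} (\<lambda>y. std_normal_density y *\<^sub>R exp (y *\<^sub>R f'))"
    have "(\<lambda>N. exp (- a n *\<^sub>R f) * ?I1 N - ?I2 N * g) \<longlonglongrightarrow> X n - exp ((1/2) *\<^sub>R (f' * f')) * g"
      unfolding X_def by (intro tendsto_intros S_gauss exp_gauss)
    then show "(\<lambda>N. norm (exp (- a n *\<^sub>R f) * ?I1 N - ?I2 N * g)) \<longlonglongrightarrow> norm (X n - exp ((1/2) *\<^sub>R (f' * f')) * g)"
      by (rule tendsto_norm)
    show "\<exists>N0. \<forall>N\<ge>N0. norm (exp (- a n *\<^sub>R f) * ?I1 N - ?I2 N * g) \<le> Q n"
    proof (intro exI allI impI)
      fix N
      have i1: "(\<lambda>y. std_normal_density y *\<^sub>R Tr (y * (1 / a n)) (exp (a n *\<^sub>R f) * g)) integrable_on {- real N..real N}"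
        by (intro integrable_continuous_real continuous_intros)
      have i2: "(\<lambda>y. std_normal_density y *\<^sub>R exp (y *\<^sub>R f')) integrable_on {- real N..real N}"
        by (intro integrable_continuous_real continuous_intros)
      have "((\<lambda>y. exp (- a n *\<^sub>R f) * (std_normal_density y *\<^sub>R Tr (y * (1 / a n)) (exp (a n *\<^sub>R f) * g)) - (std_normal_density y *\<^sub>R exp (y *\<^sub>R f')) * g)
        has_integral exp (- a n *\<^sub>R f) * ?I1 N - ?I2 N * g) {- real N..real N}"
        by (intro has_integral_diff has_integral_mult_right has_integral_mult_left integrable_integral i1 i2)
      then have "((\<lambda>y. std_normal_density y *\<^sub>R H n y) has_integral exp (- a n *\<^sub>R f) * ?I1 N - ?I2 N * g) {- real N..real N}"
        by (rule has_integral_eq[rotated]) (simp add: Heq scaleR_diff_right)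
      then have "norm (exp (- a n *\<^sub>R f) * ?I1 N - ?I2 N * g) = norm (integral {- real N..real N} (\<lambda>y. std_normal_density y *\<^sub>R H n y))"
        by (simp only: integral_unique)
      also have "\<dots> \<le> integral {- real N..real N} (\<lambda>y. std_normal_density y * norm (H n y))"
        by (rule integral_norm_bound_integral) (auto intro!: integrable_continuous_real continuous_intros Hc)
      also have "\<dots> \<le> integral UNIV (\<lambda>y. std_normal_density y * norm (H n y))"
        by (rule integral_subset_le)
          (auto intro!: integrable_continuous_real continuous_intros Hc has_integral_integrable[OF has_integral_integral_lborel[OF qi]])
      also have "\<dots> = Q n"
        unfolding Q_def by (rule integral_unique[OF has_integral_integral_lborel[OF qi]])
      finally show "norm (exp (- a n *\<^sub>R f) * ?I1 N - ?I2 N * g) \<le> Q n" .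
    qed
  qed
  have "(\<lambda>n. X n - exp ((1/2) *\<^sub>R (f' * f')) * g) \<longlonglongrightarrow> 0"
    by (rule Lim_null_comparison[OF _ Q0]) (use XQ in auto)
  then have "X \<longlonglongrightarrow> exp ((1/2) *\<^sub>R (f' * f')) * g" by (rule LIM_zero_cancel)
  then show ?thesis by (simp add: X_def a_def)
qed

lemma fn_numeral [simp]: "fn (numeral n) x = numeral n"
  using fn_of_nat[of "numeral n" x] by simp

section \<open>Exponents accessible in arbitrarily short time\<close>

definition accessible :: "wiener set" where
  "accessible = {f. reach 0 (\<lambda>y. exp f * y)}"

text \<open>A square of a derivative comes with one sign only, whereas conjugation by exp (n f) and
  the subtraction of unwanted terms use both signs; the induction over frequencies therefore runs on
  whole lines.\<close>

definition accessible_line :: "wiener \<Rightarrow> bool" where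
  "accessible_line f \<longleftrightarrow> (\<forall>a. a *\<^sub>R f \<in> accessible)"

lemma accessible_add: "f \<in> accessible \<Longrightarrow> g \<in> accessible \<Longrightarrow> f + g \<in> accessible"
proof -
  assume "f \<in> accessible" "g \<in> accessible"
  then have "reach (0 + 0) (\<lambda>y. exp g * (exp f * y))"
    unfolding accessible_def by (intro reach_compose[of 0 "\<lambda>y. exp f * y"]) auto
  moreover have "(\<lambda>y. exp g * (exp f * y)) = (\<lambda>y. exp (f + g) * y)"
    unfolding exp_add_wiener by (simp only: mult_ac)
  ultimately show ?thesis by (simp add: accessible_def)
qed

lemma accessible_limit:
  assumes "\<And>n::nat. X n \<in> accessible" "X \<longlonglongrightarrow> f"
  shows "f \<in> accessible"
proof -
  have "reach 0 (\<lambda>y. exp f * y)"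
    by (rule reach_limit[of "\<lambda>_. 0" "\<lambda>n y. exp (X n) * y"])
      (use assms in \<open>auto simp: accessible_def intro!: tendsto_intros\<close>)
  then show ?thesis by (simp add: accessible_def)
qed

lemma accessible_line_add: "accessible_line f \<Longrightarrow> accessible_line g \<Longrightarrow> accessible_line (f + g)"
  unfolding accessible_line_def scaleR_add_right by (blast intro: accessible_add)

lemma accessible_line_scaleR: "accessible_line f \<Longrightarrow> accessible_line (r *\<^sub>R f)"
  unfolding accessible_line_def by simp

lemma accessible_line_trig1: "f \<in> trig1 \<Longrightarrow> accessible_line f"
  unfolding accessible_line_def accessible_def using reach_exp_trig1 trig1_scaleR by blast

text \<open>The heat flow inside the conjugation lasts a time that tends to 0, so the limit is
  reached in arbitrarily short time. Scaling f by sqrt 2 cancels the 1/2 in the exponent of the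
  limit.\<close>

lemma accessible_square:
  assumes f: "accessible_line f" "tderiv f f'"
  shows "f' * f' \<in> accessible"
proof -
  define g where "g = sqrt 2 *\<^sub>R f"
  define g' where "g' = sqrt 2 *\<^sub>R f'"
  have g: "accessible_line g" "tderiv g g'"
    unfolding g_def g'_def using f by (auto intro: accessible_line_scaleR tderiv_scaleR)
  have r: "reach 0 (\<lambda>y. exp (a *\<^sub>R g) * y)" for a
    using g(1) by (simp add: accessible_line_def accessible_def)
  have "reach (0 + ((1 / real (Suc n))\<^sup>2 / 2) + 0) (\<lambda>y. exp (- real (Suc n) *\<^sub>R g) * S ((1 / real (Suc n))\<^sup>2 / 2) (exp (real (Suc n) *\<^sub>R g) * y))" for n
    by (intro reach_compose[of _ "\<lambda>y. S ((1 / real (Suc n))\<^sup>2 / 2) (exp (real (Suc n) *\<^sub>R g) * y)"]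
        reach_compose[of _ "\<lambda>y. exp (real (Suc n) *\<^sub>R g) * y"] r reach_S) simp
  then have 1: "reach ((1 / real (Suc n))\<^sup>2 / 2) (\<lambda>y. exp (- real (Suc n) *\<^sub>R g) * S ((1 / real (Suc n))\<^sup>2 / 2) (exp (real (Suc n) *\<^sub>R g) * y))" for n
    by simp
  have "(\<lambda>n. (1 / real (Suc n))\<^sup>2 / 2) \<longlonglongrightarrow> 0\<^sup>2 / 2"
    by (intro tendsto_intros LIMSEQ_Suc[OF lim_1_over_n]) auto
  then have 2: "(\<lambda>n. (1 / real (Suc n))\<^sup>2 / 2) \<longlonglongrightarrow> 0" by simp
  have "reach 0 (\<lambda>y. exp ((1/2) *\<^sub>R (g' * g')) * y)"
    by (rule reach_limit[OF 1 2 conjugated_heat_limit[OF g(2)]])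
  then show ?thesis by (simp add: accessible_def g'_def)
qed

text \<open>Sums of squares give the direction f with amplitude \<sigma> s^2 r plus a remainder on
  an accessible line, which is subtracted. Both signs and all s together cover every real multiple
  of f.\<close>

lemma accessible_lineI:
  assumes "\<And>\<sigma> s. \<sigma> \<in> {1, -1} \<Longrightarrow> \<exists>g. accessible_line g \<and> (\<sigma> * s\<^sup>2 * r) *\<^sub>R f + g \<in> accessible" and "r > 0"
  shows "accessible_line f"
  unfolding accessible_line_def
proof
  fix a :: real
  define \<sigma> :: real where "\<sigma> = (if a \<ge> 0 then 1 else -1)"
  define s where "s = sqrt (\<bar>a\<bar> / r)"
  have "\<sigma> * s\<^sup>2 * r = a" using \<open>r > 0\<close> by (auto simp: \<sigma>_def s_def)
  moreover obtain g where g: "accessible_line g" "(\<sigma> * s\<^sup>2 * r) *\<^sub>R f + g \<in> accessible"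
  proof -
    have "\<sigma> \<in> {1, -1}" by (simp add: \<sigma>_def)
    from assms(1)[OF this, of s] that show ?thesis by blast
  qed
  moreover have "(-1) *\<^sub>R g \<in> accessible" using g(1) unfolding accessible_line_def by blast
  ultimately show "a *\<^sub>R f \<in> accessible"
    using accessible_add[of "a *\<^sub>R f + g" "(-1) *\<^sub>R g"] by simp
qed

lemma accessible_line_1: "accessible_line 1"
  and accessible_line_cos1: "accessible_line (cosW 1)"
  and accessible_line_sin1: "accessible_line (sinW 1)"
proof -
  have "1 = 1 *\<^sub>R 1 + 0 *\<^sub>R cosW 1 + 0 *\<^sub>R sinW 1" "cosW 1 = 0 *\<^sub>R 1 + 1 *\<^sub>R cosW 1 + 0 *\<^sub>R sinW 1"
    "sinW 1 = 0 *\<^sub>R 1 + 0 *\<^sub>R cosW 1 + 1 *\<^sub>R sinW 1" by simp_all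
  then have "1 \<in> trig1" "cosW 1 \<in> trig1" "sinW 1 \<in> trig1"
    unfolding trig1_def by blast+
  then show "accessible_line 1" "accessible_line (cosW 1)" "accessible_line (sinW 1)"
    by (auto intro: accessible_line_trig1)
qed

lemma accessible_line_sum: "(\<And>a. a \<in> A \<Longrightarrow> accessible_line (g a)) \<Longrightarrow> accessible_line (sum g A)"
proof (induction A rule: infinite_finite_induct)
  case empty
  have "accessible_line (0 *\<^sub>R 1)" by (rule accessible_line_scaleR[OF accessible_line_1])
  then show ?case by simp
next
  case (infinite A)
  have "accessible_line (0 *\<^sub>R 1)" by (rule accessible_line_scaleR[OF accessible_line_1])
  then show ?case using infinite by simp
qed (auto intro: accessible_line_add)

lemma trig_step_cos: "n * sin (n * x) * (n * sin (n * x)) + sin x * sin x + n * cos (n * x) * (n * cos (n * x)) + cos x * cos x = n\<^sup>2 + 1"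
  for n x :: real
proof -
  have "n * sin (n * x) * (n * sin (n * x)) + n * cos (n * x) * (n * cos (n * x)) = n\<^sup>2 * ((sin (n * x))\<^sup>2 + (cos (n * x))\<^sup>2)"
    by (simp only: power2_eq_square distrib_left mult_ac)
  also have "\<dots> = n\<^sup>2" by simp
  finally have "n * sin (n * x) * (n * sin (n * x)) + n * cos (n * x) * (n * cos (n * x)) = n\<^sup>2" .
  moreover have "sin x * sin x + cos x * cos x = 1"
    using sin_cos_squared_add[of x] by (simp add: power2_eq_square)
  ultimately show ?thesis by simp
qed

text \<open>The squared derivative of cos (n x) - \<sigma> cos x has the cross term -2 \<sigma> n
  sin (n x) sin x = \<sigma> n (cos ((n+1) x) - cos ((n-1) x)). Adding the squared derivatives of
  sin (n x) and sin x turns the other terms into the constant n^2 + 1. Sine modes come likewise from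
  sin (n x) - \<sigma> cos x. The frequency n - 1 is why the induction uses two
  predecessors.\<close>

lemma accessible_modes:
  "accessible_line (cosW (int n)) \<and> accessible_line (sinW (int n))"
proof (induction n rule: induct_nat_012)
  case 0
  have "cosW 0 = 1" "sinW 0 = 0 *\<^sub>R 1" by (rule wiener_eqI; simp)+
  moreover have "accessible_line (0 *\<^sub>R 1)" by (rule accessible_line_scaleR[OF accessible_line_1])
  ultimately show ?case using accessible_line_1 by simp
next
  case 1
  then show ?case using accessible_line_cos1 accessible_line_sin1 by simp
next
  case (ge2 m)
  define n where "n = int (Suc m)"
  have n: "n \<ge> 1" "int m = n - 1" "int (Suc (Suc m)) = n + 1" by (auto simp: n_def)
  have IH: "accessible_line (cosW n)" "accessible_line (sinW n)" "accessible_line (cosW (n - 1))" "accessible_line (sinW (n - 1))"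
    using ge2 by (auto simp: n_def)
  let ?r = "real_of_int n"
  have r: "?r > 0" using n by simp
  note lines = accessible_line_add accessible_line_scaleR IH accessible_line_1 accessible_line_cos1 accessible_line_sin1
  note derivs = tderiv_add tderiv_scaleR tderiv_cosW tderiv_sinW
  have "accessible_line (cosW (n + 1))"
  proof (rule accessible_lineI[OF _ r])
    fix \<sigma> s :: real assume "\<sigma> \<in> {1, -1}"
    then have \<sigma>: "\<sigma> * \<sigma> = 1" by auto
    define f1 where "f1 = s *\<^sub>R (cosW n + (- \<sigma>) *\<^sub>R cosW 1)"
    define f1' where "f1' = s *\<^sub>R (- of_int n *\<^sub>R sinW n + (- \<sigma>) *\<^sub>R (- of_int 1 *\<^sub>R sinW 1))"
    define f2' where "f2' = s *\<^sub>R (of_int n *\<^sub>R cosW n)"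
    define f3' where "f3' = s *\<^sub>R (of_int 1 *\<^sub>R cosW 1)"
    have "f1' * f1' \<in> accessible"
      by (rule accessible_square[of f1]; unfold f1_def f1'_def; intro lines derivs)
    moreover have "f2' * f2' \<in> accessible"
      by (rule accessible_square[of "s *\<^sub>R sinW n"], intro lines, unfold f2'_def, intro derivs)
    moreover have "f3' * f3' \<in> accessible"
      by (rule accessible_square[of "s *\<^sub>R sinW 1"], intro lines, unfold f3'_def, intro derivs)
    ultimately have "f1' * f1' + f2' * f2' + f3' * f3' \<in> accessible"
      by (intro accessible_add)
    moreover have "f1' * f1' + f2' * f2' + f3' * f3' =
        (\<sigma> * s\<^sup>2 * ?r) *\<^sub>R cosW (n + 1) + ((s\<^sup>2 * (?r\<^sup>2 + 1)) *\<^sub>R 1 + (- \<sigma> * s\<^sup>2 * ?r) *\<^sub>R cosW (n - 1))"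
    proof (rule wiener_eqI)
      fix x
      have c: "cos ((?r + 1) * x) = cos (?r * x) * cos x - sin (?r * x) * sin x"
        "cos ((?r - 1) * x) = cos (?r * x) * cos x + sin (?r * x) * sin x"
        by (simp_all add: distrib_right left_diff_distrib cos_add cos_diff)
      have "fn (f1' * f1' + f2' * f2' + f3' * f3') x = s\<^sup>2 * (?r * sin (?r * x) * (?r * sin (?r * x)) + (\<sigma> * \<sigma>) * (sin x * sin x)
          + ?r * cos (?r * x) * (?r * cos (?r * x)) + cos x * cos x) - 2 * \<sigma> * s\<^sup>2 * ?r * (sin (?r * x) * sin x)"
        by (simp add: f1'_def f2'_def f3'_def power2_eq_square algebra_simps)
      also have "\<dots> = s\<^sup>2 * (?r\<^sup>2 + 1) - 2 * \<sigma> * s\<^sup>2 * ?r * (sin (?r * x) * sin x)"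
        unfolding \<sigma> mult_1 trig_step_cos ..
      also have "\<dots> = fn ((\<sigma> * s\<^sup>2 * ?r) *\<^sub>R cosW (n + 1) + ((s\<^sup>2 * (?r\<^sup>2 + 1)) *\<^sub>R 1 + (- \<sigma> * s\<^sup>2 * ?r) *\<^sub>R cosW (n - 1))) x"
        by (simp add: c) (simp add: algebra_simps)
      finally show "fn (f1' * f1' + f2' * f2' + f3' * f3') x =
        fn ((\<sigma> * s\<^sup>2 * ?r) *\<^sub>R cosW (n + 1) + ((s\<^sup>2 * (?r\<^sup>2 + 1)) *\<^sub>R 1 + (- \<sigma> * s\<^sup>2 * ?r) *\<^sub>R cosW (n - 1))) x" .
    qed
    ultimately show "\<exists>g. accessible_line g \<and> (\<sigma> * s\<^sup>2 * ?r) *\<^sub>R cosW (n + 1) + g \<in> accessible"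
      by (intro exI[of _ "(s\<^sup>2 * (?r\<^sup>2 + 1)) *\<^sub>R 1 + (- \<sigma> * s\<^sup>2 * ?r) *\<^sub>R cosW (n - 1)"] conjI lines) simp
  qed
  moreover have "accessible_line (sinW (n + 1))"
  proof (rule accessible_lineI[OF _ r])
    fix \<sigma> s :: real assume "\<sigma> \<in> {1, -1}"
    then have \<sigma>: "\<sigma> * \<sigma> = 1" by auto
    define f1 where "f1 = s *\<^sub>R (sinW n + (- \<sigma>) *\<^sub>R cosW 1)"
    define f1' where "f1' = s *\<^sub>R (of_int n *\<^sub>R cosW n + (- \<sigma>) *\<^sub>R (- of_int 1 *\<^sub>R sinW 1))"
    define f2' where "f2' = s *\<^sub>R (- of_int n *\<^sub>R sinW n)"
    define f3' where "f3' = s *\<^sub>R (of_int 1 *\<^sub>R cosW 1)"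
    have "f1' * f1' \<in> accessible"
      by (rule accessible_square[of f1]; unfold f1_def f1'_def; intro lines derivs)
    moreover have "f2' * f2' \<in> accessible"
      by (rule accessible_square[of "s *\<^sub>R cosW n"], intro lines, unfold f2'_def, intro derivs)
    moreover have "f3' * f3' \<in> accessible"
      by (rule accessible_square[of "s *\<^sub>R sinW 1"], intro lines, unfold f3'_def, intro derivs)
    ultimately have "f1' * f1' + f2' * f2' + f3' * f3' \<in> accessible"
      by (intro accessible_add)
    moreover have "f1' * f1' + f2' * f2' + f3' * f3' =
        (\<sigma> * s\<^sup>2 * ?r) *\<^sub>R sinW (n + 1) + ((s\<^sup>2 * (?r\<^sup>2 + 1)) *\<^sub>R 1 + (- \<sigma> * s\<^sup>2 * ?r) *\<^sub>R sinW (n - 1))"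
    proof (rule wiener_eqI)
      fix x
      have c: "sin ((?r + 1) * x) = sin (?r * x) * cos x + cos (?r * x) * sin x"
        "sin ((?r - 1) * x) = sin (?r * x) * cos x - cos (?r * x) * sin x"
        by (simp_all add: distrib_right left_diff_distrib sin_add sin_diff)
      have "fn (f1' * f1' + f2' * f2' + f3' * f3') x = s\<^sup>2 * (?r * sin (?r * x) * (?r * sin (?r * x)) + (\<sigma> * \<sigma>) * (sin x * sin x)
          + ?r * cos (?r * x) * (?r * cos (?r * x)) + cos x * cos x) + 2 * \<sigma> * s\<^sup>2 * ?r * (cos (?r * x) * sin x)"
        by (simp add: f1'_def f2'_def f3'_def power2_eq_square algebra_simps)
      also have "\<dots> = s\<^sup>2 * (?r\<^sup>2 + 1) + 2 * \<sigma> * s\<^sup>2 * ?r * (cos (?r * x) * sin x)"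
        unfolding \<sigma> mult_1 trig_step_cos ..
      also have "\<dots> = fn ((\<sigma> * s\<^sup>2 * ?r) *\<^sub>R sinW (n + 1) + ((s\<^sup>2 * (?r\<^sup>2 + 1)) *\<^sub>R 1 + (- \<sigma> * s\<^sup>2 * ?r) *\<^sub>R sinW (n - 1))) x"
        by (simp add: c) (simp add: algebra_simps)
      finally show "fn (f1' * f1' + f2' * f2' + f3' * f3') x =
        fn ((\<sigma> * s\<^sup>2 * ?r) *\<^sub>R sinW (n + 1) + ((s\<^sup>2 * (?r\<^sup>2 + 1)) *\<^sub>R 1 + (- \<sigma> * s\<^sup>2 * ?r) *\<^sub>R sinW (n - 1))) x" .
    qed
    ultimately show "\<exists>g. accessible_line g \<and> (\<sigma> * s\<^sup>2 * ?r) *\<^sub>R sinW (n + 1) + g \<in> accessible"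
      by (intro exI[of _ "(s\<^sup>2 * (?r\<^sup>2 + 1)) *\<^sub>R 1 + (- \<sigma> * s\<^sup>2 * ?r) *\<^sub>R sinW (n - 1)"] conjI lines) simp
  qed
  ultimately show ?case by (simp only: n)
qed

definition fourier_sum :: "nat \<Rightarrow> wiener \<Rightarrow> wiener" where
  "fourier_sum N f = (\<Sum>n\<le>N. (if n = 0 then Re (coef f 0) else 2 * Re (coef f (int n))) *\<^sub>R cosW (int n)
     + (- 2 * Im (coef f (int n))) *\<^sub>R sinW (int n))"

lemma coef_fourier_sum: "coef (fourier_sum N f) k = (if \<bar>k\<bar> \<le> int N then coef f k else 0)"
proof -
  have im0: "Im (coef f 0) = 0"
    using coef_cnj[of f 0] by (simp add: complex_eq_iff)
  have "coef ((if n = 0 then Re (coef f 0) else 2 * Re (coef f (int n))) *\<^sub>R cosW (int n) + (- 2 * Im (coef f (int n))) *\<^sub>R sinW (int n)) k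
      = (if n = nat \<bar>k\<bar> then coef f k else 0)" for n
  proof (cases "n = nat \<bar>k\<bar>")
    case True
    consider "k = 0" | "k > 0" "int n = k" | "k < 0" "int n = - k" using True by linarith
    then show ?thesis
    proof cases
      case 1
      then show ?thesis using True by (simp add: coef_simps(3,4) coef_cosW coef_sinW im0 complex_eq_iff)
    next
      case 2
      then show ?thesis using True by (simp add: coef_simps(3,4) coef_diff coef_uminus coef_cosW coef_sinW complex_eq_iff)
    next
      case 3
      then show ?thesis using True coef_cnj[of f "- k"] by (simp add: coef_simps(3,4) coef_diff coef_uminus coef_cosW coef_sinW complex_eq_iff)
    qed
  next
    case False
    then have "k \<noteq> int n" "k \<noteq> - int n" by auto
    then show ?thesis using False by (simp add: coef_simps(3,4) coef_diff coef_uminus coef_cosW coef_sinW)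
  qed
  then have "coef (fourier_sum N f) k = (\<Sum>n\<le>N. if n = nat \<bar>k\<bar> then coef f k else 0)"
    unfolding fourier_sum_def coef_sum by (intro sum.cong) auto
  also have "\<dots> = (if nat \<bar>k\<bar> \<le> N then coef f k else 0)" by simp
  finally show ?thesis by (simp add: nat_le_iff)
qed

lemma fourier_sum_tendsto: "(\<lambda>N. fourier_sum N f) \<longlonglongrightarrow> f"
proof (rule LIMSEQ_I)
  fix r :: real assume "r > 0"
  have h: "((\<lambda>k. norm (coef f k)) has_sum norm f) UNIV"
    unfolding norm_wiener_def by (rule has_sum_infsum[OF coef_summable])
  obtain X where X: "finite X" "dist (\<Sum>k\<in>X. norm (coef f k)) (norm f) \<le> r / 2"
    using has_sum_finite_approximation[OF h, of "r / 2"] \<open>r > 0\<close> by auto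
  obtain N where N: "\<And>k. k \<in> X \<Longrightarrow> \<bar>k\<bar> \<le> int N"
    using finite_nat_set_iff_bounded_le[of "(\<lambda>k. nat \<bar>k\<bar>) ` X"] X(1) by (auto simp: nat_le_iff)
  show "\<exists>N. \<forall>n\<ge>N. norm (fourier_sum n f - f) < r"
  proof (intro exI allI impI)
    fix n assume n: "n \<ge> N"
    have "norm (fourier_sum n f - f) = (\<Sum>\<^sub>\<infinity>k. norm (coef (fourier_sum n f - f) k))"
      by (simp add: norm_wiener_def)
    also have "\<dots> \<le> (\<Sum>\<^sub>\<infinity>k\<in>UNIV - X. norm (coef f k))"
    proof (rule infsum_mono_neutral)
      show "(\<lambda>k. norm (coef (fourier_sum n f - f) k)) summable_on UNIV" by (rule coef_summable)
      show "(\<lambda>k. norm (coef f k)) summable_on UNIV - X"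
        by (rule summable_on_subset_banach[OF coef_summable]) auto
      show "norm (coef (fourier_sum n f - f) k) \<le> 0" if "k \<in> UNIV - (UNIV - X)" for k
        using N[of k] that n by (auto simp: coef_diff coef_fourier_sum)
    qed (auto simp: coef_diff coef_fourier_sum)
    also have "\<dots> = norm f - (\<Sum>k\<in>X. norm (coef f k))"
      using infsum_Un_disjoint[of "\<lambda>k. norm (coef f k)" "UNIV - X" X] X(1)
        summable_on_subset_banach[OF coef_summable[of f], of "UNIV - X"]
      by (simp add: norm_wiener_def Un_commute Diff_Int_distrib2)
    also have "\<dots> < r" using X(2) \<open>r > 0\<close> unfolding dist_real_def by linarith
    finally show "norm (fourier_sum n f - f) < r" .
  qed
qed

theorem reach_exp: "reach 0 (\<lambda>y. exp f * y)"
proof -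
  have "fourier_sum N f \<in> accessible" for N
  proof -
    have "accessible_line (fourier_sum N f)"
      unfolding fourier_sum_def
      by (intro accessible_line_sum accessible_line_add accessible_line_scaleR) (use accessible_modes in auto)
    then show ?thesis unfolding accessible_line_def by (metis scaleR_one)
  qed
  from accessible_limit[OF this fourier_sum_tendsto] show ?thesis
    by (simp add: accessible_def)
qed

text \<open>The target is approached in some time t <= T. For the rest of the interval the potential
  is 0, which fixes the constant c and does not enlarge the error, \<open>S\<close> being a
  contraction.\<close>

lemma linear_approximate_control:
  assumes T: "T > 0" and "\<epsilon> > 0" and f: "exp f * y0 = c *\<^sub>R 1"
  shows "\<exists>v y. continuous_on {0..T} v \<and> (\<forall>r. v r \<in> trig1) \<and> heat_sol 0 T y (\<lambda>r. v r * y r) \<and> y 0 = y0 \<and>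
    norm (y T - c *\<^sub>R 1) < \<epsilon>"
proof -
  obtain t v B where t: "0 \<le> t" "t \<le> 0 + T" and B: "propagator t v B" and n: "norm (B y0 - exp f * y0) < \<epsilon>"
    using reach_exp[of f] assms(1,2) unfolding reach_def by blast
  obtain u where "propagator (t + (T - t)) u (\<lambda>x. S (T - t) (B x))"
    using propagator_compose[OF t(1) _ B propagator_S[of "T - t"]] t by auto
  then have "propagator T u (\<lambda>x. S (T - t) (B x))" by simp
  then obtain y where y: "continuous_on {0..T} u" "\<forall>r. u r \<in> trig1" "heat_sol 0 T y (\<lambda>r. u r * y r)" "y 0 = y0" "y T = S (T - t) (B y0)"
    unfolding propagator_def by blast
  have "norm (y T - c *\<^sub>R 1) = norm (S (T - t) (B y0 - c *\<^sub>R 1))"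
    by (simp only: y S_simps(2) S_const)
  also have "\<dots> \<le> norm (B y0 - c *\<^sub>R 1)" by (rule norm_S_le)
  finally show ?thesis using y n f by (intro exI[of _ u] exI[of _ y]) auto
qed

section \<open>Fourier series of smooth functions\<close>

lemma periodic_2pi_int: "periodic_2pi f \<Longrightarrow> f (x + of_int n * (2 * pi)) = f x"
proof -
  assume "periodic_2pi f"
  then interpret periodic_fun_simple f "2 * pi" by unfold_locales (simp add: periodic_2pi_def)
  show ?thesis by (rule plus_of_int)
qed

lemma periodic_2pi_cis:
  assumes f: "periodic_2pi f" and "cis x = cis y"
  shows "f x = f y"
proof -
  have "sin x = sin y \<and> cos x = cos y" using assms(2) by (simp add: complex_eq_iff)
  then obtain n :: int where "x = y + 2 * pi * of_int n" by (auto simp: sin_cos_eq_iff)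
  then have "x = y + of_int n * (2 * pi)" by simp
  then show ?thesis using periodic_2pi_int[OF f] by blast
qed

lemma cis_Arg2pi: "cis (Arg2pi (cis x)) = cis x"
  using complex_norm_eq_1_exp[of "cis x"] by (simp add: cis_conv_exp)

text \<open>Moves a periodic function to the circle, where Stone-Weierstrass applies. The jump of
  \<open>Arg2pi\<close> across the positive real axis is invisible to f by periodicity; on that axis
  the branch rotated by \<pi> is used.\<close>

lemma continuous_on_circle:
  assumes f: "continuous_on UNIV f" and p: "periodic_2pi f"
  shows "continuous_on (sphere 0 1) (\<lambda>z. f (Arg2pi z))"
proof (rule continuous_at_imp_continuous_on, rule ballI)
  fix z :: complex assume z: "z \<in> sphere 0 1"
  have fc: "continuous (at y) f" for y using f by (simp add: continuous_on_eq_continuous_at)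
  have at: "isCont (\<lambda>z. f (Arg2pi z)) z" if "z \<notin> \<real>\<^sub>\<ge>\<^sub>0" for z
    by (rule isCont_o2[OF continuous_at_Arg2pi[OF that] fc])
  show "isCont (\<lambda>z. f (Arg2pi z)) z"
  proof (cases "z \<in> \<real>\<^sub>\<ge>\<^sub>0")
    case False then show ?thesis by (rule at)
  next
    case True
    with z have "- z \<notin> \<real>\<^sub>\<ge>\<^sub>0" by (auto elim!: nonneg_Reals_cases)
    have "isCont (\<lambda>z. f (Arg2pi z + pi)) (- z)"
      by (rule isCont_o2[OF continuous_at_Arg2pi[OF \<open>- z \<notin> \<real>\<^sub>\<ge>\<^sub>0\<close>]]) (intro isCont_o2[OF _ fc] continuous_intros)
    then have "isCont (\<lambda>z. f (Arg2pi (- z) + pi)) z"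
      by (rule isCont_o2[rotated]) (intro continuous_intros)
    moreover have "\<forall>\<^sub>F w in nhds z. f (Arg2pi (- w) + pi) = f (Arg2pi w)"
    proof -
      have "\<forall>\<^sub>F w in nhds z. w \<noteq> 0" using z by (intro t1_space_nhds) auto
      then show ?thesis
      proof eventually_elim
        case (elim w)
        have "Arg2pi w = Arg2pi w + pi - pi" by simp
        moreover have "f (Arg2pi w + 2 * pi) = f (Arg2pi w)" using p by (simp add: periodic_2pi_def)
        ultimately show ?case using Arg2pi_minus[OF elim] by (auto simp: algebra_simps)
      qed
    qed
    ultimately show ?thesis
      using isCont_cong[of "\<lambda>w. f (Arg2pi (- w) + pi)" "\<lambda>w. f (Arg2pi w)" z] by simp
  qed
qed

lemma fcoef_sum_cont:
  assumes "continuous_on UNIV f" "continuous_on UNIV g"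
  shows "fcoef (\<lambda>x. f x + g x) k = fcoef f k + fcoef g k"
proof -
  have i: "(\<lambda>x. complex_of_real (h x) * cis (- (of_int k * x))) integrable_on {0..2 * pi}"
    if "continuous_on UNIV h" for h
    by (intro integrable_continuous_real continuous_intros continuous_on_subset[OF that]) auto
  show ?thesis
    using Henstock_Kurzweil_Integration.integral_add[OF i[OF assms(1)] i[OF assms(2)]]
    by (simp add: fcoef_def distrib_right add_divide_distrib)
qed

lemma fcoef_scale: "fcoef (\<lambda>x. r * f x) k = of_real r * fcoef f k"
  by (simp add: fcoef_def mult.assoc)

lemma fcoef_modulated:
  assumes f: "continuous_on UNIV f"
  shows "fcoef (\<lambda>x. f x * cos x) k = (fcoef f (k - 1) + fcoef f (k + 1)) / 2"
    and "fcoef (\<lambda>x. f x * sin x) k = (fcoef f (k - 1) - fcoef f (k + 1)) / (2 * \<i>)"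
proof -
  have h: "((\<lambda>x. complex_of_real (f x) * cis (- (of_int k * x))) has_integral 2 * pi * fcoef f k) {0..2 * pi}" for k
  proof -
    have "(\<lambda>x. complex_of_real (f x) * cis (- (of_int k * x))) integrable_on {0..2 * pi}"
      by (intro integrable_continuous_real continuous_intros continuous_on_subset[OF f]) auto
    then show ?thesis by (simp add: fcoef_def has_integral_integral)
  qed
  have e: "cis (- (of_int (k - 1) * x)) = cis (- (of_int k * x)) * cis x"
    "cis (- (of_int (k + 1) * x)) = cis (- (of_int k * x)) * cis (- x)" for x
    by (simp_all add: cis_mult algebra_simps)
  have c: "complex_of_real (cos x) = (cis x + cis (- x)) / 2" "complex_of_real (sin x) = (cis x - cis (- x)) / (2 * \<i>)" for x
    by (simp_all add: complex_eq_iff)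
  have "((\<lambda>x. complex_of_real (f x * cos x) * cis (- (of_int k * x))) has_integral
      (2 * pi * fcoef f (k - 1) + 2 * pi * fcoef f (k + 1)) / 2) {0..2 * pi}"
    using has_integral_divide[OF has_integral_add[OF h[of "k - 1"] h[of "k + 1"]], of 2]
    by (rule has_integral_cong[THEN iffD1, rotated]) (simp only: e c of_real_mult, simp add: field_simps)
  from integral_unique[OF this] show "fcoef (\<lambda>x. f x * cos x) k = (fcoef f (k - 1) + fcoef f (k + 1)) / 2"
    by (simp add: fcoef_def field_simps)
  have "((\<lambda>x. complex_of_real (f x * sin x) * cis (- (of_int k * x))) has_integral
      (2 * pi * fcoef f (k - 1) - 2 * pi * fcoef f (k + 1)) / (2 * \<i>)) {0..2 * pi}"
    using has_integral_divide[OF has_integral_diff[OF h[of "k - 1"] h[of "k + 1"]], of "2 * \<i>"]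
    by (rule has_integral_cong[THEN iffD1, rotated]) (simp only: e c of_real_mult, simp add: field_simps)
  from integral_unique[OF this] show "fcoef (\<lambda>x. f x * sin x) k = (fcoef f (k - 1) - fcoef f (k + 1)) / (2 * \<i>)"
    by (simp add: fcoef_def field_simps)
qed

text \<open>Multiplication by cos or sin only combines neighbouring coefficients, so the vanishing
  of all of them persists under multiplication by polynomials in cos x and sin x.\<close>

lemma fcoef_mult_polynomial:
  assumes "real_polynomial_function P"
  shows "continuous_on UNIV (\<lambda>x. P (cis x)) \<and>
    (\<forall>f. continuous_on UNIV f \<longrightarrow> (\<forall>k. fcoef f k = 0) \<longrightarrow> (\<forall>k. fcoef (\<lambda>x. f x * P (cis x)) k = 0))"
  using assms
proof induction
  case (linear P)
  then interpret bounded_linear P .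
  have "cis x = cos x *\<^sub>R 1 + sin x *\<^sub>R \<i>" for x by (simp add: complex_eq_iff)
  then have P: "P (cis x) = cos x * P 1 + sin x * P \<i>" for x by (simp add: add scaleR)
  have "(\<lambda>x. f x * P (cis x)) = (\<lambda>x. P 1 * (f x * cos x) + P \<i> * (f x * sin x))" for f :: "real \<Rightarrow> real"
    by (simp add: P algebra_simps fun_eq_iff)
  moreover have "fcoef (\<lambda>x. P 1 * (f x * cos x) + P \<i> * (f x * sin x)) k = 0"
    if f: "continuous_on UNIV f" and "\<forall>k. fcoef f k = 0" for f k
    by (subst fcoef_sum_cont, (intro continuous_intros f)+)
      (simp add: fcoef_scale fcoef_modulated[OF f] that(2))
  moreover have "continuous_on UNIV (\<lambda>x. P (cis x))"
    unfolding P by (intro continuous_intros)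
  ultimately show ?case by simp
next
  case (const c)
  then show ?case by (simp add: fcoef_scale mult.commute[of _ c])
next
  case (add P Q)
  have "fcoef (\<lambda>x. f x * P (cis x) + f x * Q (cis x)) k = fcoef (\<lambda>x. f x * P (cis x)) k + fcoef (\<lambda>x. f x * Q (cis x)) k"
    if "continuous_on UNIV f" for f k
    by (intro fcoef_sum_cont continuous_on_mult that add.IH[THEN conjunct1])
  with add.IH show ?case by (simp add: distrib_left continuous_on_add)
next
  case (mult P Q)
  show ?case
  proof (intro conjI allI impI)
    show "continuous_on UNIV (\<lambda>x. P (cis x) * Q (cis x))" using mult.IH by (intro continuous_on_mult) auto
    fix f k assume f: "continuous_on UNIV f" "\<forall>k. fcoef f k = 0"
    have "continuous_on UNIV (\<lambda>x. f x * P (cis x))" using mult.IH(1) f by (intro continuous_on_mult) auto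
    moreover have "\<forall>k. fcoef (\<lambda>x. f x * P (cis x)) k = 0" using mult.IH(1) f by blast
    ultimately have "fcoef (\<lambda>x. f x * P (cis x) * Q (cis x)) k = 0" using mult.IH(2) by blast
    then show "fcoef (\<lambda>x. f x * (P (cis x) * Q (cis x))) k = 0" by (simp add: mult.assoc)
  qed
qed

text \<open>f is orthogonal to every polynomial P in cos and sin, and P can be taken uniformly
  e-close to f; hence the integral of f^2 is at most e times that of |f|, for every e > 0.\<close>

lemma fourier_uniqueness:
  fixes f :: "real \<Rightarrow> real"
  assumes f: "continuous_on UNIV f" and p: "periodic_2pi f" and z: "\<And>k. fcoef f k = 0"
  shows "f x = 0"
proof -
  have fi: "continuous_on {0..2 * pi} f" by (rule continuous_on_subset[OF f]) auto
  have le: "integral {0..2 * pi} (\<lambda>x. f x * f x) \<le> e * integral {0..2 * pi} (\<lambda>x. \<bar>f x\<bar>)" if "e > 0" for e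
  proof -
    obtain P where P: "real_polynomial_function P" and Pe: "\<And>z. z \<in> sphere 0 1 \<Longrightarrow> \<bar>f (Arg2pi z) - P z\<bar> < e"
      using Stone_Weierstrass_real_polynomial_function[OF _ continuous_on_circle[OF f p] \<open>e > 0\<close>] by auto
    have "\<bar>f x - P (cis x)\<bar> < e" for x
      using Pe[of "cis x"] periodic_2pi_cis[OF p cis_Arg2pi] by simp
    then have b: "f x * f x - f x * P (cis x) \<le> e * \<bar>f x\<bar>" for x
    proof -
      have "f x * f x - f x * P (cis x) \<le> \<bar>f x\<bar> * \<bar>f x - P (cis x)\<bar>"
        unfolding abs_mult[symmetric] by (simp add: right_diff_distrib)
      also have "\<dots> \<le> \<bar>f x\<bar> * e"
        using \<open>\<And>x. \<bar>f x - P (cis x)\<bar> < e\<close>[of x] by (intro mult_left_mono) auto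
      finally show ?thesis by (simp add: mult.commute)
    qed
    have Pc: "continuous_on {0..2 * pi} (\<lambda>x. P (cis x))"
      using fcoef_mult_polynomial[OF P] continuous_on_subset by blast
    have "fcoef (\<lambda>x. f x * P (cis x)) 0 = 0" using fcoef_mult_polynomial[OF P] f z by blast
    moreover have "integral {0..2 * pi} (\<lambda>x. complex_of_real (f x * P (cis x))) = of_real (integral {0..2 * pi} (\<lambda>x. f x * P (cis x)))"
      using integral_linear[OF integrable_continuous_real bounded_linear_of_real[where 'a = complex], of 0 "2 * pi" "\<lambda>x. f x * P (cis x)"] fi Pc
      by (simp only: o_def continuous_on_mult)
    ultimately have 0: "integral {0..2 * pi} (\<lambda>x. f x * P (cis x)) = 0"
      by (simp add: fcoef_def)
    have "integral {0..2 * pi} (\<lambda>x. f x * f x - f x * P (cis x)) \<le> integral {0..2 * pi} (\<lambda>x. e * \<bar>f x\<bar>)"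
      by (intro integral_le integrable_continuous_real continuous_intros fi Pc b)
    moreover have "integral {0..2 * pi} (\<lambda>x. f x * f x - f x * P (cis x)) = integral {0..2 * pi} (\<lambda>x. f x * f x) - 0"
      by (subst Henstock_Kurzweil_Integration.integral_diff) (auto simp: 0 intro!: integrable_continuous_real continuous_intros fi Pc)
    ultimately show ?thesis by simp
  qed
  have "integral {0..2 * pi} (\<lambda>x. f x * f x) \<le> 0"
  proof (rule tendsto_lowerbound)
    show "((\<lambda>e. e * integral {0..2 * pi} (\<lambda>x. \<bar>f x\<bar>)) \<longlongrightarrow> 0) (at_right 0)"
      by (rule tendsto_eq_intros | simp)+
    show "\<forall>\<^sub>F e in at_right 0. integral {0..2 * pi} (\<lambda>x. f x * f x) \<le> e * integral {0..2 * pi} (\<lambda>x. \<bar>f x\<bar>)"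
      unfolding eventually_at_right_field using le by (auto intro!: exI[of _ 1])
  qed simp
  moreover have "integral {0..2 * pi} (\<lambda>x. f x * f x) \<ge> 0"
    by (intro integral_nonneg integrable_continuous_real continuous_intros fi) auto
  ultimately have "((\<lambda>x. f x * f x) has_integral 0) (cbox 0 (2 * pi))"
    by (intro has_integral_integrable_integral[THEN iffD2] conjI) (auto intro!: integrable_continuous_real continuous_intros fi)
  then have "f y * f y = 0" if "y \<in> cbox 0 (2 * pi)" for y
    by (rule has_integral_0_cbox_imp_0[rotated 2, where f = "\<lambda>x. f x * f x"]) (use that fi pi_gt_zero in \<open>auto intro!: continuous_intros simp: not_le\<close>)
  moreover have "f x = f (Arg2pi (cis x))" by (rule periodic_2pi_cis[OF p cis_Arg2pi[symmetric]])
  moreover have "Arg2pi (cis x) \<in> cbox 0 (2 * pi)" using Arg2pi[of "cis x"] by auto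
  ultimately show ?thesis by auto
qed

lemma fcoef_cnj: "continuous_on UNIV f \<Longrightarrow> fcoef f (- k) = cnj (fcoef f k)"
proof -
  assume f: "continuous_on UNIV f"
  have "(\<lambda>x. complex_of_real (f x) * cis (- (of_int k * x))) integrable_on {0..2 * pi}"
    by (intro integrable_continuous_real continuous_intros continuous_on_subset[OF f]) auto
  from integral_linear[OF this bounded_linear_cnj] show ?thesis
    by (simp add: fcoef_def o_def cis_cnj)
qed

text \<open>The sum of the Fourier series has the same coefficients as f, so uniqueness identifies
  the two functions.\<close>

lemma wiener_fun_summable:
  fixes f :: "real \<Rightarrow> real"
  assumes f: "continuous_on UNIV f" and p: "periodic_2pi f" and s: "(\<lambda>k. norm (fcoef f k)) summable_on UNIV"
  shows "wiener_fun f"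
proof -
  define g where "g = of_coef (fcoef f)"
  have g: "coef g = fcoef f" unfolding g_def by (rule coef_of_coef[OF s fcoef_cnj[OF f]])
  have "f x + (-1) * fn g x = 0" for x
  proof (rule fourier_uniqueness[where f = "\<lambda>x. f x + (-1) * fn g x"])
    show "continuous_on UNIV (\<lambda>x. f x + (-1) * fn g x)" by (intro continuous_intros f continuous_on_fn)
    show "periodic_2pi (\<lambda>x. f x + (-1) * fn g x)" using p fn_periodic by (simp add: periodic_2pi_def)
    show "fcoef (\<lambda>x. f x + (-1) * fn g x) k = 0" for k
      using fun_cong[OF g, of k] unfolding coef_def
      by (subst fcoef_sum_cont) (auto simp only: fcoef_scale intro!: f continuous_intros continuous_on_fn, simp)
  qed
  then have "f = fn g" by (auto simp: fun_eq_iff)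
  then show ?thesis by simp
qed

lemma summable_on_int:
  fixes g :: "int \<Rightarrow> real"
  assumes s: "summable (\<lambda>n. g (int n))" and "\<And>k. g k \<ge> 0" and "\<And>k. g (- k) = g k"
  shows "g summable_on UNIV"
proof -
  have "g summable_on range int"
    by (subst summable_on_reindex) (use assms in \<open>auto simp: o_def inj_on_def intro!: summable_nonneg_imp_summable_on\<close>)
  moreover have "g summable_on range (\<lambda>n. - int (Suc n))"
    by (subst summable_on_reindex)
      (use assms(2,3) s[THEN summable_Suc_iff[THEN iffD2]] in \<open>auto simp: o_def inj_on_def simp del: of_nat_Suc intro!: summable_nonneg_imp_summable_on\<close>)
  moreover have "range int \<inter> range (\<lambda>n. - int (Suc n)) = {}" by auto
  ultimately have "g summable_on (range int \<union> range (\<lambda>n. - int (Suc n)))"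
    by (rule summable_on_Un_disjoint)
  moreover have "range int \<union> range (\<lambda>n. - int (Suc n)) = UNIV"
  proof -
    have "k \<in> range int \<union> range (\<lambda>n. - int (Suc n))" for k
      by (cases k rule: int_cases) auto
    then show ?thesis by blast
  qed
  ultimately show ?thesis by simp
qed

lemma summable_inverse_weight: "summable (\<lambda>n. 1 / (1 + (real n)\<^sup>2))"
proof (rule summable_comparison_test)
  show "summable (\<lambda>n. inverse ((real n)\<^sup>2))" by (rule inverse_power_summable) auto
  show "\<exists>N. \<forall>n\<ge>N. norm (1 / (1 + (real n)\<^sup>2)) \<le> inverse ((real n)\<^sup>2)"
    by (intro exI[of _ 1] allI impI) (auto simp: field_simps add_pos_nonneg)
qed

lemma fcoef_second_derivative:
  assumes f: "\<And>x. (f has_real_derivative f' x) (at x)" "\<And>x. (f' has_real_derivative f'' x) (at x)"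
    and c: "continuous_on UNIV f''" and p: "periodic_2pi f" "periodic_2pi f'"
  shows "fcoef f'' k = - ((of_int k)\<^sup>2 * fcoef f k)"
proof -
  \<comment> \<open>Both integrations by parts at once: the derivative of G is (f'' + k^2 f) exp (-i
    k x), and periodicity gives G equal values at the two ends.\<close>
  let ?G = "\<lambda>x. (complex_of_real (f' x) + \<i> * of_int k * complex_of_real (f x)) * cis (- (of_int k * x))"
  have fc: "continuous_on UNIV f" by (rule DERIV_continuous_on, rule has_field_derivative_at_within, rule f)
  have d: "((\<lambda>x. cis (- (of_int k * x))) has_vector_derivative - (\<i> * of_int k) * cis (- (of_int k * x))) (at x within X)" for x X
    unfolding cis_conv_exp
    by (auto intro!: derivative_eq_intros has_vector_derivative_real_field)
  have fd: "((\<lambda>x. complex_of_real (f x)) has_vector_derivative complex_of_real (f' x)) (at x within X)"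
    "((\<lambda>x. complex_of_real (f' x)) has_vector_derivative complex_of_real (f'' x)) (at x within X)" for x X
    using f[of x] by (auto intro!: has_vector_derivative_of_real has_field_derivative_at_within)
  have "((\<lambda>x. complex_of_real (f'' x) * cis (- (of_int k * x)) + (of_int k)\<^sup>2 * (complex_of_real (f x) * cis (- (of_int k * x))))
      has_integral ?G (2 * pi) - ?G 0) {0..2 * pi}"
  proof (rule fundamental_theorem_of_calculus)
    fix x
    have "(?G has_vector_derivative
        (complex_of_real (f' x) + \<i> * of_int k * complex_of_real (f x)) * (- (\<i> * of_int k) * cis (- (of_int k * x)))
        + (complex_of_real (f'' x) + \<i> * of_int k * complex_of_real (f' x)) * cis (- (of_int k * x))) (at x within {0..2 * pi})"
      by (intro has_vector_derivative_mult d has_vector_derivative_add fd has_vector_derivative_mult_right)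
    then show "(?G has_vector_derivative complex_of_real (f'' x) * cis (- (of_int k * x))
        + (of_int k)\<^sup>2 * (complex_of_real (f x) * cis (- (of_int k * x)))) (at x within {0..2 * pi})"
      by (rule has_vector_derivative_eq_rhs) (simp add: algebra_simps power2_eq_square)
  qed simp
  moreover have "?G (2 * pi) = ?G 0"
  proof -
    have "f (2 * pi) = f 0" "f' (2 * pi) = f' 0" using p by (metis add_0 periodic_2pi_def)+
    moreover have "cis (- (of_int k * (2 * pi))) = 1"
      using cis_multiple_2pi[of "of_int (- k)"] by (simp add: mult.commute mult.left_commute)
    ultimately show ?thesis by simp
  qed
  ultimately have "((\<lambda>x. complex_of_real (f'' x) * cis (- (of_int k * x)) + (of_int k)\<^sup>2 * (complex_of_real (f x) * cis (- (of_int k * x))))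
      has_integral 0) {0..2 * pi}" by simp
  moreover have "((\<lambda>x. complex_of_real (f'' x) * cis (- (of_int k * x)) + (of_int k)\<^sup>2 * (complex_of_real (f x) * cis (- (of_int k * x))))
      has_integral 2 * pi * fcoef f'' k + (of_int k)\<^sup>2 * (2 * pi * fcoef f k)) {0..2 * pi}"
  proof -
    have h: "((\<lambda>x. complex_of_real (g x) * cis (- (of_int k * x))) has_integral 2 * pi * fcoef g k) {0..2 * pi}"
      if "continuous_on UNIV g" for g
    proof -
      have "(\<lambda>x. complex_of_real (g x) * cis (- (of_int k * x))) integrable_on {0..2 * pi}"
        by (intro integrable_continuous_real continuous_intros continuous_on_subset[OF that]) auto
      then show ?thesis by (simp add: fcoef_def has_integral_integral)
    qed
    show ?thesis by (intro has_integral_add has_integral_mult_right h c fc)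
  qed
  ultimately have "2 * pi * fcoef f'' k + (of_int k)\<^sup>2 * (2 * pi * fcoef f k) = 0"
    by (rule has_integral_unique[symmetric])
  then have "complex_of_real (2 * pi) * (fcoef f'' k + (of_int k)\<^sup>2 * fcoef f k) = 0"
    by (simp add: algebra_simps)
  then show ?thesis by (simp add: add_eq_0_iff)
qed

lemma norm_fcoef_le:
  assumes "continuous_on UNIV f" and "\<And>x. x \<in> {0..2 * pi} \<Longrightarrow> \<bar>f x\<bar> \<le> B"
  shows "norm (fcoef f k) \<le> B"
proof -
  have "norm (integral {0..2 * pi} (\<lambda>x. complex_of_real (f x) * cis (- (of_int k * x)))) \<le> B * (2 * pi - 0)"
    by (rule integral_bound) (use assms in \<open>auto simp: norm_mult intro!: continuous_intros intro: continuous_on_subset\<close>)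
  then show ?thesis by (simp add: fcoef_def norm_divide norm_mult field_simps)
qed

lemma wiener_fun_C2:
  fixes f :: "real \<Rightarrow> real"
  assumes f: "\<And>x. (f has_real_derivative f' x) (at x)" "\<And>x. (f' has_real_derivative f'' x) (at x)"
    and c: "continuous_on UNIV f''" and p: "periodic_2pi f" "periodic_2pi f'"
  shows "wiener_fun f"
proof (rule wiener_fun_summable[OF _ p(1)])
  show fc: "continuous_on UNIV f" by (rule DERIV_continuous_on, rule has_field_derivative_at_within, rule f)
  obtain B where B: "\<And>x. x \<in> {0..2 * pi} \<Longrightarrow> \<bar>f x\<bar> \<le> B"
    using continuous_norm_bound[OF continuous_on_subset[OF fc subset_UNIV]] by (metis real_norm_def)
  obtain C where C: "\<And>x. x \<in> {0..2 * pi} \<Longrightarrow> \<bar>f'' x\<bar> \<le> C"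
    using continuous_norm_bound[OF continuous_on_subset[OF c subset_UNIV]] by (metis real_norm_def)
  have b: "norm (fcoef f (int n)) \<le> (B + C) * (1 / (1 + (real n)\<^sup>2))" for n
  proof -
    have "norm (fcoef f (int n)) + (real n)\<^sup>2 * norm (fcoef f (int n)) \<le> B + C"
      using norm_fcoef_le[OF fc B, of "int n"] norm_fcoef_le[OF c C, of "int n"]
      by (simp add: fcoef_second_derivative[OF f c p] norm_mult norm_power)
    then show ?thesis by (simp add: field_simps add_pos_nonneg)
  qed
  show "(\<lambda>k. norm (fcoef f k)) summable_on UNIV"
  proof (rule summable_on_int)
    show "summable (\<lambda>n. norm (fcoef f (int n)))"
      by (rule summable_comparison_test[OF _ summable_mult[OF summable_inverse_weight, of "B + C"]]) (use b in auto)
  qed (auto simp: fcoef_cnj[OF fc])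
qed

section \<open>Real Fourier series and the space H3\<close>

lemma fn_sums:
  "(\<lambda>n. (if n = 0 then Re (coef f 0) else 2 * Re (coef f (int n))) * cos (real n * x)
      - 2 * Im (coef f (int n)) * sin (real n * x)) sums fn f x"
proof -
  have "(\<lambda>N. fn (fourier_sum N f) x) \<longlonglongrightarrow> fn f x"
    by (rule bounded_linear.tendsto[OF bounded_linear_fn fourier_sum_tendsto])
  then show ?thesis unfolding sums_def_le fourier_sum_def by (simp add: fn_sum)
qed

text \<open>Termwise differentiation: the differentiated series is that of g, and it converges
  uniformly because the norm of the algebra dominates the sup norm.\<close>

lemma fn_has_derivative:
  assumes "\<And>k. coef g k = \<i> * of_int k * coef f k"
  shows "(fn f has_real_derivative fn g x) (at x)"
proof -
  let ?u = "\<lambda>f n x. (if n = 0 then Re (coef f 0) else 2 * Re (coef f (int n))) * cos (real n * x)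
      - 2 * Im (coef f (int n)) * sin (real n * x)"
  have "\<exists>h. \<forall>x\<in>UNIV. (\<lambda>n. ?u f n x) sums h x \<and> (h has_field_derivative fn g x) (at x within UNIV)"
  proof (rule has_field_derivative_series)
    show "(?u f n has_field_derivative ?u g n x) (at x within UNIV)" for n x
      by (auto intro!: derivative_eq_intros simp: assms algebra_simps)
    show "uniform_limit UNIV (\<lambda>n x. \<Sum>i<n. ?u g i x) (fn g) sequentially"
    proof (rule uniform_limitI)
      fix e :: real assume "e > 0"
      then obtain N where N: "\<And>n. n \<ge> N \<Longrightarrow> norm (fourier_sum n g - g) < e"
        using LIMSEQ_D[OF fourier_sum_tendsto[of g]] by blast
      show "\<forall>\<^sub>F n in sequentially. \<forall>x\<in>UNIV. dist (\<Sum>i<n. ?u g i x) (fn g x) < e"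
        unfolding eventually_sequentially
      proof (intro exI[of _ "Suc N"] allI impI ballI)
        fix n x assume "Suc N \<le> n"
        then obtain m where m: "n = Suc m" "m \<ge> N" by (cases n) auto
        have "\<bar>fn (fourier_sum m g - g) x\<bar> < e"
          using fn_le_norm[of "fourier_sum m g - g" x] N[OF m(2)] by simp
        then show "dist (\<Sum>i<n. ?u g i x) (fn g x) < e"
          unfolding m(1) lessThan_Suc_atMost by (simp add: fourier_sum_def fn_sum dist_real_def)
      qed
    qed
  qed (use fn_sums sums_summable in auto)
  then obtain h where h: "\<And>x. (\<lambda>n. ?u f n x) sums h x" "\<And>x. (h has_field_derivative fn g x) (at x)" by auto
  have "h = fn f" using sums_unique2[OF h(1) fn_sums] by blast
  with h(2) show ?thesis by simp
qed

text \<open>The bridge from the orthonormal real modes of the statement to complex coefficients. A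
  mode k > 0 combines the frequencies k and -k, which accounts for the different factor at k =
  0.\<close>

lemma inner_L2_modes:
  assumes f: "continuous_on UNIV f"
  shows "inner_L2 f (cos_mode k) = (if k = 0 then sqrt (2 * pi) else 2 * sqrt pi) * Re (fcoef f (int k))"
    and "inner_L2 f (sin_mode k) = - (2 * sqrt pi * Im (fcoef f (int k)))"
proof -
  have LI: "(LINT x:{0..2 * pi}|lborel. h x) = integral {0..2 * pi} h" if "continuous_on {0..2 * pi} h" for h :: "real \<Rightarrow> real"
    by (rule set_borel_integral_eq_integral(2)[OF borel_integrable_atLeastAtMost'[OF that]])
  have fc: "continuous_on {0..2 * pi} f" by (rule continuous_on_subset[OF f]) auto
  have i: "(\<lambda>x. complex_of_real (f x) * cis (- (of_int (int k) * x))) integrable_on {0..2 * pi}"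
    by (intro integrable_continuous_real continuous_intros fc)
  have re: "integral {0..2 * pi} (\<lambda>x. f x * cos (real k * x)) = 2 * pi * Re (fcoef f (int k))"
    using integral_linear[OF i bounded_linear_Re] by (simp add: fcoef_def o_def Re_divide_of_real flip: of_real_mult)
  have im: "integral {0..2 * pi} (\<lambda>x. f x * sin (real k * x)) = - (2 * pi * Im (fcoef f (int k)))"
    using integral_linear[OF i bounded_linear_Im] by (simp add: fcoef_def o_def Im_divide_of_real flip: of_real_mult)
  have sq: "2 * pi / sqrt pi = 2 * sqrt pi" "2 * pi / sqrt (2 * pi) = sqrt (2 * pi)"
    using real_div_sqrt[of pi] real_div_sqrt[of "2 * pi"] by simp_all
  show "inner_L2 f (sin_mode k) = - (2 * sqrt pi * Im (fcoef f (int k)))"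
  proof -
    have "inner_L2 f (sin_mode k) = integral {0..2 * pi} (\<lambda>x. f x * sin (real k * x) / sqrt pi)"
      unfolding inner_L2_def by (subst LI) (auto simp: sin_mode_def[abs_def] intro!: continuous_intros fc)
    also have "\<dots> = - (2 * pi / sqrt pi * Im (fcoef f (int k)))" using im by simp
    finally show ?thesis unfolding sq .
  qed
  show "inner_L2 f (cos_mode k) = (if k = 0 then sqrt (2 * pi) else 2 * sqrt pi) * Re (fcoef f (int k))"
  proof (cases "k = 0")
    case True
    have "inner_L2 f (cos_mode k) = integral {0..2 * pi} (\<lambda>x. f x / sqrt (2 * pi))"
      unfolding inner_L2_def by (subst LI) (auto simp: True cos_mode_def[abs_def] intro!: continuous_intros fc)
    also have "\<dots> = 2 * pi / sqrt (2 * pi) * Re (fcoef f (int k))" using re True by simp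
    finally show ?thesis unfolding sq using True by simp
  next
    case False
    have "inner_L2 f (cos_mode k) = integral {0..2 * pi} (\<lambda>x. f x * cos (real k * x) / sqrt pi)"
      unfolding inner_L2_def by (subst LI) (auto simp: False cos_mode_def[abs_def] intro!: continuous_intros fc)
    also have "\<dots> = 2 * pi / sqrt pi * Re (fcoef f (int k))" using re by simp
    finally show ?thesis unfolding sq using False by simp
  qed
qed

lemma Im_fcoef_0: "continuous_on UNIV f \<Longrightarrow> Im (fcoef f 0) = 0"
  using fcoef_cnj[of f 0] by (simp add: complex_eq_iff)

lemma H3_weight_fcoef:
  assumes f: "continuous_on UNIV f"
  shows "H3_weight f k = (1 + (real k)\<^sup>2) ^ 3 * ((if k = 0 then 2 else 4) * pi * (norm (fcoef f (int k)))\<^sup>2)"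
  unfolding H3_weight_def inner_L2_modes[OF f] cmod_power2
  using Im_fcoef_0[OF f] by (auto simp: power_mult_distrib algebra_simps)

lemma heat_fn:
  assumes "t \<ge> 0"
  shows "heat t (fn f) x = fn (S t f) x"
proof -
  have e: "exp (- (real k)\<^sup>2 * t) *
        (inner_L2 (fn f) (cos_mode k) * cos_mode k x + inner_L2 (fn f) (sin_mode k) * sin_mode k x)
      = (if k = 0 then Re (coef (S t f) 0) else 2 * Re (coef (S t f) (int k))) * cos (real k * x)
      - 2 * Im (coef (S t f) (int k)) * sin (real k * x)" for k
  proof -
    have "sqrt (2 * pi) * (Re (coef f 0) * (1 / sqrt (2 * pi))) = Re (coef f 0)" by simp
    then show ?thesis
      using assms Im_fcoef_0[OF continuous_on_fn, of f]
      by (simp add: inner_L2_modes[OF continuous_on_fn] coef_S flip: coef_def)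
        (auto simp: cos_mode_def sin_mode_def algebra_simps)
  qed
  show ?thesis unfolding heat_def e by (rule sums_unique[symmetric, OF fn_sums])
qed

text \<open>The second summability makes H3 functions twice differentiable with derivatives in the
  algebra; the third conclusion is the embedding of H3 into it.\<close>

lemma H3_summable_weight:
  assumes f: "f \<in> H3"
  shows "summable (\<lambda>k. (1 + (real k)\<^sup>2) ^ 3 * (norm (fcoef f (int k)))\<^sup>2)"
    and "summable (\<lambda>k. (1 + (real k)\<^sup>2) * norm (fcoef f (int k)))"
    and "wiener_fun f"
proof -
  have fc: "continuous_on UNIV f" and p: "periodic_2pi f" and s: "summable (H3_weight f)"
    using f by (auto simp: H3_def)
  let ?w = "\<lambda>k. 1 + (real k)\<^sup>2"
  have w: "?w k \<ge> 1" for k by simp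
  show 1: "summable (\<lambda>k. ?w k ^ 3 * (norm (fcoef f (int k)))\<^sup>2)"
  proof (rule summable_comparison_test[OF _ s], intro exI allI impI)
    fix k
    have "1 * (norm (fcoef f (int k)))\<^sup>2 \<le> ((if k = 0 then 2 else 4) * pi) * (norm (fcoef f (int k)))\<^sup>2"
      using pi_gt3 by (intro mult_right_mono) auto
    then show "norm (?w k ^ 3 * (norm (fcoef f (int k)))\<^sup>2) \<le> H3_weight f k"
      unfolding H3_weight_fcoef[OF fc] by (auto intro!: mult_left_mono)
  qed
  show 2: "summable (\<lambda>k. ?w k * norm (fcoef f (int k)))"
  proof (rule summable_comparison_test[OF _ summable_add[OF 1 summable_inverse_weight]], intro exI allI impI)
    fix k
    \<comment> \<open>With w = 1 + k^2 and a = w^2 |c_k|, the bound a <= a^2 + 1 divided by w reads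
      w |c_k| <= w^3 |c_k|^2 + 1/w, and both terms are summable.\<close>
    let ?a = "?w k ^ 2 * norm (fcoef f (int k))"
    have wp: "?w k > 0" using w[of k] by linarith
    have "2 * ?a \<le> ?a\<^sup>2 + 1" using sum_squares_bound[of ?a 1] by (simp add: algebra_simps)
    then have "?a \<le> ?a\<^sup>2 + 1" by (smt (verit) wp norm_ge_zero mult_nonneg_nonneg zero_le_power2)
    then have "?a / ?w k \<le> (?a\<^sup>2 + 1) / ?w k" using wp by (intro divide_right_mono) auto
    moreover have "?a / ?w k = ?w k * norm (fcoef f (int k))" using wp by (simp add: power2_eq_square)
    moreover have "(?a\<^sup>2 + 1) / ?w k = ?w k ^ 3 * (norm (fcoef f (int k)))\<^sup>2 + 1 / ?w k"
      using wp by (simp add: field_simps power2_eq_square power3_eq_cube)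
    ultimately show "norm (?w k * norm (fcoef f (int k))) \<le> ?w k ^ 3 * (norm (fcoef f (int k)))\<^sup>2 + 1 / (1 + (real k)\<^sup>2)"
      using wp by simp
  qed
  have "summable (\<lambda>k. norm (fcoef f (int k)))"
    by (rule summable_comparison_test[OF _ 2], intro exI allI impI) (auto simp: algebra_simps)
  then have "(\<lambda>k. norm (fcoef f k)) summable_on UNIV"
    by (rule summable_on_int) (auto simp: fcoef_cnj[OF fc])
  then show "wiener_fun f" by (rule wiener_fun_summable[OF fc p])
qed

text \<open>f has continuous second derivatives and is bounded away from 0 by positivity and
  periodicity, so ln (c / f) is twice continuously differentiable and lies in the algebra. Here the
  sign of the initial state enters.\<close>

lemma H3_log_quotient:
  assumes f: "f \<in> H3" and pos: "\<And>x. f x > 0" and c: "c > 0"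
  shows "\<exists>y0 g. fn y0 = f \<and> exp g * y0 = c *\<^sub>R 1"
proof -
  define y0 where "y0 = Wiener f"
  have y0: "fn y0 = f" unfolding y0_def by (rule fn_Wiener[OF H3_summable_weight(3)[OF f]])
  have s: "(\<lambda>k. (1 + (of_int k)\<^sup>2) * norm (coef y0 k)) summable_on UNIV"
    using H3_summable_weight(2)[OF f] unfolding coef_def y0
    by (intro summable_on_int) (auto simp: coef_cnj[of y0, unfolded coef_def y0])
  have b: "norm (\<i> * of_int k * coef y0 k) \<le> (1 + (of_int k)\<^sup>2) * norm (coef y0 k)"
    "norm (- (of_int k)\<^sup>2 * coef y0 k) \<le> (1 + (of_int k)\<^sup>2) * norm (coef y0 k)" for k :: int
  proof -
    have "\<bar>real_of_int k\<bar> \<le> 1 + (of_int k)\<^sup>2"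
      using sum_squares_bound[of "\<bar>real_of_int k\<bar>" 1] by (simp add: power2_eq_square)
    then show "norm (\<i> * of_int k * coef y0 k) \<le> (1 + (of_int k)\<^sup>2) * norm (coef y0 k)"
      by (auto simp: norm_mult intro!: mult_right_mono)
    show "norm (- (of_int k)\<^sup>2 * coef y0 k) \<le> (1 + (of_int k)\<^sup>2) * norm (coef y0 k)"
      by (auto simp: norm_mult norm_power intro!: mult_right_mono)
  qed
  define y1 where "y1 = of_coef (\<lambda>k. \<i> * of_int k * coef y0 k)"
  define y2 where "y2 = of_coef (\<lambda>k. - (of_int k)\<^sup>2 * coef y0 k)"
  have y1: "coef y1 = (\<lambda>k. \<i> * of_int k * coef y0 k)"
    unfolding y1_def
  proof (rule coef_of_coef)
    show "(\<lambda>k. norm (\<i> * of_int k * coef y0 k)) summable_on UNIV"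
      by (rule summable_on_comparison_test[OF s]) (use b in auto)
  qed (simp add: coef_cnj)
  have y2: "coef y2 = (\<lambda>k. - (of_int k)\<^sup>2 * coef y0 k)"
    unfolding y2_def
  proof (rule coef_of_coef)
    show "(\<lambda>k. norm (- (of_int k)\<^sup>2 * coef y0 k)) summable_on UNIV"
      by (rule summable_on_comparison_test[OF s]) (use b in auto)
  qed (simp add: coef_cnj)
  have d: "(f has_real_derivative fn y1 x) (at x)" "(fn y1 has_real_derivative fn y2 x) (at x)" for x
  proof -
    show "(f has_real_derivative fn y1 x) (at x)"
      using fn_has_derivative[of y1 y0 x] by (simp add: y1 y0)
    have "\<i> * of_int k * (\<i> * of_int k * coef y0 k) = (\<i> * \<i>) * ((of_int k)\<^sup>2 * coef y0 k)" for k
      by (simp only: power2_eq_square mult_ac)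
    then show "(fn y1 has_real_derivative fn y2 x) (at x)"
      by (intro fn_has_derivative) (simp add: y1 y2)
  qed
  have per: "f (x + 2 * pi) = f x" for x using f by (simp add: H3_def periodic_2pi_def)
  have nz: "f x \<noteq> 0" for x using pos[of x] by simp
  have fc: "continuous_on UNIV f" using f by (simp add: H3_def)
  have w: "wiener_fun (\<lambda>x. ln (c / f x))"
  proof (rule wiener_fun_C2)
    show "((\<lambda>x. ln (c / f x)) has_real_derivative - (fn y1 x / f x)) (at x)" for x
      by (rule derivative_eq_intros d refl | use pos[of x] c in \<open>simp add: field_simps\<close>)+
    show "((\<lambda>x. - (fn y1 x / f x)) has_real_derivative - ((fn y2 x * f x - fn y1 x * fn y1 x) / (f x * f x))) (at x)" for x
      by (rule DERIV_minus, rule DERIV_divide, (rule d nz)+)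
    show "continuous_on UNIV (\<lambda>x. - ((fn y2 x * f x - fn y1 x * fn y1 x) / (f x * f x)))"
      by (intro continuous_intros continuous_on_fn fc) (simp add: nz)
  qed (auto simp: periodic_2pi_def per fn_periodic)
  define g where "g = Wiener (\<lambda>x. ln (c / f x))"
  have "exp g * y0 = c *\<^sub>R 1"
    by (rule wiener_eqI) (use pos c nz in \<open>simp add: g_def fn_Wiener[OF w] y0\<close>)
  with y0 show ?thesis by blast
qed

section \<open>Approximate control of the nonlinear equation\<close>

lemma norm_power_diff_le:
  fixes a b :: "'a::{real_normed_algebra_1, comm_ring_1}"
  assumes "norm a \<le> B" "norm b \<le> B"
  shows "norm (a ^ Suc n - b ^ Suc n) \<le> real (Suc n) * B ^ n * norm (a - b)"
proof (induction n)
  case 0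
  then show ?case by simp
next
  case (Suc n)
  have B: "B \<ge> 0" using assms(1) norm_ge_zero order_trans by blast
  have "a ^ Suc (Suc n) - b ^ Suc (Suc n) = a * (a ^ Suc n - b ^ Suc n) + (a - b) * b ^ Suc n"
    by (simp add: algebra_simps)
  then have "norm (a ^ Suc (Suc n) - b ^ Suc (Suc n)) \<le> norm (a * (a ^ Suc n - b ^ Suc n)) + norm ((a - b) * b ^ Suc n)"
    by (metis norm_triangle_ineq)
  also have "\<dots> \<le> B * (real (Suc n) * B ^ n * norm (a - b)) + norm (a - b) * B ^ Suc n"
  proof (intro add_mono order_trans[OF norm_mult_ineq] mult_mono Suc.IH assms)
    show "norm (b ^ Suc n) \<le> B ^ Suc n"
      using norm_power_ineq[of b "Suc n"] power_mono[OF assms(2), of "Suc n"] by simp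
  qed (use B in auto)
  finally show ?case by (simp add: algebra_simps)
qed

text \<open>r (T - r) is at least T/2 times the smaller of r and T - r, so the gauge is dominated by
  two exponentials of rate M T / 2, one decaying from each end.\<close>

lemma integral_gauge_le:
  fixes M T t :: real
  assumes "M > 0" "T > 0" "t \<in> {0..T}"
  shows "(\<lambda>r. exp (- M * (r * (T - r)))) integrable_on {0..t}"
    and "integral {0..t} (\<lambda>r. exp (- M * (r * (T - r)))) \<le> 4 / (M * T)"
proof -
  define a where "a = M * T / 2"
  have a: "a > 0" using assms by (simp add: a_def)
  have i: "((\<lambda>r. exp (- (a * r)) + exp (- (a * (T - r)))) has_integral
      (- exp (- (a * t)) / a + exp (- (a * (T - t))) / a) - (- exp (- (a * 0)) / a + exp (- (a * (T - 0))) / a)) {0..t}"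
    using assms a by (intro fundamental_theorem_of_calculus)
      (auto intro!: derivative_eq_intros simp flip: has_real_derivative_iff_has_vector_derivative simp: field_simps)
  show g: "(\<lambda>r. exp (- M * (r * (T - r)))) integrable_on {0..t}"
    by (intro integrable_continuous_real continuous_intros)
  have "integral {0..t} (\<lambda>r. exp (- M * (r * (T - r)))) \<le> integral {0..t} (\<lambda>r. exp (- (a * r)) + exp (- (a * (T - r))))"
  proof (rule integral_le[OF g has_integral_integrable[OF i]])
    fix r assume r: "r \<in> {0..t}"
    then have r: "0 \<le> r" "r \<le> T" using assms(3) by auto
    show "exp (- M * (r * (T - r))) \<le> exp (- (a * r)) + exp (- (a * (T - r)))"
    proof (cases "r \<le> T / 2")
      case True
      then have "r * (T / 2) \<le> r * (T - r)" using r by (intro mult_left_mono) auto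
      then have "M * (r * (T / 2)) \<le> M * (r * (T - r))"
        by (rule mult_left_mono) (use assms(1) in auto)
      moreover have "a * r = M * (r * (T / 2))" by (simp add: a_def)
      ultimately have "exp (- M * (r * (T - r))) \<le> exp (- (a * r))"
        unfolding exp_le_cancel_iff mult_minus_left neg_le_iff_le by (simp only:)
      also have "\<dots> \<le> exp (- (a * r)) + exp (- (a * (T - r)))" by simp
      finally show ?thesis .
    next
      case False
      then have "(T / 2) * (T - r) \<le> r * (T - r)" using r by (intro mult_right_mono) auto
      then have "M * ((T / 2) * (T - r)) \<le> M * (r * (T - r))"
        by (rule mult_left_mono) (use assms(1) in auto)
      moreover have "a * (T - r) = M * ((T / 2) * (T - r))" by (simp add: a_def)
      ultimately have "exp (- M * (r * (T - r))) \<le> exp (- (a * (T - r)))"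
        unfolding exp_le_cancel_iff mult_minus_left neg_le_iff_le by (simp only:)
      also have "\<dots> \<le> exp (- (a * r)) + exp (- (a * (T - r)))" by simp
      finally show ?thesis .
    qed
  qed
  also have "\<dots> = exp (- (a * (T - t))) / a - exp (- (a * t)) / a + 1 / a - exp (- (a * T)) / a"
    using integral_unique[OF i] by simp
  also have "\<dots> \<le> 1 / a - 0 + 1 / a - 0"
    using a assms(3) by (intro diff_mono add_mono divide_right_mono) auto
  also have "\<dots> = 4 / (M * T)" using assms by (simp add: a_def field_simps)
  finally show "integral {0..t} (\<lambda>r. exp (- M * (r * (T - r)))) \<le> 4 / (M * T)" .
qed

text \<open>
  The gauge \<open>m t = exp (- M t (T - t))\<close> equals 1 at both ends and is small in between. Writing the
  solution as \<open>m (\<chi> + e)\<close> costs the constant potential \<open>m' / m\<close> and multiplies the nonlinearity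
  by \<open>m ^ p\<close>, so for large \<open>M\<close> the linear solution \<open>\<chi>\<close> is a good approximation.
\<close>

theorem nonlinear_approximate_control:
  assumes T: "T > 0" and eps: "\<epsilon> > 0" and p: "p \<ge> 1" and \<kappa>: "\<kappa> \<ge> 0" and f: "exp f * y0 = c *\<^sub>R 1"
  shows "\<exists>v y. continuous_on {0..T} v \<and> (\<forall>r. v r \<in> trig1) \<and> heat_sol 0 T y (\<lambda>r. rhs \<kappa> p (v r) (y r)) \<and> y 0 = y0 \<and>
    norm (y T - c *\<^sub>R 1) < \<epsilon>"
proof -
  obtain v z where v: "continuous_on {0..T} v" "\<And>r. v r \<in> trig1" and z: "heat_sol 0 T z (\<lambda>r. v r * z r)" "z 0 = y0"
    and zT: "norm (z T - c *\<^sub>R 1) < \<epsilon> / 2"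
    using linear_approximate_control[OF T half_gt_zero[OF eps] f] by blast
  have zc: "continuous_on {0..T} z" using z(1) by (rule heat_sol_continuous)
  obtain V where V: "V > 0" "\<And>r. r \<in> {0..T} \<Longrightarrow> norm (v r) \<le> V" using continuous_norm_bound[OF v(1)] by blast
  obtain X where X: "X > 0" "\<And>r. r \<in> {0..T} \<Longrightarrow> norm (z r) \<le> X" using continuous_norm_bound[OF zc] by blast
  define R where "R = min 1 (\<epsilon> / 2)"
  have R: "R > 0" "R \<le> 1" "R \<le> \<epsilon> / 2" using eps by (auto simp: R_def)
  define L where "L = V + \<kappa> * (real (Suc p) * (X + 1) ^ p)"
  have L: "L > 0" unfolding L_def using V(1) X(1) \<kappa> by (intro add_pos_nonneg mult_nonneg_nonneg) auto
  \<comment> \<open>A forcing of size g0 keeps the correction within radius R, hence within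
    \<epsilon>/2 at the end. M is then taken so large that the gauged nonlinearity along z is a
    forcing below g0.\<close>
  define g0 where "g0 = R / (2 * exp (2 * L * T))"
  have g0: "g0 > 0" "2 * g0 * exp (2 * L * T) = R" using R(1) by (simp_all add: g0_def)
  define M where "M = 4 * (\<kappa> * X ^ Suc p + 1) / (g0 * T)"
  have KX: "\<kappa> * X ^ Suc p \<ge> 0" using \<kappa> X(1) by (intro mult_nonneg_nonneg) auto
  have M: "M > 0" unfolding M_def using KX g0(1) T by (intro divide_pos_pos mult_pos_pos) auto
  have KM: "\<kappa> * X ^ Suc p * (4 / (M * T)) \<le> g0"
  proof -
    define A where "A = \<kappa> * X ^ Suc p"
    have A: "A \<ge> 0" using KX by (simp add: A_def)
    moreover have "4 / (M * T) = g0 / (A + 1)"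
    proof -
      have "4 / (4 * B / (g0 * T) * T) = g0 / B" if "B > 0" for B using T g0(1) that by simp
      from this[of "A + 1"] show ?thesis using A by (simp add: M_def A_def)
    qed
    moreover have "A * (g0 / (A + 1)) \<le> g0"
      using mult_left_mono[of A "A + 1" g0] g0(1) A by (simp add: pos_divide_le_eq mult.commute)
    ultimately have "A * (4 / (M * T)) \<le> g0" by (simp only:)
    then show ?thesis by (simp only: A_def)
  qed
  define m where "m = (\<lambda>r. exp (- M * (r * (T - r))))"
  have mp: "m r > 0" for r by (simp add: m_def)
  have m1: "m r \<le> 1" if "r \<in> {0..T}" for r using that M by (auto simp: m_def intro!: mult_nonneg_nonneg)
  \<comment> \<open>Here p >= 1 enters: m^p is then as small as the integrable gauge, whereas for p
    = 0 the scaling would not weaken the nonlinearity.\<close>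
  have mpow: "m r ^ p \<le> m r" "m r ^ p \<le> 1" if "r \<in> {0..T}" for r
    using power_decreasing[OF p, of "m r"] mp[of r] m1[OF that] by (simp_all add: power_le_one less_imp_le)
  have mc: "continuous_on A m" for A unfolding m_def by (intro continuous_intros)
  define h where "h = duh (\<lambda>r. (- \<kappa> * m r ^ p) *\<^sub>R z r ^ Suc p)"
  define G where "G = (\<lambda>r e. v r * e + (- \<kappa> * m r ^ p) *\<^sub>R ((z r + e) ^ Suc p - z r ^ Suc p))"
  have hc: "continuous_on {0..T} (\<lambda>r. (- \<kappa> * m r ^ p) *\<^sub>R z r ^ Suc p)" by (intro continuous_intros mc zc)
  have hb: "norm (h t) \<le> g0" if t: "t \<in> {0..T}" for t
  proof -
    have "norm (h t) \<le> integral {0..t} (\<lambda>r. \<kappa> * X ^ Suc p * m r)"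
      unfolding h_def
    proof (rule norm_duh_le[OF hc t])
      fix r assume "r \<in> {0..t}"
      then have r: "r \<in> {0..T}" using t by auto
      have "norm ((- \<kappa> * m r ^ p) *\<^sub>R z r ^ Suc p) = \<kappa> * m r ^ p * norm (z r ^ Suc p)"
        using \<kappa> mp[of r] by (simp add: abs_mult)
      also have "\<dots> \<le> \<kappa> * m r * X ^ Suc p"
      proof (intro mult_mono mpow r mult_left_mono \<kappa>)
        show "norm (z r ^ Suc p) \<le> X ^ Suc p"
          using norm_power_ineq[of "z r" "Suc p"] power_mono[OF X(2)[OF r], of "Suc p"] by simp
      qed (use \<kappa> mp[of r] in auto)
      finally show "norm ((- \<kappa> * m r ^ p) *\<^sub>R z r ^ Suc p) \<le> \<kappa> * X ^ Suc p * m r" by (simp add: mult_ac)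
    qed (intro integrable_continuous_real continuous_intros mc)
    also have "\<dots> = \<kappa> * X ^ Suc p * integral {0..t} m" by simp
    also have "\<dots> \<le> \<kappa> * X ^ Suc p * (4 / (M * T))"
      unfolding m_def by (intro mult_left_mono integral_gauge_le M T t KX)
    finally show ?thesis using KM by linarith
  qed
  have "\<exists>e. continuous_on {0..T} e \<and> (\<forall>t\<in>{0..T}. e t = h t + duh (\<lambda>r. G r (e r)) t \<and> norm (e t) \<le> 2 * g0 * exp (2 * L * t))"
  proof (rule duhamel_fixed_point[where R = R])
    show "continuous_on ({0..T} \<times> cball 0 R) (\<lambda>(r, e). G r e)"
      unfolding G_def split_def
      by (intro continuous_intros continuous_on_compose2[OF v(1)] continuous_on_compose2[OF zc] continuous_on_compose2[OF mc[of UNIV]]) auto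
    show "norm (G r a - G r b) \<le> L * norm (a - b)" if r: "r \<in> {0..T}" and a: "norm a \<le> R" and b: "norm b \<le> R" for r a b
    proof -
      have "norm (z r + e) \<le> X + 1" if "norm e \<le> R" for e
        using norm_triangle_ineq[of "z r" e] X(2)[OF r] R(2) that by linarith
      then have d: "norm ((z r + a) ^ Suc p - (z r + b) ^ Suc p) \<le> real (Suc p) * (X + 1) ^ p * norm (a - b)"
        using norm_power_diff_le[of "z r + a" "X + 1" "z r + b" p] a b by simp
      have "G r a - G r b = v r * (a - b) + (- \<kappa> * m r ^ p) *\<^sub>R ((z r + a) ^ Suc p - (z r + b) ^ Suc p)"
        by (simp add: G_def algebra_simps)
      also have "norm \<dots> \<le> norm (v r * (a - b)) + norm ((- \<kappa> * m r ^ p) *\<^sub>R ((z r + a) ^ Suc p - (z r + b) ^ Suc p))"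
        by (rule norm_triangle_ineq)
      also have "\<dots> \<le> V * norm (a - b) + \<kappa> * (real (Suc p) * (X + 1) ^ p * norm (a - b))"
      proof (rule add_mono)
        show "norm (v r * (a - b)) \<le> V * norm (a - b)"
          by (rule order_trans[OF norm_mult_ineq]) (intro mult_right_mono V(2) r norm_ge_zero)
        have "norm ((- \<kappa> * m r ^ p) *\<^sub>R ((z r + a) ^ Suc p - (z r + b) ^ Suc p))
            = \<kappa> * m r ^ p * norm ((z r + a) ^ Suc p - (z r + b) ^ Suc p)"
          using \<kappa> mp[of r] by (simp add: abs_mult)
        also have "\<dots> \<le> \<kappa> * 1 * (real (Suc p) * (X + 1) ^ p * norm (a - b))"
          by (intro mult_mono d mult_left_mono mpow(2) r \<kappa>) (use \<kappa> in auto)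
        finally show "norm ((- \<kappa> * m r ^ p) *\<^sub>R ((z r + a) ^ Suc p - (z r + b) ^ Suc p))
            \<le> \<kappa> * (real (Suc p) * (X + 1) ^ p * norm (a - b))" by simp
      qed
      finally show ?thesis by (simp add: L_def algebra_simps)
    qed
    show "continuous_on {0..T} h" unfolding h_def by (rule continuous_on_duh[OF hc])
  qed (use T L hb g0 in \<open>auto simp: G_def\<close>)
  then obtain e where ec: "continuous_on {0..T} e" and e: "\<And>t. t \<in> {0..T} \<Longrightarrow> e t = h t + duh (\<lambda>r. G r (e r)) t"
    and eb: "\<And>t. t \<in> {0..T} \<Longrightarrow> norm (e t) \<le> 2 * g0 * exp (2 * L * t)" by blast
  have Gc: "continuous_on {0..T} (\<lambda>r. G r (e r))" unfolding G_def by (intro continuous_intros v zc ec mc)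
  have "heat_sol 0 T h (\<lambda>r. (- \<kappa> * m r ^ p) *\<^sub>R z r ^ Suc p)"
    by (rule heat_sol_duh[OF hc, of _ 0]) (use T in \<open>auto simp: h_def S_simps\<close>)
  moreover have "heat_sol 0 T (duh (\<lambda>r. G r (e r))) (\<lambda>r. G r (e r))"
    by (rule heat_sol_duh[OF Gc, of _ 0]) (use T in \<open>auto simp: S_simps\<close>)
  ultimately have "heat_sol 0 T (\<lambda>t. h t + duh (\<lambda>r. G r (e r)) t) (\<lambda>r. (- \<kappa> * m r ^ p) *\<^sub>R z r ^ Suc p + G r (e r))"
    by (rule heat_sol_add)
  then have "heat_sol 0 T e (\<lambda>r. (- \<kappa> * m r ^ p) *\<^sub>R z r ^ Suc p + G r (e r))"
    by (rule heat_sol_cong) (use e in auto)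
  from heat_sol_add[OF z(1) this]
  have ze: "heat_sol 0 T (\<lambda>t. z t + e t) (\<lambda>r. v r * (z r + e r) + (- \<kappa> * m r ^ p) *\<^sub>R (z r + e r) ^ Suc p)"
    by (rule heat_sol_cong) (auto simp: G_def algebra_simps)
  \<comment> \<open>The added constant is m'/m and stays in the span of 1, cos and sin.\<close>
  define w where "w = (\<lambda>r. v r + (- M * (T - 2 * r)) *\<^sub>R 1)"
  have "heat_sol 0 T (\<lambda>t. m t *\<^sub>R (z t + e t))
      (\<lambda>r. m r *\<^sub>R (v r * (z r + e r) + (- \<kappa> * m r ^ p) *\<^sub>R (z r + e r) ^ Suc p) + (m r * (- M * (T - 2 * r))) *\<^sub>R (z r + e r))"
  proof (rule heat_sol_gauge[OF ze])
    show "(m has_real_derivative m t * (- M * (T - 2 * t))) (at t within {0..T})" for t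
      unfolding m_def by (auto intro!: derivative_eq_intros simp: algebra_simps)
  qed (intro continuous_intros v zc ec mc)+
  then have "heat_sol 0 T (\<lambda>t. m t *\<^sub>R (z t + e t)) (\<lambda>r. rhs \<kappa> p (w r) (m r *\<^sub>R (z r + e r)))"
  proof (rule heat_sol_cong)
    fix r
    have "(m r *\<^sub>R (z r + e r)) ^ Suc p = (m r * m r ^ p) *\<^sub>R (z r + e r) ^ Suc p"
      unfolding scaleR_power by simp
    then show "m r *\<^sub>R (v r * (z r + e r) + (- \<kappa> * m r ^ p) *\<^sub>R (z r + e r) ^ Suc p) + (m r * (- M * (T - 2 * r))) *\<^sub>R (z r + e r)
        = rhs \<kappa> p (w r) (m r *\<^sub>R (z r + e r))"
      unfolding rhs_def w_def Suc_eq_plus1[symmetric] by (simp add: algebra_simps del: power_Suc)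
  qed simp
  moreover have "continuous_on {0..T} w" unfolding w_def by (intro continuous_intros v)
  moreover have "w r \<in> trig1" for r
  proof -
    obtain a b d where "v r = a *\<^sub>R 1 + b *\<^sub>R cosW 1 + d *\<^sub>R sinW 1" using v(2)[of r] by (auto simp: trig1_def)
    then have "w r = (a + (- M * (T - 2 * r))) *\<^sub>R 1 + b *\<^sub>R cosW 1 + d *\<^sub>R sinW 1"
      by (simp add: w_def scaleR_add_left scaleR_diff_left)
    then show ?thesis unfolding trig1_def by blast
  qed
  moreover have "m 0 *\<^sub>R (z 0 + e 0) = y0" using e[of 0] T z(2) by (simp add: m_def h_def)
  moreover have "norm (m T *\<^sub>R (z T + e T) - c *\<^sub>R 1) < \<epsilon>"
  proof -
    have "norm (m T *\<^sub>R (z T + e T) - c *\<^sub>R 1) = norm ((z T - c *\<^sub>R 1) + e T)" by (simp add: m_def algebra_simps)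
    also have "\<dots> \<le> norm (z T - c *\<^sub>R 1) + norm (e T)" by (rule norm_triangle_ineq)
    finally show ?thesis using eb[of T] T g0(2) R(3) zT by auto
  qed
  ultimately show ?thesis by blast
qed

section \<open>Regularity and mild solutions\<close>

text \<open>One jump is provided for the switch from approximate to exact control, where the two
  potentials may differ; the value at s belongs to the left piece.\<close>

definition piecewise_continuous :: "real \<Rightarrow> real \<Rightarrow> (real \<Rightarrow> 'a::topological_space) \<Rightarrow> bool" where
  "piecewise_continuous s T f \<longleftrightarrow> (\<exists>g h. continuous_on {0..s} g \<and> continuous_on {s..T} h \<and>
     (\<forall>r. f r = (if r \<le> s then g r else h r)))"

lemma piecewise_continuousI:
  "continuous_on {0..s} g \<Longrightarrow> continuous_on {s..T} h \<Longrightarrow> piecewise_continuous s T (\<lambda>r. if r \<le> s then g r else h r)"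
  unfolding piecewise_continuous_def by blast

lemma piecewise_continuous_const: "piecewise_continuous s T (\<lambda>_. a)"
  unfolding piecewise_continuous_def by (intro exI[of _ "\<lambda>_. a"]) auto

lemma piecewise_continuous_map2:
  assumes "piecewise_continuous s T f" "piecewise_continuous s T g"
    and op: "continuous_on UNIV (\<lambda>(x, y). op x y)"
  shows "piecewise_continuous s T (\<lambda>r. op (f r) (g r))"
proof -
  obtain f1 f2 g1 g2 where c: "continuous_on {0..s} f1" "continuous_on {s..T} f2" "continuous_on {0..s} g1" "continuous_on {s..T} g2"
    and e: "\<And>r. f r = (if r \<le> s then f1 r else f2 r)" "\<And>r. g r = (if r \<le> s then g1 r else g2 r)"
    using assms(1,2) unfolding piecewise_continuous_def by metis
  have "continuous_on A (\<lambda>r. op (a r) (b r))" if "continuous_on A a" "continuous_on A b" for A :: "real set" and a b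
    using continuous_on_compose2[OF op continuous_on_Pair[OF that]] by simp
  from piecewise_continuousI[OF this[OF c(1,3)] this[OF c(2,4)]] show ?thesis
    by (rule back_subst[of "piecewise_continuous s T"]) (auto simp: e fun_eq_iff)
qed

lemma piecewise_continuous_S:
  assumes "piecewise_continuous s T F"
  shows "piecewise_continuous s T (\<lambda>r. S (t - r) (F r))"
proof -
  obtain g h where c: "continuous_on {0..s} g" "continuous_on {s..T} h" and e: "\<And>r. F r = (if r \<le> s then g r else h r)"
    using assms unfolding piecewise_continuous_def by metis
  have "continuous_on {0..s} (\<lambda>r. S (t - r) (g r))" "continuous_on {s..T} (\<lambda>r. S (t - r) (h r))"
    by (intro continuous_intros c)+
  from piecewise_continuousI[OF this] show ?thesis
    by (rule back_subst[of "piecewise_continuous s T"]) (auto simp: e fun_eq_iff)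
qed

lemma piecewise_continuous_bounded:
  fixes f :: "real \<Rightarrow> 'a::real_normed_vector"
  assumes "piecewise_continuous s T f"
  obtains B where "B > 0" "\<And>r. r \<in> {0..T} \<Longrightarrow> norm (f r) \<le> B"
proof -
  obtain g h where c: "continuous_on {0..s} g" "continuous_on {s..T} h" and e: "\<And>r. f r = (if r \<le> s then g r else h r)"
    using assms unfolding piecewise_continuous_def by metis
  have "bounded (g ` {0..s} \<union> h ` {s..T})"
    using c by (simp add: compact_continuous_image compact_imp_bounded)
  then obtain B where "B > 0" and B: "\<And>x. x \<in> g ` {0..s} \<union> h ` {s..T} \<Longrightarrow> norm x \<le> B"
    unfolding bounded_pos by blast
  show ?thesis by (rule that[OF \<open>B > 0\<close>]) (auto simp: e intro!: B)
qed

lemma piecewise_continuous_integrable: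
  fixes f :: "real \<Rightarrow> 'a::banach"
  assumes "piecewise_continuous s T f" and "0 \<le> s" and t: "t \<in> {0..T}"
  shows "f integrable_on {0..t}"
proof -
  obtain g h where c: "continuous_on {0..s} g" "continuous_on {s..T} h" and e: "\<And>r. f r = (if r \<le> s then g r else h r)"
    using assms unfolding piecewise_continuous_def by metis
  have 1: "f integrable_on {0..b}" if "b \<le> s" for b
  proof -
    have "g integrable_on {0..b}" by (intro integrable_continuous_real continuous_on_subset[OF c(1)]) (use that in auto)
    then show ?thesis by (rule integrable_spike_finite[where S = "{}", rotated 2]) (use that in \<open>auto simp: e\<close>)
  qed
  show ?thesis
  proof (cases "t \<le> s")
    case True then show ?thesis by (rule 1)
  next
    case False
    have "h integrable_on {s..t}" by (intro integrable_continuous_real continuous_on_subset[OF c(2)]) (use t in auto)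
    then have "f integrable_on {s..t}"
      by (rule integrable_spike_finite[where S = "{s}", rotated 2]) (auto simp: e)
    with 1[OF order_refl] show ?thesis
      by (rule Henstock_Kurzweil_Integration.integrable_combine[OF \<open>0 \<le> s\<close>, rotated]) (use False in auto)
  qed
qed

lemma piecewise_continuous_set_integrable:
  fixes f :: "real \<Rightarrow> real"
  assumes "piecewise_continuous s T f" and t: "t \<in> {0..T}"
  shows "set_integrable lborel {0..t} f"
proof -
  obtain g h where c: "continuous_on {0..s} g" "continuous_on {s..T} h" and e: "\<And>r. f r = (if r \<le> s then g r else h r)"
    using assms unfolding piecewise_continuous_def by metis
  have "set_integrable lborel {0..min s t} g"
    by (intro borel_integrable_atLeastAtMost' continuous_on_subset[OF c(1)]) auto
  then have 1: "set_integrable lborel {0..min s t} f"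
    by (rule set_integrable_cong[THEN iffD1, rotated 3]) (auto simp: e)
  have "set_integrable lborel {s..t} h"
    by (intro borel_integrable_atLeastAtMost' continuous_on_subset[OF c(2)]) (use t in auto)
  then have "set_integrable lborel ({s<..t} \<inter> {0..}) h"
    by (rule set_integrable_subset) auto
  then have 2: "set_integrable lborel ({s<..t} \<inter> {0..}) f"
    by (rule set_integrable_cong[THEN iffD1, rotated 3]) (auto simp: e)
  have "{0..min s t} \<union> ({s<..t} \<inter> {0..}) = {0..t}" by auto
  with set_integrable_Un[OF 1 2] show ?thesis by simp
qed

text \<open>Multiplying the integrated identity by exp (-k^2 t) identifies the Duhamel integral in
  the algebra. Point evaluation is continuous and commutes with it, and for the resulting scalar
  integrand the Lebesgue integral has the same value.\<close>

lemma heat_sol_mild: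
  assumes y: "heat_sol 0 T y F" and F: "piecewise_continuous s T F" and "0 \<le> s" and t: "t \<in> {0..T}"
  shows "set_integrable lborel {0..t} (\<lambda>r. fn (S (t - r) (F r)) x)"
    and "fn (y t) x = fn (S t (y 0)) x + (LINT r:{0..t}|lborel. fn (S (t - r) (F r)) x)"
proof -
  let ?G = "\<lambda>r. S (t - r) (F r)"
  have pw: "piecewise_continuous s T ?G" by (rule piecewise_continuous_S[OF F])
  have "continuous_on UNIV (\<lambda>(f, _). fn f x)"
    unfolding split_def by (intro bounded_linear.continuous_on[OF bounded_linear_fn] continuous_intros)
  from piecewise_continuous_map2[OF pw pw this]
  show si: "set_integrable lborel {0..t} (\<lambda>r. fn (?G r) x)"
    by (intro piecewise_continuous_set_integrable[OF _ t])
  have G: "?G integrable_on {0..t}" by (rule piecewise_continuous_integrable[OF pw \<open>0 \<le> s\<close> t])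
  have "y t - S t (y 0) = integral {0..t} ?G"
  proof (rule wiener_coef_eqI)
    fix k
    let ?E = "\<lambda>r. exp ((of_int k)\<^sup>2 * r)"
    have "((\<lambda>r. ?E r *\<^sub>R coef (F r) k) has_integral ?E t *\<^sub>R coef (y t) k - ?E 0 *\<^sub>R coef (y 0) k) {0..t}"
      using y t by (auto simp: heat_sol_def)
    from has_integral_cmul[OF this, of "exp (- (of_int k)\<^sup>2 * t)"]
    have "((\<lambda>r. exp (- (of_int k)\<^sup>2 * t) *\<^sub>R (?E r *\<^sub>R coef (F r) k)) has_integral coef (y t - S t (y 0)) k) {0..t}"
      using t by (simp add: coef_diff coef_S scaleR_diff_right flip: exp_add)
    then have "((\<lambda>r. coef (?G r) k) has_integral coef (y t - S t (y 0)) k) {0..t}"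
      by (rule has_integral_eq[rotated]) (auto simp: coef_S algebra_simps simp flip: exp_add)
    moreover have "((\<lambda>r. coef (?G r) k) has_integral coef (integral {0..t} ?G) k) {0..t}"
      using has_integral_linear[OF integrable_integral[OF G] bounded_linear_coef, of k] by (simp add: o_def)
    ultimately show "coef (y t - S t (y 0)) k = coef (integral {0..t} ?G) k" by (rule has_integral_unique)
  qed
  moreover have "(LINT r:{0..t}|lborel. fn (?G r) x) = integral {0..t} (\<lambda>r. fn (?G r) x)"
    by (rule set_borel_integral_eq_integral(2)[OF si])
  moreover have "\<dots> = fn (integral {0..t} ?G) x"
    using integral_linear[OF G bounded_linear_fn, of x] by (simp add: o_def)
  ultimately show "fn (y t) x = fn (S t (y 0)) x + (LINT r:{0..t}|lborel. fn (?G r) x)"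
    by (metis add_diff_cancel_left' diff_add_cancel add.commute fn_simps(3))
qed

text \<open>An intermediate regularity class. A bounded source keeps the solution in it; a source in
  it contributes coefficients O((1 + k^2)^(-2)), whose squares are summable against (1 + k^2)^3. It
  is stable under products, so the right-hand side inherits it from the solution.\<close>

definition decays :: "real \<Rightarrow> wiener \<Rightarrow> bool" where
  "decays A f \<longleftrightarrow> (\<forall>k. (1 + (of_int k)\<^sup>2) * norm (coef f k) \<le> A)"

lemma decays_add: "decays A f \<Longrightarrow> decays B g \<Longrightarrow> decays (A + B) (f + g)"
  unfolding decays_def
proof
  fix k assume "\<forall>k. (1 + (of_int k)\<^sup>2) * norm (coef f k) \<le> A" "\<forall>k. (1 + (of_int k)\<^sup>2) * norm (coef g k) \<le> B"
  then have "(1 + (of_int k)\<^sup>2) * norm (coef f k) + (1 + (of_int k)\<^sup>2) * norm (coef g k) \<le> A + B" by (intro add_mono) auto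
  moreover have "(1 + (of_int k)\<^sup>2) * norm (coef (f + g) k) \<le> (1 + (of_int k)\<^sup>2) * (norm (coef f k) + norm (coef g k))"
    by (intro mult_left_mono) (auto simp: coef_simps norm_triangle_ineq)
  ultimately show "(1 + (of_int k)\<^sup>2) * norm (coef (f + g) k) \<le> A + B" by (simp add: distrib_left)
qed

lemma decays_scaleR:
  assumes "decays A f" "\<bar>r\<bar> \<le> B" shows "decays (B * A) (r *\<^sub>R f)"
  unfolding decays_def
proof
  fix k
  have "(1 + (of_int k)\<^sup>2) * norm (coef (r *\<^sub>R f) k) = \<bar>r\<bar> * ((1 + (of_int k)\<^sup>2) * norm (coef f k))"
    by (simp add: coef_simps)
  also have "\<dots> \<le> B * A"
    using assms by (intro mult_mono) (auto simp: decays_def)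
  finally show "(1 + (of_int k)\<^sup>2) * norm (coef (r *\<^sub>R f) k) \<le> B * A" .
qed

text \<open>k^2 <= 2 j^2 + 2 (k - j)^2 puts the weight on one factor at a time, while the other is
  measured in the norm of the algebra.\<close>

lemma decays_mult:
  assumes f: "decays A f" and g: "decays B g"
  shows "decays (2 * (A * norm g + B * norm f)) (f * g)"
  unfolding decays_def
proof
  fix k :: int
  have b: "bij (\<lambda>j. k - j)" by (rule bij_betw_byWitness[where f' = "\<lambda>j. k - j"]) auto
  have sf: "(\<lambda>j. norm (coef f j)) summable_on UNIV" by (rule coef_summable)
  have sg: "(\<lambda>j. norm (coef g (k - j))) summable_on UNIV"
    using summable_on_reindex_bij_betw[OF b, of "\<lambda>j. norm (coef g j)"] coef_summable by simp
  have ng: "(\<Sum>\<^sub>\<infinity>j. norm (coef g (k - j))) = norm g"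
    using infsum_reindex_bij_betw[OF b, of "\<lambda>j. norm (coef g j)"] by (simp add: norm_wiener_def)
  let ?w = "\<lambda>k::int. 1 + (real_of_int k)\<^sup>2"
  have tm: "?w k * norm (coef f j * coef g (k - j)) \<le> 2 * A * norm (coef g (k - j)) + 2 * B * norm (coef f j)" for j
  proof -
    \<comment> \<open>This is (2 j - k)^2 >= 0.\<close>
    have "(real_of_int k)\<^sup>2 \<le> 2 * (real_of_int j)\<^sup>2 + 2 * (real_of_int (k - j))\<^sup>2"
      using sum_squares_ge_zero[of "2 * real_of_int j - real_of_int k" 0] by (simp add: power2_eq_square algebra_simps)
    moreover have "1 + a \<le> 2 * (1 + b) + 2 * (1 + c)" if "a \<le> 2 * b + 2 * c" for a b c :: real
      using that by simp
    ultimately have "?w k \<le> 2 * ?w j + 2 * ?w (k - j)" by blast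
    then have "?w k * (norm (coef f j) * norm (coef g (k - j))) \<le> (2 * ?w j + 2 * ?w (k - j)) * (norm (coef f j) * norm (coef g (k - j)))"
      by (rule mult_right_mono) simp
    also have "\<dots> = 2 * (?w j * norm (coef f j)) * norm (coef g (k - j)) + 2 * (?w (k - j) * norm (coef g (k - j))) * norm (coef f j)"
      by (simp add: algebra_simps)
    also have "\<dots> \<le> 2 * A * norm (coef g (k - j)) + 2 * B * norm (coef f j)"
      using f g by (intro add_mono mult_right_mono mult_left_mono) (auto simp: decays_def simp del: of_int_diff)
    finally show ?thesis by (simp add: norm_mult)
  qed
  have sr: "(\<lambda>j. 2 * A * norm (coef g (k - j)) + 2 * B * norm (coef f j)) summable_on UNIV"
    by (intro summable_on_add summable_on_cmult_right sf sg)
  have sl: "(\<lambda>j. ?w k * norm (coef f j * coef g (k - j))) summable_on UNIV"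
    by (rule summable_on_comparison_test[OF sr]) (use tm in auto)
  have s: "(\<lambda>j. norm (coef f j * coef g (k - j))) summable_on UNIV"
    by (rule summable_on_comparison_test[OF sl]) (auto simp: distrib_right)
  have "?w k * norm (coef (f * g) k) \<le> ?w k * (\<Sum>\<^sub>\<infinity>j. norm (coef f j * coef g (k - j)))"
    unfolding coef_simps by (intro mult_left_mono norm_infsum_bound s) simp
  also have "\<dots> = (\<Sum>\<^sub>\<infinity>j. ?w k * norm (coef f j * coef g (k - j)))"
    by (rule infsum_cmult_right[symmetric]) (use s in auto)
  also have "\<dots> \<le> (\<Sum>\<^sub>\<infinity>j. 2 * A * norm (coef g (k - j)) + 2 * B * norm (coef f j))"
    by (intro infsum_mono sl sr tm)
  also have "\<dots> = 2 * A * norm g + 2 * B * norm f"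
    by (subst infsum_add) (auto intro!: summable_on_cmult_right sf sg simp: infsum_cmult_right' ng norm_wiener_def)
  finally show "?w k * norm (coef (f * g) k) \<le> 2 * (A * norm g + B * norm f)" by (simp add: algebra_simps)
qed

lemma decays_mono: "decays A f \<Longrightarrow> A \<le> B \<Longrightarrow> decays B f"
  unfolding decays_def by (meson order_trans)

lemma decays_nonneg: "decays A f \<Longrightarrow> A \<ge> 0"
proof -
  assume "decays A f"
  then have "(1 + (of_int 0)\<^sup>2) * norm (coef f 0) \<le> A" unfolding decays_def by blast
  moreover have "0 \<le> (1 + (of_int 0)\<^sup>2) * norm (coef f 0)" by simp
  ultimately show ?thesis by linarith
qed

lemma decays_one: "decays 1 1"
  by (simp add: decays_def coef_simps)

text \<open>The constant is the same for all f with these bounds, because it has to serve all times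
  of a trajectory at once.\<close>

lemma decays_power: "\<exists>C. \<forall>f. norm f \<le> N \<longrightarrow> decays A f \<longrightarrow> decays C (f ^ n)"
proof (induction n)
  case 0
  then show ?case using decays_one by auto
next
  case (Suc n)
  then obtain C where C: "\<And>f. norm f \<le> N \<Longrightarrow> decays A f \<Longrightarrow> decays C (f ^ n)" by blast
  show ?case
  proof (intro exI allI impI)
    fix f assume f: "norm f \<le> N" "decays A f"
    have "norm (f ^ n) \<le> N ^ n" using norm_power_ineq[of f n] power_mono[OF f(1), of n] by simp
    then have "A * norm (f ^ n) + C * norm f \<le> A * N ^ n + C * N"
      using f decays_nonneg[OF f(2)] decays_nonneg[OF C[OF f]] by (intro add_mono mult_left_mono) auto
    then show "decays (2 * (A * N ^ n + C * N)) (f ^ Suc n)"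
      using decays_mono[OF decays_mult[OF f(2) C[OF f]], of "2 * (A * N ^ n + C * N)"] by simp
  qed
qed

text \<open>The integral K of exp (-k^2 (t - r)) over [0,t] satisfies K <= T and k^2 K <= 1; adding
  the two gives the factor (T + 1) / (1 + k^2). Since k is fixed, B may itself decay in k, which
  permits a second use.\<close>

lemma heat_sol_smoothing:
  assumes y: "heat_sol 0 T y F" and t: "t \<in> {0..T}" and B: "\<And>r. r \<in> {0..T} \<Longrightarrow> norm (coef (F r) k) \<le> B"
  shows "norm (coef (y t) k) \<le> norm (coef (y 0) k) + (T + 1) * B / (1 + (of_int k)\<^sup>2)"
proof -
  let ?K = "(real_of_int k)\<^sup>2"
  let ?E = "\<lambda>r. exp (?K * r)"
  have B0: "B \<ge> 0" using B[OF t] norm_ge_zero order_trans by blast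
  have i: "((\<lambda>r. ?E r *\<^sub>R coef (F r) k) has_integral ?E t *\<^sub>R coef (y t) k - coef (y 0) k) {0..t}"
  proof -
    have "((\<lambda>r. ?E r *\<^sub>R coef (F r) k) has_integral ?E t *\<^sub>R coef (y t) k - ?E 0 *\<^sub>R coef (y 0) k) {0..t}"
      using y t by (auto simp: heat_sol_def)
    then show ?thesis by simp
  qed
  have gi: "?E integrable_on {0..t}" by (intro integrable_continuous_real continuous_intros)
  have "((\<lambda>r. ?K * ?E r) has_integral ?E t - ?E 0) {0..t}"
    using t by (intro fundamental_theorem_of_calculus)
      (auto intro!: derivative_eq_intros simp flip: has_real_derivative_iff_has_vector_derivative)
  from integral_unique[OF this] have "?K * integral {0..t} ?E = ?E t - ?E 0" by simp
  moreover have "integral {0..t} ?E \<le> integral {0..t} (\<lambda>r. ?E t)"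
    by (intro integral_le gi integrable_const_ivl) (auto intro: mult_left_mono)
  moreover have "t * ?E t \<le> T * ?E t" using t by (intro mult_right_mono) auto
  moreover have "integral {0..t} (\<lambda>r. ?E t) = t * ?E t" "?E 0 = 1" using t by simp_all
  moreover have "(1 + ?K) * integral {0..t} ?E = integral {0..t} ?E + ?K * integral {0..t} ?E" "(T + 1) * ?E t = T * ?E t + ?E t"
    by (simp_all add: distrib_right)
  ultimately have I: "(1 + ?K) * integral {0..t} ?E \<le> (T + 1) * ?E t" by linarith
  have "norm (?E t *\<^sub>R coef (y t) k - coef (y 0) k) \<le> integral {0..t} (\<lambda>r. B * ?E r)"
    unfolding integral_unique[OF i, symmetric]
  proof (rule integral_norm_bound_integral)
    show "(\<lambda>r. B * ?E r) integrable_on {0..t}" by (intro integrable_continuous_real continuous_intros)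
    show "norm (?E r *\<^sub>R coef (F r) k) \<le> B * ?E r" if "r \<in> {0..t}" for r
      using B[of r] that t by (simp add: mult.commute)
  qed (use i in auto)
  also have "\<dots> = B * integral {0..t} ?E" by simp
  also have "\<dots> \<le> B * ((T + 1) * ?E t / (1 + ?K))"
    using I by (intro mult_left_mono B0) (simp add: pos_le_divide_eq add_pos_nonneg mult.commute)
  finally have "norm (?E t *\<^sub>R coef (y t) k) \<le> norm (coef (y 0) k) + B * ((T + 1) * ?E t / (1 + ?K))"
    using norm_triangle_sub[of "?E t *\<^sub>R coef (y t) k" "coef (y 0) k"] by linarith
  also have "\<dots> \<le> ?E t * norm (coef (y 0) k) + B * ((T + 1) * ?E t / (1 + ?K))"
    using t mult_right_mono[of 1 "?E t" "norm (coef (y 0) k)"] by simp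
  finally have "?E t * norm (coef (y t) k) \<le> ?E t * (norm (coef (y 0) k) + (T + 1) * B / (1 + ?K))"
    by (simp add: algebra_simps)
  then show ?thesis by simp
qed

lemma H3_decays:
  assumes "f \<in> H3"
  obtains A where "decays A (Wiener f)"
proof -
  have fc: "continuous_on UNIV f" using assms by (simp add: H3_def)
  have c: "coef (Wiener f) = fcoef f" by (simp add: coef_def fn_Wiener[OF H3_summable_weight(3)[OF assms]])
  let ?a = "\<lambda>n. (1 + (real n)\<^sup>2) * norm (fcoef f (int n))"
  have s: "summable ?a" by (rule H3_summable_weight(2)[OF assms])
  have n: "?a n \<le> suminf ?a" for n
    using sum_le_suminf[OF s, of "{n}"] by simp
  have "(1 + (of_int k)\<^sup>2) * norm (fcoef f k) \<le> suminf ?a" for k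
    using n[of "nat \<bar>k\<bar>"] by (cases "k \<ge> 0") (auto simp: fcoef_cnj[OF fc])
  then have "decays (suminf ?a) (Wiener f)" by (simp add: decays_def c)
  then show ?thesis by (rule that)
qed

lemma continuous_on_suminf:
  fixes a :: "nat \<Rightarrow> 'a::topological_space \<Rightarrow> 'b::banach"
  assumes "\<And>k s. s \<in> X \<Longrightarrow> norm (a k s) \<le> M k" and "summable M" and "\<And>k. continuous_on X (a k)"
  shows "continuous_on X (\<lambda>s. \<Sum>k. a k s)"
proof (rule uniform_limit_theorem)
  show "uniform_limit X (\<lambda>n s. \<Sum>k<n. a k s) (\<lambda>s. \<Sum>k. a k s) sequentially"
    by (rule Weierstrass_m_test) (use assms in auto)
qed (auto intro!: always_eventually continuous_intros assms(3))

lemma heat_sol_decays: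
  assumes y: "heat_sol 0 T y F" and t: "t \<in> {0..T}" and y0: "decays A (y 0)"
    and F: "\<And>r. r \<in> {0..T} \<Longrightarrow> norm (F r) \<le> B"
  shows "decays (A + (T + 1) * B) (y t)"
  unfolding decays_def
proof
  fix k
  let ?w = "1 + (real_of_int k)\<^sup>2"
  have w: "?w > 0" by (simp add: add_pos_nonneg)
  have "norm (coef (y t) k) \<le> norm (coef (y 0) k) + (T + 1) * B / ?w"
    by (rule heat_sol_smoothing[OF y t]) (use F coef_le_norm order_trans in blast)
  from mult_left_mono[OF this, of ?w] w
  have "?w * norm (coef (y t) k) \<le> ?w * norm (coef (y 0) k) + (T + 1) * B" by (simp add: distrib_left)
  also have "\<dots> \<le> A + (T + 1) * B" using y0 by (simp add: decays_def)
  finally show "?w * norm (coef (y t) k) \<le> A + (T + 1) * B" .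
qed

lemma fn_in_H3_iff:
  "fn f \<in> H3 \<longleftrightarrow> summable (\<lambda>k. (1 + (real k)\<^sup>2) ^ 3 * (norm (coef f (int k)))\<^sup>2)"
proof
  assume "fn f \<in> H3"
  then show "summable (\<lambda>k. (1 + (real k)\<^sup>2) ^ 3 * (norm (coef f (int k)))\<^sup>2)"
    using H3_summable_weight(1) by (simp add: coef_def)
next
  assume s: "summable (\<lambda>k. (1 + (real k)\<^sup>2) ^ 3 * (norm (coef f (int k)))\<^sup>2)"
  have "summable (H3_weight (fn f))"
  proof (rule summable_comparison_test[OF _ summable_mult[OF s, of "4 * pi"]], intro exI allI impI)
    fix k
    have "(if k = 0 then 2 else 4) * pi * (norm (coef f (int k)))\<^sup>2 \<le> 4 * pi * (norm (coef f (int k)))\<^sup>2"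
      by (intro mult_right_mono) auto
    from mult_left_mono[OF this, of "(1 + (real k)\<^sup>2) ^ 3"]
    show "norm (H3_weight (fn f) k) \<le> 4 * pi * ((1 + (real k)\<^sup>2) ^ 3 * (norm (coef f (int k)))\<^sup>2)"
      by (simp add: H3_weight_fcoef[OF continuous_on_fn] flip: coef_def)
  qed
  then show "fn f \<in> H3" by (simp add: H3_def continuous_on_fn periodic_2pi_def fn_periodic)
qed

text \<open>The majorant b k, uniform in time, makes the series of the squared H3 norm converge
  uniformly, so continuity of single coefficients yields continuity in H3.\<close>

lemma heat_sol_continuous_in_H3:
  assumes y: "heat_sol 0 T y F" and y0: "fn (y 0) \<in> H3" and F: "\<And>r. r \<in> {0..T} \<Longrightarrow> decays A (F r)"
  shows "continuous_in_H3 {0..T} (\<lambda>t. fn (y t))"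
proof -
  define C where "C = (T + 1) * A"
  define b where "b = (\<lambda>k::nat. norm (coef (y 0) (int k)) + C / (1 + (real k)\<^sup>2)\<^sup>2)"
  have b: "norm (coef (y t) (int k)) \<le> b k" if t: "t \<in> {0..T}" for t k
  proof -
    have "norm (coef (y t) (int k)) \<le> norm (coef (y 0) (int k)) + (T + 1) * (A / (1 + (of_int (int k))\<^sup>2)) / (1 + (of_int (int k))\<^sup>2)"
    proof (rule heat_sol_smoothing[OF y t])
      fix r assume "r \<in> {0..T}"
      then have "(1 + (of_int (int k))\<^sup>2) * norm (coef (F r) (int k)) \<le> A" using F unfolding decays_def by blast
      then show "norm (coef (F r) (int k)) \<le> A / (1 + (of_int (int k))\<^sup>2)"
        by (simp add: pos_le_divide_eq add_pos_nonneg mult.commute)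
    qed
    then show ?thesis by (simp add: b_def C_def power2_eq_square)
  qed
  let ?M = "\<lambda>k. (1 + (real k)\<^sup>2) ^ 3 * (b k)\<^sup>2"
  have M: "summable ?M"
  proof (rule summable_comparison_test, intro exI allI impI)
    have "summable (\<lambda>k. (1 + (real k)\<^sup>2) ^ 3 * (norm (coef (y 0) (int k)))\<^sup>2)"
      using y0 by (simp add: fn_in_H3_iff)
    then show "summable (\<lambda>k. 2 * ((1 + (real k)\<^sup>2) ^ 3 * (norm (coef (y 0) (int k)))\<^sup>2) + 2 * C\<^sup>2 * (1 / (1 + (real k)\<^sup>2)))"
      by (intro summable_add summable_mult summable_inverse_weight)
    fix k
    let ?w = "1 + (real k)\<^sup>2" and ?a = "norm (coef (y 0) (int k))"
    have w: "?w > 0" by (simp add: add_pos_nonneg)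
    have "(b k)\<^sup>2 \<le> 2 * ?a\<^sup>2 + 2 * (C / ?w\<^sup>2)\<^sup>2"
      using sum_squares_bound[of ?a "C / ?w\<^sup>2"] by (simp add: b_def power2_sum)
    from mult_left_mono[OF this, of "?w ^ 3"] w
    have "?w ^ 3 * (b k)\<^sup>2 \<le> 2 * (?w ^ 3 * ?a\<^sup>2) + 2 * (?w ^ 3 * (C / ?w\<^sup>2)\<^sup>2)" by (simp add: algebra_simps)
    also have "?w ^ 3 * (C / ?w\<^sup>2)\<^sup>2 = C\<^sup>2 * (1 / ?w)"
    proof -
      have "W ^ 3 * (C / W\<^sup>2)\<^sup>2 = C\<^sup>2 * (1 / W)" if "W > 0" for W :: real
        using that by (simp add: power_divide field_simps flip: power_add power_mult power_Suc)
      from this[OF w] show ?thesis .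
    qed
    finally show "norm (?w ^ 3 * (b k)\<^sup>2) \<le> 2 * (?w ^ 3 * ?a\<^sup>2) + 2 * C\<^sup>2 * (1 / ?w)" using w by simp
  qed
  have b0: "b k \<ge> 0" if "t \<in> {0..T}" for k t using b[OF that, of k] norm_ge_zero order_trans by blast
  have "fn (y t) \<in> H3" if "t \<in> {0..T}" for t
    unfolding fn_in_H3_iff
    by (rule summable_comparison_test[OF _ M], intro exI allI impI)
      (use b[OF that] in \<open>auto intro!: mult_left_mono power_mono\<close>)
  moreover have "((\<lambda>s. H3_norm (\<lambda>x. fn (y s) x - fn (y t) x)) \<longlongrightarrow> 0) (at t within {0..T})" if t: "t \<in> {0..T}" for t
  proof -
    let ?g = "\<lambda>k s. (1 + (real k)\<^sup>2) ^ 3 * ((if k = 0 then 2 else 4) * pi * (norm (coef (y s - y t) (int k)))\<^sup>2)"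
    have e: "H3_norm (\<lambda>x. fn (y s) x - fn (y t) x) = sqrt (\<Sum>k. ?g k s)" for s
    proof -
      have "(\<lambda>x. fn (y s) x - fn (y t) x) = fn (y s - y t)" by auto
      then show ?thesis by (simp add: H3_norm_def H3_weight_fcoef[OF continuous_on_fn] coef_def)
    qed
    have "continuous_on {0..T} (\<lambda>s. \<Sum>k. ?g k s)"
    proof (rule continuous_on_suminf[OF _ summable_mult[OF M, of "16 * pi"]])
      fix k s assume s: "s \<in> {0..T}"
      have "norm (coef (y s - y t) (int k)) \<le> b k + b k"
        unfolding coef_diff by (rule order_trans[OF norm_triangle_ineq4 add_mono[OF b[OF s] b[OF t]]])
      then have "(norm (coef (y s - y t) (int k)))\<^sup>2 \<le> (2 * b k)\<^sup>2" by (intro power_mono) auto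
      then have "(if k = 0 then 2 else 4) * pi * (norm (coef (y s - y t) (int k)))\<^sup>2 \<le> 4 * pi * (2 * b k)\<^sup>2"
        by (intro mult_mono) auto
      from mult_left_mono[OF this, of "(1 + (real k)\<^sup>2) ^ 3"]
      show "norm (?g k s) \<le> 16 * pi * ?M k" by (simp add: power_mult_distrib mult_ac)
    next
      show "continuous_on {0..T} (?g k)" for k
        by (intro continuous_intros bounded_linear.continuous_on[OF bounded_linear_coef] heat_sol_continuous[OF y])
    qed
    then have "((\<lambda>s. \<Sum>k. ?g k s) \<longlongrightarrow> (\<Sum>k. ?g k t)) (at t within {0..T})"
      unfolding continuous_on_def using t by (rule bspec)
    from tendsto_real_sqrt[OF this] show ?thesis by (simp add: e coef_simps)
  qed
  ultimately show ?thesis by (simp add: continuous_in_H3_def)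
qed

text \<open>A bootstrap in two rounds: the source is bounded, so y decays; the potential decays as
  well, so the source does, and then y is continuous in H3.\<close>

theorem mild_solution_heat_sol:
  assumes y: "heat_sol 0 T y (\<lambda>r. rhs \<kappa> p (V r) (y r))" and y0: "fn (y 0) \<in> H3"
    and V: "piecewise_continuous s T V" and s: "s \<in> {0..T}" and VA: "\<And>r. r \<in> {0..T} \<Longrightarrow> decays A (V r)"
    and u: "\<And>r x. r \<in> {0..T} \<Longrightarrow> control_potential n Q (u r) x = fn (V r) x"
  shows "mild_solution \<kappa> p n Q T (fn (y 0)) u (\<lambda>t. fn (y t))"
proof -
  let ?F = "\<lambda>r. rhs \<kappa> p (V r) (y r)"
  have yc: "continuous_on {0..T} y" using y by (rule heat_sol_continuous)
  have "piecewise_continuous s T (\<lambda>r. if r \<le> s then y r else y r)"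
    by (intro piecewise_continuousI continuous_on_subset[OF yc]) (use s in auto)
  then have yp: "piecewise_continuous s T y" by simp
  have "continuous_on UNIV (\<lambda>(v, y). rhs \<kappa> p v y)"
    unfolding split_def by (intro continuous_on_rhs continuous_intros)
  from piecewise_continuous_map2[OF V yp this] have F: "piecewise_continuous s T ?F" .
  obtain N where N: "\<And>r. r \<in> {0..T} \<Longrightarrow> norm (y r) \<le> N" using piecewise_continuous_bounded[OF yp] by blast
  obtain NV where NV: "\<And>r. r \<in> {0..T} \<Longrightarrow> norm (V r) \<le> NV" using piecewise_continuous_bounded[OF V] by blast
  obtain B where B: "\<And>r. r \<in> {0..T} \<Longrightarrow> norm (?F r) \<le> B" using piecewise_continuous_bounded[OF F] by blast
  obtain A0 where "decays A0 (Wiener (fn (y 0)))" using H3_decays[OF y0] by blast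
  then have "decays A0 (y 0)" by (simp add: fn_inverse)
  define D where "D = A0 + (T + 1) * B"
  have D: "decays D (y t)" if "t \<in> {0..T}" for t
    unfolding D_def by (rule heat_sol_decays[OF y that \<open>decays A0 (y 0)\<close>]) (use B in auto)
  obtain C where C: "\<And>f. norm f \<le> N \<Longrightarrow> decays D f \<Longrightarrow> decays C (f ^ (p + 1))" using decays_power by blast
  have "decays (2 * (A * N + D * NV) + \<bar>\<kappa>\<bar> * C) (?F r)" if r: "r \<in> {0..T}" for r
  proof -
    have "decays (2 * (A * N + D * NV)) (V r * y r)"
      by (rule decays_mono[OF decays_mult[OF VA[OF r] D[OF r]]])
        (use N[OF r] NV[OF r] decays_nonneg[OF VA[OF r]] decays_nonneg[OF D[OF r]] in \<open>auto intro!: add_mono mult_left_mono\<close>)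
    moreover have "decays (\<bar>\<kappa>\<bar> * C) ((- \<kappa>) *\<^sub>R y r ^ (p + 1))"
      by (rule decays_scaleR[OF C[OF N[OF r] D[OF r]]]) simp
    ultimately have "decays (2 * (A * N + D * NV) + \<bar>\<kappa>\<bar> * C) (V r * y r + (- \<kappa>) *\<^sub>R y r ^ (p + 1))" by (rule decays_add)
    then show ?thesis by (simp add: rhs_def)
  qed
  then have "continuous_in_H3 {0..T} (\<lambda>t. fn (y t))" by (rule heat_sol_continuous_in_H3[OF y y0])
  moreover have "set_integrable lborel {0..t} (\<lambda>r. heat (t - r) (\<lambda>x. control_potential n Q (u r) x * fn (y r) x - \<kappa> * fn (y r) x ^ (p + 1)) x)
      \<and> fn (y t) x = heat t (fn (y 0)) x
        + (LINT r:{0..t}|lborel. heat (t - r) (\<lambda>x. control_potential n Q (u r) x * fn (y r) x - \<kappa> * fn (y r) x ^ (p + 1)) x)"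
    if t: "t \<in> {0..T}" for t x
  proof -
    have e: "heat (t - r) (\<lambda>x. control_potential n Q (u r) x * fn (y r) x - \<kappa> * fn (y r) x ^ (p + 1)) x = fn (S (t - r) (?F r)) x"
      if r: "r \<in> {0..t}" for r
    proof -
      have "(\<lambda>x. control_potential n Q (u r) x * fn (y r) x - \<kappa> * fn (y r) x ^ (p + 1)) = fn (?F r)"
        using r t by (simp add: u rhs_def fun_eq_iff)
      then show ?thesis using heat_fn[of "t - r"] r by simp
    qed
    have s0: "0 \<le> s" using s by simp
    have "set_integrable lborel {0..t} (\<lambda>r. heat (t - r) (\<lambda>x. control_potential n Q (u r) x * fn (y r) x - \<kappa> * fn (y r) x ^ (p + 1)) x)"
      using heat_sol_mild(1)[OF y F s0 t, of x]
      by (rule set_integrable_cong[THEN iffD1, rotated 3]) (use e in auto)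
    moreover have "(LINT r:{0..t}|lborel. heat (t - r) (\<lambda>x. control_potential n Q (u r) x * fn (y r) x - \<kappa> * fn (y r) x ^ (p + 1)) x)
        = (LINT r:{0..t}|lborel. fn (S (t - r) (?F r)) x)"
      by (rule set_lebesgue_integral_cong) (use e in auto)
    ultimately show ?thesis
      using heat_sol_mild(2)[OF y F s0 t, of x] heat_fn[of t "y 0" x] t by simp
  qed
  ultimately show ?thesis unfolding mild_solution_def Let_def by blast
qed

lemma piecewise_continuous_L2:
  assumes "\<And>i. i \<in> {1..n} \<Longrightarrow> piecewise_continuous s T (\<lambda>r. u r i)" and "0 \<le> T"
  shows "u \<in> L2_controls n T"
  unfolding L2_controls_def
proof (intro CollectI ballI conjI)
  fix i assume "i \<in> {1..n}"
  then have pw: "piecewise_continuous s T (\<lambda>r. u r i)" by (rule assms(1))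
  have T: "T \<in> {0..T}" using assms(2) by simp
  have "set_integrable lborel {0..T} (\<lambda>r. u r i)" by (rule piecewise_continuous_set_integrable[OF pw T])
  then have "set_integrable lborel {0<..<T} (\<lambda>r. u r i)" by (rule set_integrable_subset) auto
  then show "set_borel_measurable lborel {0<..<T} (\<lambda>r. u r i)"
    by (simp add: set_integrable_def set_borel_measurable_def borel_measurable_integrable)
  have "continuous_on UNIV (\<lambda>(x, y). x * (y::real))" unfolding split_def by (intro continuous_intros)
  from piecewise_continuous_map2[OF pw pw this]
  have "set_integrable lborel {0..T} (\<lambda>r. u r i * u r i)" by (rule piecewise_continuous_set_integrable[OF _ T])
  then have "set_integrable lborel {0<..<T} (\<lambda>r. u r i * u r i)" by (rule set_integrable_subset) auto
  then show "set_integrable lborel {0<..<T} (\<lambda>r. (u r i)\<^sup>2)" by (simp add: power2_eq_square)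
qed

section \<open>Global exact control\<close>

text \<open>Membership in \<open>trig1\<close> only asserts that amplitudes exist at each time.
  Expressed by Fourier coefficients they inherit the continuity of the potential.\<close>

lemma trig1_coordinates:
  assumes "f \<in> trig1"
  shows "f = Re (coef f 0) *\<^sub>R 1 + (2 * Re (coef f 1)) *\<^sub>R cosW 1 + (- 2 * Im (coef f 1)) *\<^sub>R sinW 1"
proof -
  obtain a b d where f: "f = a *\<^sub>R 1 + b *\<^sub>R cosW 1 + d *\<^sub>R sinW 1" using assms by (auto simp: trig1_def)
  have "Re (coef f 0) = a" "2 * Re (coef f 1) = b" "- 2 * Im (coef f 1) = d"
    unfolding f by (simp_all add: coef_simps coef_cosW coef_sinW)
  then show ?thesis by (simp only: f)
qed

definition admissible :: "real \<Rightarrow> real \<Rightarrow> (real \<Rightarrow> wiener) \<Rightarrow> bool" where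
  "admissible s T V \<longleftrightarrow> piecewise_continuous s T V \<and> (\<exists>A. \<forall>r\<in>{0..T}. decays A (V r))"

lemma piecewise_continuous_add:
  fixes f g :: "real \<Rightarrow> 'a::real_normed_vector"
  shows "piecewise_continuous s T f \<Longrightarrow> piecewise_continuous s T g \<Longrightarrow> piecewise_continuous s T (\<lambda>r. f r + g r)"
  by (rule piecewise_continuous_map2[where op = "(+)"]) (simp_all add: split_def continuous_intros)

lemma piecewise_continuous_cmult:
  fixes f :: "real \<Rightarrow> real"
  shows "piecewise_continuous s T f \<Longrightarrow> piecewise_continuous s T (\<lambda>r. f r * a)"
  by (rule piecewise_continuous_map2[OF _ piecewise_continuous_const, where op = "(*)"])
    (simp_all add: split_def continuous_intros)

lemma admissible_add:
  assumes "admissible s T V" "admissible s T W" shows "admissible s T (\<lambda>r. V r + W r)"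
  using assms unfolding admissible_def
  by (auto intro!: piecewise_continuous_add) (metis atLeastAtMost_iff decays_add)

lemma admissible_scaleR:
  assumes a: "piecewise_continuous s T a" and f: "decays A f"
  shows "admissible s T (\<lambda>r. a r *\<^sub>R f)"
  unfolding admissible_def
proof
  show "piecewise_continuous s T (\<lambda>r. a r *\<^sub>R f)"
    by (rule piecewise_continuous_map2[OF a piecewise_continuous_const, where op = "(*\<^sub>R)"])
      (simp add: split_def continuous_intros)
  obtain B where "\<And>r. r \<in> {0..T} \<Longrightarrow> norm (a r) \<le> B" using piecewise_continuous_bounded[OF a] by blast
  then show "\<exists>A. \<forall>r\<in>{0..T}. decays A (a r *\<^sub>R f)" using decays_scaleR[OF f] by (metis real_norm_def)
qed

lemma decays_trig: "decays 2 (cosW 1)" "decays 2 (sinW 1)"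
  unfolding decays_def coef_cosW coef_sinW by (auto simp: norm_divide)

text \<open>Keeps the control u with its potential V and the evolution in the algebra, so that the
  sign change and the absorption of \<kappa> are performed before regularity and mild solutions are
  considered.\<close>

definition controlled :: "real \<Rightarrow> nat \<Rightarrow> nat \<Rightarrow> (nat \<Rightarrow> real \<Rightarrow> real) \<Rightarrow> real \<Rightarrow> wiener \<Rightarrow> wiener \<Rightarrow> bool" where
  "controlled \<kappa> p n Q T y0 y1 \<longleftrightarrow> (\<exists>s\<in>{0..T}. \<exists>u V y. (\<forall>i\<in>{1..n}. piecewise_continuous s T (\<lambda>r. u r i)) \<and> admissible s T V \<and>
     (\<forall>r x. control_potential n Q (u r) x = fn (V r) x) \<and>
     heat_sol 0 T y (\<lambda>r. rhs \<kappa> p (V r) (y r)) \<and> y 0 = y0 \<and> y T = y1)"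

lemma controlled_mild_solution:
  assumes "controlled \<kappa> p n Q T y0 y1" and "fn y0 \<in> H3"
  shows "\<exists>u\<in>L2_controls n T. \<exists>\<psi>. mild_solution \<kappa> p n Q T (fn y0) u \<psi> \<and> \<psi> T = fn y1"
proof -
  obtain s u V y where s: "s \<in> {0..T}" and u: "\<And>i. i \<in> {1..n} \<Longrightarrow> piecewise_continuous s T (\<lambda>r. u r i)" and V: "admissible s T V"
    and uV: "\<And>r x. control_potential n Q (u r) x = fn (V r) x"
    and y: "heat_sol 0 T y (\<lambda>r. rhs \<kappa> p (V r) (y r))" "y 0 = y0" "y T = y1"
    using assms(1) unfolding controlled_def by blast
  obtain A where A: "\<And>r. r \<in> {0..T} \<Longrightarrow> decays A (V r)" using V unfolding admissible_def by blast
  have "mild_solution \<kappa> p n Q T (fn (y 0)) u (\<lambda>t. fn (y t))"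
    by (rule mild_solution_heat_sol[OF y(1) _ _ s A uV]) (use V assms(2) y(2) in \<open>auto simp: admissible_def\<close>)
  moreover have "u \<in> L2_controls n T" by (rule piecewise_continuous_L2[OF u]) (use s in auto)
  ultimately show ?thesis using y(2,3) by blast
qed

lemma controlled_uminus:
  assumes "controlled \<kappa> p n Q T y0 y1" and "even p"
  shows "controlled \<kappa> p n Q T (- y0) (- y1)"
proof -
  have e: "- 1 *\<^sub>R rhs \<kappa> p v y = rhs \<kappa> p v (- 1 *\<^sub>R y)" for v y
    using \<open>even p\<close> by (simp add: rhs_def power_minus_odd)
  have "heat_sol 0 T (\<lambda>t. - 1 *\<^sub>R y t) (\<lambda>r. rhs \<kappa> p (V r) (- 1 *\<^sub>R y r))"
    if "heat_sol 0 T y (\<lambda>r. rhs \<kappa> p (V r) (y r))" for y V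
    using heat_sol_scaleR[OF that, of "- 1"] unfolding e .
  moreover obtain s u V y where "s \<in> {0..T}" "\<forall>i\<in>{1..n}. piecewise_continuous s T (\<lambda>r. u r i)" "admissible s T V"
    "\<forall>r x. control_potential n Q (u r) x = fn (V r) x"
    "heat_sol 0 T y (\<lambda>r. rhs \<kappa> p (V r) (y r))" "y 0 = y0" "y T = y1"
    using assms(1) unfolding controlled_def by blast
  ultimately show ?thesis
    unfolding controlled_def
    by (intro bexI[of _ s] exI[of _ u] exI[of _ V] exI[of _ "\<lambda>t. - 1 *\<^sub>R y t"] conjI) auto
qed

text \<open>For p = 0 the nonlinearity is the linear term -\<kappa> y, compensated by adding
  \<kappa> to the amplitude of Q 1 = 1.\<close>

lemma controlled_constant_shift:
  assumes "controlled 0 p n Q T y0 y1" and n: "n \<ge> 1" and Q: "Q 1 = (\<lambda>x. 1)"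
  shows "controlled \<kappa> 0 n Q T y0 y1"
proof -
  obtain s u V y where s: "s \<in> {0..T}" and u: "\<And>i. i \<in> {1..n} \<Longrightarrow> piecewise_continuous s T (\<lambda>r. u r i)" and V: "admissible s T V"
    and uV: "\<And>r x. control_potential n Q (u r) x = fn (V r) x"
    and y: "heat_sol 0 T y (\<lambda>r. rhs 0 p (V r) (y r))" "y 0 = y0" "y T = y1"
    using assms(1) unfolding controlled_def by blast
  let ?u = "\<lambda>r i. u r i + (if i = 1 then \<kappa> else 0)" and ?V = "\<lambda>r. V r + \<kappa> *\<^sub>R 1"
  have "piecewise_continuous s T (\<lambda>r. ?u r i)" if "i \<in> {1..n}" for i
    by (intro piecewise_continuous_add u that piecewise_continuous_const)
  moreover have "admissible s T ?V"
    by (intro admissible_add V admissible_scaleR[OF piecewise_continuous_const decays_one])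
  moreover have "control_potential n Q (?u r) x = fn (?V r) x" for r x
  proof -
    have "(\<Sum>i=1..n. (if i = 1 then \<kappa> else 0) * Q i x) = (\<Sum>i=1..n. if i = 1 then \<kappa> * Q 1 x else 0)"
      by (intro sum.cong) auto
    also have "\<dots> = \<kappa>" using n Q by (simp add: sum.delta)
    finally show ?thesis
      using uV[of r x] by (simp add: control_potential_def distrib_right sum.distrib)
  qed
  moreover have "rhs 0 p (V r) (y r) = rhs \<kappa> 0 (?V r) (y r)" for r
    by (simp add: rhs_def algebra_simps)
  ultimately show ?thesis
    unfolding controlled_def using s y by (intro bexI[OF _ s] exI[of _ ?u] exI[of _ ?V] exI[of _ y]) auto
qed

text \<open>Approximate control up to time s, exact control afterwards. The accuracy \<epsilon>
  demanded at the switch depends on \<tau> and the fixed data, not on the state, so it is available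
  when the first phase is designed.\<close>

lemma controlled_positive:
  fixes \<mu>\<^sub>1 \<mu>\<^sub>2 :: "real \<Rightarrow> real"
  assumes kappa: "\<kappa> \<ge> 0" and p: "p \<ge> 1"
    and mu: "Q (q + 1) = \<mu>\<^sub>1" "Q (q + 2) = \<mu>\<^sub>2"
    and span: "{\<lambda>x. 1, cos, sin} \<subseteq> family_span q Q"
    and H3: "\<mu>\<^sub>1 \<in> H3" "\<mu>\<^sub>2 \<in> H3"
    and zero: "inner_L2 \<mu>\<^sub>1 (cos_mode 0) \<noteq> 0" "inner_L2 \<mu>\<^sub>2 (cos_mode 0) = 0"
    and pos: "b\<^sub>1 > 0" "b\<^sub>2 > 0"
    and modes: "\<And>k. k \<ge> 1 \<Longrightarrow> ((real k)\<^sup>2) powr q\<^sub>1 * \<bar>inner_L2 \<mu>\<^sub>1 (cos_mode k)\<bar> \<ge> b\<^sub>1"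
      "\<And>k. k \<ge> 1 \<Longrightarrow> inner_L2 \<mu>\<^sub>1 (sin_mode k) = 0"
      "\<And>k. k \<ge> 1 \<Longrightarrow> ((real k)\<^sup>2) powr q\<^sub>2 * \<bar>inner_L2 \<mu>\<^sub>2 (sin_mode k)\<bar> \<ge> b\<^sub>2"
      "\<And>k. k \<ge> 1 \<Longrightarrow> inner_L2 \<mu>\<^sub>2 (cos_mode k) = 0"
    and T: "T > 0" and f: "f \<in> H3" "\<And>x. f x > 0"
  shows "controlled \<kappa> p (q + 2) Q T (Wiener f) ((1 / sqrt (2 * pi)) *\<^sub>R 1)"
proof -
  define c where "c = 1 / sqrt (2 * pi)"
  have c: "c > 0" by (simp add: c_def)
  define M1 where "M1 = Wiener \<mu>\<^sub>1"
  define M2 where "M2 = Wiener \<mu>\<^sub>2"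
  have M: "fn M1 = \<mu>\<^sub>1" "fn M2 = \<mu>\<^sub>2" using H3 H3_summable_weight(3) by (auto simp: M1_def M2_def fn_Wiener)
  have inner: "inner_L2 \<mu>\<^sub>1 (cos_mode k) = (if k = 0 then sqrt (2 * pi) else 2 * sqrt pi) * Re (coef M1 (int k))"
    "inner_L2 \<mu>\<^sub>1 (sin_mode k) = - (2 * sqrt pi * Im (coef M1 (int k)))"
    "inner_L2 \<mu>\<^sub>2 (cos_mode k) = (if k = 0 then sqrt (2 * pi) else 2 * sqrt pi) * Re (coef M2 (int k))"
    "inner_L2 \<mu>\<^sub>2 (sin_mode k) = - (2 * sqrt pi * Im (coef M2 (int k)))" for k
    using inner_L2_modes[OF continuous_on_fn, of M1 k] inner_L2_modes[OF continuous_on_fn, of M2 k]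
    by (simp_all add: M coef_def)
  \<comment> \<open>One exponent for both potentials: the powers of k^2 with exponents
    \<open>q\<^sub>1\<close> and \<open>q\<^sub>2\<close> are at most (k+1)^m.\<close>
  define m where "m = nat \<lceil>2 * max q\<^sub>1 q\<^sub>2\<rceil>"
  have powr: "((real k)\<^sup>2) powr a \<le> (real k + 1) ^ m" if "k \<ge> 1" "a \<le> max q\<^sub>1 q\<^sub>2" for k a
  proof -
    have "((real k)\<^sup>2) powr a = real k powr (2 * a)"
      using that(1) by (simp add: powr_powr flip: powr_numeral)
    also have "\<dots> \<le> real k powr real m"
      using that by (intro powr_mono) (auto simp: m_def intro: order_trans[OF _ real_nat_ceiling_ge])
    also have "\<dots> = real k ^ m" using that(1) by (simp add: powr_realpow)
    also have "\<dots> \<le> (real k + 1) ^ m" by (intro power_mono) auto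
    finally show ?thesis .
  qed
  \<comment> \<open>The first term is for frequency 0, where only \<open>\<mu>\<^sub>1\<close> acts;
    division by \<open>2 * sqrt pi\<close> converts inner products into complex
    coefficients.\<close>
  define b where "b = min \<bar>Re (coef M1 0)\<bar> (min b\<^sub>1 b\<^sub>2 / (2 * sqrt pi))"
  have lower: "b \<le> \<bar>X\<bar> * (real k + 1) ^ m"
    if "k \<ge> 1" "a \<le> max q\<^sub>1 q\<^sub>2" "((real k)\<^sup>2) powr a * \<bar>2 * sqrt pi * X\<bar> \<ge> d" "d \<ge> min b\<^sub>1 b\<^sub>2" for k a d X
  proof -
    have "d \<le> (real k + 1) ^ m * (2 * sqrt pi * \<bar>X\<bar>)"
      using order_trans[OF that(3) mult_right_mono[OF powr[OF that(1,2)]]] by (simp add: abs_mult)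
    then have "min b\<^sub>1 b\<^sub>2 \<le> (\<bar>X\<bar> * (real k + 1) ^ m) * (2 * sqrt pi)" using that(4) by (simp add: mult_ac)
    then have "min b\<^sub>1 b\<^sub>2 / (2 * sqrt pi) \<le> \<bar>X\<bar> * (real k + 1) ^ m" by (simp only: pos_divide_le_eq[OF mult_pos_pos[OF zero_less_numeral real_sqrt_gt_zero[OF pi_gt_zero]]])
    then show ?thesis by (simp add: b_def)
  qed
  have b: "b > 0" using zero(1) pos inner(1)[of 0] by (simp add: b_def)
  have m1: "\<bar>Re (coef M1 (int k))\<bar> * (real k + 1) ^ m \<ge> b" "Im (coef M1 (int k)) = 0" for k
  proof -
    show "\<bar>Re (coef M1 (int k))\<bar> * (real k + 1) ^ m \<ge> b"
    proof (cases "k \<ge> 1")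
      case True
      then show ?thesis
        by (intro lower[of k q\<^sub>1 b\<^sub>1]) (use modes(1)[OF True] inner(1)[of k] in auto)
    qed (auto simp: b_def not_le)
    show "Im (coef M1 (int k)) = 0"
      using modes(2)[of k] inner(2)[of k] Im_fcoef_0[OF continuous_on_fn, of M1] by (cases "k \<ge> 1") (auto simp: coef_def not_le)
  qed
  have m2: "k \<ge> 1 \<Longrightarrow> \<bar>Im (coef M2 (int k))\<bar> * (real k + 1) ^ m \<ge> b" "Re (coef M2 (int k)) = 0" for k
  proof -
    show "\<bar>Im (coef M2 (int k))\<bar> * (real k + 1) ^ m \<ge> b" if "k \<ge> 1"
      by (intro lower[of k q\<^sub>2 b\<^sub>2]) (use that modes(3)[OF that] inner(4)[of k] in auto)
    show "Re (coef M2 (int k)) = 0"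
      using modes(4)[of k] zero(2) inner(3)[of k] by (cases "k \<ge> 1") (auto simp: not_le)
  qed
  define \<tau> where "\<tau> = min 1 (T / 2)"
  define s where "s = T - \<tau>"
  have \<tau>: "0 < \<tau>" "\<tau> \<le> 1" and s: "0 < s" "s < T" "s + \<tau> = T" using T by (auto simp: \<tau>_def s_def)
  obtain \<epsilon> where eps: "\<epsilon> > 0" and loc: "\<And>\<xi>0. norm \<xi>0 \<le> \<epsilon> \<Longrightarrow> \<exists>v1 v2 \<xi>. continuous_on {0..\<tau>} v1 \<and> continuous_on {0..\<tau>} v2 \<and>
        heat_sol 0 \<tau> \<xi> (\<lambda>r. rhs \<kappa> p (v1 r *\<^sub>R M1 + v2 r *\<^sub>R M2 + (\<kappa> * c ^ p) *\<^sub>R 1) (c *\<^sub>R 1 + \<xi> r)) \<and>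
        \<xi> 0 = \<xi>0 \<and> \<xi> \<tau> = 0"
    using local_exact_control[OF c b kappa m1 m2 \<tau>] by blast
  obtain y0 g where y0: "fn y0 = f" and g: "exp g * y0 = c *\<^sub>R 1" using H3_log_quotient[OF f c] by blast
  obtain v y1 where v: "continuous_on {0..s} v" "\<And>r. v r \<in> trig1" and y1: "heat_sol 0 s y1 (\<lambda>r. rhs \<kappa> p (v r) (y1 r))" "y1 0 = y0"
    and y1s: "norm (y1 s - c *\<^sub>R 1) < \<epsilon>"
    using nonlinear_approximate_control[OF s(1) eps p kappa g] by blast
  obtain v1 v2 \<xi> where v12: "continuous_on {0..\<tau>} v1" "continuous_on {0..\<tau>} v2"
    and \<xi>: "heat_sol 0 \<tau> \<xi> (\<lambda>r. rhs \<kappa> p (v1 r *\<^sub>R M1 + v2 r *\<^sub>R M2 + (\<kappa> * c ^ p) *\<^sub>R 1) (c *\<^sub>R 1 + \<xi> r))"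
      "\<xi> 0 = y1 s - c *\<^sub>R 1" "\<xi> \<tau> = 0"
    using loc[OF less_imp_le[OF y1s]] by blast
  \<comment> \<open>Amplitudes of 1, cos, sin and of the last two potentials. In the second phase
    the constant \<open>\<kappa> * c ^ p\<close> holds the target stationary while \<open>M1\<close>
    and \<open>M2\<close> steer.\<close>
  define a where "a = (\<lambda>r. if r \<le> s then Re (coef (v r) 0) else \<kappa> * c ^ p)"
  define b' where "b' = (\<lambda>r. if r \<le> s then 2 * Re (coef (v r) 1) else 0)"
  define d where "d = (\<lambda>r. if r \<le> s then - 2 * Im (coef (v r) 1) else 0)"
  define w1 where "w1 = (\<lambda>r. if r \<le> s then 0 else v1 (r - s))"
  define w2 where "w2 = (\<lambda>r. if r \<le> s then 0 else v2 (r - s))"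
  have vs: "continuous_on {s..T} (\<lambda>r. v1 (r - s))" "continuous_on {s..T} (\<lambda>r. v2 (r - s))"
    by (rule continuous_on_compose2[OF v12(1)] continuous_on_compose2[OF v12(2)];
        use s in \<open>auto intro!: continuous_intros\<close>)+
  have pw: "piecewise_continuous s T a" "piecewise_continuous s T b'" "piecewise_continuous s T d"
    "piecewise_continuous s T w1" "piecewise_continuous s T w2"
    unfolding a_def b'_def d_def w1_def w2_def
    by (intro piecewise_continuousI continuous_intros vs bounded_linear.continuous_on[OF bounded_linear_coef] v)+
  define V where "V = (\<lambda>r. a r *\<^sub>R 1 + b' r *\<^sub>R cosW 1 + d r *\<^sub>R sinW 1 + w1 r *\<^sub>R M1 + w2 r *\<^sub>R M2)"
  obtain A1 A2 where A: "decays A1 M1" "decays A2 M2" using H3_decays H3 unfolding M1_def M2_def by metis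
  have V: "admissible s T V"
    unfolding V_def by (intro admissible_add admissible_scaleR[OF pw(1) decays_one] admissible_scaleR[OF pw(2) decays_trig(1)]
        admissible_scaleR[OF pw(3) decays_trig(2)] admissible_scaleR[OF pw(4) A(1)] admissible_scaleR[OF pw(5) A(2)])
  obtain \<alpha> \<beta> \<gamma> where span1: "(\<lambda>x. 1) = (\<lambda>x. \<Sum>i=1..q. \<alpha> i * Q i x)"
    and span2: "cos = (\<lambda>x. \<Sum>i=1..q. \<beta> i * Q i x)" and span3: "sin = (\<lambda>x. \<Sum>i=1..q. \<gamma> i * Q i x)"
    using span unfolding family_span_def by auto
  \<comment> \<open>The coefficients expressing 1, cos and sin in the family
    \<open>Q 1, ..., Q q\<close> do not depend on time, so the controls inherit piecewise continuity
    from the amplitudes.\<close>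
  define u where "u = (\<lambda>r i. if i \<le> q then a r * \<alpha> i + b' r * \<beta> i + d r * \<gamma> i else if i = q + 1 then w1 r else w2 r)"
  have "piecewise_continuous s T (\<lambda>r. u r i)" for i
    unfolding u_def by (cases "i \<le> q"; cases "i = q + 1")
      (auto intro!: piecewise_continuous_add piecewise_continuous_cmult pw)
  moreover have "control_potential (q + 2) Q (u r) x = fn (V r) x" for r x
  proof -
    have "control_potential (q + 2) Q (u r) x = (\<Sum>i=1..q. u r i * Q i x) + u r (q + 1) * \<mu>\<^sub>1 x + u r (q + 2) * \<mu>\<^sub>2 x"
      using mu by (simp add: control_potential_def numeral_2_eq_2)
    also have "(\<Sum>i=1..q. u r i * Q i x) = (\<Sum>i=1..q. a r * (\<alpha> i * Q i x) + b' r * (\<beta> i * Q i x) + d r * (\<gamma> i * Q i x))"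
      by (intro sum.cong) (auto simp: u_def algebra_simps)
    also have "\<dots> = a r * 1 + b' r * cos x + d r * sin x"
      unfolding sum.distrib sum_distrib_left[symmetric]
        fun_cong[OF span1, symmetric] fun_cong[OF span2, symmetric] fun_cong[OF span3, symmetric] ..
    finally show ?thesis by (simp add: V_def u_def M)
  qed
  moreover define y where "y = (\<lambda>t. if t \<le> s then y1 t else c *\<^sub>R 1 + \<xi> (t - s))"
  have "heat_sol 0 T y (\<lambda>r. rhs \<kappa> p (V r) (y r))"
  proof (rule heat_sol_join[of 0 s])
    show "heat_sol 0 s y (\<lambda>r. rhs \<kappa> p (V r) (y r))"
    proof (rule heat_sol_cong[OF y1(1)])
      fix r assume "r \<in> {0<..<s}"
      then show "rhs \<kappa> p (v r) (y1 r) = rhs \<kappa> p (V r) (y r)"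
        using trig1_coordinates[OF v(2), of r] by (simp add: y_def V_def a_def b'_def d_def w1_def w2_def)
    qed (auto simp: y_def)
    have duh0: "duh (\<lambda>_. 0) t = 0" for t by (simp add: duh_def S_simps)
    \<comment> \<open>The constant c solves the heat equation with zero source, so adding it turns
      the equation for the deviation into the one for the state.\<close>
    have "heat_sol 0 \<tau> (\<lambda>_. c *\<^sub>R 1) (\<lambda>_. 0)"
      by (rule heat_sol_duh[of _ _ _ "c *\<^sub>R 1"]) (use \<tau> in \<open>auto simp: duh0 S_const\<close>)
    from heat_sol_shift[OF heat_sol_add[OF this \<xi>(1)], of s]
    have "heat_sol s T (\<lambda>t. c *\<^sub>R 1 + \<xi> (t - s))
      (\<lambda>r. rhs \<kappa> p (v1 (r - s) *\<^sub>R M1 + v2 (r - s) *\<^sub>R M2 + (\<kappa> * c ^ p) *\<^sub>R 1) (c *\<^sub>R 1 + \<xi> (r - s)))"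
      using s(3) by (simp add: add.commute)
    then show "heat_sol s T y (\<lambda>r. rhs \<kappa> p (V r) (y r))"
    proof (rule heat_sol_cong)
      show "c *\<^sub>R 1 + \<xi> (t - s) = y t" if "t \<in> {s..T}" for t
        using that \<xi>(2) by (cases "t = s") (auto simp: y_def)
    qed (auto simp: y_def V_def a_def b'_def d_def w1_def w2_def add_ac)
  qed (use s in auto)
  moreover have "y 0 = Wiener f" using s(1) y1(2) y0 by (auto simp: y_def fn_inverse)
  moreover have "y T = c *\<^sub>R 1"
  proof -
    have "T - s = \<tau>" using s(3) by simp
    then show ?thesis using s(2) \<xi>(3) by (simp add: y_def)
  qed
  ultimately show ?thesis
    unfolding controlled_def c_def[symmetric] using s V
    by (intro bexI[of _ s] exI[of _ u] exI[of _ V] exI[of _ y] conjI) auto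
qed

theorem theoremB:
  fixes \<kappa> :: real and p q :: nat
    and Q :: "nat \<Rightarrow> real \<Rightarrow> real" and \<mu>\<^sub>1 \<mu>\<^sub>2 :: "real \<Rightarrow> real"
  assumes kappa: "\<kappa> \<ge> 0"
    and p: "even p"
    and q: "q \<ge> 3"
    and mu: "Q (q + 1) = \<mu>\<^sub>1" "Q (q + 2) = \<mu>\<^sub>2"
    and I_smooth: "\<forall>i\<in>{1..q}. Q i \<in> smooth_torus"
    and I_span: "{\<lambda>x. 1, cos, sin} \<subseteq> family_span q Q"
    and II_Q1: "Q 1 = (\<lambda>x. 1)"
    and II_H3: "\<mu>\<^sub>1 \<in> H3" "\<mu>\<^sub>2 \<in> H3"
    and II_zero: "inner_L2 \<mu>\<^sub>1 (cos_mode 0) \<noteq> 0" "inner_L2 \<mu>\<^sub>2 (cos_mode 0) = 0"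
    and II_modes: "\<exists>b\<^sub>1 q\<^sub>1 b\<^sub>2 q\<^sub>2 :: real. b\<^sub>1 > 0 \<and> q\<^sub>1 > 0 \<and> b\<^sub>2 > 0 \<and> q\<^sub>2 > 0 \<and>
      (\<forall>k\<ge>1.
        ((real k)\<^sup>2) powr q\<^sub>1 * \<bar>inner_L2 \<mu>\<^sub>1 (cos_mode k)\<bar> \<ge> b\<^sub>1 \<and>
        inner_L2 \<mu>\<^sub>1 (sin_mode k) = 0 \<and>
        ((real k)\<^sup>2) powr q\<^sub>2 * \<bar>inner_L2 \<mu>\<^sub>2 (sin_mode k)\<bar> \<ge> b\<^sub>2 \<and>
        inner_L2 \<mu>\<^sub>2 (cos_mode k) = 0)"
  shows "(\<forall>T>0. \<forall>\<psi>0\<in>H3. (\<forall>x. \<psi>0 x > 0) \<longrightarrow>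
           (\<exists>u\<in>L2_controls (q + 2) T. \<exists>\<psi>.
              mild_solution \<kappa> p (q + 2) Q T \<psi>0 u \<psi> \<and> \<psi> T = cos_mode 0)) \<and>
         (\<forall>T>0. \<forall>\<psi>0\<in>H3. (\<forall>x. \<psi>0 x < 0) \<longrightarrow>
           (\<exists>u\<in>L2_controls (q + 2) T. \<exists>\<psi>.
              mild_solution \<kappa> p (q + 2) Q T \<psi>0 u \<psi> \<and> \<psi> T = (\<lambda>x. - cos_mode 0 x)))"
proof -
  obtain b\<^sub>1 q\<^sub>1 b\<^sub>2 q\<^sub>2 where pos: "b\<^sub>1 > 0" "b\<^sub>2 > 0"
    and modes: "\<And>k. k \<ge> 1 \<Longrightarrow> ((real k)\<^sup>2) powr q\<^sub>1 * \<bar>inner_L2 \<mu>\<^sub>1 (cos_mode k)\<bar> \<ge> b\<^sub>1"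
      "\<And>k. k \<ge> 1 \<Longrightarrow> inner_L2 \<mu>\<^sub>1 (sin_mode k) = 0"
      "\<And>k. k \<ge> 1 \<Longrightarrow> ((real k)\<^sup>2) powr q\<^sub>2 * \<bar>inner_L2 \<mu>\<^sub>2 (sin_mode k)\<bar> \<ge> b\<^sub>2"
      "\<And>k. k \<ge> 1 \<Longrightarrow> inner_L2 \<mu>\<^sub>2 (cos_mode k) = 0"
    using II_modes by blast
  note pos_case = controlled_positive[OF _ _ mu I_span II_H3 II_zero pos modes]
  let ?c = "(1 / sqrt (2 * pi)) *\<^sub>R (1 :: wiener)"
  have ctrl: "controlled \<kappa> p (q + 2) Q T (Wiener f) ?c" if "T > 0" "f \<in> H3" "\<And>x. f x > 0" for T f
  proof (cases "p = 0")
    case True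
    \<comment> \<open>With coefficient 0 the exponent is a dummy; 2 satisfies p >= 1.\<close>
    have "controlled 0 2 (q + 2) Q T (Wiener f) ?c" by (rule pos_case) (use that in auto)
    then show ?thesis unfolding True by (rule controlled_constant_shift) (use II_Q1 in auto)
  next
    case False
    show ?thesis by (rule pos_case) (use that kappa False in auto)
  qed
  have c: "fn ?c = cos_mode 0" "fn (- ?c) = (\<lambda>x. - cos_mode 0 x)" by (auto simp: cos_mode_def)
  show ?thesis
  proof (intro conjI allI ballI impI)
    fix T :: real and \<psi>0 assume T: "T > 0" and \<psi>0: "\<psi>0 \<in> H3" "\<forall>x. \<psi>0 x > 0"
    have f: "fn (Wiener \<psi>0) = \<psi>0" by (rule fn_Wiener[OF H3_summable_weight(3)[OF \<psi>0(1)]])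
    show "\<exists>u\<in>L2_controls (q + 2) T. \<exists>\<psi>. mild_solution \<kappa> p (q + 2) Q T \<psi>0 u \<psi> \<and> \<psi> T = cos_mode 0"
      using controlled_mild_solution[OF ctrl[OF T \<psi>0(1)]] \<psi>0 unfolding f c by blast
  next
    fix T :: real and \<psi>0 assume T: "T > 0" and \<psi>0: "\<psi>0 \<in> H3" "\<forall>x. \<psi>0 x < 0"
    have f: "fn (Wiener \<psi>0) = \<psi>0" by (rule fn_Wiener[OF H3_summable_weight(3)[OF \<psi>0(1)]])
    have "fn (- Wiener \<psi>0) \<in> H3"
      using \<psi>0(1) fn_in_H3_iff[of "Wiener \<psi>0"] fn_in_H3_iff[of "- Wiener \<psi>0"] by (simp add: f coef_uminus)
    from ctrl[OF T this] \<psi>0(2) have "controlled \<kappa> p (q + 2) Q T (- Wiener \<psi>0) ?c"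
      by (simp add: f fn_inverse)
    from controlled_mild_solution[OF controlled_uminus[OF this p]] \<psi>0(1)
    show "\<exists>u\<in>L2_controls (q + 2) T. \<exists>\<psi>. mild_solution \<kappa> p (q + 2) Q T \<psi>0 u \<psi> \<and> \<psi> T = (\<lambda>x. - cos_mode 0 x)"
      by (simp only: minus_minus f c)
  qed
qed

end
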